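(* Let $r,s,n$ be positive integers and let $\Upsilon:\bar{\mathsf{A}}_{s,n}\otimes\mathsf{A}_{r,n}\to\mathsf{A}_{r,n}\otimes\bar{\mathsf{A}}_{s,n}$ be the $\mathbb{C}(q)$-linear map specified in the context. Then $\Upsilon$ is a homomorphism of $\mathrm{U}_q(\mathfrak{q}_n)$-supermodules, where $\mathrm{U}_q(\mathfrak{q}_n)$ acts on $\mathsf{A}_{r,n}$ and $\bar{\mathsf{A}}_{s,n}$ by $\Phi$ and on tensor products via the comultiplication, i.e. $u\cdot(x\otimes y)=\sum_{(u)}(-1)^{|x||u_{(2)}|}\Phi_{u_{(1)}}(x)\otimes\Phi_{u_{(2)}}(y)$.
   Context: **Basic notation.** The ground field is $\mathbb{C}(q)$, $q$ an indeterminate; $\xi=q-q^{-1}$. For $N\ge 1$ let $I_{N|N}=\{-N,\ldots,-1,1,\ldots,N\}$, $|i|=\bar0$ for $i>0$ and $|i|=\bar1$ for $i<0$. $V_N$ is the superspace with basis $v_i$ ($i\in I_{N|N}$) of parity $|i|$. $E_{ij}$ denotes a (possibly rectangular) matrix unit, of parity $|i|+|j|$. Tensor products of superalgebras follow the super sign rule $(x\otimes y)(x'\otimes y')=(-1)^{|y||x'|}xx'\otimes yy'$. Put $\varphi(i,j)=(-1)^{|j|}(\delta_{i,j}+\delta_{i,-j})$ and $$S=\sum_{i,j\in I_{N|N}}q^{\varphi(i,j)}E_{ii}\otimes E_{jj}+\xi\sum_{i<j}(-1)^{|i|}(E_{ji}+E_{-j,-i})\otimes E_{ij}=\sum_{i,j}S_{ij}\otimes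 E_{ij}\in\mathrm{End}(V_N)^{\otimes2}$$ (invertible; the same letter $S$ is used for every $N$, the size being determined by the formula). **Superscripts.** For $X=\sum E_{ij}\otimes x_{ij}$ with entries in a superalgebra, $X^{k[l]}$ means that $E_{ij}$ is placed in tensor slot $k$ and $x_{ij}$ in slot $l$ (when the algebra slot comes first we write $X^{[l]k}$), identities (of the size making products defined) elsewhere; $S^{kl}$ is $S$ placed in matrix slots $k,l$. **The quantum queer superalgebra.** $\mathrm{U}_q(\mathfrak{q}_N)$ is the unital associative superalgebra generated by $L_{ij}$ ($i,j\in I_{N|N}$, $i\le j$), of parity $|i|+|j|$, with relations $L_{ii}L_{-i,-i}=1=L_{-i,-i}L_{ii}$ and $L^{[1]2}L^{[1]3}S^{23}=S^{23}L^{[1]3}L^{[1]2}$, where $L=\sum_{i\le j}L_{ij}\otimes E_{ij}$. It is a Hopf superalgebra with $\Delta(L)=L\otimes L$, i.e. $\Delta(L_{ij})=\sum_k(-1)^{(|i|+|k|)(|k|+|j|)}L_{ik}\otimes L_{kj}$, $\varepsilon(L)=1$, antipode $\mathcal{S}(L)=L^{-1}$. For $m\le N$ the sub-superalgebra generated by $L_{ij}$, $i,j\in I_{m|m}$, is a Hopf sub-superalgebra identified with $\mathrm{U}_q(\mathfrak{q}_m)$. $V_N$ is a supermodule via $L_{ij}\mapsto S_{ij}$. **Coordinate superalgebras.** $\mathrm{U}_q(\mathfrak{q}_N)^\circ$ is the finite dual (functionals whose kernel contains a $\mathbb{Z}_2$-graded ideal of finite codimension), with product $\langle ff',u\rangle=\sum(-1)^{|f'||u_{(1)}|}\langle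 f,u_{(1)}\rangle\langle f',u_{(2)}\rangle$ and the $\mathrm{U}_q(\mathfrak{q}_N)$-action $\langle\Phi_u(f),u'\rangle=(-1)^{|u|}\langle f,u'u\rangle$. Let $t_{ia}$ ($i,a\in I_{N|N}$) be the matrix elements $u.v_a=\sum_i\langle t_{ia},u\rangle v_i$, and let $\langle\bar t_{\alpha b},u\rangle=(-1)^{|b|(|\alpha|+|b|)}\langle t_{b\alpha},\mathcal{S}(u)\rangle$. For $N\ge\max(r,s,n)$, $\mathsf{A}_{r,n}$ is the sub-superalgebra generated by $1$ and $t_{ia}$, $i\in I_{r|r}$, $a\in I_{n|n}$, and $\bar{\mathsf{A}}_{s,n}$ is the one generated by $1$ and $\bar t_{\alpha b}$, $\alpha\in I_{s|s}$, $b\in I_{n|n}$ (both independent of $N$ up to canonical isomorphism); both are stable under $\Phi_u$, $u\in\mathrm{U}_q(\mathfrak{q}_n)$. Since $t_{-i,-a}=t_{ia}$, $\mathsf{A}_{r,n}$ is generated by $1$ and $t_{ia}$ with $1\le i\le r$, $a\in I_{n|n}$. Put $T_+=\sum_{i=1}^r\sum_{a\in I_{n|n}}E_{ia}\otimes t_{ia}$ and $\bar T=\sum_{\alpha\in I_{s|s},b\in I_{n|n}}(-1)^{|b|(|\alpha|+|b|)}E_{b\alpha}\otimes\bar t_{\alpha b}$. **The map $\Upsilon$.** $\Upsilon:\bar{\mathsf{A}}_{s,n}\otimes\mathsf{A}_{r,n}\to\mathsf{A}_{r,n}\otimes\bar{\mathsf{A}}_{s,n}$ is the (unique) $\mathbb{C}(q)$-linear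 map with $\Upsilon(1\otimes f)=f\otimes1$, $\Upsilon(\bar g\otimes1)=1\otimes\bar g$, $\Upsilon(\bar T^{1[3]}T_+^{2[4]})=T_+^{2[3]}(S^{-1})^{12}\bar T^{1[4]}$ ($\Upsilon$ applied to the algebra slots), $\Upsilon\circ(1\otimes\mathrm{mul})=(\mathrm{mul}\otimes1)(1\otimes\Upsilon)(\Upsilon\otimes1)$ and $\Upsilon\circ(\mathrm{mul}\otimes1)=(1\otimes\mathrm{mul})(\Upsilon\otimes1)(1\otimes\Upsilon)$, where $\mathrm{mul}$ is multiplication. In components, for $1\le i\le r$, $a,b\in I_{n|n}$, $\alpha\in I_{s|s}$, $$\Upsilon(\bar t_{\alpha b}\otimes t_{ia})=(-1)^{|a|(|\alpha|+|b|)}q^{-\varphi(b,a)}t_{ia}\otimes\bar t_{\alpha b}-(-1)^{|a||\alpha|}\xi\sum_{p<a}t_{ip}\otimes(\delta_{ab}\bar t_{\alpha p}+(-1)^{|p|}\delta_{a,-b}\bar t_{\alpha,-p}).$$ (Existence of $\Upsilon$ is known.) *)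

theory Defs
  imports
    "HOL-Computational_Algebra.Polynomial"
    "HOL-Computational_Algebra.Fraction_Field"
    "HOL-Library.Poly_Mapping"
    "HOL-Library.Z2"
    "HOL-Library.Cardinality"
begin

section \<open>The ground field\<close>

text \<open>A copy of \<open>complex poly fract\<close>: type classes of spaces over this fixed field need
  the field to be a type constructor of its own.\<close>

typedef cq = "UNIV :: complex poly fract set" ..

setup_lifting type_definition_cq

instantiation cq :: field
begin
lift_definition zero_cq :: cq is 0 .
lift_definition one_cq :: cq is 1 .
lift_definition plus_cq :: "cq \<Rightarrow> cq \<Rightarrow> cq" is "(+)" .
lift_definition minus_cq :: "cq \<Rightarrow> cq \<Rightarrow> cq" is "(-)" .
lift_definition uminus_cq :: "cq \<Rightarrow> cq" is uminus .
lift_definition times_cq :: "cq \<Rightarrow> cq \<Rightarrow> cq" is "(*)" .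
lift_definition inverse_cq :: "cq \<Rightarrow> cq" is inverse .
lift_definition divide_cq :: "cq \<Rightarrow> cq \<Rightarrow> cq" is "(div)" .
instance
  by (intro_classes; transfer) (auto simp: algebra_simps divide_fract_def)
end

lift_definition qq :: cq is "Fract [:0, 1:] 1" .

lifting_forget cq.lifting

definition \<xi> :: cq where "\<xi> = qq - inverse qq"

section \<open>Superspaces and superalgebras\<close>

text \<open>Parities live in the two-element field.\<close>

definition sgnp :: "bit \<Rightarrow> cq" where "sgnp p = (if p = 0 then 1 else - 1)"

class cqspace = ab_group_add +
  fixes scl :: "cq \<Rightarrow> 'a \<Rightarrow> 'a" (infixr "\<cdot>" 75)
  assumes scl_add_right: "c \<cdot> (x + y) = c \<cdot> x + c \<cdot> y"
    and scl_add_left: "(c + d) \<cdot> x = c \<cdot> x + d \<cdot> x"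
    and scl_scl: "c \<cdot> d \<cdot> x = (c * d) \<cdot> x"
    and scl_one: "1 \<cdot> x = x"

global_interpretation cqs: vector_space "scl :: cq \<Rightarrow> 'a::cqspace \<Rightarrow> 'a"
  by unfold_locales (simp_all add: scl_add_right scl_add_left scl_scl scl_one)

abbreviation cqlinear :: "('a::cqspace \<Rightarrow> 'b::cqspace) \<Rightarrow> bool" where
  "cqlinear \<equiv> Vector_Spaces.linear scl scl"

abbreviation cqspan :: "'a::cqspace set \<Rightarrow> 'a set" where
  "cqspan \<equiv> module.span scl"

abbreviation cqsubspace :: "'a::cqspace set \<Rightarrow> bool" where
  "cqsubspace \<equiv> module.subspace scl"

text \<open>\<open>hpart p\<close> is the projection to the homogeneous component of parity \<open>p\<close>.\<close>

class superspace = cqspace +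
  fixes hpart :: "bit \<Rightarrow> 'a \<Rightarrow> 'a"
  assumes hpart_add: "hpart p (x + y) = hpart p x + hpart p y"
    and hpart_scl: "hpart p (c \<cdot> x) = c \<cdot> hpart p x"
    and hpart_hpart: "hpart p (hpart p' x) = (if p = p' then hpart p x else 0)"
    and hpart_sum: "hpart 0 x + hpart 1 x = x"

text \<open>Superalgebras need not be unital, since matrices of unbounded size will be one.\<close>

class superalgebra = superspace + ring +
  assumes scl_mult_left: "(c \<cdot> x) * y = c \<cdot> (x * y)"
    and scl_mult_right: "x * (c \<cdot> y) = c \<cdot> (x * y)"
    and hpart_mult: "hpart (p + p') (hpart p x * hpart p' y) = hpart p x * hpart p' y"

class superalgebra_1 = superalgebra + monoid_mult

lemma cqlinearI:
  "(\<And>x y. f (x + y) = f x + f y) \<Longrightarrow> (\<And>c x. f (c \<cdot> x) = c \<cdot> f x) \<Longrightarrow> cqlinear f"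
  by (simp add: Vector_Spaces.linear_iff cqs.vector_space_axioms)

lemma cqlinear_hpart: "cqlinear (hpart p)"
  by (rule cqlinearI) (simp_all add: hpart_add hpart_scl)

lemma hpart_0 [simp]: "hpart p 0 = (0 :: 'a::superspace)"
  by (metis cqs.scale_zero_left hpart_scl)

lemma hpart_diff: "hpart p (x - y) = hpart p x - hpart p (y :: 'a::superspace)"
  by (metis add_diff_cancel diff_add_cancel hpart_add)

lemma bit_exhaust: "p = (0::bit) \<or> p = 1"
  by (cases p) auto

lemma hpart_1 [simp]: "hpart p (1 :: 'a::superalgebra_1) = (if p = 0 then 1 else 0)"
proof -
  let ?e = "hpart 0 (1::'a)" and ?o = "hpart 1 (1::'a)"
  have hom: "?e * hpart p x = hpart p x" for p and x :: 'a
  proof -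
    have "hpart p x = ?e * hpart p x + ?o * hpart p x"
      by (metis distrib_right hpart_sum mult_1_left)
    then have "hpart p (hpart p x) = hpart p (?e * hpart p x) + hpart p (?o * hpart p x)"
      by (metis hpart_add)
    moreover have "hpart p (?e * hpart p x) = ?e * hpart p x"
      by (metis add_0 hpart_mult)
    moreover have "hpart p (?o * hpart p x) = hpart p (hpart (1 + p) (?o * hpart p x))"
      by (simp only: hpart_mult)
    then have "hpart p (?o * hpart p x) = 0"
      using bit_exhaust[of p] by (auto simp: hpart_hpart)
    ultimately show ?thesis
      by (simp add: hpart_hpart)
  qed
  have "?e * x = x" for x :: 'a
    by (metis hom distrib_left hpart_sum)
  then have e: "?e = 1"
    by (metis mult_1_right)
  with hpart_sum[of "1::'a"] have "?o = 0"
    by (simp add: add_eq_0_iff)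
  with e show ?thesis
    using bit_exhaust[of p] by auto
qed

instantiation cq :: superalgebra_1
begin
definition scl_cq :: "cq \<Rightarrow> cq \<Rightarrow> cq" where "scl_cq = (*)"
definition hpart_cq :: "bit \<Rightarrow> cq \<Rightarrow> cq" where "hpart_cq p x = (if p = 0 then x else 0)"
instance
  by intro_classes (auto simp: scl_cq_def hpart_cq_def algebra_simps)
end


instantiation poly_mapping :: (type, cqspace) cqspace
begin
lift_definition scl_poly_mapping :: "cq \<Rightarrow> ('a \<Rightarrow>\<^sub>0 'b) \<Rightarrow> 'a \<Rightarrow>\<^sub>0 'b" is
  "\<lambda>c f k. c \<cdot> f k"
  by (rule finite_subset[rotated]) auto
instance
  by (intro_classes; rule poly_mapping_eqI)
    (simp_all add: scl_poly_mapping.rep_eq lookup_add scl_add_right scl_add_left)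
end

definition lin_ext :: "('a \<Rightarrow> 'b::cqspace) \<Rightarrow> ('a \<Rightarrow>\<^sub>0 cq) \<Rightarrow> 'b" where
  "lin_ext f x = (\<Sum>k\<in>Poly_Mapping.keys x. Poly_Mapping.lookup x k \<cdot> f k)"

lemma lin_ext_superset:
  assumes "finite K" "Poly_Mapping.keys x \<subseteq> K"
  shows "lin_ext f x = (\<Sum>k\<in>K. Poly_Mapping.lookup x k \<cdot> f k)"
  unfolding lin_ext_def
  by (rule sum.mono_neutral_left) (use assms in \<open>auto simp: in_keys_iff\<close>)

lemma cqlinear_lin_ext: "cqlinear (lin_ext f)"
proof (rule cqlinearI)
  fix x y :: "'a \<Rightarrow>\<^sub>0 cq" and c :: cq
  let ?K = "Poly_Mapping.keys x \<union> Poly_Mapping.keys y"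
  have "lin_ext f z = (\<Sum>k\<in>?K. Poly_Mapping.lookup z k \<cdot> f k)"
    if "z \<in> {x, y, x + y}" for z
    by (rule lin_ext_superset) (use that keys_add[of x y] in auto)
  then show "lin_ext f (x + y) = lin_ext f x + lin_ext f y"
    by (simp add: lookup_add scl_add_left sum.distrib)
  have "lin_ext f (c \<cdot> x) = (\<Sum>k\<in>Poly_Mapping.keys x. Poly_Mapping.lookup (c \<cdot> x) k \<cdot> f k)"
    by (rule lin_ext_superset) (auto simp: in_keys_iff scl_poly_mapping.rep_eq scl_cq_def)
  then show "lin_ext f (c \<cdot> x) = c \<cdot> lin_ext f x"
    by (simp add: lin_ext_def cqs.scale_sum_right scl_poly_mapping.rep_eq scl_scl scl_cq_def)
qed

lemma lin_ext_single [simp]: "lin_ext f (Poly_Mapping.single k c) = c \<cdot> f k"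
  by (simp add: lin_ext_def)

lemma poly_mapping_eq_lin_ext: "x = lin_ext (\<lambda>k. Poly_Mapping.single k 1) x"
  by (rule poly_mapping_eqI)
     (auto simp: lin_ext_def lookup_sum scl_poly_mapping.rep_eq scl_cq_def lookup_single when_def
       in_keys_iff if_distrib sum.delta cong: if_cong)

section \<open>Tensor products\<close>

text \<open>The tensor product over the ground field is the free space on pairs modulo bilinearity.\<close>

inductive_set tensor_relators :: "('a::cqspace \<times> 'b::cqspace \<Rightarrow>\<^sub>0 cq) set" where
  "Poly_Mapping.single (a + a', b) 1
     - (Poly_Mapping.single (a, b) 1 + Poly_Mapping.single (a', b) 1) \<in> tensor_relators"
| "Poly_Mapping.single (a, b + b') 1
     - (Poly_Mapping.single (a, b) 1 + Poly_Mapping.single (a, b') 1) \<in> tensor_relators"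
| "Poly_Mapping.single (c \<cdot> a, b) 1 - c \<cdot> Poly_Mapping.single (a, b) 1 \<in> tensor_relators"
| "Poly_Mapping.single (a, c \<cdot> b) 1 - c \<cdot> Poly_Mapping.single (a, b) 1 \<in> tensor_relators"

definition tensor_rel ::
  "('a::cqspace \<times> 'b::cqspace \<Rightarrow>\<^sub>0 cq) \<Rightarrow> ('a \<times> 'b \<Rightarrow>\<^sub>0 cq) \<Rightarrow> bool" where
  "tensor_rel x y \<longleftrightarrow> x - y \<in> cqspan tensor_relators"

lemma equivp_diff_span: "equivp (\<lambda>x y. x - y \<in> cqspan S)"
proof (rule equivpI)
  show "symp (\<lambda>x y. x - y \<in> cqspan S)"
  proof (rule sympI)
    fix x y :: 'a assume "x - y \<in> cqspan S"
    from cqs.span_neg[OF this] show "y - x \<in> cqspan S" by simp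
  qed
  show "transp (\<lambda>x y. x - y \<in> cqspan S)"
  proof (rule transpI)
    fix x y z :: 'a assume "x - y \<in> cqspan S" "y - z \<in> cqspan S"
    from cqs.span_add[OF this] show "x - z \<in> cqspan S" by simp
  qed
qed (simp add: reflp_def cqs.span_zero)

lemma span_cong:
  assumes "x - x' \<in> cqspan S"
  shows span_cong_uminus: "- x - (- x') \<in> cqspan S"
    and span_cong_scl: "c \<cdot> x - c \<cdot> x' \<in> cqspan S"
  using cqs.span_neg[OF assms] cqs.span_scale[OF assms, of c]
  by (simp_all add: cqs.scale_right_diff_distrib)

lemma span_cong2:
  assumes "x - x' \<in> cqspan S" "y - y' \<in> cqspan S"
  shows span_cong_add: "(x + y) - (x' + y') \<in> cqspan S"
    and span_cong_diff: "(x - y) - (x' - y') \<in> cqspan S"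
  using cqs.span_add[OF assms] cqs.span_diff[OF assms] by (simp_all add: algebra_simps)

quotient_type (overloaded) ('a, 'b) tensor = "'a::cqspace \<times> 'b::cqspace \<Rightarrow>\<^sub>0 cq" / tensor_rel
  using equivp_diff_span[of tensor_relators] by (simp add: tensor_rel_def[abs_def])

lemma tensor_exhaust: obtains x where "t = abs_tensor x"
  using tensor.abs_induct[of "\<lambda>t. \<exists>x. t = abs_tensor x" t] by blast

instantiation tensor :: (cqspace, cqspace) cqspace
begin
lift_definition zero_tensor :: "('a, 'b) tensor" is 0 .
lift_definition plus_tensor :: "('a, 'b) tensor \<Rightarrow> ('a, 'b) tensor \<Rightarrow> ('a, 'b) tensor" is "(+)"
  unfolding tensor_rel_def by (rule span_cong_add)
lift_definition minus_tensor :: "('a, 'b) tensor \<Rightarrow> ('a, 'b) tensor \<Rightarrow> ('a, 'b) tensor" is "(-)"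
  unfolding tensor_rel_def by (rule span_cong_diff)
lift_definition uminus_tensor :: "('a, 'b) tensor \<Rightarrow> ('a, 'b) tensor" is uminus
  unfolding tensor_rel_def by (rule span_cong_uminus)
lift_definition scl_tensor :: "cq \<Rightarrow> ('a, 'b) tensor \<Rightarrow> ('a, 'b) tensor" is scl
  unfolding tensor_rel_def by (rule span_cong_scl)
instance
proof
  fix a b c :: "('a, 'b) tensor" and k l :: cq
  obtain x y z where xyz: "a = abs_tensor x" "b = abs_tensor y" "c = abs_tensor z"
    using tensor_exhaust by metis
  note abs = plus_tensor.abs_eq minus_tensor.abs_eq uminus_tensor.abs_eq scl_tensor.abs_eq
    zero_tensor_def xyz
  show "a + b + c = a + (b + c)" by (simp add: abs add.assoc)
  show "a + b = b + a" by (simp add: abs add.commute)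
  show "0 + a = a" by (simp add: abs)
  show "- a + a = 0" by (simp add: abs)
  show "a - b = a + - b" by (simp add: abs)
  show "k \<cdot> (a + b) = k \<cdot> a + k \<cdot> b" by (simp add: abs scl_add_right)
  show "(k + l) \<cdot> a = k \<cdot> a + l \<cdot> a" by (simp add: abs scl_add_left)
  show "k \<cdot> l \<cdot> a = (k * l) \<cdot> a" by (simp add: abs)
  show "1 \<cdot> a = a" by (simp add: abs)
qed
end

lift_definition tens :: "'a::cqspace \<Rightarrow> 'b::cqspace \<Rightarrow> ('a, 'b) tensor" (infixr "\<otimes>" 72) is
  "\<lambda>a b. Poly_Mapping.single (a, b) 1" .

text \<open>The linear map induced by a bilinear map \<open>B\<close>.\<close>

definition tlift ::
  "('a::cqspace \<Rightarrow> 'b::cqspace \<Rightarrow> 'c::cqspace) \<Rightarrow> ('a, 'b) tensor \<Rightarrow> 'c" where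
  "tlift B t = lin_ext (\<lambda>(a, b). B a b) (rep_tensor t)"

definition bilin :: "('a::cqspace \<Rightarrow> 'b::cqspace \<Rightarrow> 'c::cqspace) \<Rightarrow> bool" where
  "bilin B \<longleftrightarrow> (\<forall>a. cqlinear (B a)) \<and> (\<forall>b. cqlinear (\<lambda>a. B a b))"


lemma bilinI:
  assumes "\<And>a b b'. B a (b + b') = B a b + B a b'" "\<And>a c b. B a (c \<cdot> b) = c \<cdot> B a b"
    "\<And>a a' b. B (a + a') b = B a b + B a' b" "\<And>a c b. B (c \<cdot> a) b = c \<cdot> B a b"
  shows "bilin B"
  using assms unfolding bilin_def by (auto intro!: cqlinearI)

lemma cqlinearD:
  assumes "cqlinear f"
  shows "f (x + y) = f x + f y" "f (c \<cdot> x) = c \<cdot> f x" "f 0 = 0" "f (x - y) = f x - f y"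
    "f (- x) = - f x" "f (sum g A) = (\<Sum>i\<in>A. f (g i))"
proof -
  interpret f: Vector_Spaces.linear scl scl f by fact
  show "f (x + y) = f x + f y" "f (c \<cdot> x) = c \<cdot> f x" "f 0 = 0" "f (x - y) = f x - f y"
    "f (- x) = - f x" "f (sum g A) = (\<Sum>i\<in>A. f (g i))"
    by (rule f.add f.scale f.zero f.diff f.neg f.sum)+
qed

lemma bilinD:
  assumes "bilin B"
  shows "B a (b + b') = B a b + B a b'" "B a (c \<cdot> b) = c \<cdot> B a b"
    "B (a + a') b = B a b + B a' b" "B (c \<cdot> a) b = c \<cdot> B a b"
proof -
  have 1: "cqlinear (B a)" and 2: "cqlinear (\<lambda>a. B a b)"
    using assms by (auto simp: bilin_def)
  show "B a (b + b') = B a b + B a b'" "B a (c \<cdot> b) = c \<cdot> B a b"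
    by (rule cqlinearD[OF 1])+
  show "B (a + a') b = B a b + B a' b" "B (c \<cdot> a) b = c \<cdot> B a b"
    by (rule cqlinearD[OF 2])+
qed

lemma cqlinear_abs_tensor: "cqlinear abs_tensor"
  by (rule cqlinearI) (simp_all add: plus_tensor.abs_eq scl_tensor.abs_eq)

lemma bilin_tens: "bilin (\<otimes>)"
proof (rule bilinI)
  note defs = tens.abs_eq plus_tensor.abs_eq scl_tensor.abs_eq tensor.abs_eq_iff tensor_rel_def
  have base: "x - y \<in> cqspan tensor_relators"
    if "x - y \<in> tensor_relators" for x y :: "'a \<times> 'b \<Rightarrow>\<^sub>0 cq"
    using that by (rule cqs.span_base)
  fix a a' :: 'a and b b' :: 'b and c
  show "a \<otimes> (b + b') = a \<otimes> b + a \<otimes> b'" "(a + a') \<otimes> b = a \<otimes> b + a' \<otimes> b"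
    "a \<otimes> (c \<cdot> b) = c \<cdot> (a \<otimes> b)" "(c \<cdot> a) \<otimes> b = c \<cdot> (a \<otimes> b)"
    unfolding defs by (rule base, rule tensor_relators.intros)+
qed

lemmas tens_lin = bilinD[OF bilin_tens]

lemma tens_zero [simp]: "0 \<otimes> b = 0" "a \<otimes> 0 = 0"
  using tens_lin(4)[of 0 0 b] tens_lin(2)[of a 0 0] by simp_all

lemma tlift_abs:
  assumes "bilin B"
  shows "tlift B (abs_tensor x) = lin_ext (\<lambda>(a, b). B a b) x"
proof -
  let ?L = "lin_ext (\<lambda>(a, b). B a b)"
  note L = cqlinearD[OF cqlinear_lin_ext[of "\<lambda>(a, b). B a b"]]
  have "?L r = 0" if "r \<in> cqspan tensor_relators" for r
    using that
  proof (induction rule: cqs.span_induct_alt)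
    case base
    show ?case by (simp add: L)
  next
    case (step c r s)
    then have "?L r = 0"
      by (auto elim!: tensor_relators.cases simp: L bilinD[OF assms])
    with step show ?case by (simp add: L)
  qed
  moreover have "rep_tensor (abs_tensor x) - x \<in> cqspan tensor_relators"
    using Quotient_rep_abs[OF Quotient_tensor] Quotient3_tensor
    by (metis tensor_rel_def tensor.abs_eq_iff Quotient3_abs_rep)
  ultimately have "?L (rep_tensor (abs_tensor x) - x) = 0"
    by blast
  then show ?thesis
    by (simp add: tlift_def L)
qed

lemma cqlinear_tlift:
  assumes "bilin B"
  shows "cqlinear (tlift B)"
proof (rule cqlinearI)
  note L = cqlinearD[OF cqlinear_lin_ext[of "\<lambda>(a, b). B a b"]]
  fix x y :: "('a, 'b) tensor" and c
  obtain x' y' where xy: "x = abs_tensor x'" "y = abs_tensor y'"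
    using tensor_exhaust by metis
  show "tlift B (x + y) = tlift B x + tlift B y"
    by (simp add: xy plus_tensor.abs_eq tlift_abs[OF assms] L)
  show "tlift B (c \<cdot> x) = c \<cdot> tlift B x"
    by (simp add: xy scl_tensor.abs_eq tlift_abs[OF assms] L)
qed

lemma tlift_tens:
  assumes "bilin B"
  shows "tlift B (a \<otimes> b) = B a b"
  by (simp add: tens.abs_eq tlift_abs[OF assms])

lemma tensor_induct [case_names tens add]:
  assumes tens: "\<And>a b. P (a \<otimes> b)" and add: "\<And>x y. P x \<Longrightarrow> P y \<Longrightarrow> P (x + y)"
  shows "P t"
proof (induction t rule: tensor.abs_induct)
  case (1 x)
  have 0: "P 0"
    using tens[of 0 0] tens_lin(4)[of 0 "0::'a" "0::'b"] by simp
  have "abs_tensor x = (\<Sum>(a, b)\<in>Poly_Mapping.keys x. (Poly_Mapping.lookup x (a, b) \<cdot> a) \<otimes> b)"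
    by (subst poly_mapping_eq_lin_ext[of x])
       (simp add: lin_ext_def tens_lin(4) cqlinearD[OF cqlinear_abs_tensor] split_def,
        simp add: tens.abs_eq)
  also have "P \<dots>"
    using finite_keys by (induction rule: finite_induct) (auto simp: 0 tens add)
  finally show ?case .
qed


lemma tlift_add_fun: "tlift (\<lambda>a b. B a b + B' a b) t = tlift B t + tlift B' t"
  by (simp add: tlift_def lin_ext_def split_def scl_add_right sum.distrib)

lemma tlift_scl_fun: "tlift (\<lambda>a b. c \<cdot> B a b) t = c \<cdot> tlift B t"
  by (simp add: tlift_def lin_ext_def split_def cqs.scale_sum_right mult.commute)

definition homog :: "bit \<Rightarrow> 'a::superspace \<Rightarrow> bool" where
  "homog p x \<longleftrightarrow> hpart p x = x"

lemma homog_hpart [simp]: "homog p (hpart p x)"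
  by (simp add: homog_def hpart_hpart)

lemma hpart_homog: "homog p x \<Longrightarrow> hpart p' x = (if p = p' then x else 0)"
  unfolding homog_def by (metis hpart_hpart)

lemma homog_mult: "homog p x \<Longrightarrow> homog p' y \<Longrightarrow> homog (p + p') (x * y)"
  for x y :: "'a::superalgebra"
  unfolding homog_def by (metis hpart_mult)

lemma tensor_induct_homog [case_names tens add]:
  fixes P :: "('a::superspace, 'b::superspace) tensor \<Rightarrow> bool"
  assumes tens: "\<And>p p' a b. homog p a \<Longrightarrow> homog p' b \<Longrightarrow> P (a \<otimes> b)"
    and add: "\<And>x y. P x \<Longrightarrow> P y \<Longrightarrow> P (x + y)"
  shows "P t"
proof (induction t rule: tensor_induct)
  case (tens a b)
  have "a \<otimes> b = (hpart 0 a + hpart 1 a) \<otimes> (hpart 0 b + hpart 1 b)"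
    by (simp only: hpart_sum)
  also have "P \<dots>"
    unfolding tens_lin by (intro add assms(1)[OF homog_hpart homog_hpart])
  finally show ?case .
qed (rule add)

instantiation tensor :: (superspace, superspace) superspace
begin

definition hpart_tensor :: "bit \<Rightarrow> ('a, 'b) tensor \<Rightarrow> ('a, 'b) tensor" where
  "hpart_tensor p = tlift (\<lambda>a b. \<Sum>u\<in>{0, 1}. hpart u a \<otimes> hpart (p - u) b)"

lemma bilin_hpart_tensor:
  "bilin (\<lambda>(a::'a) (b::'b). \<Sum>u\<in>{0, 1}. hpart u a \<otimes> hpart (p - u) b)"
  by (rule bilinI) (simp_all add: hpart_add hpart_scl tens_lin scl_add_right add_ac)

lemma hpart_tens: "hpart p (a \<otimes> b) = (\<Sum>u\<in>{0, 1}. hpart u a \<otimes> hpart (p - u) b)" for a :: 'a and b :: 'b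
  unfolding hpart_tensor_def by (rule tlift_tens[OF bilin_hpart_tensor])

lemma hpart_tens_homog:
  fixes a :: 'a and b :: 'b
  assumes "homog u a" "homog v b"
  shows "hpart p (a \<otimes> b) = (if p = u + v then a \<otimes> b else 0)"
  using bit_exhaust[of p] bit_exhaust[of u] bit_exhaust[of v]
  by (auto simp: hpart_tens hpart_homog[OF assms(1)] hpart_homog[OF assms(2)])

lemma cqlinear_hpart_tensor: "cqlinear (hpart p :: ('a, 'b) tensor \<Rightarrow> ('a, 'b) tensor)"
  unfolding hpart_tensor_def by (rule cqlinear_tlift[OF bilin_hpart_tensor])

lemmas hpart_tensor_lin = cqlinearD[OF cqlinear_hpart_tensor]

lemma hpart_hpart_tensor:
  "hpart p (hpart p' t) = (if p = p' then hpart p t else 0)" for t :: "('a, 'b) tensor"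
  by (induction t rule: tensor_induct_homog)
     (auto simp: hpart_tens_homog hpart_tensor_lin(1,3))

lemma hpart_sum_tensor: "hpart 0 t + hpart 1 t = t" for t :: "('a, 'b) tensor"
proof (induction t rule: tensor_induct_homog)
  case (tens p p' a b)
  then show ?case
    using bit_exhaust[of p] bit_exhaust[of p'] by (auto simp: hpart_tens_homog)
next
  case (add x y)
  have "hpart 0 (x + y) + hpart 1 (x + y) = (hpart 0 x + hpart 1 x) + (hpart 0 y + hpart 1 y)"
    by (simp only: hpart_tensor_lin(1) add_ac)
  with add show ?case by (simp only:)
qed

instance
  by intro_classes
     (simp_all only: hpart_tensor_lin hpart_hpart_tensor hpart_sum_tensor)

end

text \<open>Super sign rule: \<open>(a \<otimes> b) (a' \<otimes> b') = (-1)\<^bsup>|b||a'|\<^esup> (a a') \<otimes> (b b')\<close>.\<close>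

definition tensor_mult :: "'a::superalgebra \<Rightarrow> 'b::superalgebra \<Rightarrow> 'a \<Rightarrow> 'b \<Rightarrow> ('a, 'b) tensor" where
  "tensor_mult a b a' b' =
     (\<Sum>u\<in>{0, 1}. \<Sum>v\<in>{0, 1}. sgnp (v * u) \<cdot> ((a * hpart u a') \<otimes> (hpart v b * b')))"

lemma tensor_mult_linear:
  "tensor_mult (a + a2) b a' b' = tensor_mult a b a' b' + tensor_mult a2 b a' b'"
  "tensor_mult a (b + b2) a' b' = tensor_mult a b a' b' + tensor_mult a b2 a' b'"
  "tensor_mult a b (a' + a2) b' = tensor_mult a b a' b' + tensor_mult a b a2 b'"
  "tensor_mult a b a' (b' + b2) = tensor_mult a b a' b' + tensor_mult a b a' b2"
  "tensor_mult (c \<cdot> a) b a' b' = c \<cdot> tensor_mult a b a' b'"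
  "tensor_mult a (c \<cdot> b) a' b' = c \<cdot> tensor_mult a b a' b'"
  "tensor_mult a b (c \<cdot> a') b' = c \<cdot> tensor_mult a b a' b'"
  "tensor_mult a b a' (c \<cdot> b') = c \<cdot> tensor_mult a b a' b'"
  unfolding tensor_mult_def
  by (simp_all add: hpart_add hpart_scl tens_lin distrib_left distrib_right scl_add_right
      scl_mult_left scl_mult_right mult.commute[of _ c] add_ac)

lemma bilin_tensor_mult: "bilin (tensor_mult a b)"
  by (rule bilinI) (simp_all add: tensor_mult_linear)

lemma tensor_mult_fun:
  "tensor_mult (a + a2) b = (\<lambda>a' b'. tensor_mult a b a' b' + tensor_mult a2 b a' b')"
  "tensor_mult a (b + b2) = (\<lambda>a' b'. tensor_mult a b a' b' + tensor_mult a b2 a' b')"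
  "tensor_mult (c \<cdot> a) b = (\<lambda>a' b'. c \<cdot> tensor_mult a b a' b')"
  "tensor_mult a (c \<cdot> b) = (\<lambda>a' b'. c \<cdot> tensor_mult a b a' b')"
  by (intro ext, rule tensor_mult_linear)+

lemma bilin_times_tensor: "bilin (\<lambda>a b. tlift (tensor_mult a b) t')"
  by (rule bilinI) (simp_all only: tensor_mult_fun tlift_add_fun tlift_scl_fun)

instantiation tensor :: (superalgebra, superalgebra) superalgebra
begin

definition times_tensor :: "('a, 'b) tensor \<Rightarrow> ('a, 'b) tensor \<Rightarrow> ('a, 'b) tensor" where
  "t * t' = tlift (\<lambda>a b. tlift (tensor_mult a b) t') t"

lemma times_tens: "(a \<otimes> b) * (a' \<otimes> b') = tensor_mult a b a' b'"
  unfolding times_tensor_def tlift_tens[OF bilin_times_tensor]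
  by (rule tlift_tens[OF bilin_tensor_mult])

lemma times_tens_homog:
  fixes a :: 'a and b' :: 'b
  assumes "homog v b" "homog u a'"
  shows "(a \<otimes> b) * (a' \<otimes> b') = sgnp (v * u) \<cdot> ((a * a') \<otimes> (b * b'))"
  using bit_exhaust[of u] bit_exhaust[of v]
  by (auto simp: times_tens tensor_mult_def hpart_homog[OF assms(1)] hpart_homog[OF assms(2)])

lemma cqlinear_times_tensor:
  "cqlinear (\<lambda>t. t * t')" "cqlinear (\<lambda>t. t' * t)" for t' :: "('a, 'b) tensor"
proof -
  show "cqlinear (\<lambda>t. t * t')"
    unfolding times_tensor_def by (rule cqlinear_tlift[OF bilin_times_tensor])
  show "cqlinear (\<lambda>t. t' * t)"
    by (rule cqlinearI)
       (simp_all add: times_tensor_def cqlinearD[OF cqlinear_tlift[OF bilin_tensor_mult]]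
         tlift_add_fun tlift_scl_fun)
qed

lemmas times_tensor_lin_left = cqlinearD[OF cqlinear_times_tensor(1)]
lemmas times_tensor_lin_right = cqlinearD[OF cqlinear_times_tensor(2)]

lemma mult_assoc_tensor: "(x * y) * z = x * (y * z)" for x y z :: "('a, 'b) tensor"
proof (induction x rule: tensor_induct_homog)
  case (tens p p' a b)
  note 1 = tens
  show ?case
  proof (induction y rule: tensor_induct_homog)
    case (tens u u' a' b')
    note 2 = tens
    show ?case
    proof (induction z rule: tensor_induct_homog)
      case (tens v v' a'' b'')
      have "(a \<otimes> b * a' \<otimes> b') * a'' \<otimes> b'' =
          (sgnp (p' * u) * sgnp ((p' + u') * v)) \<cdot> ((a * a' * a'') \<otimes> (b * b' * b''))"
        using times_tens_homog[OF 1(2) 2(1)] times_tens_homog[OF homog_mult[OF 1(2) 2(2)] tens(1)]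
        by (simp only: times_tensor_lin_left cqs.scale_scale)
      moreover have "a \<otimes> b * (a' \<otimes> b' * a'' \<otimes> b'') =
          (sgnp (u' * v) * sgnp (p' * (u + v))) \<cdot> ((a * (a' * a'')) \<otimes> (b * (b' * b'')))"
        using times_tens_homog[OF 2(2) tens(1)] times_tens_homog[OF 1(2) homog_mult[OF 2(1) tens(1)]]
        by (simp only: times_tensor_lin_right cqs.scale_scale)
      moreover have "sgnp (p' * u) * sgnp ((p' + u') * v) = sgnp (u' * v) * sgnp (p' * (u + v))"
        using bit_exhaust[of p'] bit_exhaust[of u] bit_exhaust[of u'] bit_exhaust[of v]
        by (auto simp: sgnp_def)
      ultimately show ?case
        by (simp only: mult.assoc)
    qed (simp only: times_tensor_lin_right)
  qed (simp only: times_tensor_lin_left times_tensor_lin_right)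
qed (simp only: times_tensor_lin_left)

lemma hpart_mult_tensor:
  "hpart (p + p') (hpart p x * hpart p' y) = hpart p x * hpart p' y" for x y :: "('a, 'b) tensor"
proof (induction x rule: tensor_induct_homog)
  case (tens u u' a b)
  note 1 = tens
  show ?case
  proof (induction y rule: tensor_induct_homog)
    case (tens v v' a' b')
    have "hpart (u + u' + (v + v')) ((a * a') \<otimes> (b * b')) = (a * a') \<otimes> (b * b')"
      by (simp only: hpart_tens_homog[OF homog_mult[OF 1(1) tens(1)] homog_mult[OF 1(2) tens(2)]]
          add_ac) simp
    then have 2: "hpart (u + u' + (v + v')) (a \<otimes> b * a' \<otimes> b') = a \<otimes> b * a' \<otimes> b'"
      by (simp only: times_tens_homog[OF 1(2) tens(1)] hpart_scl)
    show ?case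
    proof (cases "p = u + u' \<and> p' = v + v'")
      case True
      with 2 show ?thesis
        by (simp only: hpart_tens_homog[OF 1] hpart_tens_homog[OF tens] if_True simp_thms)
    next
      case False
      then have "hpart p (a \<otimes> b) = 0 \<or> hpart p' (a' \<otimes> b') = 0"
        by (simp only: hpart_tens_homog[OF 1] hpart_tens_homog[OF tens] de_Morgan_conj) auto
      then have "hpart p (a \<otimes> b) * hpart p' (a' \<otimes> b') = 0"
        by (auto simp: times_tensor_lin_left times_tensor_lin_right)
      then show ?thesis
        by simp
    qed
  qed (simp only: hpart_add times_tensor_lin_right)
qed (simp only: hpart_add times_tensor_lin_left)

instance
  by intro_classes
     (simp_all only: mult_assoc_tensor times_tensor_lin_left times_tensor_lin_right hpart_mult_tensor)

end

instantiation tensor :: (superalgebra_1, superalgebra_1) superalgebra_1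
begin
definition one_tensor :: "('a, 'b) tensor" where "1 = 1 \<otimes> 1"
lemma homog_one: "homog 0 (1 :: 'c::superalgebra_1)"
  by (simp add: homog_def)
lemma one_tensor_mult: "1 * t = t" "t * 1 = t" for t :: "('a, 'b) tensor"
  by (induction t rule: tensor_induct_homog)
     (simp_all only: one_tensor_def times_tensor_lin_left times_tensor_lin_right
       times_tens_homog[OF homog_one] times_tens_homog[OF _ homog_one]
       mult_zero_left mult_zero_right mult_1_left mult_1_right sgnp_def if_True scl_one simp_thms)
instance
  by intro_classes (rule one_tensor_mult)+
end

section \<open>Matrices\<close>

definition parity :: "int \<Rightarrow> bit" where "parity i = (if i < 0 then 1 else 0)"

text \<open>Matrices with rows and columns indexed by all integers and finitely many nonzero entries.
  They contain the matrices of every finite size, rectangular ones included; \<open>munit i j\<close> is the matrix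
  unit and \<open>idm N\<close> the identity of \<open>End(V\<^sub>N)\<close>.\<close>

typedef mat = "{f :: int \<Rightarrow> int \<Rightarrow> cq. finite {(i, j). f i j \<noteq> 0}}"
  morphisms entry Abs_mat
  by (rule exI[of _ "\<lambda>_ _. 0"]) simp

setup_lifting type_definition_mat

lemma mat_eqI: "(\<And>i j. entry A i j = entry B i j) \<Longrightarrow> A = B"
  by transfer (auto simp: fun_eq_iff)

lemma mat_support:
  obtains K where "finite K" "\<And>i j. entry A i j \<noteq> 0 \<Longrightarrow> i \<in> K \<and> j \<in> K"
proof
  have fin: "finite {(i, j). entry A i j \<noteq> 0}"
    using entry[of A] by simp
  let ?K = "fst ` {(i, j). entry A i j \<noteq> 0} \<union> snd ` {(i, j). entry A i j \<noteq> 0}"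
  show "finite ?K"
    using fin by blast
  show "i \<in> ?K \<and> j \<in> ?K" if "entry A i j \<noteq> 0" for i j
    using that by force
qed

instantiation mat :: superspace
begin
lift_definition zero_mat :: mat is "\<lambda>_ _. 0" by simp
lift_definition plus_mat :: "mat \<Rightarrow> mat \<Rightarrow> mat" is "\<lambda>A B i j. A i j + B i j"
  by (erule (1) finite_subset[OF _ finite_UnI, rotated]) auto
lift_definition minus_mat :: "mat \<Rightarrow> mat \<Rightarrow> mat" is "\<lambda>A B i j. A i j - B i j"
  by (erule (1) finite_subset[OF _ finite_UnI, rotated]) auto
lift_definition uminus_mat :: "mat \<Rightarrow> mat" is "\<lambda>A i j. - A i j"
  by simp
lift_definition scl_mat :: "cq \<Rightarrow> mat \<Rightarrow> mat" is "\<lambda>c A i j. c * A i j"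
  by (erule finite_subset[rotated]) auto
lift_definition hpart_mat :: "bit \<Rightarrow> mat \<Rightarrow> mat" is
  "\<lambda>p A i j. if parity i + parity j = p then A i j else 0"
  by (erule finite_subset[rotated]) auto
instance
proof (intro_classes; rule mat_eqI)
  fix i j :: int
  show "entry (hpart 0 A + hpart 1 A) i j = entry A i j" for A
    using bit_exhaust[of "parity i + parity j"] by (auto simp: plus_mat.rep_eq hpart_mat.rep_eq)
qed (auto simp: plus_mat.rep_eq minus_mat.rep_eq uminus_mat.rep_eq zero_mat.rep_eq scl_mat.rep_eq
      hpart_mat.rep_eq algebra_simps)
end

instantiation mat :: superalgebra
begin

lift_definition times_mat :: "mat \<Rightarrow> mat \<Rightarrow> mat" is
  "\<lambda>A B i j. \<Sum>k | A i k \<noteq> 0. A i k * B k j"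
proof -
  fix A B :: "int \<Rightarrow> int \<Rightarrow> cq"
  assume "finite {(i, j). A i j \<noteq> 0}" "finite {(i, j). B i j \<noteq> 0}"
  then have "finite (fst ` {(i, j). A i j \<noteq> 0} \<times> snd ` {(i, j). B i j \<noteq> 0})"
    by blast
  then show "finite {(i, j). (\<Sum>k | A i k \<noteq> 0. A i k * B k j) \<noteq> 0}"
    by (rule finite_subset[rotated]) (force elim!: sum.not_neutral_contains_not_neutral)
qed

lemma entry_mult:
  assumes "finite K" "\<And>i j. entry A i j \<noteq> 0 \<Longrightarrow> j \<in> K"
  shows "entry (A * B) i j = (\<Sum>k\<in>K. entry A i k * entry B k j)"
  unfolding times_mat.rep_eq
  by (rule sum.mono_neutral_left) (use assms in auto)

instance
proof (intro_classes; rule mat_eqI)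
  fix A B C :: mat and i j :: int and c and p p' :: bit
  obtain K where K: "finite K" "\<And>i j. entry A i j \<noteq> 0 \<Longrightarrow> i \<in> K \<and> j \<in> K"
    using mat_support[of A] by blast
  obtain K' where K': "finite K'" "\<And>i j. entry B i j \<noteq> 0 \<Longrightarrow> i \<in> K' \<and> j \<in> K'"
    using mat_support[of B] by blast
  let ?M = "K \<union> K'"
  have fin: "finite ?M"
    using K K' by simp
  have A: "entry (A * D) i j = (\<Sum>k\<in>?M. entry A i k * entry D k j)" for D i j
    by (rule entry_mult[OF fin]) (use K in blast)
  have B: "entry (B * D) i j = (\<Sum>k\<in>?M. entry B i k * entry D k j)" for D i j
    by (rule entry_mult[OF fin]) (use K' in blast)
  have AB: "entry (A * B * D) i j = (\<Sum>k\<in>?M. entry (A * B) i k * entry D k j)" for D i j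
  proof (rule entry_mult[OF fin])
    fix i j assume "entry (A * B) i j \<noteq> 0"
    then obtain k where "entry A i k * entry B k j \<noteq> 0"
      unfolding A by (rule sum.not_neutral_contains_not_neutral)
    then show "j \<in> ?M"
      using K'(2)[of k j] by simp
  qed
  show "entry (A * B * C) i j = entry (A * (B * C)) i j"
    by (simp add: AB A B sum_distrib_left sum_distrib_right mult.assoc) (rule sum.swap)
  show "entry ((A + B) * C) i j = entry (A * C + B * C) i j"
  proof -
    have "entry ((A + B) * C) i j = (\<Sum>k\<in>?M. entry (A + B) i k * entry C k j)"
    proof (rule entry_mult[OF fin])
      fix i j assume "entry (A + B) i j \<noteq> 0"
      then have "entry A i j \<noteq> 0 \<or> entry B i j \<noteq> 0"
        by (auto simp: plus_mat.rep_eq)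
      then show "j \<in> ?M"
        using K(2) K'(2) by blast
    qed
    then show ?thesis
      by (simp add: plus_mat.rep_eq A B distrib_right sum.distrib)
  qed
  show "entry (A * (B + C)) i j = entry (A * B + A * C) i j"
    by (simp add: plus_mat.rep_eq A distrib_left sum.distrib)
  show "entry ((c \<cdot> A) * B) i j = entry (c \<cdot> (A * B)) i j"
  proof -
    have "entry ((c \<cdot> A) * B) i j = (\<Sum>k\<in>?M. entry (c \<cdot> A) i k * entry B k j)"
      by (rule entry_mult[OF fin]) (use K(2) in \<open>auto simp: scl_mat.rep_eq\<close>)
    then show ?thesis
      by (simp add: scl_mat.rep_eq A sum_distrib_left mult.assoc)
  qed
  show "entry (A * (c \<cdot> B)) i j = entry (c \<cdot> (A * B)) i j"
    by (simp add: scl_mat.rep_eq A sum_distrib_left mult.left_commute)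
  have h: "entry (hpart p A * D) i j = (\<Sum>k\<in>?M. entry (hpart p A) i k * entry D k j)" for D i j
    by (rule entry_mult[OF fin]) (use K(2) in \<open>auto simp: hpart_mat.rep_eq split: if_splits\<close>)
  show "entry (hpart (p + p') (hpart p A * hpart p' B)) i j = entry (hpart p A * hpart p' B) i j"
  proof (cases "parity i + parity j = p + p'")
    case False
    have "entry (hpart p A) i k * entry (hpart p' B) k j = 0" for k
      using False bit_exhaust[of "parity i"] bit_exhaust[of "parity j"] bit_exhaust[of "parity k"]
        bit_exhaust[of p] bit_exhaust[of p']
      by (auto simp: hpart_mat.rep_eq)
    then have "entry (hpart p A * hpart p' B) i j = 0"
      by (simp only: h sum.neutral_const)
    with False show ?thesis
      by (simp only: hpart_mat.rep_eq if_False)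
  qed (simp only: hpart_mat.rep_eq if_True simp_thms)
qed

end

lift_definition munit :: "int \<Rightarrow> int \<Rightarrow> mat" is
  "\<lambda>i j k l. if k = i \<and> l = j then 1 else 0"
  by (rule finite_subset[of _ "{(i, j)}" for i j]) auto

definition idx :: "nat \<Rightarrow> int set" where "idx N = {- int N..int N} - {0}"

definition idm :: "nat \<Rightarrow> mat" where "idm N = (\<Sum>i\<in>idx N. munit i i)"

definition \<phi> :: "int \<Rightarrow> int \<Rightarrow> int" where
  "\<phi> i j = (if parity j = 0 then 1 else - 1) * (of_bool (i = j) + of_bool (i = - j))"

definition Smat :: "nat \<Rightarrow> (mat, mat) tensor" where
  "Smat N = (\<Sum>i\<in>idx N. \<Sum>j\<in>idx N. (qq powi \<phi> i j) \<cdot> (munit i i \<otimes> munit j j))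
       + \<xi> \<cdot> (\<Sum>i\<in>idx N. \<Sum>j\<in>{j\<in>idx N. i < j}.
                sgnp (parity i) \<cdot> ((munit j i + munit (- j) (- i)) \<otimes> munit i j))"

text \<open>\<open>ecoef i j X\<close> is \<open>x\<^sub>i\<^sub>j\<close> for \<open>X = \<Sum>\<^sub>i\<^sub>j x\<^sub>i\<^sub>j \<otimes> munit i j\<close>.\<close>

definition ecoef :: "int \<Rightarrow> int \<Rightarrow> ('a::cqspace, mat) tensor \<Rightarrow> 'a" where
  "ecoef i j = tlift (\<lambda>x m. entry m i j \<cdot> x)"

section \<open>The quantum queer superalgebra\<close>

subsection \<open>The free superalgebra on symbols indexed by pairs of integers\<close>

datatype lword = Word "(int \<times> int) list"

instantiation lword :: monoid_add
begin
definition zero_lword :: lword where "0 = Word []"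
fun plus_lword :: "lword \<Rightarrow> lword \<Rightarrow> lword" where "Word v + Word w = Word (v @ w)"
instance
proof
  fix u v w :: lword
  show "u + v + w = u + (v + w)" by (cases u; cases v; cases w) simp
  show "0 + u = u" "u + 0 = u" by (cases u; simp add: zero_lword_def)+
qed
end

fun word_parity :: "lword \<Rightarrow> bit" where
  "word_parity (Word w) = (\<Sum>(i, j)\<leftarrow>w. parity i + parity j)"

lemma word_parity_add: "word_parity (v + w) = word_parity v + word_parity w"
  by (cases v; cases w) (simp del: add_bit_eq_xor)

lemma poly_mapping_induct [case_names zero single add]:
  fixes x :: "'a \<Rightarrow>\<^sub>0 cq"
  assumes zero: "P 0" and single: "\<And>k c. P (Poly_Mapping.single k c)"
    and add: "\<And>x y. P x \<Longrightarrow> P y \<Longrightarrow> P (x + y)"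
  shows "P x"
proof -
  have "c \<cdot> Poly_Mapping.single k (1::cq) = Poly_Mapping.single k c" for c and k :: 'a
    by (rule poly_mapping_eqI) (simp add: scl_poly_mapping.rep_eq scl_cq_def lookup_single when_def)
  then have "x = (\<Sum>k\<in>Poly_Mapping.keys x. Poly_Mapping.single k (Poly_Mapping.lookup x k))"
    by (subst poly_mapping_eq_lin_ext[of x]) (simp add: lin_ext_def)
  also have "P \<dots>"
    using finite_keys by (induction rule: finite_induct) (auto intro: zero single add)
  finally show ?thesis .
qed

lemma scl_poly_mapping_eq_mult:
  fixes x :: "'a::monoid_add \<Rightarrow>\<^sub>0 cq"
  shows "c \<cdot> x = Poly_Mapping.single 0 c * x" "c \<cdot> x = x * Poly_Mapping.single 0 c"
proof -
  have s: "c \<cdot> Poly_Mapping.single k d = Poly_Mapping.single k (c * d)" for d and k :: 'a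
    by (rule poly_mapping_eqI) (simp add: scl_poly_mapping.rep_eq scl_cq_def lookup_single when_def)
  show "c \<cdot> x = Poly_Mapping.single 0 c * x"
    by (induction x rule: poly_mapping_induct) (auto simp: s mult_single scl_add_right distrib_left)
  show "c \<cdot> x = x * Poly_Mapping.single 0 c"
    by (induction x rule: poly_mapping_induct)
       (auto simp: s mult_single scl_add_right distrib_right mult.commute)
qed

definition word_part :: "bit \<Rightarrow> (lword \<Rightarrow>\<^sub>0 cq) \<Rightarrow> lword \<Rightarrow>\<^sub>0 cq" where
  "word_part p = Poly_Mapping.mapp (\<lambda>w c. if word_parity w = p then c else 0)"

lemma lookup_word_part:
  "Poly_Mapping.lookup (word_part p x) w =
     (if word_parity w = p then Poly_Mapping.lookup x w else 0)"
  by (simp add: word_part_def lookup_mapp when_def in_keys_iff)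

lemma word_part_add: "word_part p (x + y) = word_part p x + word_part p y"
  by (rule poly_mapping_eqI) (simp add: lookup_word_part lookup_add)

lemma word_part_single:
  "word_part p (Poly_Mapping.single w c) =
     (if word_parity w = p then Poly_Mapping.single w c else 0)"
  by (rule poly_mapping_eqI) (auto simp: lookup_word_part lookup_single when_def)

lemma word_part_mult:
  "word_part (p + p') (word_part p x * word_part p' y) = word_part p x * word_part p' y"
proof (induction x rule: poly_mapping_induct)
  case zero
  have "word_part p 0 = 0" for p
    by (rule poly_mapping_eqI) (simp add: lookup_word_part)
  then show ?case by simp
next
  case (single k c)
  have z: "word_part p 0 = 0" for p
    by (rule poly_mapping_eqI) (simp add: lookup_word_part)
  show ?case
    by (induction y rule: poly_mapping_induct)
       (auto simp: word_part_single mult_single word_parity_add z word_part_add distrib_left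
         simp del: add_bit_eq_xor)
next
  case (add x x')
  then show ?case
    by (simp add: word_part_add distrib_right)
qed

typedef falg = "UNIV :: (lword \<Rightarrow>\<^sub>0 cq) set" ..

setup_lifting type_definition_falg

instantiation falg :: superalgebra_1
begin
lift_definition zero_falg :: falg is 0 .
lift_definition one_falg :: falg is 1 .
lift_definition plus_falg :: "falg \<Rightarrow> falg \<Rightarrow> falg" is "(+)" .
lift_definition minus_falg :: "falg \<Rightarrow> falg \<Rightarrow> falg" is "(-)" .
lift_definition uminus_falg :: "falg \<Rightarrow> falg" is uminus .
lift_definition times_falg :: "falg \<Rightarrow> falg \<Rightarrow> falg" is "(*)" .
lift_definition scl_falg :: "cq \<Rightarrow> falg \<Rightarrow> falg" is scl .
lift_definition hpart_falg :: "bit \<Rightarrow> falg \<Rightarrow> falg" is word_part .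
instance
proof
  fix x y z :: falg and c d :: cq and p p' :: bit
  show "x + y + z = x + (y + z)" by transfer (rule add.assoc)
  show "x + y = y + x" by transfer (rule add.commute)
  show "0 + x = x" by transfer simp
  show "- x + x = 0" by transfer simp
  show "x - y = x + - y" by transfer simp
  show "x * y * z = x * (y * z)" by transfer (rule mult.assoc)
  show "(x + y) * z = x * z + y * z" by transfer (rule distrib_right)
  show "x * (y + z) = x * y + x * z" by transfer (rule distrib_left)
  show "1 * x = x" "x * 1 = x" by (transfer, simp)+
  show "c \<cdot> (x + y) = c \<cdot> x + c \<cdot> y" by transfer (rule scl_add_right)
  show "(c + d) \<cdot> x = c \<cdot> x + d \<cdot> x" by transfer (rule scl_add_left)
  show "c \<cdot> d \<cdot> x = (c * d) \<cdot> x" by transfer (rule scl_scl)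
  show "1 \<cdot> x = x" by transfer (rule scl_one)
  show "(c \<cdot> x) * y = c \<cdot> (x * y)"
    by transfer (simp only: scl_poly_mapping_eq_mult(1) mult.assoc)
  show "x * (c \<cdot> y) = c \<cdot> (x * y)"
    by transfer (simp only: scl_poly_mapping_eq_mult(2) mult.assoc)
  show "hpart p (x + y) = hpart p x + hpart p y"
    by transfer (rule word_part_add)
  show "hpart p (c \<cdot> x) = c \<cdot> hpart p x"
    by transfer (rule poly_mapping_eqI, simp add: lookup_word_part scl_poly_mapping.rep_eq)
  show "hpart p (hpart p' x) = (if p = p' then hpart p x else 0)"
    by transfer (rule poly_mapping_eqI, auto simp: lookup_word_part)
  show "hpart 0 x + hpart 1 x = x"
    by transfer (rule poly_mapping_eqI, use bit_exhaust in \<open>auto simp: lookup_word_part lookup_add\<close>)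
  show "hpart (p + p') (hpart p x * hpart p' y) = hpart p x * hpart p' y"
    by transfer (rule word_part_mult)
qed
end

lift_definition fgen :: "int \<Rightarrow> int \<Rightarrow> falg" is
  "\<lambda>i j. Poly_Mapping.single (Word [(i, j)]) 1" .

lifting_forget falg.lifting

subsection \<open>The defining relations\<close>

definition slots13 :: "nat \<Rightarrow> ('a::superalgebra, mat) tensor \<Rightarrow> (('a, mat) tensor, mat) tensor" where
  "slots13 N = tlift (\<lambda>x m. (x \<otimes> idm N) \<otimes> m)"

definition slots23 :: "(mat, mat) tensor \<Rightarrow> (('a::superalgebra_1, mat) tensor, mat) tensor" where
  "slots23 = tlift (\<lambda>m m'. (1 \<otimes> m) \<otimes> m')"

definition free_L :: "nat \<Rightarrow> (falg, mat) tensor" where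
  "free_L N = (\<Sum>i\<in>idx N. \<Sum>j\<in>{j\<in>idx N. i \<le> j}. fgen i j \<otimes> munit i j)"

definition RLL :: "nat \<Rightarrow> ((falg, mat) tensor, mat) tensor" where
  "RLL N = (free_L N \<otimes> idm N) * slots13 N (free_L N) * slots23 (Smat N)
         - slots23 (Smat N) * slots13 N (free_L N) * (free_L N \<otimes> idm N)"

text \<open>The last family of relators removes the surplus symbols of the free superalgebra.\<close>

definition relators :: "nat \<Rightarrow> falg set" where
  "relators N = {ecoef i j (ecoef k l (RLL N)) | i j k l. True}
     \<union> {fgen i i * fgen (- i) (- i) - 1 | i. i \<in> idx N}
     \<union> {fgen i j | i j. \<not> (i \<in> idx N \<and> j \<in> idx N \<and> i \<le> j)}"

definition uq_ideal :: "nat \<Rightarrow> falg set" where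
  "uq_ideal N = cqspan {x * r * y | x r y. r \<in> relators N}"

lemma homog_add: "homog p x \<Longrightarrow> homog p y \<Longrightarrow> homog p (x + y)"
  and homog_diff: "homog p x \<Longrightarrow> homog p y \<Longrightarrow> homog p (x - y)"
  and homog_scl: "homog p x \<Longrightarrow> homog p (c \<cdot> x)"
  and homog_zero: "homog p (0 :: 'b::superspace)"
  by (simp_all add: homog_def hpart_add hpart_diff hpart_scl)

lemma homog_sum: "(\<And>i. i \<in> A \<Longrightarrow> homog p (f i)) \<Longrightarrow> homog p (sum f A)"
  by (induction A rule: infinite_finite_induct) (auto intro: homog_add homog_zero)

lemma homog_tens: "homog p a \<Longrightarrow> homog p' b \<Longrightarrow> homog (p + p') (a \<otimes> b)"
  by (simp only: homog_def[of "p + p'"] hpart_tens_homog if_True simp_thms)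

lemma homog_munit: "homog (parity i + parity j) (munit i j)"
  unfolding homog_def by (rule mat_eqI) (simp add: hpart_mat.rep_eq munit.rep_eq)

lemma homog_fgen: "homog (parity i + parity j) (fgen i j)"
  unfolding homog_def fgen_def hpart_falg_def by (simp add: Abs_falg_inverse word_part_single)

lemma homog_idm: "homog 0 (idm N)"
  unfolding idm_def by (rule homog_sum) (use homog_munit[of i i for i] in simp)

lemma homog_even_tens: "homog p a \<Longrightarrow> homog p b \<Longrightarrow> homog 0 (a \<otimes> b)"
  using homog_tens[of p a p b] by simp

lemma homog_Smat: "homog 0 (Smat N)"
proof -
  have e: "homog 0 (munit i i)" for i
    using homog_munit[of i i] by simp
  have n: "homog (parity i + parity j) (munit (- j) (- i))" if "i \<in> idx N" "j \<in> idx N" for i j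
    using homog_munit[of "- j" "- i"] that by (auto simp: idx_def parity_def split: if_splits)
  have n': "homog (parity i + parity j) (munit j i)" for i j
    using homog_munit[of j i] by (simp add: add.commute del: add_bit_eq_xor)
  show ?thesis
    unfolding Smat_def
    by (intro homog_add homog_scl homog_sum homog_even_tens[OF e e]
        homog_even_tens[OF homog_add[OF n' n] homog_munit]) auto
qed

lemma bilin_slots13: "bilin (\<lambda>x m. (x \<otimes> idm N) \<otimes> m)"
  and bilin_slots23: "bilin (\<lambda>m m'. ((1::'a::superalgebra_1) \<otimes> m) \<otimes> m')"
  and bilin_ecoef: "bilin (\<lambda>x m. entry m i j \<cdot> x)"
  by (rule bilinI; simp add: tens_lin scl_add_left scl_add_right plus_mat.rep_eq scl_mat.rep_eq
      mult.commute)+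

lemma cqlinear_slots13: "cqlinear (slots13 N)"
  unfolding slots13_def by (rule cqlinear_tlift[OF bilin_slots13])

lemma cqlinear_slots23: "cqlinear slots23"
  unfolding slots23_def by (rule cqlinear_tlift[OF bilin_slots23])

lemma cqlinear_ecoef: "cqlinear (ecoef i j)"
  unfolding ecoef_def by (rule cqlinear_tlift[OF bilin_ecoef])

lemma slots_tens:
  "slots13 N (x \<otimes> m) = (x \<otimes> idm N) \<otimes> m"
  "slots23 (m \<otimes> m') = (1 \<otimes> m) \<otimes> m'"
  "ecoef i j (y \<otimes> m) = entry m i j \<cdot> y"
  unfolding slots13_def slots23_def ecoef_def
  by (rule tlift_tens[OF bilin_slots13] tlift_tens[OF bilin_slots23] tlift_tens[OF bilin_ecoef])+

lemma homog_slots23: "homog 0 X \<Longrightarrow> homog 0 (slots23 X :: (('a::superalgebra_1, mat) tensor, mat) tensor)"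
proof -
  note lin = cqlinearD[OF cqlinear_slots23]
  have "hpart p (slots23 X) = (slots23 (hpart p X) :: (('a, mat) tensor, mat) tensor)" for p
  proof (induction X rule: tensor_induct_homog)
    case (tens u u' a b)
    have 1: "homog (0 + u) ((1::'a) \<otimes> a)"
      using homog_tens[OF homog_one tens(1)] .
    show ?case
      using hpart_tens_homog[OF 1 tens(2), of p] hpart_tens_homog[OF tens, of p]
      by (simp add: slots_tens lin del: add_bit_eq_xor)
  next
    case (add x y)
    then show ?case by (simp only: lin hpart_add)
  qed
  then show "homog 0 X \<Longrightarrow> ?thesis"
    by (simp add: homog_def)
qed

lemma homog_free_L: "homog 0 (free_L N)"
  unfolding free_L_def by (intro homog_sum homog_even_tens[OF homog_fgen homog_munit])

lemma slots13_free_L: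
  "slots13 N (free_L N) = (\<Sum>i\<in>idx N. \<Sum>j\<in>{j\<in>idx N. i \<le> j}. (fgen i j \<otimes> idm N) \<otimes> munit i j)"
  unfolding free_L_def
  by (simp only: cqlinearD[OF cqlinear_slots13] slots_tens)

lemma homog_RLL: "homog 0 (RLL N)"
proof -
  have 12: "homog 0 (free_L N \<otimes> idm N)"
    by (rule homog_even_tens[OF homog_free_L homog_idm])
  have f: "homog (parity i + parity j) (fgen i j \<otimes> idm N)" for i j
    using homog_tens[OF homog_fgen[of i j] homog_idm] by (simp del: add_bit_eq_xor)
  have 13: "homog 0 (slots13 N (free_L N))"
    unfolding slots13_free_L by (intro homog_sum homog_even_tens[OF f homog_munit])
  have even: "homog 0 (x * y)" if "homog 0 x" "homog 0 y" for x y :: "((falg, mat) tensor, mat) tensor"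
    using homog_mult[OF that] by simp
  show ?thesis
    unfolding RLL_def by (intro homog_diff even 12 13 homog_slots23 homog_Smat)
qed

lemma homog_ecoef:
  assumes "homog p X"
  shows "homog (p + parity i + parity j) (ecoef i j X)"
proof -
  note lin = cqlinearD[OF cqlinear_ecoef]
  have eq: "hpart (p + parity i + parity j) (ecoef i j X) = ecoef i j (hpart p X)" for p
  proof (induction X rule: tensor_induct_homog)
    case (tens u u' a m)
    have "ecoef i j (a \<otimes> m) = entry m i j \<cdot> a"
      by (rule slots_tens)
    moreover have "entry m i j = 0 \<or> parity i + parity j = u'"
      using tens(2) unfolding homog_def by (metis hpart_mat.rep_eq)
    ultimately show ?case
      using tens bit_exhaust[of p] bit_exhaust[of u] bit_exhaust[of u']
        bit_exhaust[of "parity i"] bit_exhaust[of "parity j"]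
      by (auto simp: hpart_tens_homog[OF tens] lin hpart_scl hpart_homog)
  next
    case (add x y)
    then show ?case by (simp only: lin hpart_add)
  qed
  show ?thesis
    using eq[of p] assms by (simp only: homog_def)
qed

lemma relators_homog: "r \<in> relators N \<Longrightarrow> \<exists>p. homog p r"
proof -
  have "homog 0 (fgen i i * fgen (- i) (- i) - 1)" for i
    using homog_mult[OF homog_fgen[of i i] homog_fgen[of "- i" "- i"]]
    by (intro homog_diff homog_one) simp
  then show "r \<in> relators N \<Longrightarrow> \<exists>p. homog p r"
    unfolding relators_def using homog_ecoef[OF homog_ecoef[OF homog_RLL]] homog_fgen by blast
qed

lemma uq_ideal_mult:
  assumes "x \<in> uq_ideal N"
  shows "y * x \<in> uq_ideal N" "x * y \<in> uq_ideal N"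
  using assms unfolding uq_ideal_def
proof (induction rule: cqs.span_induct_alt)
  case (step c r s)
  then obtain a b r' where r: "r = a * r' * b" "r' \<in> relators N"
    by blast
  {
    case 1
    have "y * r = (y * a) * r' * b"
      by (simp add: r mult.assoc)
    then have "y * r \<in> cqspan {x * r * y | x r y. r \<in> relators N}"
      using r by (auto intro!: cqs.span_base)
    with step show ?case
      by (simp add: distrib_left scl_mult_right cqs.span_add cqs.span_scale)
  next
    case 2
    have "r * y = a * r' * (b * y)"
      by (simp add: r mult.assoc)
    then have "r * y \<in> cqspan {x * r * y | x r y. r \<in> relators N}"
      using r by (auto intro!: cqs.span_base)
    with step show ?case
      by (simp add: distrib_right scl_mult_left cqs.span_add cqs.span_scale)
  }
qed (simp_all add: cqs.span_zero)

lemma uq_ideal_hpart: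
  assumes "x \<in> uq_ideal N"
  shows "hpart p x \<in> uq_ideal N"
  using assms unfolding uq_ideal_def
proof (induction rule: cqs.span_induct_alt)
  case (step c r s)
  then obtain a b r' where r: "r = a * r' * b" "r' \<in> relators N"
    by blast
  then obtain u where u: "homog u r'"
    using relators_homog by blast
  let ?J = "cqspan {x * r * y | x r y. r \<in> relators N}"
  have "hpart p (hpart v a * r' * hpart w b) \<in> ?J" for v w
  proof -
    have "homog (v + u + w) (hpart v a * r' * hpart w b)"
      by (intro homog_mult homog_hpart u)
    moreover have "hpart v a * r' * hpart w b \<in> ?J"
      using r by (auto intro!: cqs.span_base)
    ultimately show ?thesis
      by (simp add: hpart_homog cqs.span_zero)
  qed
  moreover have "r = (hpart 0 a + hpart 1 a) * r' * (hpart 0 b + hpart 1 b)"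
    by (simp only: hpart_sum r)
  ultimately have "hpart p r \<in> ?J"
    by (simp add: distrib_left distrib_right hpart_add cqs.span_add)
  with step show ?case
    by (simp add: hpart_add hpart_scl cqs.span_add cqs.span_scale)
qed (simp add: cqs.span_zero)

subsection \<open>The Hopf superalgebra\<close>

text \<open>\<open>'N uq\<close> is the quantum queer superalgebra for \<open>N = CARD('N)\<close>.\<close>

definition uq_rel :: "'N::finite itself \<Rightarrow> falg \<Rightarrow> falg \<Rightarrow> bool" where
  "uq_rel _ x y \<longleftrightarrow> x - y \<in> uq_ideal CARD('N)"

quotient_type (overloaded) 'N uq = falg / "uq_rel TYPE('N::finite)"
  using equivp_diff_span by (simp add: uq_rel_def[abs_def] uq_ideal_def)

lemma uq_exhaust: obtains x where "u = abs_uq x"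
  using uq.abs_induct[of "\<lambda>u. \<exists>x. u = abs_uq x" u] by blast

instantiation uq :: (finite) superalgebra_1
begin
lift_definition zero_uq :: "'a uq" is 0 .
lift_definition one_uq :: "'a uq" is 1 .
lift_definition plus_uq :: "'a uq \<Rightarrow> 'a uq \<Rightarrow> 'a uq" is "(+)"
  unfolding uq_rel_def uq_ideal_def by (rule span_cong_add)
lift_definition minus_uq :: "'a uq \<Rightarrow> 'a uq \<Rightarrow> 'a uq" is "(-)"
  unfolding uq_rel_def uq_ideal_def by (rule span_cong_diff)
lift_definition uminus_uq :: "'a uq \<Rightarrow> 'a uq" is uminus
  unfolding uq_rel_def uq_ideal_def by (rule span_cong_uminus)
lift_definition scl_uq :: "cq \<Rightarrow> 'a uq \<Rightarrow> 'a uq" is scl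
  unfolding uq_rel_def uq_ideal_def by (rule span_cong_scl)
lift_definition times_uq :: "'a uq \<Rightarrow> 'a uq \<Rightarrow> 'a uq" is "(*)"
proof -
  fix x x' y y' :: falg
  assume "uq_rel TYPE('a) x x'" "uq_rel TYPE('a) y y'"
  then have "(x - x') * y \<in> uq_ideal CARD('a)" "x' * (y - y') \<in> uq_ideal CARD('a)"
    by (auto simp: uq_rel_def intro: uq_ideal_mult)
  then have "(x - x') * y + x' * (y - y') \<in> uq_ideal CARD('a)"
    unfolding uq_ideal_def by (rule cqs.span_add)
  then show "uq_rel TYPE('a) (x * y) (x' * y')"
    by (simp add: uq_rel_def left_diff_distrib right_diff_distrib)
qed
lift_definition hpart_uq :: "bit \<Rightarrow> 'a uq \<Rightarrow> 'a uq" is hpart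
  unfolding uq_rel_def by (simp add: uq_ideal_hpart flip: hpart_diff)
instance
proof
  fix u v w :: "'a uq" and c d :: cq and p p' :: bit
  obtain x y z where xyz: "u = abs_uq x" "v = abs_uq y" "w = abs_uq z"
    using uq_exhaust by metis
  note abs = plus_uq.abs_eq minus_uq.abs_eq uminus_uq.abs_eq scl_uq.abs_eq times_uq.abs_eq
    hpart_uq.abs_eq zero_uq_def one_uq_def xyz
  show "u + v + w = u + (v + w)" by (simp add: abs add.assoc)
  show "u + v = v + u" by (simp add: abs add.commute)
  show "0 + u = u" by (simp add: abs)
  show "- u + u = 0" by (simp add: abs)
  show "u - v = u + - v" by (simp add: abs)
  show "u * v * w = u * (v * w)" by (simp add: abs mult.assoc)
  show "(u + v) * w = u * w + v * w" by (simp add: abs distrib_right)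
  show "u * (v + w) = u * v + u * w" by (simp add: abs distrib_left)
  show "1 * u = u" "u * 1 = u" by (simp_all add: abs)
  show "c \<cdot> (u + v) = c \<cdot> u + c \<cdot> v" by (simp add: abs scl_add_right)
  show "(c + d) \<cdot> u = c \<cdot> u + d \<cdot> u" by (simp add: abs scl_add_left)
  show "c \<cdot> d \<cdot> u = (c * d) \<cdot> u" by (simp add: abs)
  show "1 \<cdot> u = u" by (simp add: abs)
  show "(c \<cdot> u) * v = c \<cdot> (u * v)" by (simp add: abs scl_mult_left)
  show "u * (c \<cdot> v) = c \<cdot> (u * v)" by (simp add: abs scl_mult_right)
  show "hpart p (u + v) = hpart p u + hpart p v" by (simp add: abs hpart_add)
  show "hpart p (c \<cdot> u) = c \<cdot> hpart p u" by (simp add: abs hpart_scl)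
  show "hpart p (hpart p' u) = (if p = p' then hpart p u else 0)" by (simp add: abs hpart_hpart)
  show "hpart 0 u + hpart 1 u = u" by (simp add: abs hpart_sum)
  show "hpart (p + p') (hpart p u * hpart p' v) = hpart p u * hpart p' v"
    by (simp only: abs hpart_mult)
qed
end

lift_definition Lgen :: "int \<Rightarrow> int \<Rightarrow> 'N::finite uq" is fgen .

definition superalg_hom :: "('a::superalgebra \<Rightarrow> 'b::superalgebra) \<Rightarrow> bool" where
  "superalg_hom f \<longleftrightarrow> cqlinear f \<and> (\<forall>p x. f (hpart p x) = hpart p (f x)) \<and>
     (\<forall>x y. f (x * y) = f x * f y)"

text \<open>\<open>Lgen i j = 0\<close> unless \<open>i \<le> j\<close>, so the sum below only involves \<open>i \<le> k \<le> j\<close>.\<close>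

definition comult :: "'N::finite uq \<Rightarrow> ('N uq, 'N uq) tensor" where
  "comult = (THE D. superalg_hom D \<and> D 1 = 1 \<and>
     (\<forall>i\<in>idx CARD('N). \<forall>j\<in>idx CARD('N). i \<le> j \<longrightarrow>
        D (Lgen i j) = (\<Sum>k\<in>idx CARD('N).
          sgnp ((parity i + parity k) * (parity k + parity j)) \<cdot> (Lgen i k \<otimes> Lgen k j))))"

definition counit :: "'N::finite uq \<Rightarrow> cq" where
  "counit = (THE e. superalg_hom e \<and> e 1 = 1 \<and>
     (\<forall>i\<in>idx CARD('N). \<forall>j\<in>idx CARD('N). i \<le> j \<longrightarrow> e (Lgen i j) = of_bool (i = j)))"

text \<open>The antipode is the convolution inverse of the identity; \<open>S(L) = L\<^sup>-\<^sup>1\<close> follows from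
  \<open>\<Delta>(L) = L \<otimes> L\<close>.\<close>

definition antipode :: "'N::finite uq \<Rightarrow> 'N uq" where
  "antipode = (THE A. cqlinear A \<and>
     (\<forall>u. tlift (\<lambda>x y. A x * y) (comult u) = counit u \<cdot> 1) \<and>
     (\<forall>u. tlift (\<lambda>x y. x * A y) (comult u) = counit u \<cdot> 1))"

text \<open>The action on \<open>V\<^sub>N\<close>: \<open>Smat N = \<Sum>\<^sub>i\<^sub>j S\<^sub>i\<^sub>j \<otimes> munit i j\<close> and \<open>Lgen i j\<close> acts by \<open>S\<^sub>i\<^sub>j\<close>.\<close>

definition vrep :: "'N::finite uq \<Rightarrow> mat" where
  "vrep = (THE R. superalg_hom R \<and> R 1 = idm CARD('N) \<and>
     (\<forall>i\<in>idx CARD('N). \<forall>j\<in>idx CARD('N). i \<le> j \<longrightarrow>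
        R (Lgen i j) = ecoef i j (Smat CARD('N))))"

inductive_set generated_subalg ::
  "('a \<Rightarrow> 'a \<Rightarrow> 'a) \<Rightarrow> 'a \<Rightarrow> 'a set \<Rightarrow> 'a::cqspace set"
  for mult :: "'a \<Rightarrow> 'a \<Rightarrow> 'a" and one :: 'a and G :: "'a set" where
  one: "one \<in> generated_subalg mult one G"
| gen: "x \<in> G \<Longrightarrow> x \<in> generated_subalg mult one G"
| add: "x \<in> generated_subalg mult one G \<Longrightarrow> y \<in> generated_subalg mult one G \<Longrightarrow>
    x + y \<in> generated_subalg mult one G"
| scl: "x \<in> generated_subalg mult one G \<Longrightarrow> c \<cdot> x \<in> generated_subalg mult one G"
| mult: "x \<in> generated_subalg mult one G \<Longrightarrow> y \<in> generated_subalg mult one G \<Longrightarrow>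
    mult x y \<in> generated_subalg mult one G"

text \<open>The copy of the quantum queer superalgebra of size \<open>n \<le> N\<close> inside the one of size \<open>N\<close>.\<close>

definition uq_sub :: "nat \<Rightarrow> 'N::finite uq set" where
  "uq_sub n = generated_subalg (*) 1 {Lgen i j | i j. i \<in> idx n \<and> j \<in> idx n \<and> i \<le> j}"

section \<open>Coordinate superalgebras\<close>

typedef (overloaded) 'a dual = "{f :: 'a::cqspace \<Rightarrow> cq. cqlinear f}"
  morphisms pair Abs_dual
  by (rule exI[of _ "\<lambda>_. 0"]) (simp add: cqlinearI)

setup_lifting type_definition_dual

lemma dual_eqI: "(\<And>u. pair f u = pair g u) \<Longrightarrow> f = g"
  by (metis ext pair_inject)

lemma cqlinear_pair: "cqlinear (pair f)"
  using pair by blast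

instantiation dual :: (superspace) superspace
begin
lift_definition zero_dual :: "'a dual" is "\<lambda>_. 0"
  by (rule cqlinearI) simp_all
lift_definition plus_dual :: "'a dual \<Rightarrow> 'a dual \<Rightarrow> 'a dual" is "\<lambda>f g u. f u + g u"
  by (rule cqlinearI) (simp_all add: cqlinearD(1,2) scl_add_right)
lift_definition minus_dual :: "'a dual \<Rightarrow> 'a dual \<Rightarrow> 'a dual" is "\<lambda>f g u. f u - g u"
  by (rule cqlinearI) (simp_all add: cqlinearD(1,2) cqs.scale_right_diff_distrib)
lift_definition uminus_dual :: "'a dual \<Rightarrow> 'a dual" is "\<lambda>f u. - f u"
  by (rule cqlinearI) (simp_all add: cqlinearD(1,2))
lift_definition scl_dual :: "cq \<Rightarrow> 'a dual \<Rightarrow> 'a dual" is "\<lambda>c f u. c \<cdot> f u"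
  by (rule cqlinearI) (simp_all add: cqlinearD(1,2) scl_add_right mult.commute)
lift_definition hpart_dual :: "bit \<Rightarrow> 'a dual \<Rightarrow> 'a dual" is "\<lambda>p f u. f (hpart p u)"
  by (rule cqlinearI) (simp_all add: cqlinearD(1,2) hpart_add hpart_scl)
instance
proof (intro_classes; rule dual_eqI)
  fix f :: "'a dual" and u :: 'a
  have "pair f (hpart 0 u) + pair f (hpart 1 u) = pair f u"
    by (metis cqlinearD(1) cqlinear_pair hpart_sum)
  then show "pair (hpart 0 f + hpart 1 f) u = pair f u"
    by (simp add: plus_dual.rep_eq hpart_dual.rep_eq)
next
  fix f :: "'a dual" and u :: 'a and p p' :: bit
  show "pair (hpart p (hpart p' f)) u = pair (if p = p' then hpart p f else 0) u"
    by (auto simp: hpart_dual.rep_eq zero_dual.rep_eq hpart_hpart cqlinearD[OF cqlinear_pair])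
qed (simp_all add: plus_dual.rep_eq minus_dual.rep_eq uminus_dual.rep_eq zero_dual.rep_eq
      scl_dual.rep_eq hpart_dual.rep_eq scl_add_right scl_add_left)
end

text \<open>The formulas for the product and the action make sense on the full dual, of which the finite
  dual is a sub-superalgebra and a submodule.  The matrix elements below lie in the finite dual, so
  the subalgebras they generate are the same in either.\<close>

definition dual_mult :: "'N::finite uq dual \<Rightarrow> 'N uq dual \<Rightarrow> 'N uq dual" where
  "dual_mult f f' = Abs_dual (\<lambda>u. tlift (\<lambda>u1 u2. \<Sum>p\<in>{0, 1}. \<Sum>p'\<in>{0, 1}.
     sgnp (p' * p) * pair f (hpart p u1) * pair (hpart p' f') u2) (comult u))"

definition dual_one :: "'N::finite uq dual" where
  "dual_one = Abs_dual counit"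

definition \<Phi> :: "'N::finite uq \<Rightarrow> 'N uq dual \<Rightarrow> 'N uq dual" where
  "\<Phi> u f = Abs_dual (\<lambda>u'. \<Sum>p\<in>{0, 1}. sgnp p * pair f (u' * hpart p u))"

definition tgen :: "int \<Rightarrow> int \<Rightarrow> 'N::finite uq dual" where
  "tgen i a = Abs_dual (\<lambda>u. entry (vrep u) i a)"

definition tbar :: "int \<Rightarrow> int \<Rightarrow> 'N::finite uq dual" where
  "tbar \<alpha> b = Abs_dual (\<lambda>u.
     sgnp (parity b * (parity \<alpha> + parity b)) * pair (tgen b \<alpha>) (antipode u))"

definition coordA :: "nat \<Rightarrow> nat \<Rightarrow> 'N::finite uq dual set" where
  "coordA r n = generated_subalg dual_mult dual_one {tgen i a | i a. i \<in> idx r \<and> a \<in> idx n}"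

definition coordAbar :: "nat \<Rightarrow> nat \<Rightarrow> 'N::finite uq dual set" where
  "coordAbar s n = generated_subalg dual_mult dual_one {tbar \<alpha> b | \<alpha> b. \<alpha> \<in> idx s \<and> b \<in> idx n}"

text \<open>Over a field the tensor product of two subspaces embeds in that of the ambient spaces.\<close>

definition tensor_sub ::
  "'a::cqspace set \<Rightarrow> 'b::cqspace set \<Rightarrow> ('a, 'b) tensor set" where
  "tensor_sub A B = cqspan {a \<otimes> b | a b. a \<in> A \<and> b \<in> B}"

definition tensor_act ::
  "'N::finite uq \<Rightarrow> ('N uq dual, 'N uq dual) tensor \<Rightarrow> ('N uq dual, 'N uq dual) tensor" where
  "tensor_act u z = tlift (\<lambda>u1 u2. tlift (\<lambda>x y. \<Sum>p\<in>{0, 1}. \<Sum>p'\<in>{0, 1}.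
     sgnp (p * p') \<cdot> (\<Phi> u1 (hpart p x) \<otimes> \<Phi> (hpart p' u2) y)) z) (comult u)"

section \<open>Supermodules\<close>

definition supermodule_on ::
  "'u::superalgebra_1 set \<Rightarrow> ('u \<Rightarrow> 'm::superspace \<Rightarrow> 'm) \<Rightarrow> 'm set \<Rightarrow> bool" where
  "supermodule_on U act M \<longleftrightarrow>
     cqsubspace M \<and> (\<forall>p. \<forall>x\<in>M. hpart p x \<in> M) \<and>
     (\<forall>u\<in>U. \<forall>x\<in>M. act u x \<in> M) \<and>
     (\<forall>u\<in>U. \<forall>x\<in>M. \<forall>y\<in>M. \<forall>c. act u (x + y) = act u x + act u y \<and> act u (c \<cdot> x) = c \<cdot> act u x) \<and>
     (\<forall>u\<in>U. \<forall>v\<in>U. \<forall>x\<in>M. \<forall>c. act (u + v) x = act u x + act v x \<and> act (c \<cdot> u) x = c \<cdot> act u x) \<and>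
     (\<forall>x\<in>M. act 1 x = x) \<and>
     (\<forall>u\<in>U. \<forall>v\<in>U. \<forall>x\<in>M. act (u * v) x = act u (act v x)) \<and>
     (\<forall>u\<in>U. \<forall>x\<in>M. \<forall>p p'. homog p u \<longrightarrow> homog p' x \<longrightarrow> homog (p + p') (act u x))"

definition supermodule_hom ::
  "'u::superalgebra_1 set \<Rightarrow> ('u \<Rightarrow> 'm::superspace \<Rightarrow> 'm) \<Rightarrow> 'm set
     \<Rightarrow> ('u \<Rightarrow> 'm'::superspace \<Rightarrow> 'm') \<Rightarrow> 'm' set \<Rightarrow> ('m \<Rightarrow> 'm') \<Rightarrow> bool" where
  "supermodule_hom U act M act' M' f \<longleftrightarrow>
     supermodule_on U act M \<and> supermodule_on U act' M' \<and>
     (\<forall>x\<in>M. f x \<in> M') \<and>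
     (\<forall>x\<in>M. \<forall>y\<in>M. \<forall>c. f (x + y) = f x + f y \<and> f (c \<cdot> x) = c \<cdot> f x) \<and>
     (\<forall>p. \<forall>x\<in>M. f (hpart p x) = hpart p (f x)) \<and>
     (\<forall>u\<in>U. \<forall>x\<in>M. f (act u x) = act' u (f x))"

section \<open>The map \<open>\<Upsilon>\<close>\<close>

definition tmap ::
  "('a::cqspace \<Rightarrow> 'c::cqspace) \<Rightarrow> ('b::cqspace \<Rightarrow> 'd::cqspace) \<Rightarrow> ('a, 'b) tensor \<Rightarrow> ('c, 'd) tensor"
  where "tmap f g = tlift (\<lambda>a b. f a \<otimes> g b)"

definition assocl ::
  "('a::cqspace, ('b::cqspace, 'c::cqspace) tensor) tensor \<Rightarrow> (('a, 'b) tensor, 'c) tensor" where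
  "assocl = tlift (\<lambda>a. tlift (\<lambda>b c. (a \<otimes> b) \<otimes> c))"

definition assocr ::
  "(('a::cqspace, 'b::cqspace) tensor, 'c::cqspace) tensor \<Rightarrow> ('a, ('b, 'c) tensor) tensor" where
  "assocr = tlift (\<lambda>t c. tlift (\<lambda>a b. a \<otimes> (b \<otimes> c)) t)"

definition mul :: "('N::finite uq dual, 'N uq dual) tensor \<Rightarrow> 'N uq dual" where
  "mul = tlift dual_mult"

text \<open>A linear map on the subspace \<open>coordAbar s n \<otimes> coordA r n\<close> is given by any linear
  extension of it to the ambient tensor product; everything below only concerns the restriction.
  The formula on the generators is \<open>\<Upsilon>(Tbar\<^sub>1 T\<^sub>2) = T\<^sub>2 S\<^sup>-\<^sup>1 Tbar\<^sub>1\<close> written out in matrix entries.  The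
  two compatibilities with the products are stated on elementary tensors, which suffices by
  linearity.\<close>

definition is_Upsilon :: "nat \<Rightarrow> nat \<Rightarrow> nat \<Rightarrow>
    (('N::finite uq dual, 'N uq dual) tensor \<Rightarrow> ('N uq dual, 'N uq dual) tensor) \<Rightarrow> bool" where
  "is_Upsilon r s n \<Upsilon> \<longleftrightarrow>
     cqlinear \<Upsilon> \<and>
     \<Upsilon> ` tensor_sub (coordAbar s n) (coordA r n) \<subseteq> tensor_sub (coordA r n) (coordAbar s n) \<and>
     (\<forall>f\<in>coordA r n. \<Upsilon> (dual_one \<otimes> f) = f \<otimes> dual_one) \<and>
     (\<forall>g\<in>coordAbar s n. \<Upsilon> (g \<otimes> dual_one) = dual_one \<otimes> g) \<and>
     (\<forall>\<alpha>\<in>idx s. \<forall>b\<in>idx n. \<forall>i\<in>{1..int r}. \<forall>a\<in>idx n.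
        \<Upsilon> (tbar \<alpha> b \<otimes> tgen i a) =
          (sgnp (parity a * (parity \<alpha> + parity b)) * qq powi (- \<phi> b a)) \<cdot> (tgen i a \<otimes> tbar \<alpha> b)
          - (sgnp (parity a * parity \<alpha>) * \<xi>) \<cdot>
            (\<Sum>p\<in>{p\<in>idx n. p < a}. tgen i p \<otimes>
               (of_bool (a = b) \<cdot> tbar \<alpha> p
                + (sgnp (parity p) * of_bool (a = - b)) \<cdot> tbar \<alpha> (- p)))) \<and>
     (\<forall>g\<in>coordAbar s n. \<forall>f\<in>coordA r n. \<forall>f'\<in>coordA r n.
        \<Upsilon> (tmap id mul (g \<otimes> (f \<otimes> f'))) =
          tmap mul id (assocl (tmap id \<Upsilon> (assocr (tmap \<Upsilon> id (assocl (g \<otimes> (f \<otimes> f')))))))) \<and>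
     (\<forall>g\<in>coordAbar s n. \<forall>g'\<in>coordAbar s n. \<forall>f\<in>coordA r n.
        \<Upsilon> (tmap mul id ((g \<otimes> g') \<otimes> f)) =
          tmap id mul (assocr (tmap \<Upsilon> id (assocl (tmap id \<Upsilon> (assocr ((g \<otimes> g') \<otimes> f)))))))"

end

theory Submission
  imports Defs
begin

text \<open>For a generator \<open>u = Lgen i j\<close> and for generators \<open>tbar \<alpha> b\<close>, \<open>tgen k a\<close> of the two coordinate
  superalgebras, the identity \<open>\<Upsilon>(u \<cdot> (tbar \<otimes> tgen)) = u \<cdot> \<Upsilon>(tbar \<otimes> tgen)\<close> is, in components, the form
  \<open>S\<^sub>1\<^sub>3\<^sup>-\<^sup>1 S\<^sub>1\<^sub>2\<^sup>-\<^sup>1 S\<^sub>2\<^sub>3 = S\<^sub>2\<^sub>3 S\<^sub>1\<^sub>2\<^sup>-\<^sup>1 S\<^sub>1\<^sub>3\<^sup>-\<^sup>1\<close> of the Yang-Baxter equation.  Multiplication and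
  the associators are equivariant, and \<open>\<Upsilon> \<circ> (1 \<otimes> mul)\<close> and \<open>\<Upsilon> \<circ> (mul \<otimes> 1)\<close> are composites of these with
  copies of \<open>\<Upsilon>\<close> on smaller stable subspaces; so equivariance spreads from the generators first
  over the left factor and then over the right one.\<close>

section \<open>Signs, tensor products and superalgebra homomorphisms\<close>

text \<open>The structure maps of \<open>uq\<close> and the representation \<open>vrep\<close> are
  definite descriptions, so nothing can be computed with them before existence is shown. This is why
  a universal property comes early, with a prescribed idempotent in place of a unit: it serves the
  comultiplication, the counit, the opposite superalgebra behind the antipode, and the nonunital
  algebra \<open>mat\<close>, for which the relation to be verified is the Yang-Baxter equation
  itself. The map \<Upsilon> is controlled only on one tensor product of subspaces and is not given
  by a closed formula on products of generators, so its equivariance there is inferred from its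
  composites with multiplication. The left factor goes first because \<Upsilon> keeps the span of
  the generators \<open>tgen\<close> as the first factor of its image: when a product on the left is
  resolved, the second application of \<Upsilon> meets that same span. Afterwards the left factor
  can be the whole superalgebra while products on the right are resolved.\<close>

declare add_bit_eq_xor [simp del] mult_bit_eq_and [simp del]

lemma sgnp_0 [simp]: "sgnp 0 = 1" and sgnp_1 [simp]: "sgnp 1 = - 1"
  by (simp_all add: sgnp_def)

lemma sgnp_add: "sgnp (p + p') = sgnp p * sgnp p'"
  using bit_exhaust[of p] bit_exhaust[of p'] by auto

lemma sgnp_square [simp]: "sgnp p * sgnp p = 1" "sgnp p * (sgnp p * c) = c"
  using bit_exhaust[of p] by auto

lemma bit_add_cancel [simp]: "p + (p + p') = (p' :: bit)" "p + (p' + p) = p'"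
  by (cases p; cases p'; simp)+

lemma bit_minus_eq [simp]: "p - p' = p + (p' :: bit)"
  by (cases p; cases p'; simp)

lemma bit_mult_idem [simp]: "p * p = (p :: bit)"
  by (cases p) auto

text \<open>Sign rules are available for homogeneous elements; additive claims about arbitrary
  elements are reduced to them here.\<close>

lemma homog_decomp:
  fixes x :: "'a::superspace"
  assumes "\<And>x y. P x \<Longrightarrow> P y \<Longrightarrow> P (x + y)" "\<And>p x. homog p x \<Longrightarrow> P x"
  shows "P x"
  by (metis assms homog_hpart hpart_sum)

lemma cqlinear_id: "cqlinear (\<lambda>x. x)" and cqlinear_id': "cqlinear id"
  by (rule cqlinearI; simp)+

lemma cqlinear_compose: "cqlinear f \<Longrightarrow> cqlinear g \<Longrightarrow> cqlinear (\<lambda>x. f (g x))"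
  by (rule cqlinearI) (simp_all add: cqlinearD(1,2))

lemma cqlinear_add: "cqlinear f \<Longrightarrow> cqlinear g \<Longrightarrow> cqlinear (\<lambda>x. f x + g x)"
  by (rule cqlinearI) (simp_all add: cqlinearD(1,2) scl_add_right)

lemma cqlinear_scl: "cqlinear f \<Longrightarrow> cqlinear (\<lambda>x. c \<cdot> f x)"
  by (rule cqlinearI) (simp_all add: cqlinearD(1,2) scl_add_right mult.commute)

lemma cqlinear_sum: "(\<And>i. i \<in> I \<Longrightarrow> cqlinear (f i)) \<Longrightarrow> cqlinear (\<lambda>x. \<Sum>i\<in>I. f i x)"
  by (rule cqlinearI) (simp_all add: cqlinearD(1,2) sum.distrib cqs.scale_sum_right)

lemma cqlinear_mult:
  fixes a :: "'a::superalgebra"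
  shows "cqlinear (\<lambda>x. a * x)" "cqlinear (\<lambda>x. x * a)"
  by (rule cqlinearI; simp add: distrib_left distrib_right scl_mult_left scl_mult_right)+

lemma bilin_iff: "bilin B \<longleftrightarrow> (\<forall>a. cqlinear (B a)) \<and> (\<forall>b. cqlinear (\<lambda>a. B a b))"
  by (rule bilin_def)

lemma bilin_compose:
  assumes "bilin B" "cqlinear f" "cqlinear g" "cqlinear h"
  shows "bilin (\<lambda>a b. h (B (f a) (g b)))"
  by (rule bilinI) (simp_all add: bilinD[OF assms(1)] cqlinearD[OF assms(2)] cqlinearD[OF assms(3)]
      cqlinearD[OF assms(4)])

lemmas bilin_precompose = bilin_compose[OF _ _ _ cqlinear_id]

lemma bilin_mult: "bilin ((*) :: 'a::superalgebra \<Rightarrow> 'a \<Rightarrow> 'a)"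
  unfolding bilin_iff by (intro conjI allI cqlinear_mult)

lemma cqlinear_tens: "cqlinear (\<lambda>x. a \<otimes> x)" "cqlinear (\<lambda>x. x \<otimes> a)"
  by (rule cqlinearI; simp add: tens_lin)+

lemma tens_sum:
  "(\<Sum>i\<in>I. f i) \<otimes> b = (\<Sum>i\<in>I. f i \<otimes> b)" "a \<otimes> (\<Sum>i\<in>I. g i) = (\<Sum>i\<in>I. a \<otimes> g i)"
  by (rule cqlinearD(6)[OF cqlinear_tens(2)] cqlinearD(6)[OF cqlinear_tens(1)])+

lemma tensor_ext:
  assumes "cqlinear f" "cqlinear g" "\<And>a b. f (a \<otimes> b) = g (a \<otimes> b)"
  shows "f t = g t"
  by (induction t rule: tensor_induct) (simp_all add: assms(3) cqlinearD[OF assms(1)] cqlinearD[OF assms(2)])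

text \<open>The signs of the super sign rule are constants only on homogeneous elementary tensors,
  so most identities between maps out of a tensor product are checked there.\<close>

lemma tensor_ext_homog:
  fixes f g :: "('a::superspace, 'b::superspace) tensor \<Rightarrow> 'c::cqspace"
  assumes "cqlinear f" "cqlinear g"
    "\<And>p p' a b. homog p a \<Longrightarrow> homog p' b \<Longrightarrow> f (a \<otimes> b) = g (a \<otimes> b)"
  shows "f t = g t"
  by (induction t rule: tensor_induct_homog)
     (simp_all add: assms(3) cqlinearD[OF assms(1)] cqlinearD[OF assms(2)])

text \<open>Bilinearity of \<open>B x\<close> does not enter: \<open>tlift\<close> evaluates on the
  representative \<open>rep_tensor t\<close>, a fixed finite combination of pairs.\<close>

lemma cqlinear_tlift_fun:
  assumes "\<And>a b. cqlinear (\<lambda>x. B x a b)"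
  shows "cqlinear (\<lambda>x. tlift (B x) t)"
  unfolding tlift_def lin_ext_def split_def
  by (intro cqlinear_sum cqlinear_scl assms)

lemma bilin_tens_compose: "cqlinear f \<Longrightarrow> cqlinear g \<Longrightarrow> bilin (\<lambda>a b. f a \<otimes> g b)"
  by (rule bilin_precompose[OF bilin_tens])

lemma cqlinear_tmap: "cqlinear f \<Longrightarrow> cqlinear g \<Longrightarrow> cqlinear (tmap f g)"
  unfolding tmap_def by (intro cqlinear_tlift bilin_tens_compose)

lemma tmap_tens: "cqlinear f \<Longrightarrow> cqlinear g \<Longrightarrow> tmap f g (a \<otimes> b) = f a \<otimes> g b"
  unfolding tmap_def by (intro tlift_tens bilin_tens_compose)

lemma cqlinear_tens_out:
  "cqlinear (\<lambda>c. (a \<otimes> b) \<otimes> c)" "cqlinear (\<lambda>b. (a \<otimes> b) \<otimes> c)" "cqlinear (\<lambda>a. (a \<otimes> b) \<otimes> c)"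
  "cqlinear (\<lambda>c. a \<otimes> (b \<otimes> c))" "cqlinear (\<lambda>b. a \<otimes> (b \<otimes> c))" "cqlinear (\<lambda>a. a \<otimes> (b \<otimes> c))"
  by (rule cqlinearI; simp add: tens_lin)+

lemma bilin_tens_out: "bilin (\<lambda>b c. (a \<otimes> b) \<otimes> c)" "bilin (\<lambda>a b. a \<otimes> (b \<otimes> c))"
  unfolding bilin_iff by (intro conjI allI cqlinear_tens_out)+

lemma bilin_assocl: "bilin (\<lambda>a. tlift (\<lambda>b c. (a \<otimes> b) \<otimes> c))"
  unfolding bilin_iff
  by (intro conjI allI cqlinear_tlift bilin_tens_out cqlinear_tlift_fun cqlinear_tens_out)

lemma bilin_assocr: "bilin (\<lambda>t c. tlift (\<lambda>a b. a \<otimes> (b \<otimes> c)) t)"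
  unfolding bilin_iff
  by (intro conjI allI cqlinear_tlift bilin_tens_out cqlinear_tlift_fun cqlinear_tens_out)

lemma cqlinear_assocl: "cqlinear assocl" and cqlinear_assocr: "cqlinear assocr"
  unfolding assocl_def assocr_def by (rule cqlinear_tlift bilin_assocl bilin_assocr)+

lemma assocl_tens: "assocl (a \<otimes> (b \<otimes> c)) = (a \<otimes> b) \<otimes> c"
  and assocr_tens: "assocr ((a \<otimes> b) \<otimes> c) = a \<otimes> (b \<otimes> c)"
  by (simp_all add: assocl_def assocr_def tlift_tens bilin_assocl bilin_assocr bilin_tens_out)

lemma tensor3_ext:
  assumes "cqlinear f" "cqlinear g" "\<And>a b c. f (a \<otimes> (b \<otimes> c)) = g (a \<otimes> (b \<otimes> c))"
  shows "f t = g t"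
proof (rule tensor_ext[OF assms(1,2)])
  fix a s
  show "f (a \<otimes> s) = g (a \<otimes> s)"
    by (rule tensor_ext[where f = "\<lambda>s. f (a \<otimes> s)" and g = "\<lambda>s. g (a \<otimes> s)"])
       (intro cqlinear_compose[OF _ cqlinear_tens(1)] assms)+
qed

lemma tensor3l_ext:
  assumes "cqlinear f" "cqlinear g" "\<And>a b c. f ((a \<otimes> b) \<otimes> c) = g ((a \<otimes> b) \<otimes> c)"
  shows "f t = g t"
proof (rule tensor_ext[OF assms(1,2)])
  fix c s
  show "f (s \<otimes> c) = g (s \<otimes> c)"
    by (rule tensor_ext[where f = "\<lambda>s. f (s \<otimes> c)" and g = "\<lambda>s. g (s \<otimes> c)"])
       (intro cqlinear_compose[OF _ cqlinear_tens(2)] assms)+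
qed

lemma assocl_assocr [simp]: "assocl (assocr t) = t"
  by (rule tensor3l_ext[OF cqlinear_compose[OF cqlinear_assocl cqlinear_assocr] cqlinear_id])
     (simp add: assocl_tens assocr_tens)

lemma assocr_assocl [simp]: "assocr (assocl t) = t"
  by (rule tensor3_ext[OF cqlinear_compose[OF cqlinear_assocr cqlinear_assocl] cqlinear_id])
     (simp add: assocl_tens assocr_tens)

section \<open>Even maps and homomorphisms between tensor products of superalgebras\<close>

definition even_map :: "('a::superspace \<Rightarrow> 'b::superspace) \<Rightarrow> bool" where
  "even_map f \<longleftrightarrow> cqlinear f \<and> (\<forall>p x. f (hpart p x) = hpart p (f x))"

lemma even_map_linear: "even_map f \<Longrightarrow> cqlinear f"
  and even_map_hpart: "even_map f \<Longrightarrow> f (hpart p x) = hpart p (f x)"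
  by (simp_all add: even_map_def)

lemma even_map_homog: "even_map f \<Longrightarrow> homog p x \<Longrightarrow> homog p (f x)"
  by (metis even_map_hpart homog_def)

lemma even_map_compose: "even_map f \<Longrightarrow> even_map g \<Longrightarrow> even_map (\<lambda>x. f (g x))"
  by (simp add: even_map_def cqlinear_compose)

lemma even_mapI_tensor:
  fixes f :: "('a::superspace, 'b::superspace) tensor \<Rightarrow> 'c::superspace"
  assumes "cqlinear f" "\<And>p p' a b. homog p a \<Longrightarrow> homog p' b \<Longrightarrow> homog (p + p') (f (a \<otimes> b))"
  shows "even_map f"
  unfolding even_map_def
proof (intro conjI allI)
  fix p x
  show "f (hpart p x) = hpart p (f x)"
  proof (rule tensor_ext_homog[where t = x])
    fix u v and a :: 'a and b :: 'b
    assume ab: "homog u a" "homog v b"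
    show "f (hpart p (a \<otimes> b)) = hpart p (f (a \<otimes> b))"
      using hpart_homog[OF assms(2)[OF ab], of p] hpart_tens_homog[OF ab, of p]
      by (auto simp: cqlinearD[OF assms(1)])
  qed (intro cqlinear_compose[OF assms(1) cqlinear_hpart] cqlinear_compose[OF cqlinear_hpart assms(1)])+
qed (rule assms(1))

lemma even_map_tmap: "even_map f \<Longrightarrow> even_map g \<Longrightarrow> even_map (tmap f g)"
  by (rule even_mapI_tensor)
     (simp_all add: cqlinear_tmap even_map_linear tmap_tens homog_tens even_map_homog)

lemma even_map_assocl: "even_map (assocl :: ('a::superspace, ('b::superspace, 'c::superspace) tensor) tensor \<Rightarrow> _)"
proof (rule even_mapI_tensor[OF cqlinear_assocl])
  fix p p' and a :: 'a and t :: "('b, 'c) tensor"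
  assume a: "homog p a" and t: "homog p' t"
  have "assocl (a \<otimes> hpart u t) = hpart (p + u) (assocl (a \<otimes> t))" for u
  proof (rule tensor_ext_homog[where t = t])
    fix v v' and b :: 'b and c :: 'c
    assume bc: "homog v b" "homog v' c"
    have "hpart (p + u) ((a \<otimes> b) \<otimes> c) = (if p + u = p + v + v' then (a \<otimes> b) \<otimes> c else 0)"
      by (rule hpart_tens_homog[OF homog_tens[OF a bc(1)] bc(2)])
    then show "assocl (a \<otimes> hpart u (b \<otimes> c)) = hpart (p + u) (assocl (a \<otimes> (b \<otimes> c)))"
      by (simp add: assocl_tens hpart_tens_homog[OF bc] cqlinearD[OF cqlinear_assocl] add.assoc)
  qed (intro cqlinear_compose[OF cqlinear_assocl] cqlinear_compose[OF cqlinear_tens(1)]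
      cqlinear_compose[OF cqlinear_hpart] cqlinear_hpart cqlinear_tens)+
  from this[of p'] t show "homog (p + p') (assocl (a \<otimes> t))"
    by (metis homog_def)
qed

lemma even_map_assocr: "even_map (assocr :: (('a::superspace, 'b::superspace) tensor, 'c::superspace) tensor \<Rightarrow> _)"
proof -
  have "assocr (hpart p t) = hpart p (assocr t)" for p and t :: "(('a, 'b) tensor, 'c) tensor"
    by (metis assocr_assocl assocl_assocr even_map_hpart[OF even_map_assocl])
  then show ?thesis
    by (simp add: even_map_def cqlinear_assocr)
qed

lemma superalg_hom_even: "superalg_hom f \<Longrightarrow> even_map f"
  and superalg_hom_linear: "superalg_hom f \<Longrightarrow> cqlinear f"
  and superalg_hom_mult: "superalg_hom f \<Longrightarrow> f (x * y) = f x * f y"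
  by (simp_all add: superalg_hom_def even_map_def)

lemma superalg_hom_id: "superalg_hom (\<lambda>x. x)" "superalg_hom id"
  by (simp_all add: superalg_hom_def cqlinear_id cqlinear_id')

lemma superalg_hom_compose: "superalg_hom f \<Longrightarrow> superalg_hom g \<Longrightarrow> superalg_hom (\<lambda>x. f (g x))"
  by (simp add: superalg_hom_def cqlinear_compose)

lemma superalg_homI_tensor:
  fixes f :: "('a::superalgebra, 'b::superalgebra) tensor \<Rightarrow> 'c::superalgebra"
  assumes "even_map f"
    "\<And>u u' v v' a b a' b'. homog u a \<Longrightarrow> homog u' b \<Longrightarrow> homog v a' \<Longrightarrow> homog v' b' \<Longrightarrow>
       sgnp (u' * v) \<cdot> f ((a * a') \<otimes> (b * b')) = f (a \<otimes> b) * f (a' \<otimes> b')"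
  shows "superalg_hom f"
proof -
  note lin = even_map_linear[OF assms(1)]
  have "f (x * y) = f x * f y" for x y
  proof (rule tensor_ext_homog[where t = x and f = "\<lambda>x. f (x * y)" and g = "\<lambda>x. f x * f y"])
    fix u u' and a :: 'a and b :: 'b
    assume ab: "homog u a" "homog u' b"
    show "f (a \<otimes> b * y) = f (a \<otimes> b) * f y"
    proof (rule tensor_ext_homog[where t = y and f = "\<lambda>y. f (a \<otimes> b * y)" and g = "\<lambda>y. f (a \<otimes> b) * f y"])
      fix v v' and a' :: 'a and b' :: 'b
      assume ab': "homog v a'" "homog v' b'"
      show "f (a \<otimes> b * a' \<otimes> b') = f (a \<otimes> b) * f (a' \<otimes> b')"
        by (simp add: times_tens_homog[OF ab(2) ab'(1)] cqlinearD[OF lin] assms(2)[OF ab ab'])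
    qed (intro cqlinear_compose[OF lin cqlinear_mult(1)] cqlinear_compose[OF cqlinear_mult(1) lin])+
  qed (intro cqlinear_compose[OF lin cqlinear_mult(2)] cqlinear_compose[OF cqlinear_mult(2) lin])+
  with assms(1) show ?thesis
    by (simp add: superalg_hom_def even_map_def)
qed

text \<open>Evenness of the two maps matters: \<open>g b\<close> and \<open>f a'\<close> keep the
  parities of \<open>b\<close> and \<open>a'\<close>, so the product before and after the maps
  carries the same sign.\<close>

lemma superalg_hom_tmap:
  fixes f :: "'a::superalgebra \<Rightarrow> 'c::superalgebra" and g :: "'b::superalgebra \<Rightarrow> 'd::superalgebra"
  assumes "superalg_hom f" "superalg_hom g"
  shows "superalg_hom (tmap f g)"
proof (rule superalg_homI_tensor)
  show "even_map (tmap f g)"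
    using assms by (intro even_map_tmap superalg_hom_even)
  fix u u' v v' and a a' :: 'a and b b' :: 'b
  assume h: "homog u a" "homog u' b" "homog v a'" "homog v' b'"
  show "sgnp (u' * v) \<cdot> tmap f g ((a * a') \<otimes> (b * b')) = tmap f g (a \<otimes> b) * tmap f g (a' \<otimes> b')"
    using times_tens_homog[OF even_map_homog[OF superalg_hom_even[OF assms(2)] h(2)]
        even_map_homog[OF superalg_hom_even[OF assms(1)] h(3)], of "f a" "g b'"]
    by (simp add: tmap_tens assms superalg_hom_linear superalg_hom_mult)
qed

text \<open>Only \<open>b\<close> and \<open>a'\<close> change places, so one even element among
  them removes the sign; the other one is split into its homogeneous parts.\<close>

lemma times_tens_even:
  assumes "homog 0 b \<or> homog 0 a'"
  shows "(a \<otimes> b) * (a' \<otimes> b') = (a * a') \<otimes> (b * b')"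
  using assms
proof
  assume b: "homog 0 b"
  have *: "(\<lambda>a'. (a \<otimes> b) * (a' \<otimes> b')) a' = (\<lambda>a'. (a * a') \<otimes> (b * b')) a'"
    by (induction a' rule: homog_decomp)
       (simp_all add: times_tens_homog[OF b] tens_lin distrib_left)
  then show ?thesis .
next
  assume a: "homog 0 a'"
  have *: "(\<lambda>b. (a \<otimes> b) * (a' \<otimes> b')) b = (\<lambda>b. (a * a') \<otimes> (b * b')) b"
    by (induction b rule: homog_decomp)
       (simp_all add: times_tens_homog[OF _ a] tens_lin distrib_left distrib_right)
  then show ?thesis .
qed

lemma sgnp_mult_add: "sgnp (p * (u + v)) = sgnp (p * u) * sgnp (p * v)"
  "sgnp ((u + v) * p) = sgnp (u * p) * sgnp (v * p)"
  by (simp_all add: distrib_left distrib_right sgnp_add)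

text \<open>One sign for each crossing pair: \<open>b\<close> passes \<open>a'\<close>, and
  \<open>c\<close> passes both \<open>a'\<close> and \<open>b'\<close>.\<close>

lemma times_assoc3_homog:
  fixes a a' :: "'a::superalgebra" and b b' :: "'b::superalgebra" and c c' :: "'c::superalgebra"
  assumes "homog pb b" "homog pc c" "homog pa' a'" "homog pb' b'"
  shows "((a \<otimes> b) \<otimes> c) * ((a' \<otimes> b') \<otimes> c') =
    (sgnp (pb * pa') * sgnp (pc * pa') * sgnp (pc * pb')) \<cdot> (((a * a') \<otimes> (b * b')) \<otimes> (c * c'))"
  using times_tens_homog[OF assms(2) homog_tens[OF assms(3,4)], of "a \<otimes> b" c']
    times_tens_homog[OF assms(1,3), of a b']
  by (simp add: tens_lin sgnp_mult_add mult_ac)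

text \<open>Both groupings of a triple tensor product cross the same three pairs of factors. This
  lets coassociativity be treated as an equation between homomorphisms.\<close>

lemma superalg_hom_assocr:
  "superalg_hom (assocr :: (('a::superalgebra, 'b::superalgebra) tensor, 'c::superalgebra) tensor \<Rightarrow> _)"
  (is "superalg_hom ?f")
proof -
  have "?f (x * y) = ?f x * ?f y" for x y
  proof (rule tensor_ext_homog[where t = x and f = "\<lambda>x. ?f (x * y)" and g = "\<lambda>x. ?f x * ?f y"])
    fix u pc and s :: "('a, 'b) tensor" and c :: 'c
    assume c: "homog pc c"
    show "?f ((s \<otimes> c) * y) = ?f (s \<otimes> c) * ?f y"
    proof (rule tensor_ext_homog[where t = s and f = "\<lambda>s. ?f ((s \<otimes> c) * y)" and g = "\<lambda>s. ?f (s \<otimes> c) * ?f y"])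
      fix pa pb and a :: 'a and b :: 'b
      assume b: "homog pb b"
      show "?f (((a \<otimes> b) \<otimes> c) * y) = ?f ((a \<otimes> b) \<otimes> c) * ?f y" (is "?F y = ?G y")
      proof (rule tensor_ext_homog[where t = y and f = ?F and g = ?G])
        fix v pc' and s' :: "('a, 'b) tensor" and c' :: 'c
        assume c': "homog pc' c'"
        show "?F (s' \<otimes> c') = ?G (s' \<otimes> c')"
        proof (rule tensor_ext_homog[where t = s' and f = "\<lambda>s. ?F (s \<otimes> c')" and g = "\<lambda>s. ?G (s \<otimes> c')"])
          fix pa' pb' and a' :: 'a and b' :: 'b
          assume a': "homog pa' a'" and b': "homog pb' b'"
          show "?F ((a' \<otimes> b') \<otimes> c') = ?G ((a' \<otimes> b') \<otimes> c')"
            using times_tens_homog[OF homog_tens[OF b c] a', of a "b' \<otimes> c'"]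
              times_tens_homog[OF c b', of b c']
            by (simp add: times_assoc3_homog[OF b c a' b'] assocr_tens cqlinearD[OF cqlinear_assocr]
                tens_lin sgnp_mult_add mult_ac)
        qed (intro cqlinear_compose[OF cqlinear_assocr] cqlinear_compose[OF cqlinear_mult(1)]
            cqlinear_compose[OF _ cqlinear_tens(2)] cqlinear_mult cqlinear_assocr)+
      qed (intro cqlinear_compose[OF cqlinear_assocr] cqlinear_compose[OF cqlinear_mult(1)]
            cqlinear_mult cqlinear_assocr)+
    qed (intro cqlinear_compose[OF cqlinear_assocr] cqlinear_compose[OF cqlinear_mult(2)]
            cqlinear_compose[OF _ cqlinear_tens(2)] cqlinear_mult cqlinear_assocr)+
  qed (intro cqlinear_compose[OF cqlinear_assocr] cqlinear_compose[OF cqlinear_mult(2)]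
            cqlinear_mult cqlinear_assocr)+
  with even_map_assocr show ?thesis
    by (simp add: superalg_hom_def even_map_def)
qed

section \<open>The universal property of the quantum queer superalgebra\<close>

lemma falg_expand: "x = lin_ext (\<lambda>w. Abs_falg (Poly_Mapping.single w 1)) (Rep_falg x)"
proof -
  have lin: "cqlinear (\<lambda>y. Abs_falg y)"
    by (rule cqlinearI) (simp_all add: plus_falg_def scl_falg_def Abs_falg_inverse)
  have "x = Abs_falg (lin_ext (\<lambda>w. Poly_Mapping.single w 1) (Rep_falg x))"
    by (simp add: Rep_falg_inverse flip: poly_mapping_eq_lin_ext)
  also have "\<dots> = lin_ext (\<lambda>w. Abs_falg (Poly_Mapping.single w 1)) (Rep_falg x)"
    by (simp add: lin_ext_def cqlinearD[OF lin])
  finally show ?thesis .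
qed

lemma falg_one: "1 = Abs_falg (Poly_Mapping.single (Word []) 1)"
  by (simp add: one_falg_def flip: zero_lword_def)

lemma falg_word_mult:
  "Abs_falg (Poly_Mapping.single v 1) * Abs_falg (Poly_Mapping.single w 1) = Abs_falg (Poly_Mapping.single (v + w) 1)"
  by (simp add: times_falg_def Abs_falg_inverse mult_single)

lemma falg_word_Cons:
  "Abs_falg (Poly_Mapping.single (Word ((i, j) # w)) 1) = fgen i j * Abs_falg (Poly_Mapping.single (Word w) 1)"
  by (simp add: fgen_def falg_word_mult)

lemma falg_word_snoc:
  "Abs_falg (Poly_Mapping.single (Word (w @ [(i, j)])) 1) = Abs_falg (Poly_Mapping.single (Word w) 1) * fgen i j"
  by (simp add: fgen_def falg_word_mult)

lemma falg_span_induct: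
  assumes "\<And>w. P (Abs_falg (Poly_Mapping.single (Word w) 1))"
    and "\<And>x y. P x \<Longrightarrow> P y \<Longrightarrow> P (x + y)" "\<And>c x. P x \<Longrightarrow> P (c \<cdot> x)"
  shows "P x"
proof -
  have P0: "P 0"
    using assms(3)[OF assms(1), of 0] by simp
  have w: "P (Abs_falg (Poly_Mapping.single w 1))" for w
    using assms(1) by (cases w) auto
  have "P (\<Sum>k\<in>K. c k \<cdot> Abs_falg (Poly_Mapping.single k 1))" for K c
    by (induction K rule: infinite_finite_induct) (auto intro: P0 assms(2,3) w)
  then show ?thesis
    by (subst falg_expand) (simp add: lin_ext_def)
qed

lemma falg_induct [case_names one gen add scl]:
  assumes "P 1" "\<And>i j x. P x \<Longrightarrow> P (fgen i j * x)"
    and "\<And>x y. P x \<Longrightarrow> P y \<Longrightarrow> P (x + y)" "\<And>c x. P x \<Longrightarrow> P (c \<cdot> x)"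
  shows "P x"
proof (rule falg_span_induct[OF _ assms(3,4)])
  fix w show "P (Abs_falg (Poly_Mapping.single (Word w) 1))"
  proof (induction w)
    case (Cons a w)
    then show ?case
      by (cases a) (simp add: falg_word_Cons assms(2))
  qed (simp add: assms(1) flip: falg_one)
qed

lemma falg_induct_right [case_names one gen add scl]:
  assumes "P 1" "\<And>i j x. P x \<Longrightarrow> P (x * fgen i j)"
    and "\<And>x y. P x \<Longrightarrow> P y \<Longrightarrow> P (x + y)" "\<And>c x. P x \<Longrightarrow> P (c \<cdot> x)"
  shows "P x"
proof (rule falg_span_induct[OF _ assms(3,4)])
  fix w show "P (Abs_falg (Poly_Mapping.single (Word w) 1))"
  proof (induction w rule: rev_induct)
    case (snoc a w)
    then show ?case
      by (cases a) (simp add: falg_word_snoc assms(2))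
  qed (simp add: assms(1) flip: falg_one)
qed

lemma relator_in_ideal: "r \<in> relators N \<Longrightarrow> r \<in> uq_ideal N"
  unfolding uq_ideal_def
  by (rule cqs.span_base, rule CollectI, rule exI[of _ 1], rule exI[of _ r], rule exI[of _ 1]) simp

text \<open>The surplus symbols are relators. Hence the triangularity of L is built into
  \<open>Lgen\<close>, and sums over all intermediate indices k silently reduce to those between i
  and j.\<close>

lemma fgen_outside: "\<not> (i \<in> idx CARD('N) \<and> j \<in> idx CARD('N) \<and> i \<le> j) \<Longrightarrow> Lgen i j = (0 :: 'N::finite uq)"
proof -
  assume *: "\<not> (i \<in> idx CARD('N) \<and> j \<in> idx CARD('N) \<and> i \<le> j)"
  have "fgen i j \<in> uq_ideal CARD('N)"
    by (rule relator_in_ideal) (use * in \<open>auto simp: relators_def\<close>)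
  then show ?thesis
    by (simp add: Lgen.abs_eq zero_uq_def uq.abs_eq_iff uq_rel_def)
qed

lemma superalg_hom_abs_uq: "superalg_hom abs_uq"
  by (simp add: superalg_hom_def cqlinearI plus_uq.abs_eq scl_uq.abs_eq times_uq.abs_eq hpart_uq.abs_eq)

lemma abs_uq_1 [simp]: "abs_uq 1 = 1"
  by (simp add: one_uq_def)

lemma abs_uq_fgen: "abs_uq (fgen i j) = Lgen i j"
  by (simp add: Lgen.abs_eq)

lemma uq_induct [case_names one gen add scl]:
  fixes u :: "'N::finite uq"
  assumes "P 1"
    and "\<And>i j u. i \<in> idx CARD('N) \<Longrightarrow> j \<in> idx CARD('N) \<Longrightarrow> i \<le> j \<Longrightarrow> P u \<Longrightarrow> P (Lgen i j * u)"
    and "\<And>u v. P u \<Longrightarrow> P v \<Longrightarrow> P (u + v)" "\<And>c u. P u \<Longrightarrow> P (c \<cdot> u)"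
  shows "P u"
proof -
  have P0: "P 0"
    using assms(4)[OF assms(1), of 0] by simp
  have "P (abs_uq x)" for x
  proof (induction x rule: falg_induct)
    case (gen i j x)
    then show ?case
      using assms(2)[of i j "abs_uq x"] fgen_outside[of i j, where 'N = 'N] P0
      by (cases "i \<in> idx CARD('N) \<and> j \<in> idx CARD('N) \<and> i \<le> j")
         (auto simp: superalg_hom_mult[OF superalg_hom_abs_uq] abs_uq_fgen)
  qed (use assms(1,3,4) in \<open>simp_all add: plus_uq.abs_eq[symmetric] scl_uq.abs_eq[symmetric]\<close>)
  then show ?thesis
    by (metis uq_exhaust)
qed

text \<open>The mirror image is needed for \<open>anti_right\<close>, where the image of the last
  generator under the comultiplication has to land in the middle of the product.\<close>

lemma uq_induct_right [case_names one gen add scl]: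
  fixes u :: "'N::finite uq"
  assumes "P 1"
    and "\<And>i j u. i \<in> idx CARD('N) \<Longrightarrow> j \<in> idx CARD('N) \<Longrightarrow> i \<le> j \<Longrightarrow> P u \<Longrightarrow> P (u * Lgen i j)"
    and "\<And>u v. P u \<Longrightarrow> P v \<Longrightarrow> P (u + v)" "\<And>c u. P u \<Longrightarrow> P (c \<cdot> u)"
  shows "P u"
proof -
  have P0: "P 0"
    using assms(4)[OF assms(1), of 0] by simp
  have "P (abs_uq x)" for x
  proof (induction x rule: falg_induct_right)
    case (gen i j x)
    then show ?case
      using assms(2)[of i j "abs_uq x"] fgen_outside[of i j, where 'N = 'N] P0
      by (cases "i \<in> idx CARD('N) \<and> j \<in> idx CARD('N) \<and> i \<le> j")
         (auto simp: superalg_hom_mult[OF superalg_hom_abs_uq] abs_uq_fgen)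
  qed (use assms(1,3,4) in \<open>simp_all add: plus_uq.abs_eq[symmetric] scl_uq.abs_eq[symmetric]\<close>)
  then show ?thesis
    by (metis uq_exhaust)
qed

lemma uq_hom_unique:
  fixes f g :: "'N::finite uq \<Rightarrow> 'b::superalgebra"
  assumes "superalg_hom f" "superalg_hom g" "f 1 = g 1"
    and "\<And>i j. i \<in> idx CARD('N) \<Longrightarrow> j \<in> idx CARD('N) \<Longrightarrow> i \<le> j \<Longrightarrow> f (Lgen i j) = g (Lgen i j)"
  shows "f u = g u"
  by (induction u rule: uq_induct)
     (simp_all add: assms superalg_hom_mult cqlinearD[OF superalg_hom_linear])

subsection \<open>Homomorphisms from the free superalgebra\<close>

text \<open>The empty word goes to a prescribed idempotent \<open>e\<close> rather than to 1,
  because the target may be \<open>mat\<close>, which has no unit; there \<open>e\<close> is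
  \<open>idm N\<close>. The conditions in \<open>unit_for\<close> make \<open>e\<close> a two-sided
  unit for the chosen images of the generators.\<close>

definition word_eval :: "'b::superalgebra \<Rightarrow> (int \<Rightarrow> int \<Rightarrow> 'b) \<Rightarrow> lword \<Rightarrow> 'b" where
  "word_eval e l w = (case w of Word xs \<Rightarrow> foldr (\<lambda>(i, j) y. l i j * y) xs e)"

definition falg_eval :: "'b::superalgebra \<Rightarrow> (int \<Rightarrow> int \<Rightarrow> 'b) \<Rightarrow> falg \<Rightarrow> 'b" where
  "falg_eval e l x = lin_ext (word_eval e l) (Rep_falg x)"

definition unit_for :: "'b::superalgebra \<Rightarrow> (int \<Rightarrow> int \<Rightarrow> 'b) \<Rightarrow> bool" where
  "unit_for e l \<longleftrightarrow> e * e = e \<and> homog 0 e \<and>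
     (\<forall>i j. e * l i j = l i j \<and> l i j * e = l i j \<and> homog (parity i + parity j) (l i j))"

lemma cqlinear_falg_eval: "cqlinear (falg_eval e l)"
  by (rule cqlinearI)
     (simp_all add: falg_eval_def plus_falg.rep_eq scl_falg.rep_eq cqlinearD[OF cqlinear_lin_ext])

lemma falg_eval_word: "falg_eval e l (Abs_falg (Poly_Mapping.single w 1)) = word_eval e l w"
  by (simp add: falg_eval_def Abs_falg_inverse scl_one)

lemma falg_eval_1: "falg_eval e l 1 = e"
  by (simp add: falg_one falg_eval_word word_eval_def)

lemma falg_eval_fgen: "unit_for e l \<Longrightarrow> falg_eval e l (fgen i j) = l i j"
  by (simp add: fgen_def falg_eval_word word_eval_def unit_for_def)

lemma falg_eval_gen_mult: "falg_eval e l (fgen i j * x) = l i j * falg_eval e l x"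
proof (induction x rule: falg_span_induct)
  case (1 w)
  then show ?case
    by (simp add: falg_eval_word word_eval_def flip: falg_word_Cons)
qed (simp_all add: distrib_left scl_mult_right cqlinearD[OF cqlinear_falg_eval])

lemma superalg_hom_falg_eval:
  assumes u: "unit_for e l"
  shows "superalg_hom (falg_eval e l)"
proof -
  let ?f = "falg_eval e l"
  note lin = cqlinearD[OF cqlinear_falg_eval, of e l]
  have e: "e * ?f y = ?f y" for y
    using u
    by (induction y rule: falg_induct)
       (simp_all add: falg_eval_1 falg_eval_gen_mult unit_for_def lin distrib_left scl_mult_right
         flip: mult.assoc)
  have mult: "?f (x * y) = ?f x * ?f y" for x y
    by (induction x rule: falg_induct)
       (simp_all add: falg_eval_1 falg_eval_gen_mult e mult.assoc lin distrib_right scl_mult_left)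
  have "?f (hpart p x) = hpart p (?f x)" for p x
  proof (induction x arbitrary: p rule: falg_induct)
    case one
    then show ?case
      using u by (auto simp: unit_for_def falg_eval_1 hpart_homog lin)
  next
    case (gen i j x)
    \<comment> \<open>Parities are added modulo 2, so \<open>p + v\<close> is also their difference:
      the part of \<open>a * y\<close> of parity \<open>p\<close> comes from exactly one part of
      \<open>y\<close>.\<close>
    have hp: "hpart p (a * y) = a * hpart (p + v) y" if "homog v a" for a y :: "'c::superalgebra" and v
    proof -
      have *: "homog (v + w) (a * hpart w y)" for w
        by (intro homog_mult homog_hpart that)
      have "hpart p (a * y) = hpart p (a * hpart 0 y) + hpart p (a * hpart 1 y)"
        by (metis distrib_left hpart_add hpart_sum)
      also have "\<dots> = a * hpart (p + v) y"
        unfolding hpart_homog[OF *] using bit_exhaust[of p] bit_exhaust[of v] by auto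
      finally show ?thesis .
    qed
    have "homog (parity i + parity j) (l i j)"
      using u by (simp add: unit_for_def)
    from hp[OF this] show ?case
      by (simp add: hp[OF homog_fgen] falg_eval_gen_mult gen)
  qed (simp_all add: hpart_add hpart_scl lin)
  with mult cqlinear_falg_eval show ?thesis
    by (simp add: superalg_hom_def)
qed

subsection \<open>Matrices with entries in a superalgebra\<close>

definition smat :: "nat \<Rightarrow> (int \<Rightarrow> int \<Rightarrow> 'b::cqspace) \<Rightarrow> ('b, mat) tensor" where
  "smat N l = (\<Sum>i\<in>idx N. \<Sum>j\<in>idx N. l i j \<otimes> munit i j)"

text \<open>Generalises \<open>slots23\<close> by the element placed in the algebra slot, which has
  to be \<open>idm N\<close> when the algebra is \<open>mat\<close>.\<close>

definition slot23 :: "'b::cqspace \<Rightarrow> (mat, mat) tensor \<Rightarrow> (('b, mat) tensor, mat) tensor" where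
  "slot23 e = tlift (\<lambda>m m'. (e \<otimes> m) \<otimes> m')"

definition rll :: "nat \<Rightarrow> 'b::superalgebra \<Rightarrow> ('b, mat) tensor \<Rightarrow> bool" where
  "rll N e X \<longleftrightarrow> (X \<otimes> idm N) * slots13 N X * slot23 e (Smat N)
     = slot23 e (Smat N) * slots13 N X * (X \<otimes> idm N)"

lemma finite_idx [simp]: "finite (idx N)"
  by (simp add: idx_def)

lemma slot23_tens: "slot23 e (m \<otimes> m') = (e \<otimes> m) \<otimes> m'" and cqlinear_slot23: "cqlinear (slot23 e)"
proof -
  have b: "bilin (\<lambda>m m'. (e \<otimes> m) \<otimes> m')" by (rule bilin_tens_out)
  show "slot23 e (m \<otimes> m') = (e \<otimes> m) \<otimes> m'" "cqlinear (slot23 e)"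
    unfolding slot23_def by (simp_all add: tlift_tens[OF b] cqlinear_tlift[OF b])
qed

lemma slots23_eq_slot23: "slots23 = slot23 1"
  by (rule ext) (simp add: slots23_def slot23_def)

lemma free_L_eq_smat:
  "free_L N = smat N (\<lambda>i j. if i \<le> j then fgen i j else 0)"
  unfolding free_L_def smat_def
  by (intro sum.cong refl sum.mono_neutral_cong_left) auto

lemma tmap_smat:
  "cqlinear f \<Longrightarrow> tmap f id (smat N l) = smat N (\<lambda>i j. f (l i j))"
  by (simp add: smat_def cqlinearD[OF cqlinear_tmap[OF _ cqlinear_id']] tmap_tens cqlinear_id')

lemma tmap_slots13:
  assumes "cqlinear f"
  shows "tmap (tmap f id) id (slots13 N X) = slots13 N (tmap f id X)"
  by (rule tensor_ext[where t = X])
     (simp_all add: cqlinear_compose[OF cqlinear_tmap] cqlinear_compose[OF cqlinear_slots13]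
       cqlinear_slots13 cqlinear_tmap cqlinear_id cqlinear_id' assms tmap_tens slots_tens)

lemma tmap_slot23:
  assumes "cqlinear f"
  shows "tmap (tmap f id) id (slot23 e X) = slot23 (f e) X"
  by (rule tensor_ext[where t = X])
     (simp_all add: cqlinear_compose[OF cqlinear_tmap] 
       cqlinear_slot23 cqlinear_tmap cqlinear_id cqlinear_id' assms tmap_tens slot23_tens)

text \<open>The homomorphism touches only the algebra slot, while S lives in the matrix slots, so
  the whole relation is transported.\<close>

lemma rll_hom:
  assumes f: "superalg_hom f" and "rll N e X"
  shows "rll N (f e) (tmap f id X)"
proof -
  let ?F = "tmap (tmap f id) id :: (('a, mat) tensor, mat) tensor \<Rightarrow> (('b, mat) tensor, mat) tensor"
  have F: "superalg_hom ?F"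
    by (intro superalg_hom_tmap f superalg_hom_id)
  note lin = superalg_hom_linear[OF f]
  have "?F ((X \<otimes> idm N) * slots13 N X * slot23 e (Smat N))
      = ?F (slot23 e (Smat N) * slots13 N X * (X \<otimes> idm N))"
    using assms(2) by (simp add: rll_def)
  then show ?thesis
    by (simp add: rll_def superalg_hom_mult[OF F] tmap_slots13[OF lin] tmap_slot23[OF lin]
        tmap_tens cqlinear_tmap lin cqlinear_id')
qed

lemma mat_expand:
  assumes "finite K" "\<And>i j. entry m i j \<noteq> 0 \<Longrightarrow> i \<in> K \<and> j \<in> K"
  shows "m = (\<Sum>i\<in>K. \<Sum>j\<in>K. entry m i j \<cdot> munit i j)"
proof (rule mat_eqI)
  fix k l
  have lin: "cqlinear (\<lambda>m. entry m k l)"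
    by (rule cqlinearI) (simp_all add: plus_mat.rep_eq scl_mat.rep_eq scl_cq_def)
  have "entry (\<Sum>i\<in>K. \<Sum>j\<in>K. entry m i j \<cdot> munit i j) k l
      = (\<Sum>i\<in>K. \<Sum>j\<in>K. entry m i j * (if k = i \<and> l = j then 1 else 0))"
    by (simp only: cqlinearD(6)[OF lin] cqlinearD(2)[OF lin] munit.rep_eq scl_cq_def)
  also have "\<dots> = (\<Sum>i\<in>K. if k = i then (\<Sum>j\<in>K. if l = j then entry m i j else 0) else 0)"
    by (rule sum.cong) (auto intro!: sum.cong)
  also have "\<dots> = entry m k l"
    using assms(2)[of k l] by (auto simp: sum.delta'[OF assms(1)])
  finally show "entry m k l = entry (\<Sum>i\<in>K. \<Sum>j\<in>K. entry m i j \<cdot> munit i j) k l" ..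
qed

text \<open>Matrices are unbounded in size, so no index set works for all tensors. Each tensor has
  its own finite one, and the claim for every larger set allows two of them to be merged.\<close>

lemma tensor_mat_expand:
  fixes t :: "('a::cqspace, mat) tensor"
  shows "\<exists>K. finite K \<and> (\<forall>K'. finite K' \<longrightarrow> K \<subseteq> K' \<longrightarrow> t = (\<Sum>i\<in>K'. \<Sum>j\<in>K'. ecoef i j t \<otimes> munit i j))"
proof (induction t rule: tensor_induct)
  case (tens a m)
  obtain K where K: "finite K" "\<And>i j. entry m i j \<noteq> 0 \<Longrightarrow> i \<in> K \<and> j \<in> K"
    using mat_support[of m] by blast
  have "a \<otimes> m = (\<Sum>i\<in>K'. \<Sum>j\<in>K'. ecoef i j (a \<otimes> m) \<otimes> munit i j)"
    if K': "finite K'" "K \<subseteq> K'" for K'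
  proof -
    have "a \<otimes> m = a \<otimes> (\<Sum>i\<in>K'. \<Sum>j\<in>K'. entry m i j \<cdot> munit i j)"
      using mat_expand[OF K'(1), of m] K(2) K'(2) by (metis subsetD)
    also have "\<dots> = (\<Sum>i\<in>K'. \<Sum>j\<in>K'. ecoef i j (a \<otimes> m) \<otimes> munit i j)"
      by (simp only: slots_tens tens_lin tens_sum)
    finally show ?thesis .
  qed
  with K(1) show ?case by blast
next
  case (add x y)
  obtain K where K: "finite K"
    "\<And>L. finite L \<Longrightarrow> K \<subseteq> L \<Longrightarrow> x = (\<Sum>i\<in>L. \<Sum>j\<in>L. ecoef i j x \<otimes> munit i j)"
    using add.IH(1) by blast
  obtain K' where K': "finite K'"
    "\<And>L. finite L \<Longrightarrow> K' \<subseteq> L \<Longrightarrow> y = (\<Sum>i\<in>L. \<Sum>j\<in>L. ecoef i j y \<otimes> munit i j)"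
    using add.IH(2) by blast
  show ?case
  proof (intro exI[of _ "K \<union> K'"] conjI allI impI)
    fix L assume L: "finite L" "K \<union> K' \<subseteq> L"
    have "x + y = (\<Sum>i\<in>L. \<Sum>j\<in>L. ecoef i j x \<otimes> munit i j) + (\<Sum>i\<in>L. \<Sum>j\<in>L. ecoef i j y \<otimes> munit i j)"
      using K(2)[of L] K'(2)[of L] L by simp
    also have "\<dots> = (\<Sum>i\<in>L. \<Sum>j\<in>L. ecoef i j (x + y) \<otimes> munit i j)"
      by (simp only: cqlinearD[OF cqlinear_ecoef] tens_lin sum.distrib)
    finally show "x + y = (\<Sum>i\<in>L. \<Sum>j\<in>L. ecoef i j (x + y) \<otimes> munit i j)" .
  qed (use K(1) K'(1) in blast)
qed

text \<open>The relators of \<open>uq\<close> are matrix entries of \<open>RLL\<close>. This is what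
  converts the vanishing of those entries into the matrix relation itself.\<close>

lemma tensor_mat_eqI:
  fixes s t :: "('a::cqspace, mat) tensor"
  assumes "\<And>i j. ecoef i j s = ecoef i j t"
  shows "s = t"
proof -
  obtain K where K: "finite K" "\<And>L. finite L \<Longrightarrow> K \<subseteq> L \<Longrightarrow> s = (\<Sum>i\<in>L. \<Sum>j\<in>L. ecoef i j s \<otimes> munit i j)"
    using tensor_mat_expand[of s] by blast
  obtain K' where K': "finite K'" "\<And>L. finite L \<Longrightarrow> K' \<subseteq> L \<Longrightarrow> t = (\<Sum>i\<in>L. \<Sum>j\<in>L. ecoef i j t \<otimes> munit i j)"
    using tensor_mat_expand[of t] by blast
  have fin: "finite (K \<union> K')"
    using K(1) K'(1) by simp
  have "s = (\<Sum>i\<in>K \<union> K'. \<Sum>j\<in>K \<union> K'. ecoef i j s \<otimes> munit i j)"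
    by (rule K(2)[OF fin]) simp
  also have "\<dots> = (\<Sum>i\<in>K \<union> K'. \<Sum>j\<in>K \<union> K'. ecoef i j t \<otimes> munit i j)"
    by (simp only: assms)
  also have "\<dots> = t"
    by (rule K'(2)[OF fin, symmetric]) simp
  finally show ?thesis .
qed

lemma ecoef_tmap: "cqlinear f \<Longrightarrow> ecoef i j (tmap f id t) = f (ecoef i j t)"
  by (rule tensor_ext[where t = t])
     (simp_all add: cqlinear_compose[OF cqlinear_ecoef] cqlinear_compose[OF _ cqlinear_ecoef] cqlinear_tmap
       cqlinear_id cqlinear_id' tmap_tens slots_tens cqlinearD)

abbreviation uqL :: "('N::finite uq, mat) tensor" where
  "uqL \<equiv> smat CARD('N) Lgen"

lemma rll_uq: "rll CARD('N) 1 (uqL :: ('N::finite uq, mat) tensor)"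
proof -
  let ?A = "abs_uq :: falg \<Rightarrow> 'N uq"
  let ?N = "CARD('N)"
  let ?F = "tmap (tmap ?A id) id :: ((falg, mat) tensor, mat) tensor \<Rightarrow> (('N uq, mat) tensor, mat) tensor"
  note lin = superalg_hom_linear[OF superalg_hom_abs_uq]
  have F: "superalg_hom ?F"
    by (intro superalg_hom_tmap superalg_hom_abs_uq superalg_hom_id)
  have L: "tmap ?A id (free_L ?N) = uqL"
    unfolding free_L_eq_smat tmap_smat[OF lin] unfolding smat_def
    by (intro sum.cong refl) (auto simp: abs_uq_fgen fgen_outside cqlinearD[OF lin])
  have "?F (RLL ?N) = 0"
  proof (intro tensor_mat_eqI)
    fix i j k l
    have "ecoef k l (ecoef i j (RLL ?N)) \<in> uq_ideal ?N"
      by (rule relator_in_ideal) (unfold relators_def, blast)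
    then have "?A (ecoef k l (ecoef i j (RLL ?N))) = 0"
      by (simp add: zero_uq_def uq.abs_eq_iff uq_rel_def)
    then show "ecoef k l (ecoef i j (?F (RLL ?N))) = ecoef k l (ecoef i j 0)"
      by (simp add: ecoef_tmap cqlinear_tmap lin cqlinear_id' cqlinearD[OF cqlinear_ecoef])
  qed
  then show ?thesis
    by (simp add: RLL_def rll_def slots23_eq_slot23 cqlinearD[OF superalg_hom_linear[OF F]]
        superalg_hom_mult[OF F] tmap_slots13[OF lin] tmap_slot23[OF lin]
        tmap_tens cqlinear_tmap lin cqlinear_id' L)
qed

text \<open>The data for a homomorphism out of \<open>uq\<close>. Since \<open>idx N\<close> is
  symmetric under negation, one product per index covers both inverse relations.\<close>

definition uq_family :: "nat \<Rightarrow> 'b::superalgebra \<Rightarrow> (int \<Rightarrow> int \<Rightarrow> 'b) \<Rightarrow> bool" where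
  "uq_family N e l \<longleftrightarrow> unit_for e l \<and>
     (\<forall>i j. \<not> (i \<in> idx N \<and> j \<in> idx N \<and> i \<le> j) \<longrightarrow> l i j = 0) \<and>
     (\<forall>i\<in>idx N. l i i * l (- i) (- i) = e) \<and> rll N e (smat N l)"

text \<open>Evaluation on the free superalgebra kills the relators: applying a homomorphism commutes
  with taking matrix entries, so the entries of \<open>RLL\<close> go to the entries of a relation
  that holds in the target. All definite descriptions of homomorphisms out of \<open>uq\<close>
  denote because of this.\<close>

theorem uq_universal:
  fixes e :: "'b::superalgebra"
  assumes "uq_family CARD('N) e l"
  shows "\<exists>!f :: 'N::finite uq \<Rightarrow> 'b. superalg_hom f \<and> f 1 = e \<and>
    (\<forall>i\<in>idx CARD('N). \<forall>j\<in>idx CARD('N). i \<le> j \<longrightarrow> f (Lgen i j) = l i j)"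
proof -
  let ?N = "CARD('N)"
  have u: "unit_for e l" and out: "\<And>i j. \<not> (i \<in> idx ?N \<and> j \<in> idx ?N \<and> i \<le> j) \<Longrightarrow> l i j = 0"
    and inv: "\<And>i. i \<in> idx ?N \<Longrightarrow> l i i * l (- i) (- i) = e" and rll: "rll ?N e (smat ?N l)"
    using assms by (auto simp: uq_family_def)
  let ?f = "falg_eval e l"
  let ?F = "tmap (tmap ?f id) id :: ((falg, mat) tensor, mat) tensor \<Rightarrow> (('b, mat) tensor, mat) tensor"
  have f: "superalg_hom ?f"
    by (rule superalg_hom_falg_eval[OF u])
  note lin = superalg_hom_linear[OF f]
  have F: "superalg_hom ?F"
    by (intro superalg_hom_tmap f superalg_hom_id)
  have L: "tmap ?f id (free_L ?N) = smat ?N l"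
    unfolding free_L_eq_smat tmap_smat[OF lin] unfolding smat_def
    by (intro sum.cong refl) (auto simp: falg_eval_fgen[OF u] out cqlinearD[OF lin])
  have FR: "?F (RLL ?N) = 0"
    using rll
    by (simp add: RLL_def rll_def slots23_eq_slot23 cqlinearD[OF superalg_hom_linear[OF F]]
        superalg_hom_mult[OF F] tmap_slots13[OF lin] tmap_slot23[OF lin]
        tmap_tens cqlinear_tmap lin cqlinear_id' L falg_eval_1)
  have "?f (ecoef i j (ecoef k l' (RLL ?N))) = 0" for i j k l'
  proof -
    have "ecoef i j (ecoef k l' (?F (RLL ?N))) = ?f (ecoef i j (ecoef k l' (RLL ?N)))"
      by (simp add: ecoef_tmap cqlinear_tmap lin cqlinear_id')
    then show ?thesis
      by (simp add: FR cqlinearD[OF cqlinear_ecoef])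
  qed
  moreover have "?f (fgen i i * fgen (- i) (- i) - 1) = 0" if "i \<in> idx ?N" for i
    using inv[OF that] by (simp add: cqlinearD[OF lin] superalg_hom_mult[OF f] falg_eval_fgen[OF u] falg_eval_1)
  ultimately have rel: "?f r = 0" if "r \<in> relators ?N" for r
    using that by (auto simp: relators_def falg_eval_fgen[OF u] out)
  have ideal: "?f x = 0" if "x \<in> uq_ideal ?N" for x
    using that unfolding uq_ideal_def
    by (induction rule: cqs.span_induct_alt)
       (auto simp: cqlinearD[OF lin] superalg_hom_mult[OF f] rel)
  \<comment> \<open>Descent through chosen representatives; the choice is immaterial because
    \<open>?f\<close> vanishes on the ideal.\<close>
  define g where "g = (\<lambda>w :: 'N uq. ?f (rep_uq w))"
  have g: "g (abs_uq x) = ?f x" for x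
  proof -
    have "abs_uq (rep_uq (abs_uq x :: 'N uq)) = (abs_uq x :: 'N uq)"
      by (rule Quotient3_abs_rep[OF Quotient3_uq])
    then have "uq_rel TYPE('N) (rep_uq (abs_uq x :: 'N uq)) x"
      by (simp only: uq.abs_eq_iff)
    then have "?f (rep_uq (abs_uq x :: 'N uq) - x) = 0"
      unfolding uq_rel_def by (rule ideal)
    then show ?thesis
      by (simp add: g_def cqlinearD[OF lin])
  qed
  have "superalg_hom g"
    unfolding superalg_hom_def
  proof (intro conjI allI cqlinearI)
    fix v w :: "'N uq" and c p
    obtain x y where xy: "v = abs_uq x" "w = abs_uq y"
      using uq_exhaust by metis
    show "g (v + w) = g v + g w" by (simp add: xy plus_uq.abs_eq g cqlinearD[OF lin])
    show "g (c \<cdot> v) = c \<cdot> g v" by (simp add: xy scl_uq.abs_eq g cqlinearD[OF lin])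
    show "g (hpart p v) = hpart p (g v)"
      by (simp add: xy hpart_uq.abs_eq g even_map_hpart[OF superalg_hom_even[OF f]])
    show "g (v * w) = g v * g w" by (simp add: xy times_uq.abs_eq g superalg_hom_mult[OF f])
  qed
  moreover have "g 1 = e"
    using g[of 1] by (simp add: falg_eval_1)
  moreover have "g (Lgen i j) = l i j" for i j
    using g[of "fgen i j"] by (simp add: falg_eval_fgen[OF u] abs_uq_fgen)
  ultimately show ?thesis
  proof (intro ex1I[of _ g] conjI ballI impI)
    fix h :: "'N uq \<Rightarrow> 'b"
    assume g: "superalg_hom g" "g 1 = e" "\<And>i j. g (Lgen i j) = l i j"
      and h: "superalg_hom h \<and> h 1 = e \<and> (\<forall>i\<in>idx ?N. \<forall>j\<in>idx ?N. i \<le> j \<longrightarrow> h (Lgen i j) = l i j)"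
    show "h = g"
      by (rule ext, rule uq_hom_unique) (use g h in simp_all)
  qed
qed

section \<open>Comultiplication, counit and antipode\<close>

subsection \<open>Calculus of matrices over a superalgebra\<close>

lemma cqlinear_entry: "cqlinear (\<lambda>m. entry m i j)"
  by (rule cqlinearI) (simp_all add: plus_mat.rep_eq scl_mat.rep_eq scl_cq_def)

lemma munit_mult: "munit i j * munit k l = (if j = k then munit i l else 0)"
proof (rule mat_eqI)
  fix a b
  have "entry (munit i j * munit k l) a b = (\<Sum>c\<in>{j}. entry (munit i j) a c * entry (munit k l) c b)"
    by (rule entry_mult) (auto simp: munit.rep_eq split: if_splits)
  then show "entry (munit i j * munit k l) a b = entry (if j = k then munit i l else 0) a b"
    by (auto simp: munit.rep_eq zero_mat.rep_eq)
qed

lemma idm_munit [simp]: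
  assumes "i \<in> idx N"
  shows "idm N * munit i j = munit i j" "munit j i * idm N = munit j i"
  using assms by (simp_all add: idm_def sum_distrib_left sum_distrib_right munit_mult if_distrib
      sum.delta' cong: if_cong)

lemma idm_idm [simp]: "idm N * idm N = idm N"
  by (subst (2) idm_def, simp add: sum_distrib_left) (simp add: idm_def)

lemma homog_munit_sum: "homog p (munit i j) \<longleftrightarrow> p = parity i + parity j"
proof
  assume "homog p (munit i j)"
  then have "entry (hpart p (munit i j)) i j = 1"
    by (simp add: homog_def munit.rep_eq)
  then show "p = parity i + parity j"
    by (auto simp: hpart_mat.rep_eq split: if_splits)
qed (simp add: homog_munit)

text \<open>The sign of the comultiplication formula. The same sign governs products of matrices
  over a superalgebra, where \<open>munit i k\<close> has to pass an entry with indices k and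
  j.\<close>

definition csign :: "int \<Rightarrow> int \<Rightarrow> int \<Rightarrow> cq" where
  "csign i k j = sgnp ((parity i + parity k) * (parity k + parity j))"

lemma csign_simps [simp]: "csign i i j = 1" "csign i j j = 1"
  by (simp_all add: csign_def)

text \<open>Compares the two groupings of a triple product; on generators this is
  coassociativity.\<close>

lemma csign_cocycle: "csign i k j * csign i l k = csign i l j * csign l k j"
  unfolding csign_def
  by (cases "parity i"; cases "parity j"; cases "parity k"; cases "parity l") simp_all

definition graded :: "(int \<Rightarrow> int \<Rightarrow> 'b::superspace) \<Rightarrow> bool" where
  "graded x \<longleftrightarrow> (\<forall>i j. homog (parity i + parity j) (x i j))"

lemma gradedD: "graded x \<Longrightarrow> homog (parity i + parity j) (x i j)"
  by (simp add: graded_def)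

lemma sum_if_const: "(\<Sum>j\<in>A. if P then f j else 0) = (if P then \<Sum>j\<in>A. f j else 0)"
  by simp

lemma double_sum_mult:
  fixes f g :: "_ \<Rightarrow> _ \<Rightarrow> 'b::superalgebra"
  shows "(\<Sum>i\<in>A. \<Sum>k\<in>B. f i k) * (\<Sum>l\<in>C. \<Sum>j\<in>D. g l j) = (\<Sum>i\<in>A. \<Sum>k\<in>B. \<Sum>l\<in>C. \<Sum>j\<in>D. f i k * g l j)"
    and "(\<Sum>l\<in>C. \<Sum>j\<in>D. g l j) * (\<Sum>i\<in>A. \<Sum>k\<in>B. f i k) = (\<Sum>i\<in>A. \<Sum>k\<in>B. \<Sum>l\<in>C. \<Sum>j\<in>D. g l j * f i k)"
  by (simp only: sum_distrib_right, simp only: sum_distrib_left)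
     (simp only: sum_distrib_left, simp only: sum_distrib_right)

lemma smat_mult:
  fixes x y :: "int \<Rightarrow> int \<Rightarrow> 'b::superalgebra"
  assumes "graded x" "graded y"
  shows "smat N x * smat N y = smat N (\<lambda>i j. \<Sum>k\<in>idx N. csign i k j \<cdot> (x i k * y k j))"
proof -
  have *: "(x i k \<otimes> munit i k) * (y l j \<otimes> munit l j)
      = (if k = l then csign i k j \<cdot> ((x i k * y k j) \<otimes> munit i j) else 0)" for i j k l
    using times_tens_homog[OF homog_munit gradedD[OF assms(2)], of "x i k" i k l j "munit l j"]
    by (simp add: munit_mult csign_def)
  have "smat N x * smat N y = (\<Sum>i\<in>idx N. \<Sum>k\<in>idx N. \<Sum>l\<in>idx N. \<Sum>j\<in>idx N.
      if k = l then csign i k j \<cdot> ((x i k * y k j) \<otimes> munit i j) else 0)"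
    by (simp only: smat_def double_sum_mult *)
  also have "\<dots> = (\<Sum>i\<in>idx N. \<Sum>k\<in>idx N. \<Sum>j\<in>idx N. csign i k j \<cdot> ((x i k * y k j) \<otimes> munit i j))"
    by (rule sum.cong[OF refl], rule sum.cong[OF refl]) (simp add: sum_if_const sum.delta')
  also have "\<dots> = smat N (\<lambda>i j. \<Sum>k\<in>idx N. csign i k j \<cdot> (x i k * y k j))"
    unfolding smat_def by (rule sum.cong[OF refl], rule trans[OF sum.swap]) (simp add: tens_sum tens_lin)
  finally show ?thesis .
qed

lemma smat_cong: "(\<And>i j. i \<in> idx N \<Longrightarrow> j \<in> idx N \<Longrightarrow> x i j = y i j) \<Longrightarrow> smat N x = smat N y"
  by (simp add: smat_def)

lemma smat_delta: "smat N (\<lambda>i j. if i = j then e else 0) = e \<otimes> idm N"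
  by (simp add: smat_def idm_def tens_sum if_distribR sum.delta' if_distrib[of "\<lambda>x. x \<otimes> _"] cong: if_cong)

lemma unit_smat:
  assumes "homog 0 e" "\<And>i j. e * x i j = x i j" "\<And>i j. x i j * e = x i j"
  shows "(e \<otimes> idm N) * smat N x = smat N x" "smat N x * (e \<otimes> idm N) = smat N x"
  by (simp_all add: smat_def sum_distrib_left sum_distrib_right times_tens_even homog_idm assms)

section \<open>Slots, supercommuting matrices and products of solutions of the RLL relation\<close>

lemma slot12_mult: "(X \<otimes> idm N) * (Y \<otimes> idm N) = (X * Y) \<otimes> idm N"
  by (simp add: times_tens_even homog_idm)

lemma slots13_mult:
  fixes X Y :: "('b::superalgebra, mat) tensor"
  shows "slots13 N X * slots13 N Y = slots13 N (X * Y)"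
proof (rule tensor_ext_homog[where t = X])
  fix u u' and a :: 'b and m :: mat
  assume am: "homog u a" "homog u' m"
  show "slots13 N (a \<otimes> m) * slots13 N Y = slots13 N (a \<otimes> m * Y)"
  proof (rule tensor_ext_homog[where t = Y])
    fix v v' and b :: 'b and m' :: mat
    assume bm: "homog v b" "homog v' m'"
    show "slots13 N (a \<otimes> m) * slots13 N (b \<otimes> m') = slots13 N (a \<otimes> m * b \<otimes> m')"
      using times_assoc3_homog[OF homog_idm am(2) bm(1) homog_idm, where c' = m']
      by (simp add: slots_tens times_tens_homog[OF am(2) bm(1)] cqlinearD[OF cqlinear_slots13])
  qed (intro cqlinear_compose[OF cqlinear_mult(1)] cqlinear_compose[OF cqlinear_slots13]
      cqlinear_mult cqlinear_slots13)+
qed (intro cqlinear_compose[OF cqlinear_mult(2)] cqlinear_compose[OF cqlinear_slots13]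
      cqlinear_mult cqlinear_slots13)+

lemma slot23_mult:
  fixes e :: "'b::superalgebra"
  assumes "homog 0 e" "e * e = e"
  shows "slot23 e X * slot23 e Y = slot23 e (X * Y)"
proof (rule tensor_ext_homog[where t = X])
  fix u u' and a m :: mat
  assume am: "homog u a" "homog u' m"
  show "slot23 e (a \<otimes> m) * slot23 e Y = slot23 e (a \<otimes> m * Y)"
  proof (rule tensor_ext_homog[where t = Y])
    fix v v' and b m' :: mat
    assume bm: "homog v b" "homog v' m'"
    show "slot23 e (a \<otimes> m) * slot23 e (b \<otimes> m') = slot23 e (a \<otimes> m * b \<otimes> m')"
      using times_assoc3_homog[OF am assms(1) bm(1), of e m']
      by (simp add: slot23_tens times_tens_homog[OF am(2) bm(1)] cqlinearD[OF cqlinear_slot23] assms)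
  qed (intro cqlinear_compose[OF cqlinear_mult(1)] cqlinear_compose[OF cqlinear_slot23]
      cqlinear_mult cqlinear_slot23)+
qed (intro cqlinear_compose[OF cqlinear_mult(2)] cqlinear_compose[OF cqlinear_slot23]
      cqlinear_mult cqlinear_slot23)+

lemma neg_idx [simp]: "- i \<in> idx N \<longleftrightarrow> i \<in> idx N"
  by (auto simp: idx_def)

lemma idm_Smat [simp]:
  "(idm N \<otimes> idm N) * Smat N = Smat N" "Smat N * (idm N \<otimes> idm N) = Smat N"
  unfolding Smat_def
  by (simp_all add: distrib_left distrib_right sum_distrib_left sum_distrib_right scl_mult_left scl_mult_right
      times_tens_even homog_idm)

text \<open>In the first product \<open>munit i j\<close> crosses \<open>y k l\<close>, which leaves
  a sign. In the second \<open>munit k l\<close> crosses both \<open>x i j\<close> and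
  \<open>munit i j\<close>, which have equal parity, so the two signs cancel.\<close>

lemma slot_products:
  fixes x y :: "int \<Rightarrow> int \<Rightarrow> 'b::superalgebra"
  assumes "graded x" "graded y"
  shows "(smat N x \<otimes> idm N) * slots13 N (smat N y) =
      (\<Sum>i\<in>idx N. \<Sum>j\<in>idx N. \<Sum>k\<in>idx N. \<Sum>l\<in>idx N.
        sgnp ((parity i + parity j) * (parity k + parity l)) \<cdot> (((x i j * y k l) \<otimes> munit i j) \<otimes> munit k l))"
    and "slots13 N (smat N y) * (smat N x \<otimes> idm N) =
      (\<Sum>i\<in>idx N. \<Sum>j\<in>idx N. \<Sum>k\<in>idx N. \<Sum>l\<in>idx N. ((y k l * x i j) \<otimes> munit i j) \<otimes> munit k l)"
proof -
  have 12: "smat N x \<otimes> idm N = (\<Sum>i\<in>idx N. \<Sum>j\<in>idx N. (x i j \<otimes> munit i j) \<otimes> idm N)"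
    by (simp add: smat_def tens_sum)
  have 13: "slots13 N (smat N y) = (\<Sum>k\<in>idx N. \<Sum>l\<in>idx N. (y k l \<otimes> idm N) \<otimes> munit k l)"
    by (simp add: smat_def cqlinearD[OF cqlinear_slots13] slots_tens)
  have 1: "((x i j \<otimes> munit i j) \<otimes> idm N) * ((y k l \<otimes> idm N) \<otimes> munit k l) =
      sgnp ((parity i + parity j) * (parity k + parity l)) \<cdot> (((x i j * y k l) \<otimes> munit i j) \<otimes> munit k l)"
    if "j \<in> idx N" "k \<in> idx N" for i j k l
    using times_assoc3_homog[OF homog_munit homog_idm gradedD[OF assms(2)] homog_idm,
        of "x i j" i j N k l N "munit k l"] that by simp
  have 2: "((y k l \<otimes> idm N) \<otimes> munit k l) * ((x i j \<otimes> munit i j) \<otimes> idm N) =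
      ((y k l * x i j) \<otimes> munit i j) \<otimes> munit k l"
    if "i \<in> idx N" "l \<in> idx N" for i j k l
    using times_assoc3_homog[OF homog_idm homog_munit gradedD[OF assms(1)] homog_munit,
        of "y k l" N k l i j i j "idm N"] that by (simp add: scl_one)
  show "(smat N x \<otimes> idm N) * slots13 N (smat N y) =
      (\<Sum>i\<in>idx N. \<Sum>j\<in>idx N. \<Sum>k\<in>idx N. \<Sum>l\<in>idx N.
        sgnp ((parity i + parity j) * (parity k + parity l)) \<cdot> (((x i j * y k l) \<otimes> munit i j) \<otimes> munit k l))"
    unfolding 12 13 double_sum_mult(1) by (intro sum.cong refl 1)
  have "slots13 N (smat N y) * (smat N x \<otimes> idm N) =
    (\<Sum>i\<in>idx N. \<Sum>j\<in>idx N. \<Sum>k\<in>idx N. \<Sum>l\<in>idx N.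
      ((y k l \<otimes> idm N) \<otimes> munit k l) * ((x i j \<otimes> munit i j) \<otimes> idm N))"
    by (simp only: 12 13 double_sum_mult(2))
  also have "\<dots> = (\<Sum>i\<in>idx N. \<Sum>j\<in>idx N. \<Sum>k\<in>idx N. \<Sum>l\<in>idx N. ((y k l * x i j) \<otimes> munit i j) \<otimes> munit k l)"
    by (intro sum.cong refl 2)
  finally show "slots13 N (smat N y) * (smat N x \<otimes> idm N) =
    (\<Sum>i\<in>idx N. \<Sum>j\<in>idx N. \<Sum>k\<in>idx N. \<Sum>l\<in>idx N. ((y k l * x i j) \<otimes> munit i j) \<otimes> munit k l)" .
qed

definition supercommute :: "(int \<Rightarrow> int \<Rightarrow> 'b::superalgebra) \<Rightarrow> (int \<Rightarrow> int \<Rightarrow> 'b) \<Rightarrow> bool" where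
  "supercommute x y \<longleftrightarrow> (\<forall>i j k l.
     y k l * x i j = sgnp ((parity i + parity j) * (parity k + parity l)) \<cdot> (x i j * y k l))"

lemma supercommute_sym:
  assumes "supercommute x y" shows "supercommute y x"
  unfolding supercommute_def
proof (intro allI)
  fix i j k l
  have "y i j * x k l = sgnp ((parity i + parity j) * (parity k + parity l)) \<cdot> (x k l * y i j)"
    using assms by (simp add: supercommute_def mult.commute)
  then show "x k l * y i j = sgnp ((parity i + parity j) * (parity k + parity l)) \<cdot> (y i j * x k l)"
    by (simp add: scl_one)
qed

lemma slot_commute:
  assumes "graded x" "graded y" "supercommute x y"
  shows "slots13 N (smat N y) * (smat N x \<otimes> idm N) = (smat N x \<otimes> idm N) * slots13 N (smat N y)"
  unfolding slot_products[OF assms(1,2)] using assms(3) by (simp add: supercommute_def tens_lin)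

text \<open>By supercommutativity the factors of \<open>x\<close> and \<open>y\<close> sitting in
  different slots commute, so S can be pulled through the two \<open>y\<close> factors and then
  through the two \<open>x\<close> factors. This is the reason why the comultiplication respects the
  defining relation.\<close>

lemma rll_mult:
  fixes x y :: "int \<Rightarrow> int \<Rightarrow> 'b::superalgebra"
  assumes "graded x" "graded y" "supercommute x y" "rll N e (smat N x)" "rll N e (smat N y)"
  shows "rll N e (smat N x * smat N y)"
proof -
  let ?X12 = "smat N x \<otimes> idm N" and ?X13 = "slots13 N (smat N x)"
  let ?Y12 = "smat N y \<otimes> idm N" and ?Y13 = "slots13 N (smat N y)"
  let ?S = "slot23 e (Smat N)"
  have c: "?Y13 * ?X12 = ?X12 * ?Y13" "?X13 * ?Y12 = ?Y12 * ?X13"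
    using slot_commute[OF assms(1-3)] slot_commute[OF assms(2,1) supercommute_sym[OF assms(3)]] by auto
  have "(?X12 * ?Y12) * (?X13 * ?Y13) * ?S = ?X12 * (?X13 * ?Y12) * ?Y13 * ?S"
    by (simp only: c mult.assoc)
  also have "\<dots> = ?X12 * ?X13 * (?Y12 * ?Y13 * ?S)"
    by (simp only: mult.assoc)
  also have "\<dots> = ?X12 * ?X13 * ?S * (?Y13 * ?Y12)"
    using assms(5) by (simp only: rll_def mult.assoc)
  also have "\<dots> = ?S * ?X13 * (?X12 * ?Y13) * ?Y12"
    using assms(4) by (simp only: rll_def mult.assoc)
  also have "\<dots> = ?S * (?X13 * ?Y13) * (?X12 * ?Y12)"
    by (simp only: c[symmetric] mult.assoc)
  finally show ?thesis
    by (simp only: rll_def slot12_mult slots13_mult)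
qed

lemma unit_for_1: "unit_for (1 :: 'b::superalgebra_1) l \<longleftrightarrow> graded l"
  by (simp add: unit_for_def graded_def homog_one)

subsection \<open>Counit and comultiplication\<close>

lemma homog_cq: "homog p (c :: cq) \<longleftrightarrow> p = 0 \<or> c = 0"
  by (auto simp: homog_def hpart_cq_def)

lemma slots13_unit: "slots13 N (e \<otimes> idm N) = slot23 e (idm N \<otimes> idm N)"
  "(e \<otimes> idm N) \<otimes> idm N = slot23 e (idm N \<otimes> idm N)"
  by (simp_all add: slots_tens slot23_tens)

lemma zero_notin_idx [simp]: "0 \<notin> idx N"
  by (simp add: idx_def)

lemma uq_family_counit: "uq_family N (1 :: cq) (\<lambda>i j. if i = j \<and> i \<in> idx N then 1 else 0)"
  (is "uq_family _ _ ?l")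
proof -
  have "smat N ?l = smat N (\<lambda>i j. if i = j then 1 else 0)"
    by (rule smat_cong) auto
  then have "rll N 1 (smat N ?l)"
    by (simp add: smat_delta rll_def slots13_unit slot23_mult homog_one mult.assoc times_tens_even homog_idm)
  then show ?thesis
    by (auto simp: uq_family_def unit_for_1 graded_def homog_cq)
qed

text \<open>The definitions prescribe values \<open>l'\<close> only for i \<le> j, whereas a family
  has to vanish outside the triangle. The two are therefore kept apart and compared only where both
  are meaningful.\<close>

lemma uq_universal_THE:
  fixes e :: "'b::superalgebra"
  assumes "uq_family CARD('N) e l"
    and "\<And>i j. i \<in> idx CARD('N) \<Longrightarrow> j \<in> idx CARD('N) \<Longrightarrow> i \<le> j \<Longrightarrow> l i j = l' i j"
    and f: "f = (THE f :: 'N::finite uq \<Rightarrow> 'b. superalg_hom f \<and> f 1 = e \<and>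
      (\<forall>i\<in>idx CARD('N). \<forall>j\<in>idx CARD('N). i \<le> j \<longrightarrow> f (Lgen i j) = l' i j))"
  shows "superalg_hom f" "f 1 = e" "f (Lgen i j) = l i j"
proof -
  have ex: "\<exists>!f :: 'N uq \<Rightarrow> 'b. superalg_hom f \<and> f 1 = e \<and>
      (\<forall>i\<in>idx CARD('N). \<forall>j\<in>idx CARD('N). i \<le> j \<longrightarrow> f (Lgen i j) = l' i j)"
    using uq_universal[OF assms(1)] by (simp add: assms(2))
  have *: "superalg_hom f \<and> f 1 = e \<and>
      (\<forall>i\<in>idx CARD('N). \<forall>j\<in>idx CARD('N). i \<le> j \<longrightarrow> f (Lgen i j) = l' i j)"
    using theI'[OF ex] unfolding f[symmetric] .
  then show hom: "superalg_hom f" and "f 1 = e"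
    by simp_all
  show "f (Lgen i j) = l i j"
  proof (cases "i \<in> idx CARD('N) \<and> j \<in> idx CARD('N) \<and> i \<le> j")
    case False
    then show ?thesis
      using assms(1) by (simp add: uq_family_def fgen_outside cqlinearD(3)[OF superalg_hom_linear[OF hom]])
  qed (simp add: * assms(2))
qed

lemma superalg_hom_counit: "superalg_hom (counit :: 'N::finite uq \<Rightarrow> cq)"
  and counit_1 [simp]: "counit (1 :: 'N uq) = 1"
  and counit_Lgen: "counit (Lgen i j :: 'N uq) = (if i = j \<and> i \<in> idx CARD('N) then 1 else 0)"
proof -
  note * = uq_universal_THE[OF uq_family_counit _ counit_def]
  show "superalg_hom (counit :: 'N uq \<Rightarrow> cq)"
    by (rule *(1)) auto
  show "counit (1 :: 'N uq) = 1"
    by (rule *(2)) auto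
  show "counit (Lgen i j :: 'N uq) = (if i = j \<and> i \<in> idx CARD('N) then 1 else 0)"
    by (rule *(3)) auto
qed

lemma hpart_tens_one:
  "hpart p (x \<otimes> (1 :: 'b::superalgebra_1)) = hpart p x \<otimes> 1"
  "hpart p ((1 :: 'b::superalgebra_1) \<otimes> x) = 1 \<otimes> hpart p x"
  using bit_exhaust[of p] by (auto simp: hpart_tens)

lemma superalg_hom_tens1: "superalg_hom (\<lambda>x. x \<otimes> (1 :: 'b::superalgebra_1) :: ('a::superalgebra, 'b) tensor)"
  and superalg_hom_1tens: "superalg_hom (\<lambda>y. (1 :: 'b) \<otimes> y :: ('b, 'a) tensor)"
  unfolding superalg_hom_def
  by (simp_all add: cqlinear_tens times_tens_even homog_one hpart_tens_one)

lemma graded_Lgen: "graded (Lgen :: int \<Rightarrow> int \<Rightarrow> 'N::finite uq)"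
  unfolding graded_def abs_uq_fgen[symmetric]
  by (intro allI even_map_homog[OF superalg_hom_even[OF superalg_hom_abs_uq] homog_fgen])

lemma Lgen_inverse:
  assumes "i \<in> idx CARD('N)"
  shows "Lgen i i * Lgen (- i) (- i) = (1 :: 'N::finite uq)"
proof -
  have "fgen i i * fgen (- i) (- i) - 1 \<in> uq_ideal CARD('N)"
    by (rule relator_in_ideal) (use assms in \<open>auto simp: relators_def\<close>)
  then have "abs_uq (fgen i i * fgen (- i) (- i)) = (abs_uq 1 :: 'N uq)"
    unfolding uq.abs_eq_iff uq_rel_def .
  then show ?thesis
    by (simp add: superalg_hom_mult[OF superalg_hom_abs_uq] abs_uq_fgen)
qed

lemma graded_sum: "(\<And>k. k \<in> K \<Longrightarrow> graded (f k)) \<Longrightarrow> graded (\<lambda>i j. \<Sum>k\<in>K. f k i j)"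
  by (simp add: graded_def homog_sum)

lemma graded_mult_entry:
  fixes x y :: "int \<Rightarrow> int \<Rightarrow> 'b::superalgebra"
  assumes "graded x" "graded y"
  shows "graded (\<lambda>i j. csign i k j \<cdot> (x i k * y k j))"
  unfolding graded_def
proof (intro allI)
  fix i j
  show "homog (parity i + parity j) (csign i k j \<cdot> (x i k * y k j))"
    using homog_scl[OF homog_mult[OF gradedD[OF assms(1), of i k] gradedD[OF assms(2), of k j]]]
    by (simp add: add.assoc)
qed

lemma graded_hom: "even_map f \<Longrightarrow> graded x \<Longrightarrow> graded (\<lambda>i j. f (x i j))"
  by (simp add: graded_def even_map_homog)

text \<open>The matrices with entries \<open>Lgen i j \<otimes> 1\<close> and
  \<open>1 \<otimes> Lgen i j\<close> both solve the RLL relation and supercommute with each other;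
  their product is the required matrix.\<close>

lemma uq_family_comult:
  "uq_family CARD('N) 1 (\<lambda>i j. \<Sum>k\<in>idx CARD('N).
     csign i k j \<cdot> (Lgen i k \<otimes> Lgen k j) :: ('N::finite uq, 'N uq) tensor)"
  (is "uq_family ?N _ ?l")
proof -
  let ?x = "\<lambda>i j. Lgen i j \<otimes> 1 :: ('N uq, 'N uq) tensor" and ?y = "\<lambda>i j. 1 \<otimes> Lgen i j :: ('N uq, 'N uq) tensor"
  have gx: "graded ?x"
    by (rule graded_hom[OF superalg_hom_even[OF superalg_hom_tens1] graded_Lgen])
  have gy: "graded ?y"
    by (rule graded_hom[OF superalg_hom_even[OF superalg_hom_1tens] graded_Lgen])
  have rx: "rll ?N 1 (smat ?N ?x)"
    using rll_hom[OF superalg_hom_tens1 rll_uq]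
    by (simp add: tmap_smat cqlinear_tens one_tensor_def)
  have ry: "rll ?N 1 (smat ?N ?y)"
    using rll_hom[OF superalg_hom_1tens rll_uq]
    by (simp add: tmap_smat cqlinear_tens one_tensor_def)
  have c: "supercommute ?x ?y"
    unfolding supercommute_def
  proof (intro allI)
    fix i j k l
    show "?y k l * ?x i j = sgnp ((parity i + parity j) * (parity k + parity l)) \<cdot> (?x i j * ?y k l)"
      using times_tens_homog[OF gradedD[OF graded_Lgen, of k l] gradedD[OF graded_Lgen, of i j],
          of "1 :: 'N uq" "1 :: 'N uq"]
      by (simp add: times_tens_even homog_one mult.commute)
  qed
  have l: "?l = (\<lambda>i j. \<Sum>k\<in>idx ?N. csign i k j \<cdot> (?x i k * ?y k j))"
    by (simp add: times_tens_even homog_one)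
  have "rll ?N 1 (smat ?N ?l)"
    using rll_mult[OF gx gy c rx ry] unfolding smat_mult[OF gx gy] l .
  moreover have "graded ?l"
    unfolding l by (intro graded_sum graded_mult_entry gx gy)
  moreover have "?l i j = 0" if "\<not> (i \<in> idx ?N \<and> j \<in> idx ?N \<and> i \<le> j)" for i j
  proof (rule sum.neutral, rule ballI)
    fix k
    have "(Lgen i k :: 'N uq) = 0 \<or> (Lgen k j :: 'N uq) = 0"
      using that fgen_outside[of i k, where 'N = 'N] fgen_outside[of k j, where 'N = 'N]
      by (meson order_trans)
    then show "csign i k j \<cdot> (Lgen i k \<otimes> Lgen k j) = (0 :: ('N uq, 'N uq) tensor)"
      by auto
  qed
  moreover have "?l i i * ?l (- i) (- i) = 1" if "i \<in> idx ?N" for i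
  proof -
    \<comment> \<open>By triangularity only k = j contributes to a diagonal entry.\<close>
    have d: "?l j j = Lgen j j \<otimes> Lgen j j" if "j \<in> idx ?N" for j
    proof -
      have "csign j k j \<cdot> (Lgen j k \<otimes> Lgen k j :: ('N uq, 'N uq) tensor) = 0" if "k \<noteq> j" for k
        using that fgen_outside[of j k, where 'N = 'N] fgen_outside[of k j, where 'N = 'N] by fastforce
      then have "?l j j = (\<Sum>k\<in>{j}. csign j k j \<cdot> (Lgen j k \<otimes> Lgen k j))"
        by (intro sum.mono_neutral_right) (use that in auto)
      then show ?thesis by (simp add: scl_one)
    qed
    have "homog 0 (Lgen i i :: 'N uq)"
      using gradedD[OF graded_Lgen, of i i] by simp
    then show ?thesis
      using that by (simp add: d times_tens_even Lgen_inverse one_tensor_def)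
  qed
  ultimately show ?thesis
    unfolding uq_family_def unit_for_1 by blast
qed

lemma superalg_hom_comult: "superalg_hom (comult :: 'N::finite uq \<Rightarrow> _)"
  and comult_1 [simp]: "comult (1 :: 'N uq) = 1"
  and comult_Lgen: "comult (Lgen i j :: 'N uq) =
    (\<Sum>k\<in>idx CARD('N). csign i k j \<cdot> (Lgen i k \<otimes> Lgen k j))"
proof -
  note * = uq_universal_THE[OF uq_family_comult _ comult_def]
  show "superalg_hom (comult :: 'N uq \<Rightarrow> _)"
    by (rule *(1); simp add: csign_def)
  show "comult (1 :: 'N uq) = 1"
    by (rule *(2); simp add: csign_def)
  show "comult (Lgen i j :: 'N uq) = (\<Sum>k\<in>idx CARD('N). csign i k j \<cdot> (Lgen i k \<otimes> Lgen k j))"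
    by (rule *(3); simp add: csign_def)
qed

lemmas comult_lin = cqlinearD[OF superalg_hom_linear[OF superalg_hom_comult]]
lemmas counit_lin = cqlinearD[OF superalg_hom_linear[OF superalg_hom_counit]]

text \<open>Both sides are homomorphisms, \<open>assocr\<close> included, so generators decide;
  there the two sums differ only by the signs that \<open>csign_cocycle\<close> compares.\<close>

lemma coassoc: "assocr (tmap comult id (comult u)) = tmap id comult (comult (u :: 'N::finite uq))"
proof (rule uq_hom_unique)
  show "superalg_hom (\<lambda>u :: 'N uq. assocr (tmap comult id (comult u)))"
    by (rule superalg_hom_compose[OF superalg_hom_assocr superalg_hom_compose[OF
          superalg_hom_tmap[OF superalg_hom_comult superalg_hom_id(2)] superalg_hom_comult]])
  show "superalg_hom (\<lambda>u :: 'N uq. tmap id comult (comult u))"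
    by (rule superalg_hom_compose[OF superalg_hom_tmap[OF superalg_hom_id(2) superalg_hom_comult] superalg_hom_comult])
  note lin = superalg_hom_linear[OF superalg_hom_comult]
  note t1 = tmap_tens[OF lin cqlinear_id'] and t2 = tmap_tens[OF cqlinear_id' lin]
  show "assocr (tmap comult id (comult (1 :: 'N uq))) = tmap id comult (comult 1)"
    by (simp only: comult_1 one_tensor_def t1 t2 id_apply assocr_tens)
  fix i j :: int
  let ?I = "idx CARD('N)"
  have "assocr (tmap comult id (comult (Lgen i j :: 'N uq))) =
      (\<Sum>k\<in>?I. \<Sum>l\<in>?I. (csign i k j * csign i l k) \<cdot> (Lgen i l \<otimes> (Lgen l k \<otimes> Lgen k j)))"
    by (simp only: comult_Lgen cqlinearD[OF cqlinear_tmap[OF lin cqlinear_id']] t1 tens_sum tens_lin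
        cqlinearD[OF cqlinear_assocr] assocr_tens id_apply cqs.scale_sum_right cqs.scale_scale)
  also have "\<dots> = (\<Sum>l\<in>?I. \<Sum>k\<in>?I. (csign i k j * csign i l k) \<cdot> (Lgen i l \<otimes> (Lgen l k \<otimes> Lgen k j)))"
    by (rule sum.swap)
  also have "\<dots> = (\<Sum>l\<in>?I. \<Sum>k\<in>?I. (csign i l j * csign l k j) \<cdot> (Lgen i l \<otimes> (Lgen l k \<otimes> Lgen k j)))"
    by (simp only: csign_cocycle)
  also have "\<dots> = tmap id comult (comult (Lgen i j :: 'N uq))"
    by (simp only: comult_Lgen cqlinearD[OF cqlinear_tmap[OF cqlinear_id' lin]] t2 tens_sum tens_lin
        id_apply cqs.scale_sum_right cqs.scale_scale)
  finally show "assocr (tmap comult id (comult (Lgen i j :: 'N uq))) = tmap id comult (comult (Lgen i j))" .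
qed

lemma bilin_counit: "bilin (\<lambda>x y. counit x \<cdot> y)" "bilin (\<lambda>x y. counit y \<cdot> x)"
  for y :: "'N::finite uq"
  by (rule bilinI; simp add: counit_lin scl_add_left scl_add_right scl_cq_def mult.commute)+

lemma counit_homog: "homog u (x :: 'N::finite uq) \<Longrightarrow> counit x = 0 \<or> u = 0"
  using even_map_homog[OF superalg_hom_even[OF superalg_hom_counit]] by (auto simp: homog_cq)

text \<open>Contraction with the counit is a homomorphism because the counit kills odd elements,
  which removes the crossing sign. It then suffices to look at generators, where a single
  intermediate index survives.\<close>

lemma counit_left: "tlift (\<lambda>x y. counit x \<cdot> y) (comult u) = (u :: 'N::finite uq)"
  and counit_right: "tlift (\<lambda>x y. counit y \<cdot> x) (comult u) = (u :: 'N::finite uq)"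
proof -
  note lin = cqlinearD[OF cqlinear_tlift[OF bilin_counit(1)]] cqlinearD[OF cqlinear_tlift[OF bilin_counit(2)]]
  note tt = tlift_tens[OF bilin_counit(1)] tlift_tens[OF bilin_counit(2)]
  have 1: "superalg_hom (tlift (\<lambda>(x::'N uq) (y::'N uq). counit x \<cdot> y))"
  proof (rule superalg_homI_tensor, rule even_mapI_tensor)
    fix p p' and a b :: "'N uq"
    assume "homog p a" "homog p' b"
    then show "homog (p + p') (tlift (\<lambda>x y. counit x \<cdot> y) (a \<otimes> b))"
      using counit_homog[of p a] by (auto simp: tt homog_zero homog_scl)
  next
    fix u u' v v' and a b a' b' :: "'N uq"
    assume "homog v a'"
    then show "sgnp (u' * v) \<cdot> tlift (\<lambda>x y. counit x \<cdot> y) ((a * a') \<otimes> (b * b'))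
        = tlift (\<lambda>x y. counit x \<cdot> y) (a \<otimes> b) * tlift (\<lambda>x y. counit x \<cdot> y) (a' \<otimes> b')"
      using counit_homog[of v a']
      by (auto simp: tt superalg_hom_mult[OF superalg_hom_counit] scl_mult_left scl_mult_right mult.commute scl_one)
  qed (rule cqlinear_tlift[OF bilin_counit(1)])
  have 2: "superalg_hom (tlift (\<lambda>(x::'N uq) (y::'N uq). counit y \<cdot> x))"
  proof (rule superalg_homI_tensor, rule even_mapI_tensor)
    fix p p' and a b :: "'N uq"
    assume "homog p a" "homog p' b"
    then show "homog (p + p') (tlift (\<lambda>x y. counit y \<cdot> x) (a \<otimes> b))"
      using counit_homog[of p' b] by (auto simp: tt homog_zero homog_scl)
  next
    fix u u' v v' and a b a' b' :: "'N uq"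
    assume "homog u' b"
    then show "sgnp (u' * v) \<cdot> tlift (\<lambda>x y. counit y \<cdot> x) ((a * a') \<otimes> (b * b'))
        = tlift (\<lambda>x y. counit y \<cdot> x) (a \<otimes> b) * tlift (\<lambda>x y. counit y \<cdot> x) (a' \<otimes> b')"
      using counit_homog[of u' b]
      by (auto simp: tt superalg_hom_mult[OF superalg_hom_counit] scl_mult_left scl_mult_right mult.commute scl_one)
  qed (rule cqlinear_tlift[OF bilin_counit(2)])
  let ?I = "idx CARD('N)"
  have "tlift (\<lambda>x y. counit x \<cdot> y) (comult (Lgen i j :: 'N uq)) = Lgen i j" if "i \<in> ?I" for i j
  proof -
    have "tlift (\<lambda>x y. counit x \<cdot> y) (comult (Lgen i j :: 'N uq))
        = (\<Sum>k\<in>?I. csign i k j \<cdot> (if i = k \<and> i \<in> ?I then 1 else 0) \<cdot> Lgen k j)"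
      by (simp only: comult_Lgen lin tt counit_Lgen)
    also have "\<dots> = (\<Sum>k\<in>?I. if i = k then Lgen k j else 0)"
      using that by (intro sum.cong) auto
    finally show ?thesis using that by (simp add: sum.delta)
  qed
  then show "tlift (\<lambda>x y. counit x \<cdot> y) (comult u) = u"
    by - (rule uq_hom_unique[OF superalg_hom_compose[OF 1 superalg_hom_comult] superalg_hom_id(1)], simp_all add: one_tensor_def tt)
  have "tlift (\<lambda>x y. counit y \<cdot> x) (comult (Lgen i j :: 'N uq)) = Lgen i j" if "j \<in> ?I" for i j
  proof -
    have "tlift (\<lambda>x y. counit y \<cdot> x) (comult (Lgen i j :: 'N uq))
        = (\<Sum>k\<in>?I. csign i k j \<cdot> (if k = j \<and> k \<in> ?I then 1 else 0) \<cdot> Lgen i k)"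
      by (simp only: comult_Lgen lin tt counit_Lgen)
    also have "\<dots> = (\<Sum>k\<in>?I. if k = j then Lgen i k else 0)"
      using that by (intro sum.cong) auto
    finally show ?thesis using that by (simp add: sum.delta')
  qed
  then show "tlift (\<lambda>x y. counit y \<cdot> x) (comult u) = u"
    by - (rule uq_hom_unique[OF superalg_hom_compose[OF 2 superalg_hom_comult] superalg_hom_id(1)], simp_all add: one_tensor_def tt)
qed

subsection \<open>The opposite superalgebra\<close>

definition op_mult :: "'a::superalgebra \<Rightarrow> 'a \<Rightarrow> 'a" where
  "op_mult x y = (\<Sum>p\<in>{0, 1}. \<Sum>p'\<in>{0, 1}. sgnp (p * p') \<cdot> (hpart p' y * hpart p x))"

lemma bilin_op_mult: "bilin op_mult"
  by (rule bilinI)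
     (simp_all add: op_mult_def hpart_add hpart_scl distrib_left distrib_right scl_add_right
       scl_mult_left scl_mult_right mult.commute add_ac cqs.scale_right_diff_distrib)

lemma op_mult_homog:
  assumes "homog u x" "homog v y"
  shows "op_mult x y = sgnp (u * v) \<cdot> (y * x)"
  using bit_exhaust[of u] bit_exhaust[of v]
  by (auto simp: op_mult_def hpart_homog[OF assms(1)] hpart_homog[OF assms(2)])

lemmas op_mult_lin = bilinD[OF bilin_op_mult]

lemma op_mult_assoc: "op_mult (op_mult x y) z = op_mult x (op_mult y z)"
proof (induction x rule: homog_decomp)
  case (2 u x)
  note x = 2
  show ?case
  proof (induction y rule: homog_decomp)
    case (2 v y)
    note y = 2
    show ?case
    proof (induction z rule: homog_decomp)
      case (2 w z)
      have "op_mult (y * x) z = sgnp ((u + v) * w) \<cdot> (z * (y * x))"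
        using op_mult_homog[OF homog_mult[OF y x] 2] by (simp add: add.commute)
      moreover have "op_mult x (z * y) = sgnp (u * (v + w)) \<cdot> ((z * y) * x)"
        using op_mult_homog[OF x homog_mult[OF 2 y]] by (simp add: add.commute)
      ultimately show ?case
        by (simp add: op_mult_homog[OF x y] op_mult_homog[OF y 2] op_mult_lin sgnp_mult_add mult_ac)
    qed (simp add: op_mult_lin)
  qed (simp add: op_mult_lin)
qed (simp add: op_mult_lin)

lemma homog_op_mult:
  assumes "homog u x" "homog v y"
  shows "homog (u + v) (op_mult x y)"
  using homog_scl[OF homog_mult[OF assms(2,1)]] by (simp add: op_mult_homog[OF assms] add.commute)

text \<open>A copy of the type, because a class instance fixes one multiplication per type. With it
  as target the universal property produces superalgebra antihomomorphisms.\<close>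

typedef 'a sop = "UNIV :: 'a::superalgebra_1 set" morphisms un_sop Sop ..

setup_lifting type_definition_sop

instantiation sop :: (superalgebra_1) superalgebra_1
begin
lift_definition zero_sop :: "'a sop" is 0 .
lift_definition one_sop :: "'a sop" is 1 .
lift_definition plus_sop :: "'a sop \<Rightarrow> 'a sop \<Rightarrow> 'a sop" is "(+)" .
lift_definition minus_sop :: "'a sop \<Rightarrow> 'a sop \<Rightarrow> 'a sop" is "(-)" .
lift_definition uminus_sop :: "'a sop \<Rightarrow> 'a sop" is uminus .
lift_definition times_sop :: "'a sop \<Rightarrow> 'a sop \<Rightarrow> 'a sop" is op_mult .
lift_definition scl_sop :: "cq \<Rightarrow> 'a sop \<Rightarrow> 'a sop" is scl .
lift_definition hpart_sop :: "bit \<Rightarrow> 'a sop \<Rightarrow> 'a sop" is hpart .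
instance
proof
  fix x y z :: "'a sop" and c d :: cq and p p' :: bit
  have one: "op_mult 1 a = a" "op_mult a 1 = a" for a :: 'a
    by (simp_all add: op_mult_def hpart_sum)
  show "x + y + z = x + (y + z)" by transfer (rule add.assoc)
  show "x + y = y + x" by transfer (rule add.commute)
  show "0 + x = x" by transfer simp
  show "- x + x = 0" by transfer simp
  show "x - y = x + - y" by transfer simp
  show "x * y * z = x * (y * z)" by transfer (rule op_mult_assoc)
  show "(x + y) * z = x * z + y * z" by transfer (rule op_mult_lin)
  show "x * (y + z) = x * y + x * z" by transfer (rule op_mult_lin)
  show "1 * x = x" "x * 1 = x" by (transfer, rule one)+
  show "c \<cdot> (x + y) = c \<cdot> x + c \<cdot> y" by transfer (rule scl_add_right)
  show "(c + d) \<cdot> x = c \<cdot> x + d \<cdot> x" by transfer (rule scl_add_left)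
  show "c \<cdot> d \<cdot> x = (c * d) \<cdot> x" by transfer (rule scl_scl)
  show "1 \<cdot> x = x" by transfer (rule scl_one)
  show "(c \<cdot> x) * y = c \<cdot> (x * y)" by transfer (rule op_mult_lin)
  show "x * (c \<cdot> y) = c \<cdot> (x * y)" by transfer (rule op_mult_lin)
  show "hpart p (x + y) = hpart p x + hpart p y" by transfer (rule hpart_add)
  show "hpart p (c \<cdot> x) = c \<cdot> hpart p x" by transfer (rule hpart_scl)
  show "hpart p (hpart p' x) = (if p = p' then hpart p x else 0)" by transfer (rule hpart_hpart)
  show "hpart 0 x + hpart 1 x = x" by transfer (rule hpart_sum)
  show "hpart (p + p') (hpart p x * hpart p' y) = hpart p x * hpart p' y"
    by transfer (rule homog_op_mult[OF homog_hpart homog_hpart, unfolded homog_def])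
qed
end

lemma even_map_Sop: "even_map Sop" and even_map_un_sop: "even_map un_sop"
  by (simp_all add: even_map_def cqlinearI plus_sop.abs_eq scl_sop.abs_eq hpart_sop.abs_eq
      plus_sop.rep_eq scl_sop.rep_eq hpart_sop.rep_eq eq_onp_def)

lemma Sop_mult:
  assumes "homog u x" "homog v y"
  shows "Sop x * Sop y = sgnp (u * v) \<cdot> Sop (y * x)"
  by (simp add: times_sop.abs_eq eq_onp_def op_mult_homog[OF assms]
      cqlinearD[OF even_map_linear[OF even_map_Sop]])

lemma Sop_1: "Sop 1 = 1"
  by (simp add: one_sop_def)

text \<open>The map \<open>h\<close> need not be multiplicative: S has scalar entries, so
  multiplication by it meets \<open>h\<close> only through the element \<open>e\<close> in the
  algebra slot. This is needed for \<open>Sop\<close>, which reverses products.\<close>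

lemma slot23_even_map:
  fixes h :: "'b::superalgebra \<Rightarrow> 'c::superalgebra"
  assumes h: "even_map h" and e: "homog 0 e" "homog 0 e'" "\<And>x. h (e * x) = e' * h x" "\<And>x. h (x * e) = h x * e'"
  shows "tmap (tmap h id) id (slot23 e S * Z) = slot23 e' S * tmap (tmap h id) id Z"
    and "tmap (tmap h id) id (Z * slot23 e S) = tmap (tmap h id) id Z * slot23 e' S"
proof -
  let ?t = "tmap (tmap h id) id :: (('b, mat) tensor, mat) tensor \<Rightarrow> (('c, mat) tensor, mat) tensor"
  note lin = even_map_linear[OF h]
  note tt = tmap_tens[OF lin cqlinear_id'] tmap_tens[OF cqlinear_tmap[OF lin cqlinear_id'] cqlinear_id']
  have tl: "cqlinear ?t"
    by (intro cqlinear_tmap lin cqlinear_id')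
  have l: "cqlinear (\<lambda>S. ?t (slot23 e S * Z))" "cqlinear (\<lambda>S. slot23 e' S * ?t Z)"
    "cqlinear (\<lambda>Z. ?t (slot23 e S * Z))" "cqlinear (\<lambda>Z. slot23 e' S * ?t Z)"
    "cqlinear (\<lambda>S. ?t (Z * slot23 e S))" "cqlinear (\<lambda>S. ?t Z * slot23 e' S)"
    "cqlinear (\<lambda>Z. ?t (Z * slot23 e S))" "cqlinear (\<lambda>Z. ?t Z * slot23 e' S)" for S Z
    by (rule cqlinearI; simp add: cqlinearD[OF tl] cqlinearD[OF cqlinear_slot23] distrib_left distrib_right
        scl_mult_left scl_mult_right)+
  show "?t (slot23 e S * Z) = slot23 e' S * ?t Z"
  proof (rule tensor_ext_homog[where t = S, OF l(1,2)])
    fix u u' and a b :: mat assume ab: "homog u a" "homog u' b"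
    show "?t (slot23 e (a \<otimes> b) * Z) = slot23 e' (a \<otimes> b) * ?t Z"
    proof (rule tensor_ext_homog[where t = Z, OF l(3,4)])
      fix v v' and z :: "('b, mat) tensor" and c :: mat assume c: "homog v' c"
      show "?t (slot23 e (a \<otimes> b) * z \<otimes> c) = slot23 e' (a \<otimes> b) * ?t (z \<otimes> c)"
      proof (rule tensor_ext_homog[where t = z, OF cqlinear_compose[OF l(3) cqlinear_tens(2)]
            cqlinear_compose[OF l(4) cqlinear_tens(2)]])
        fix w w' and x :: 'b and m :: mat assume x: "homog w x" "homog w' m"
        show "?t (slot23 e (a \<otimes> b) * (x \<otimes> m) \<otimes> c) = slot23 e' (a \<otimes> b) * ?t ((x \<otimes> m) \<otimes> c)"
          by (simp only: slot23_tens tt id_apply times_assoc3_homog[OF ab x]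
              times_assoc3_homog[OF ab even_map_homog[OF h x(1)] x(2)] cqlinearD[OF tl] e)
      qed
    qed
  qed
  show "?t (Z * slot23 e S) = ?t Z * slot23 e' S"
  proof (rule tensor_ext_homog[where t = S, OF l(5,6)])
    fix u u' and a b :: mat assume ab: "homog u a" "homog u' b"
    show "?t (Z * slot23 e (a \<otimes> b)) = ?t Z * slot23 e' (a \<otimes> b)"
    proof (rule tensor_ext_homog[where t = Z, OF l(7,8)])
      fix v v' and z :: "('b, mat) tensor" and c :: mat assume c: "homog v' c"
      show "?t (z \<otimes> c * slot23 e (a \<otimes> b)) = ?t (z \<otimes> c) * slot23 e' (a \<otimes> b)"
      proof (rule tensor_ext_homog[where t = z, OF cqlinear_compose[OF l(7) cqlinear_tens(2)]
            cqlinear_compose[OF l(8) cqlinear_tens(2)]])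
        fix w w' and x :: 'b and m :: mat assume x: "homog w x" "homog w' m"
        show "?t ((x \<otimes> m) \<otimes> c * slot23 e (a \<otimes> b)) = ?t ((x \<otimes> m) \<otimes> c) * slot23 e' (a \<otimes> b)"
          by (simp only: slot23_tens tt id_apply times_assoc3_homog[OF x(2) c e(1) ab(1)]
              times_assoc3_homog[OF x(2) c e(2) ab(1)] cqlinearD[OF tl] e)
      qed
    qed
  qed
qed

text \<open>Entrywise inversion turns the defining relation into the one with the two factors
  exchanged, which is the defining relation read in the opposite superalgebra.\<close>

lemma rll_op:
  fixes l l' :: "int \<Rightarrow> int \<Rightarrow> 'b::superalgebra_1"
  assumes g: "graded l" "graded l'" and rll: "rll N 1 (smat N l)"
    and inv: "smat N l * smat N l' = 1 \<otimes> idm N" "smat N l' * smat N l = 1 \<otimes> idm N"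
  shows "rll N 1 (smat N (\<lambda>i j. Sop (l' i j)))"
proof -
  let ?L12 = "smat N l \<otimes> idm N" and ?L13 = "slots13 N (smat N l)"
  let ?K12 = "smat N l' \<otimes> idm N" and ?K13 = "slots13 N (smat N l')"
  let ?S = "slot23 1 (Smat N) :: (('b, mat) tensor, mat) tensor" and ?I = "slot23 1 (idm N \<otimes> idm N) :: (('b, mat) tensor, mat) tensor"
  let ?O12 = "smat N (\<lambda>i j. Sop (l' i j)) \<otimes> idm N" and ?O13 = "slots13 N (smat N (\<lambda>i j. Sop (l' i j)))"
  have i: "?L12 * ?K12 = ?I" "?K12 * ?L12 = ?I" "?L13 * ?K13 = ?I" "?K13 * ?L13 = ?I"
    by (simp_all add: slot12_mult slots13_mult inv slots13_unit)
  have IS: "?I * ?S = ?S" "?S * ?I = ?S"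
    by (simp_all add: slot23_mult homog_one)
  have IL: "?I * ?L13 = ?L13" "?I * ?K13 = ?K13"
    by (simp_all add: slots13_mult unit_smat homog_one flip: slots13_unit(1))
  \<comment> \<open>The RLL relation is multiplied by the inverse of \<open>?L12 * ?L13\<close> on
    the left and by the inverse of \<open>?L13 * ?L12\<close> on the right; inverting a product
    reverses the order of its slots.\<close>
  have eq: "?S * (?K12 * ?K13) = (?K13 * ?K12) * ?S"
  proof -
    have "(?K13 * ?K12) * (?L12 * ?L13 * ?S) = ?K13 * (?K12 * ?L12) * ?L13 * ?S"
      by (simp only: mult.assoc)
    also have "\<dots> = ?S"
      by (simp only: i mult.assoc) (simp only: mult.assoc[symmetric] IL i IS)
    finally have S: "?S = (?K13 * ?K12) * (?S * ?L13 * ?L12)"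
      using rll by (simp only: rll_def)
    have "?S * (?K12 * ?K13) = (?K13 * ?K12) * (?S * ?L13 * ?L12) * (?K12 * ?K13)"
      using S by simp
    also have "\<dots> = (?K13 * ?K12) * ?S * (?L13 * ((?L12 * ?K12) * ?K13))"
      by (simp only: mult.assoc)
    also have "\<dots> = (?K13 * ?K12) * (?S * ?I)"
      by (simp only: i IL mult.assoc)
    finally show ?thesis by (simp only: IS)
  qed
  let ?t = "tmap (tmap Sop id) id :: (('b, mat) tensor, mat) tensor \<Rightarrow> (('b sop, mat) tensor, mat) tensor"
  note lin = even_map_linear[OF even_map_Sop]
  note tt = tmap_tens[OF lin cqlinear_id'] tmap_tens[OF cqlinear_tmap[OF lin cqlinear_id'] cqlinear_id']
  have tl: "cqlinear ?t"
    by (intro cqlinear_tmap lin cqlinear_id')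
  note go = graded_hom[OF even_map_Sop g(2)]
  have mult: "Sop (l' i j) * Sop (l' k m) = sgnp ((parity i + parity j) * (parity k + parity m)) \<cdot> Sop (l' k m * l' i j)"
    for i j k m
    by (rule Sop_mult[OF gradedD[OF g(2)] gradedD[OF g(2)]])
  have mult': "Sop (l' k m) * Sop (l' i j) = sgnp ((parity i + parity j) * (parity k + parity m)) \<cdot> Sop (l' i j * l' k m)"
    for i j k m
    using mult[of k m i j] by (simp add: mult.commute)
  \<comment> \<open>The two slot orders in \<open>slot_products\<close> differ by exactly the sign
    in the opposite product, so passing to the opposite superalgebra exchanges them.\<close>
  have o1: "?O12 * ?O13 = ?t (?K13 * ?K12)"
    unfolding slot_products[OF go go] slot_products[OF g(2) g(2)]
    by (simp only: cqlinearD[OF tl] tt id_apply mult tens_lin cqs.scale_scale sgnp_square scl_one)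
  have o2: "?O13 * ?O12 = ?t (?K12 * ?K13)"
    unfolding slot_products[OF go go] slot_products[OF g(2) g(2)]
    by (simp only: cqlinearD[OF tl] tt id_apply mult' tens_lin)
  have h: "homog 0 (1 :: 'b sop)" "Sop (1 * x) = 1 * Sop x" "Sop (x * 1) = Sop x * 1" for x :: 'b
    by (simp_all add: homog_one)
  note s = slot23_even_map[OF even_map_Sop homog_one h(1) h(2,3)]
  have "?O12 * ?O13 * slot23 1 (Smat N) = ?t ((?K13 * ?K12) * ?S)"
    by (simp only: o1 s)
  also have "\<dots> = slot23 1 (Smat N) * (?O13 * ?O12)"
    by (simp only: o2 s flip: eq)
  finally show ?thesis
    by (simp only: rll_def mult.assoc)
qed

subsection \<open>Inverses of triangular matrices\<close>

text \<open>Back substitution: the entry (i, j) of the equation saying that \<open>l\<close> times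
  the unknown matrix is the identity is solved for the unknown entry (i, j), with \<open>d i\<close>
  the inverse of \<open>l i i\<close>. Only rows k with i < k \<le> j are consulted, so j - i
  decreases.\<close>

function tri_inv :: "nat \<Rightarrow> (int \<Rightarrow> int \<Rightarrow> 'b::superalgebra_1) \<Rightarrow> (int \<Rightarrow> 'b) \<Rightarrow> int \<Rightarrow> int \<Rightarrow> 'b" where
  "tri_inv N l d i j = (if i = j then d i
     else - (d i * (\<Sum>k\<in>{k\<in>idx N. i < k \<and> k \<le> j}. csign i k j \<cdot> (l i k * tri_inv N l d k j))))"
  by pat_completeness auto
termination
  by (relation "measure (\<lambda>(N, l, d, i, j). nat (j - i))") auto

declare tri_inv.simps [simp del]

definition upper :: "nat \<Rightarrow> (int \<Rightarrow> int \<Rightarrow> 'b::zero) \<Rightarrow> bool" where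
  "upper N l \<longleftrightarrow> (\<forall>i j. \<not> (i \<in> idx N \<and> j \<in> idx N \<and> i \<le> j) \<longrightarrow> l i j = 0)"

lemma upperD: "upper N l \<Longrightarrow> \<not> (i \<in> idx N \<and> j \<in> idx N \<and> i \<le> j) \<Longrightarrow> l i j = 0"
  unfolding upper_def by blast

lemma homog_tri_inv:
  assumes "graded l" "\<And>i. homog 0 (d i)"
  shows "homog (parity i + parity j) (tri_inv N l d i j)"
  using assms
proof (induction N l d i j rule: tri_inv.induct)
  case (1 N l d i j)
  show ?case
  proof (cases "i = j")
    case True
    with 1(3)[of j] show ?thesis by (simp add: tri_inv.simps)
  next
    case False
    have "homog (parity i + parity j) (l i k * tri_inv N l d k j)" if "k \<in> idx N" "i < k" "k \<le> j" for k
      using homog_mult[OF gradedD[OF 1(2), of i k] 1(1)[OF False _ 1(2,3), of k]] that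
      by (simp add: add.assoc)
    then have "homog (0 + (parity i + parity j))
        (d i * (\<Sum>k\<in>{k\<in>idx N. i < k \<and> k \<le> j}. csign i k j \<cdot> (l i k * tri_inv N l d k j)))"
      by (intro homog_mult[OF 1(3)] homog_sum homog_scl) simp
    then have "homog (parity i + parity j)
        (- 1 \<cdot> (d i * (\<Sum>k\<in>{k\<in>idx N. i < k \<and> k \<le> j}. csign i k j \<cdot> (l i k * tri_inv N l d k j))))"
      by (intro homog_scl) simp
    with False show ?thesis
      by (subst tri_inv.simps) simp
  qed
qed

lemma tri_right_inverse:
  fixes l :: "int \<Rightarrow> int \<Rightarrow> 'b::superalgebra_1"
  assumes "graded l" "upper N l" "\<And>i. homog 0 (d i)" "\<And>i. i \<in> idx N \<Longrightarrow> l i i * d i = 1"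
  shows "\<exists>r. graded r \<and> upper N r \<and> (\<forall>i\<in>idx N. r i i = d i) \<and> smat N l * smat N r = 1 \<otimes> idm N"
proof -
  define r where "r i j = (if i \<in> idx N \<and> j \<in> idx N \<and> i \<le> j then tri_inv N l d i j else 0)" for i j
  have g: "graded r"
    unfolding graded_def r_def using homog_tri_inv[OF assms(1,3)] by (auto simp: homog_zero)
  have up: "upper N r"
    unfolding upper_def r_def by auto
  have d: "r i i = d i" if "i \<in> idx N" for i
    using that by (simp add: r_def tri_inv.simps)
  have "(\<Sum>k\<in>idx N. csign i k j \<cdot> (l i k * r k j)) = (if i = j then 1 else 0)"
    if ij: "i \<in> idx N" "j \<in> idx N" for i j
  proof (cases "i < j")
    case False
    have z: "csign i k j \<cdot> (l i k * r k j) = 0" if "k \<noteq> i \<or> i \<noteq> j" for k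
    proof -
      have "l i k = 0 \<or> r k j = 0"
        using that False upperD[OF assms(2), of i k] upperD[OF up, of k j] by fastforce
      then show ?thesis by auto
    qed
    show ?thesis
    proof (cases "i = j")
      case True
      have "(\<Sum>k\<in>idx N. csign i k j \<cdot> (l i k * r k j)) = (\<Sum>k\<in>{i}. csign i k j \<cdot> (l i k * r k j))"
        by (rule sum.mono_neutral_right) (use ij z in auto)
      then show ?thesis
        using ij True by (simp add: d assms(4))
    qed (simp add: z)
  next
    case True
    let ?K = "{k\<in>idx N. i < k \<and> k \<le> j}"
    have K: "csign i k j \<cdot> (l i k * r k j) = 0" if "k \<in> idx N - insert i ?K" for k
    proof -
      have "l i k = 0 \<or> r k j = 0"
        using that upperD[OF assms(2), of i k] upperD[OF up, of k j] by fastforce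
      then show ?thesis by auto
    qed
    \<comment> \<open>Only k = i and i < k \<le> j contribute, and the recursion for
      \<open>tri_inv\<close> was set up so that the term for k = i cancels the others.\<close>
    have "(\<Sum>k\<in>idx N. csign i k j \<cdot> (l i k * r k j)) = (\<Sum>k\<in>insert i ?K. csign i k j \<cdot> (l i k * r k j))"
      by (rule sum.mono_neutral_right) (use ij K in auto)
    also have "\<dots> = l i i * r i j + (\<Sum>k\<in>?K. csign i k j \<cdot> (l i k * r k j))"
      by (simp add: )
    also have "r i j = - (d i * (\<Sum>k\<in>?K. csign i k j \<cdot> (l i k * tri_inv N l d k j)))"
      using True ij by (simp add: r_def) (subst tri_inv.simps, simp)
    also have "(\<Sum>k\<in>?K. csign i k j \<cdot> (l i k * tri_inv N l d k j)) = (\<Sum>k\<in>?K. csign i k j \<cdot> (l i k * r k j))"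
      using ij by (intro sum.cong refl) (simp add: r_def)
    finally show ?thesis
      using True assms(4)[OF ij(1)] by (simp flip: mult.assoc)
  qed
  then have "smat N l * smat N r = smat N (\<lambda>i j. if i = j then 1 else 0)"
    unfolding smat_mult[OF assms(1) g] by (intro smat_cong)
  with g up d show ?thesis
    by (auto simp: smat_delta)
qed

text \<open>The right inverse is again triangular with invertible diagonal, hence has a right
  inverse of its own; associativity identifies the latter with the original matrix.\<close>

lemma tri_inverse:
  fixes l :: "int \<Rightarrow> int \<Rightarrow> 'b::superalgebra_1"
  assumes "graded l" "upper N l" "\<And>i. homog 0 (d i)"
    "\<And>i. i \<in> idx N \<Longrightarrow> l i i * d i = 1" "\<And>i. i \<in> idx N \<Longrightarrow> d i * l i i = 1"
  shows "\<exists>r. graded r \<and> upper N r \<and> (\<forall>i\<in>idx N. r i i = d i) \<and>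
    smat N l * smat N r = 1 \<otimes> idm N \<and> smat N r * smat N l = 1 \<otimes> idm N"
proof -
  obtain r where r: "graded r" "upper N r" "\<forall>i\<in>idx N. r i i = d i" "smat N l * smat N r = 1 \<otimes> idm N"
    using tri_right_inverse[OF assms(1-4)] by blast
  have h: "homog 0 (l i i)" for i
    using gradedD[OF assms(1), of i i] by simp
  obtain r' where r': "smat N r * smat N r' = 1 \<otimes> idm N"
    using tri_right_inverse[OF r(1,2), of "\<lambda>i. l i i"] r(3) assms(5) h by auto
  have "smat N l = smat N l * (smat N r * smat N r')"
    by (simp add: r' unit_smat homog_one)
  also have "\<dots> = smat N r'"
    by (simp only: mult.assoc[symmetric] r(4)) (simp add: unit_smat homog_one)
  finally have "smat N r * smat N l = 1 \<otimes> idm N"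
    using r' by simp
  with r show ?thesis by blast
qed

subsection \<open>The antipode\<close>

lemma ecoef_smat:
  assumes "i \<in> idx N" "j \<in> idx N"
  shows "ecoef i j (smat N z) = z i j"
proof -
  have "ecoef i j (smat N z) = (\<Sum>a\<in>idx N. \<Sum>b\<in>idx N. (if i = a \<and> j = b then 1 else 0) \<cdot> z a b)"
    by (simp only: smat_def cqlinearD[OF cqlinear_ecoef] slots_tens munit.rep_eq)
  also have "\<dots> = (\<Sum>a\<in>idx N. if i = a then (\<Sum>b\<in>idx N. if j = b then z a b else 0) else 0)"
    by (rule sum.cong[OF refl]) (simp add: if_distrib[of "\<lambda>c. c \<cdot> _"] cong: if_cong)
  finally show ?thesis
    using assms by (simp add: sum.delta)
qed

lemma smat_entry: "smat N x = smat N y \<Longrightarrow> i \<in> idx N \<Longrightarrow> j \<in> idx N \<Longrightarrow> x i j = y i j"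
  by (metis ecoef_smat)

text \<open>\<open>Linv i j\<close> is the image of \<open>Lgen i j\<close> under the antipode.\<close>

definition Linv :: "int \<Rightarrow> int \<Rightarrow> 'N::finite uq" where
  "Linv = (SOME r. graded r \<and> upper CARD('N) r \<and> (\<forall>i\<in>idx CARD('N). r i i = Lgen (- i) (- i)) \<and>
     smat CARD('N) Lgen * smat CARD('N) r = 1 \<otimes> idm CARD('N) \<and>
     smat CARD('N) r * smat CARD('N) Lgen = 1 \<otimes> idm CARD('N))"

lemma graded_Linv: "graded (Linv :: int \<Rightarrow> int \<Rightarrow> 'N::finite uq)"
    and upper_Linv: "upper CARD('N) (Linv :: int \<Rightarrow> int \<Rightarrow> 'N uq)"
    and diag_Linv: "i \<in> idx CARD('N) \<Longrightarrow> (Linv i i :: 'N uq) = Lgen (- i) (- i)"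
    and uqL_Linv: "uqL * smat CARD('N) Linv = (1 :: 'N uq) \<otimes> idm CARD('N)"
    and Linv_uqL: "smat CARD('N) Linv * uqL = (1 :: 'N uq) \<otimes> idm CARD('N)"
proof -
  have 1: "homog 0 (Lgen (- i) (- i) :: 'N uq)" for i
    using gradedD[OF graded_Lgen, of "- i" "- i"] by simp
  have 2: "Lgen (- i) (- i) * Lgen i i = (1 :: 'N uq)" if "i \<in> idx CARD('N)" for i
    using Lgen_inverse[of "- i"] that by simp
  have "\<exists>r :: int \<Rightarrow> int \<Rightarrow> 'N uq. graded r \<and> upper CARD('N) r \<and> (\<forall>i\<in>idx CARD('N). r i i = Lgen (- i) (- i)) \<and>
     smat CARD('N) Lgen * smat CARD('N) r = 1 \<otimes> idm CARD('N) \<and>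
     smat CARD('N) r * smat CARD('N) Lgen = 1 \<otimes> idm CARD('N)"
    by (intro tri_inverse graded_Lgen 1) (auto simp: upper_def fgen_outside Lgen_inverse 2)
  from someI_ex[OF this, folded Linv_def]
  show "graded (Linv :: int \<Rightarrow> int \<Rightarrow> 'N uq)" "upper CARD('N) (Linv :: int \<Rightarrow> int \<Rightarrow> 'N uq)"
    "i \<in> idx CARD('N) \<Longrightarrow> (Linv i i :: 'N uq) = Lgen (- i) (- i)"
    "uqL * smat CARD('N) Linv = (1 :: 'N uq) \<otimes> idm CARD('N)"
    "smat CARD('N) Linv * uqL = (1 :: 'N uq) \<otimes> idm CARD('N)"
    by simp_all
qed

lemma Linv_sums:
  assumes "i \<in> idx CARD('N)" "j \<in> idx CARD('N)"
  shows "(\<Sum>k\<in>idx CARD('N). csign i k j \<cdot> (Lgen i k * Linv k j)) = (if i = j then 1 else (0 :: 'N::finite uq))"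
    and "(\<Sum>k\<in>idx CARD('N). csign i k j \<cdot> (Linv i k * Lgen k j)) = (if i = j then 1 else (0 :: 'N::finite uq))"
  using smat_entry[OF trans[OF trans[OF smat_mult[OF graded_Lgen graded_Linv, symmetric] uqL_Linv] smat_delta[symmetric]] assms]
    smat_entry[OF trans[OF trans[OF smat_mult[OF graded_Linv graded_Lgen, symmetric] Linv_uqL] smat_delta[symmetric]] assms]
  by auto

lemma uq_family_antipode: "uq_family CARD('N) 1 (\<lambda>i j. Sop (Linv i j :: 'N::finite uq))"
proof -
  note lin = cqlinearD[OF even_map_linear[OF even_map_Sop]]
  have "Sop (Linv i i) * Sop (Linv (- i) (- i)) = (1 :: 'N uq sop)" if "i \<in> idx CARD('N)" for i
  proof -
    have "homog 0 (Linv i i :: 'N uq)" "homog 0 (Linv (- i) (- i) :: 'N uq)"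
      using gradedD[OF graded_Linv, of i i] gradedD[OF graded_Linv, of "- i" "- i"] by simp_all
    from Sop_mult[OF this] that show ?thesis
      by (simp add: diag_Linv Lgen_inverse Sop_1)
  qed
  moreover have "rll CARD('N) 1 (smat CARD('N) (\<lambda>i j. Sop (Linv i j :: 'N uq)))"
    by (rule rll_op[OF graded_Lgen graded_Linv rll_uq uqL_Linv Linv_uqL])
  moreover have "graded (\<lambda>i j. Sop (Linv i j :: 'N uq))"
    by (rule graded_hom[OF even_map_Sop graded_Linv])
  ultimately show ?thesis
    by (auto simp: uq_family_def unit_for_1 upperD[OF upper_Linv] lin)
qed

text \<open>A concrete candidate for the antipode, which is itself defined by the convolution
  property; the two are identified once \<open>anti\<close> is known to have that property. Reading
  the value back through \<open>un_sop\<close> turns a homomorphism into an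
  antihomomorphism.\<close>

definition anti :: "'N::finite uq \<Rightarrow> 'N uq" where
  "anti u = un_sop ((THE f. superalg_hom f \<and> f 1 = 1 \<and>
      (\<forall>i\<in>idx CARD('N). \<forall>j\<in>idx CARD('N). i \<le> j \<longrightarrow> f (Lgen i j) = Sop (Linv i j))) u)"

lemma even_map_anti: "even_map (anti :: 'N::finite uq \<Rightarrow> 'N uq)"
  and anti_1: "anti (1 :: 'N uq) = 1"
  and anti_Lgen: "anti (Lgen i j :: 'N uq) = Linv i j"
  and anti_mult: "homog p u \<Longrightarrow> homog p' v \<Longrightarrow> anti (u * v :: 'N uq) = sgnp (p * p') \<cdot> (anti v * anti u)"
proof -
  define f :: "'N uq \<Rightarrow> 'N uq sop" where "f = (THE f. superalg_hom f \<and> f 1 = 1 \<and>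
      (\<forall>i\<in>idx CARD('N). \<forall>j\<in>idx CARD('N). i \<le> j \<longrightarrow> f (Lgen i j) = Sop (Linv i j)))"
  note * = uq_universal_THE[OF uq_family_antipode refl f_def]
  have a: "anti = (\<lambda>u. un_sop (f u))"
    by (rule ext) (simp add: anti_def f_def)
  show "even_map (anti :: 'N uq \<Rightarrow> 'N uq)"
    unfolding a by (intro even_map_compose[OF even_map_un_sop] superalg_hom_even *)
  show "anti (1 :: 'N uq) = 1"
    by (simp add: a *(2) one_sop.rep_eq)
  show "anti (Lgen i j :: 'N uq) = Linv i j"
    by (simp add: a *(3) Sop_inverse)
  show "anti (u * v) = sgnp (p * p') \<cdot> (anti v * anti u)" if "homog p u" "homog p' v" for u v :: "'N uq" and p p'
    using op_mult_homog[OF even_map_homog[OF even_map_compose[OF even_map_un_sop superalg_hom_even[OF *(1)]] that(1)]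
        even_map_homog[OF even_map_compose[OF even_map_un_sop superalg_hom_even[OF *(1)]] that(2)]]
    by (simp add: a superalg_hom_mult[OF *(1)] times_sop.rep_eq)
qed

lemmas anti_lin = cqlinearD[OF even_map_linear[OF even_map_anti]]

lemma bilin_anti: "bilin (\<lambda>x y. anti x * y)" "bilin (\<lambda>x y. x * anti y)"
  by (rule bilinI; simp add: anti_lin distrib_left distrib_right scl_mult_left scl_mult_right)+

text \<open>Since \<open>anti\<close> reverses products, a generator split off on the left
  contributes \<open>Linv i k * Lgen k j\<close> in the middle, between \<open>anti x\<close> and
  \<open>y\<close>, and the sum over k collapses. The inner claim is made for every tensor
  \<open>z\<close>, not only for coproducts, so that it can be checked on elementary
  tensors.\<close>

lemma anti_left: "tlift (\<lambda>x y. anti x * y) (comult u) = counit u \<cdot> (1 :: 'N::finite uq)"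
proof (induction u rule: uq_induct)
  note lin = cqlinearD[OF cqlinear_tlift[OF bilin_anti(1)]] and tt = tlift_tens[OF bilin_anti(1)]
  let ?I = "idx CARD('N)" and ?P = "tlift (\<lambda>(x :: 'N uq) y. anti x * y)"
  case (gen i j u)
  have "?P (comult (Lgen i j) * z) = (if i = j then 1 else 0) \<cdot> ?P z" for z
  proof (rule tensor_ext_homog[where t = z and f = "\<lambda>z. ?P (comult (Lgen i j) * z)"])
    show "cqlinear (\<lambda>z. ?P (comult (Lgen i j) * z))"
      by (rule cqlinear_compose[OF cqlinear_tlift[OF bilin_anti(1)] cqlinear_mult(1)])
    show "cqlinear (\<lambda>z. (if i = j then 1 else 0) \<cdot> ?P z)"
      by (rule cqlinear_scl[OF cqlinear_tlift[OF bilin_anti(1)]])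
    fix p p' and x y :: "'N uq" assume x: "homog p x"
    have "csign i k j \<cdot> ?P ((Lgen i k \<otimes> Lgen k j) * x \<otimes> y)
        = sgnp ((parity i + parity j) * p) \<cdot> (anti x * (csign i k j \<cdot> (Linv i k * Lgen k j)) * y)" for k
      using times_tens_homog[OF gradedD[OF graded_Lgen, of k j] x, of "Lgen i k" y]
        anti_mult[OF gradedD[OF graded_Lgen, of i k] x] sgnp_mult_add(2)[of "parity k + parity j" "parity i + parity k" p]
      by (simp add: lin tt anti_Lgen scl_mult_left scl_mult_right mult_ac add_ac)
    then have "?P (comult (Lgen i j) * x \<otimes> y)
        = sgnp ((parity i + parity j) * p) \<cdot> (anti x * (\<Sum>k\<in>?I. csign i k j \<cdot> (Linv i k * Lgen k j)) * y)"
      by (simp only: comult_Lgen sum_distrib_right sum_distrib_left lin scl_mult_left cqs.scale_sum_right)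
    also have "\<dots> = (if i = j then 1 else 0) \<cdot> ?P (x \<otimes> y)"
      using Linv_sums(2)[OF gen(1,2)] by (simp add: tt)
    finally show "?P (comult (Lgen i j) * x \<otimes> y) = (if i = j then 1 else 0) \<cdot> ?P (x \<otimes> y)" .
  qed
  then show ?case
    using gen by (simp add: superalg_hom_mult[OF superalg_hom_comult] superalg_hom_mult[OF superalg_hom_counit] counit_Lgen)
next
  case one
  show ?case by (simp add: one_tensor_def tlift_tens[OF bilin_anti(1)] anti_1)
qed (simp_all add: cqlinearD[OF cqlinear_tlift[OF bilin_anti(1)]] comult_lin counit_lin scl_add_left scl_cq_def)

text \<open>Here the generator has to be split off on the right for
  \<open>Lgen i k * Linv k j\<close> to meet in the middle, between \<open>x\<close> and
  \<open>anti y\<close>.\<close>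

lemma anti_right: "tlift (\<lambda>x y. x * anti y) (comult u) = counit u \<cdot> (1 :: 'N::finite uq)"
proof (induction u rule: uq_induct_right)
  note lin = cqlinearD[OF cqlinear_tlift[OF bilin_anti(2)]] and tt = tlift_tens[OF bilin_anti(2)]
  let ?I = "idx CARD('N)" and ?P = "tlift (\<lambda>(x :: 'N uq) y. x * anti y)"
  case (gen i j u)
  have "?P (z * comult (Lgen i j)) = (if i = j then 1 else 0) \<cdot> ?P z" for z
  proof (rule tensor_ext_homog[where t = z and f = "\<lambda>z. ?P (z * comult (Lgen i j))"])
    show "cqlinear (\<lambda>z. ?P (z * comult (Lgen i j)))"
      by (rule cqlinear_compose[OF cqlinear_tlift[OF bilin_anti(2)] cqlinear_mult(2)])
    show "cqlinear (\<lambda>z. (if i = j then 1 else 0) \<cdot> ?P z)"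
      by (rule cqlinear_scl[OF cqlinear_tlift[OF bilin_anti(2)]])
    fix p p' and x y :: "'N uq" assume y: "homog p' y"
    have "csign i k j \<cdot> ?P (x \<otimes> y * (Lgen i k \<otimes> Lgen k j))
        = sgnp (p' * (parity i + parity j)) \<cdot> (x * (csign i k j \<cdot> (Lgen i k * Linv k j)) * anti y)" for k
      using times_tens_homog[OF y gradedD[OF graded_Lgen, of i k], of x "Lgen k j"]
        anti_mult[OF y gradedD[OF graded_Lgen, of k j]] sgnp_mult_add(1)[of p' "parity i + parity k" "parity k + parity j"]
      by (simp add: lin tt anti_Lgen scl_mult_left scl_mult_right mult_ac add_ac)
    then have "?P (x \<otimes> y * comult (Lgen i j))
        = sgnp (p' * (parity i + parity j)) \<cdot> (x * (\<Sum>k\<in>?I. csign i k j \<cdot> (Lgen i k * Linv k j)) * anti y)"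
      by (simp only: comult_Lgen sum_distrib_right sum_distrib_left lin scl_mult_right cqs.scale_sum_right)
    also have "\<dots> = (if i = j then 1 else 0) \<cdot> ?P (x \<otimes> y)"
      using Linv_sums(1)[OF gen(1,2)] by (simp add: tt)
    finally show "?P (x \<otimes> y * comult (Lgen i j)) = (if i = j then 1 else 0) \<cdot> ?P (x \<otimes> y)" .
  qed
  then show ?case
    using gen by (simp add: superalg_hom_mult[OF superalg_hom_comult] superalg_hom_mult[OF superalg_hom_counit] counit_Lgen)
next
  case one
  show ?case by (simp add: one_tensor_def tlift_tens[OF bilin_anti(2)] anti_1)
qed (simp_all add: cqlinearD[OF cqlinear_tlift[OF bilin_anti(2)]] comult_lin counit_lin scl_add_left scl_cq_def)

lemma tmap_id_tens:
  "cqlinear g \<Longrightarrow> tmap id g (a \<otimes> b) = a \<otimes> g b"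
  "cqlinear f \<Longrightarrow> tmap f id (a \<otimes> b) = f a \<otimes> b"
  using tmap_tens[OF cqlinear_id', of g a b] tmap_tens[OF _ cqlinear_id', of f a b] by simp_all

text \<open>Evaluate \<open>A(u\<^sub>1) u\<^sub>2 B(u\<^sub>3)\<close> in two ways.\<close>

lemma convolution_inverse_unique:
  fixes A B :: "'N::finite uq \<Rightarrow> 'N uq"
  assumes A: "cqlinear A" "\<And>u. tlift (\<lambda>x y. A x * y) (comult u) = counit u \<cdot> 1"
    and B: "cqlinear B" "\<And>u. tlift (\<lambda>x y. x * B y) (comult u) = counit u \<cdot> 1"
  shows "A u = B u"
proof -
  have bA: "bilin (\<lambda>x y. A x * y)" and bB: "bilin (\<lambda>x y. x * B y)" and b: "bilin (\<lambda>x y. A x * (y * B z))"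
    and b': "bilin (\<lambda>x t. A x * tlift (\<lambda>y z. y * B z) t)" for z
    by (rule bilinI; simp add: cqlinearD[OF A(1)] cqlinearD[OF B(1)] distrib_left distrib_right scl_mult_left scl_mult_right
        cqlinearD[OF cqlinear_tlift[OF bilin_precompose[OF bilin_mult cqlinear_id B(1)]]])+
  define T where "T = tlift (\<lambda>x. \<lambda>t. A x * tlift (\<lambda>y z. y * B z) t)"
  have T: "cqlinear T" "T (x \<otimes> t) = A x * tlift (\<lambda>y z. y * B z) t" for x t
    by (simp_all add: T_def cqlinear_tlift[OF b'] tlift_tens[OF b'])
  have c: "cqlinear (comult :: 'N uq \<Rightarrow> _)"
    by (rule superalg_hom_linear[OF superalg_hom_comult])
  have "T (tmap id comult t) = A (tlift (\<lambda>x y. counit y \<cdot> x) t)" for t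
  proof (rule tensor_ext[where t = t])
    show "cqlinear (\<lambda>t. T (tmap id comult t))"
      by (rule cqlinear_compose[OF T(1) cqlinear_tmap[OF cqlinear_id' c]])
    show "cqlinear (\<lambda>t. A (tlift (\<lambda>x y. counit y \<cdot> x) t))"
      by (rule cqlinear_compose[OF A(1) cqlinear_tlift[OF bilin_counit(2)]])
  qed (simp only: tmap_id_tens(1)[OF c] T(2) B(2) scl_mult_right mult_1_right
      tlift_tens[OF bilin_counit(2)] cqlinearD(2)[OF A(1)])
  then have 1: "T (tmap id comult (comult u)) = A u"
    by (simp add: counit_right)
  have *: "T (assocr (t \<otimes> z)) = tlift (\<lambda>x y. A x * y) t * B z" for t z
  proof (rule tensor_ext[where t = t])
    show "cqlinear (\<lambda>t. T (assocr (t \<otimes> z)))"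
      by (rule cqlinear_compose[OF T(1) cqlinear_compose[OF cqlinear_assocr cqlinear_tens(2)]])
    show "cqlinear (\<lambda>t. tlift (\<lambda>x y. A x * y) t * B z)"
      by (rule cqlinear_compose[OF cqlinear_mult(2) cqlinear_tlift[OF bA]])
  qed (simp add: assocr_tens T(2) tlift_tens[OF bA] tlift_tens[OF bB] mult.assoc)
  have "T (assocr (tmap comult id t)) = B (tlift (\<lambda>x y. counit x \<cdot> y) t)" for t
  proof (rule tensor_ext[where t = t])
    show "cqlinear (\<lambda>t. T (assocr (tmap comult id t)))"
      by (rule cqlinear_compose[OF T(1) cqlinear_compose[OF cqlinear_assocr cqlinear_tmap[OF c cqlinear_id']]])
    show "cqlinear (\<lambda>t. B (tlift (\<lambda>x y. counit x \<cdot> y) t))"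
      by (rule cqlinear_compose[OF B(1) cqlinear_tlift[OF bilin_counit(1)]])
  qed (simp only: tmap_id_tens(2)[OF c] * A(2) scl_mult_left mult_1_left
      tlift_tens[OF bilin_counit(1)] cqlinearD(2)[OF B(1)])
  then have 2: "T (assocr (tmap comult id (comult u))) = B u"
    by (simp add: counit_left)
  show ?thesis
    using 1 2 by (simp add: coassoc)
qed

lemma antipode_eq_anti: "antipode = (anti :: 'N::finite uq \<Rightarrow> 'N uq)"
  unfolding antipode_def
proof (rule the_equality)
  show "cqlinear anti \<and>
     (\<forall>u. tlift (\<lambda>x y. anti x * y) (comult u) = counit u \<cdot> 1) \<and>
     (\<forall>u. tlift (\<lambda>x y. x * anti y) (comult u) = counit u \<cdot> (1 :: 'N uq))"
    by (simp add: even_map_linear[OF even_map_anti] anti_left anti_right)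
  fix A :: "'N uq \<Rightarrow> 'N uq"
  assume A: "cqlinear A \<and> (\<forall>u. tlift (\<lambda>x y. A x * y) (comult u) = counit u \<cdot> 1) \<and>
    (\<forall>u. tlift (\<lambda>x y. x * A y) (comult u) = counit u \<cdot> 1)"
  show "A = anti"
    by (rule ext, rule convolution_inverse_unique) (use A in \<open>simp_all add: even_map_linear[OF even_map_anti] anti_right\<close>)
qed

section \<open>The Yang-Baxter equation\<close>

text \<open>\<open>S\<close> maps \<open>v\<^sub>i \<otimes> v\<^sub>j\<close> to \<open>R1 q i j\<close> times itself plus \<open>R2 \<xi> i j\<close> times \<open>v\<^sub>j \<otimes> v\<^sub>i\<close> plus
  \<open>R3 \<xi> i j\<close> times \<open>v\<^sub>-\<^sub>j \<otimes> v\<^sub>-\<^sub>i\<close>, and its inverse is obtained by replacing \<open>q\<close> with its inverse.  The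
  operators \<open>D12\<close>, \<open>D13\<close>, \<open>D23\<close> are the transposes of \<open>S\<close> in two of three factors.\<close>

lemma parity_simps [simp]: "0 < i \<Longrightarrow> parity i = 0" "i < 0 \<Longrightarrow> parity i = 1"
  by (simp_all add: parity_def)

lemma qq_nonzero [simp]: "qq \<noteq> 0"
proof
  assume "qq = 0"
  then have "Fract [:0, 1 :: complex:] 1 = (0 :: complex poly fract)"
    unfolding qq_def zero_cq_def by (simp only: Abs_cq_inject UNIV_I)
  then have "[:0, 1 :: complex:] * 1 = 0 * 1"
    unfolding Zero_fract_def by (subst (asm) eq_fract) simp_all
  then show False by simp
qed

definition R1 :: "cq \<Rightarrow> int \<Rightarrow> int \<Rightarrow> cq" where
  "R1 c i j = c powi \<phi> i j"

definition R2 :: "cq \<Rightarrow> int \<Rightarrow> int \<Rightarrow> cq" where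
  "R2 x i j = (if i < j then sgnp (parity i * parity j) * x else 0)"

definition R3 :: "cq \<Rightarrow> int \<Rightarrow> int \<Rightarrow> cq" where
  "R3 x i j = (if - i < j then sgnp (parity i * parity j + parity i + 1) * x else 0)"

definition D12 :: "cq \<Rightarrow> cq \<Rightarrow> (int \<Rightarrow> int \<Rightarrow> int \<Rightarrow> 'v::cqspace) \<Rightarrow> int \<Rightarrow> int \<Rightarrow> int \<Rightarrow> 'v" where
  "D12 c x w i j k = R1 c i j \<cdot> w i j k + R2 x i j \<cdot> w j i k + R3 x i j \<cdot> w (- j) (- i) k"

definition D23 :: "cq \<Rightarrow> cq \<Rightarrow> (int \<Rightarrow> int \<Rightarrow> int \<Rightarrow> 'v::cqspace) \<Rightarrow> int \<Rightarrow> int \<Rightarrow> int \<Rightarrow> 'v" where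
  "D23 c x w i j k = R1 c j k \<cdot> w i j k + R2 x j k \<cdot> w i k j + R3 x j k \<cdot> w i (- k) (- j)"

text \<open>The additional signs record the crossing of the middle slot: each exponent is the change
  of parity in the third slot times the parity of \<open>j\<close>. The third slot changes from k to
  i in one term and from k to -i, whose parity is that of i plus 1, in the other.\<close>

definition D13 :: "cq \<Rightarrow> cq \<Rightarrow> (int \<Rightarrow> int \<Rightarrow> int \<Rightarrow> 'v::cqspace) \<Rightarrow> int \<Rightarrow> int \<Rightarrow> int \<Rightarrow> 'v" where
  "D13 c x w i j k = R1 c i k \<cdot> w i j k
     + (R2 x i k * sgnp ((parity i + parity k) * parity j)) \<cdot> w k j i
     + (R3 x i k * sgnp ((parity i + parity k + 1) * parity j)) \<cdot> w (- k) j (- i)"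

lemma phi_pos: "0 < i \<Longrightarrow> 0 < j \<Longrightarrow> \<phi> i j = of_bool (i = j)"
  "0 < i \<Longrightarrow> 0 < j \<Longrightarrow> \<phi> (- i) j = of_bool (i = j)"
  "0 < i \<Longrightarrow> 0 < j \<Longrightarrow> \<phi> i (- j) = - of_bool (i = j)"
  "0 < i \<Longrightarrow> 0 < j \<Longrightarrow> \<phi> (- i) (- j) = - of_bool (i = j)"
  by (auto simp: \<phi>_def parity_def)

lemma R1_pos: assumes "0 < i" "0 < j"
  shows "R1 c i j = (if i = j then c else 1)" "R1 c (- i) j = (if i = j then c else 1)"
  "R1 c i (- j) = (if i = j then inverse c else 1)" "R1 c (- i) (- j) = (if i = j then inverse c else 1)"
  using assms by (simp_all add: R1_def phi_pos power_int_minus)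

lemma R2_pos: assumes "0 < i" "0 < j"
  shows "R2 x i j = (if i < j then x else 0)" "R2 x (- i) j = x" "R2 x i (- j) = 0"
    "R2 x (- i) (- j) = (if j < i then - x else 0)"
  using assms by (simp_all add: R2_def)

lemma R3_pos: assumes "0 < i" "0 < j"
  shows "R3 x i j = - x" "R3 x (- i) j = (if i < j then x else 0)" "R3 x i (- j) = (if j < i then - x else 0)"
    "R3 x (- i) (- j) = 0"
  using assms by (simp_all add: R3_def)

lemmas R_pos = R1_pos R2_pos R3_pos

lemma pos_neg_cases:
  fixes i :: int assumes "i \<noteq> 0"
  obtains x where "0 < x" "i = x" | x where "0 < x" "i = - x"
  using assms by (metis neg_0_less_iff_less linorder_neqE minus_minus)

text \<open>A finite check. The operators only permute and negate the three indices, and once the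
  signs are fixed the coefficients depend only on how the absolute values compare. What remains in
  each case is an identity that is linear in the values of \<open>w\<close>, with coefficients
  polynomial in \<open>c\<close> and \<open>x\<close>.\<close>

lemma yang_baxter_pos:
  fixes w :: "int \<Rightarrow> int \<Rightarrow> int \<Rightarrow> cq"
  assumes "c * d = 1" "x = c - d" "0 < i" "0 < j" "0 < k"
  defines "P \<equiv> \<lambda>i j k. D23 c x (D13 c x (D12 c x w)) i j k = D12 c x (D13 c x (D23 c x w)) i j k"
  shows "P i j k" "P (- i) j k" "P i (- j) k" "P i j (- k)"
    "P (- i) (- j) k" "P (- i) j (- k)" "P i (- j) (- k)" "P (- i) (- j) (- k)"
proof -
  have d: "inverse c = c - x" "d = c - x" and nz: "c \<noteq> 0"
    using assms(1,2) by (auto simp: inverse_unique mult.commute)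
  \<comment> \<open>The quadratic relation of Hecke type satisfied by q, used to reduce powers of
    \<open>c\<close>.\<close>
  have cc: "c * c = 1 + c * x"
    using assms(1) by (simp add: d(2) algebra_simps)
  have cc': "c * (c * y) = y + c * (x * y)" for y
    by (simp only: mult.assoc[symmetric] cc) (simp add: algebra_simps)
  note R = R_pos[OF assms(3,4)] R_pos[OF assms(4,3)] R_pos[OF assms(3,5)] R_pos[OF assms(5,3)]
    R_pos[OF assms(3,3)] R_pos[OF assms(4,4)] R_pos[OF assms(5,5)] R_pos[OF assms(4,5)] R_pos[OF assms(5,4)]
  have p: "parity i = 0" "parity j = 0" "parity k = 0" "parity (- i) = 1" "parity (- j) = 1" "parity (- k) = 1"
    using assms(3-5) by simp_all
  note D = D12_def D13_def D23_def R scl_cq_def d(1) nz p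
  show "P i j k"
    unfolding P_def
    by (cases i j rule: linorder_cases; cases j k rule: linorder_cases; cases i k rule: linorder_cases)
      (simp_all add: D, (simp_all add: algebra_simps)?, (simp_all add: cc cc')?, (simp_all add: algebra_simps)?)
  show "P (- i) j k"
    unfolding P_def
    by (cases i j rule: linorder_cases; cases j k rule: linorder_cases; cases i k rule: linorder_cases)
      (simp_all add: D, (simp_all add: algebra_simps)?, (simp_all add: cc cc')?, (simp_all add: algebra_simps)?)
  show "P i (- j) k"
    unfolding P_def
    by (cases i j rule: linorder_cases; cases j k rule: linorder_cases; cases i k rule: linorder_cases)
      (simp_all add: D, (simp_all add: algebra_simps)?, (simp_all add: cc cc')?, (simp_all add: algebra_simps)?)
  show "P i j (- k)"
    unfolding P_def
    by (cases i j rule: linorder_cases; cases j k rule: linorder_cases; cases i k rule: linorder_cases)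
      (simp_all add: D, (simp_all add: algebra_simps)?, (simp_all add: cc cc')?, (simp_all add: algebra_simps)?)
  show "P (- i) (- j) k"
    unfolding P_def
    by (cases i j rule: linorder_cases; cases j k rule: linorder_cases; cases i k rule: linorder_cases)
      (simp_all add: D, (simp_all add: algebra_simps)?, (simp_all add: cc cc')?, (simp_all add: algebra_simps)?)
  show "P (- i) j (- k)"
    unfolding P_def
    by (cases i j rule: linorder_cases; cases j k rule: linorder_cases; cases i k rule: linorder_cases)
      (simp_all add: D, (simp_all add: algebra_simps)?, (simp_all add: cc cc')?, (simp_all add: algebra_simps)?)
  show "P i (- j) (- k)"
    unfolding P_def
    by (cases i j rule: linorder_cases; cases j k rule: linorder_cases; cases i k rule: linorder_cases)
      (simp_all add: D, (simp_all add: algebra_simps)?, (simp_all add: cc cc')?, (simp_all add: algebra_simps)?)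
  show "P (- i) (- j) (- k)"
    unfolding P_def
    by (cases i j rule: linorder_cases; cases j k rule: linorder_cases; cases i k rule: linorder_cases)
      (simp_all add: D, (simp_all add: algebra_simps)?, (simp_all add: cc cc')?, (simp_all add: algebra_simps)?)
qed

lemma yang_baxter_scalar:
  fixes w :: "int \<Rightarrow> int \<Rightarrow> int \<Rightarrow> cq"
  assumes "c * d = 1" "x = c - d" "i \<noteq> 0" "j \<noteq> 0" "k \<noteq> 0"
  shows "D23 c x (D13 c x (D12 c x w)) i j k = D12 c x (D13 c x (D23 c x w)) i j k"
proof -
  note yb = yang_baxter_pos[OF assms(1,2)]
  show ?thesis
    using assms(3)
  proof (cases i rule: pos_neg_cases)
    case i: (1 a)
    show ?thesis
      using assms(4)
    proof (cases j rule: pos_neg_cases)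
      case j: (1 b)
      show ?thesis
        using assms(5) by (cases k rule: pos_neg_cases) (use i j yb(1,4) in simp_all)
    next
      case j: (2 b)
      show ?thesis
        using assms(5) by (cases k rule: pos_neg_cases) (use i j yb(3,7) in simp_all)
    qed
  next
    case i: (2 a)
    show ?thesis
      using assms(4)
    proof (cases j rule: pos_neg_cases)
      case j: (1 b)
      show ?thesis
        using assms(5) by (cases k rule: pos_neg_cases) (use i j yb(2,6) in simp_all)
    next
      case j: (2 b)
      show ?thesis
        using assms(5) by (cases k rule: pos_neg_cases) (use i j yb(5,8) in simp_all)
    qed
  qed
qed

text \<open>Ring normalisation applies to scalars. Functionals carry an identity with scalar
  coefficients over to families with values in any space, in particular in tensor powers of
  \<open>mat\<close>.\<close>

lemma linear_functionals_separate:
  fixes x y :: "'v::cqspace"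
  assumes "\<And>f :: 'v \<Rightarrow> cq. cqlinear f \<Longrightarrow> f x = f y"
  shows "x = y"
proof (rule ccontr)
  assume "x \<noteq> y"
  interpret p: vector_space_pair "scl :: cq \<Rightarrow> 'v \<Rightarrow> 'v" "scl :: cq \<Rightarrow> cq \<Rightarrow> cq" ..
  from \<open>x \<noteq> y\<close> have "cqs.independent {x - y}"
    by simp
  then obtain f :: "'v \<Rightarrow> cq" where f: "cqlinear f" "f (x - y) = 1"
    using p.linear_independent_extend[of "{x - y}" "\<lambda>_. 1"] by auto
  with assms[OF f(1)] show False
    by (simp add: cqlinearD[OF f(1)])
qed

lemma D_linear:
  assumes "cqlinear f"
  shows "f (D12 c x w i j k) = D12 c x (\<lambda>i j k. f (w i j k)) i j k"
    "f (D13 c x w i j k) = D13 c x (\<lambda>i j k. f (w i j k)) i j k"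
    "f (D23 c x w i j k) = D23 c x (\<lambda>i j k. f (w i j k)) i j k"
  by (simp_all add: D12_def D13_def D23_def cqlinearD[OF assms])

lemma yang_baxter:
  fixes w :: "int \<Rightarrow> int \<Rightarrow> int \<Rightarrow> 'v::cqspace"
  assumes "c * d = 1" "x = c - d" "i \<noteq> 0" "j \<noteq> 0" "k \<noteq> 0"
  shows "D23 c x (D13 c x (D12 c x w)) i j k = D12 c x (D13 c x (D23 c x w)) i j k"
proof (rule linear_functionals_separate)
  fix f :: "'v \<Rightarrow> cq" assume "cqlinear f"
  then show "f (D23 c x (D13 c x (D12 c x w)) i j k) = f (D12 c x (D13 c x (D23 c x w)) i j k)"
    using yang_baxter_scalar[OF assms, of "\<lambda>i j k. f (w i j k)"] by (simp add: D_linear)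
qed

definition D2 :: "cq \<Rightarrow> cq \<Rightarrow> (int \<Rightarrow> int \<Rightarrow> 'v::cqspace) \<Rightarrow> int \<Rightarrow> int \<Rightarrow> 'v" where
  "D2 c x w i j = R1 c i j \<cdot> w i j + R2 x i j \<cdot> w j i + R3 x i j \<cdot> w (- j) (- i)"

text \<open>Replacing \<open>c\<close> by its inverse negates \<open>x\<close>, which is their
  difference, so the inverse of S has the same shape as S. The proof is again a comparison of
  absolute values and the quadratic relation.\<close>

lemma D2_inverse_scalar:
  fixes w :: "int \<Rightarrow> int \<Rightarrow> cq"
  assumes "c * d = 1" "x = c - d" "i \<noteq> 0" "j \<noteq> 0"
  shows "D2 c x (D2 d (- x) w) i j = w i j"
proof -
  have d: "inverse c = c - x" "inverse d = c" "d = c - x" and nz: "c \<noteq> 0" "c - x \<noteq> 0"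
    using assms(1,2) by (auto simp: inverse_unique mult.commute)
  have cc: "c * c = 1 + c * x"
    using assms(1) by (simp add: d(3) algebra_simps)
  have cc': "c * (c * y) = y + c * (x * y)" for y
    by (simp only: mult.assoc[symmetric] cc) (simp add: algebra_simps)
  have *: "D2 c x (D2 d (- x) w) i j = w i j \<and> D2 c x (D2 d (- x) w) (- i) j = w (- i) j \<and>
    D2 c x (D2 d (- x) w) i (- j) = w i (- j) \<and> D2 c x (D2 d (- x) w) (- i) (- j) = w (- i) (- j)"
    if ij: "0 < i" "0 < j" for i j
  proof -
    note R = R_pos[OF ij] R_pos[OF ij(2,1)] R_pos[OF ij(1,1)] R_pos[OF ij(2,2)]
    show ?thesis
      by (cases i j rule: linorder_cases)
         (simp_all add: D2_def R scl_cq_def d(1,2), simp_all add: d(3) algebra_simps cc cc')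
  qed
  show ?thesis
    using assms(3)
  proof (cases i rule: pos_neg_cases)
    case i: (1 a)
    show ?thesis
      using assms(4) by (cases j rule: pos_neg_cases) (use i * in simp_all)
  next
    case i: (2 a)
    show ?thesis
      using assms(4) by (cases j rule: pos_neg_cases) (use i * in simp_all)
  qed
qed

lemma D2_linear: "cqlinear f \<Longrightarrow> f (D2 c x w i j) = D2 c x (\<lambda>i j. f (w i j)) i j"
  by (simp add: D2_def cqlinearD)

lemma D2_inverse:
  fixes w :: "int \<Rightarrow> int \<Rightarrow> 'v::cqspace"
  assumes "c * d = 1" "x = c - d" "i \<noteq> 0" "j \<noteq> 0"
  shows "D2 c x (D2 d (- x) w) i j = w i j"
proof (rule linear_functionals_separate)
  fix f :: "'v \<Rightarrow> cq" assume "cqlinear f"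
  then show "f (D2 c x (D2 d (- x) w) i j) = f (w i j)"
    using D2_inverse_scalar[OF assms, of "\<lambda>i j. f (w i j)"] by (simp add: D2_linear)
qed

subsection \<open>The matrix \<open>S\<close> as an element of the tensor algebra\<close>

text \<open>The two parameters cover both S and its inverse; the latter has parameters
  \<open>inverse qq\<close> and \<open>- \<xi>\<close>.\<close>

definition Rmat :: "cq \<Rightarrow> cq \<Rightarrow> nat \<Rightarrow> (mat, mat) tensor" where
  "Rmat c x N = (\<Sum>i\<in>idx N. \<Sum>j\<in>idx N. (c powi \<phi> i j) \<cdot> (munit i i \<otimes> munit j j))
       + x \<cdot> (\<Sum>i\<in>idx N. \<Sum>j\<in>{j\<in>idx N. i < j}.
                sgnp (parity i) \<cdot> ((munit j i + munit (- j) (- i)) \<otimes> munit i j))"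

lemma Smat_eq_Rmat: "Smat N = Rmat qq \<xi> N"
  by (simp add: Smat_def Rmat_def)

lemma idx_nonzero: "i \<in> idx N \<Longrightarrow> i \<noteq> 0"
  by (auto simp: idx_def)

lemma parity_neg: "i \<noteq> 0 \<Longrightarrow> parity (- i) = parity i + 1"
  by (auto simp: parity_def)

lemma homog_munit_neg:
  "i \<noteq> 0 \<Longrightarrow> j \<noteq> 0 \<Longrightarrow> homog (parity i + parity j) (munit (- i) (- j))"
  using homog_munit[of "- i" "- j"] by (simp add: parity_neg add_ac)

lemma homog_Rmat: "homog 0 (Rmat c x N)"
proof -
  have e: "homog 0 (munit i i)" for i
    using homog_munit[of i i] by simp
  have n: "homog (parity i + parity j) (munit j i + munit (- j) (- i))" if "i \<in> idx N" "j \<in> idx N" for i j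
    using homog_add[OF homog_munit[of j i] homog_munit_neg[of j i]] that by (simp add: add.commute idx_nonzero)
  show ?thesis
    unfolding Rmat_def
    by (intro homog_add homog_scl homog_sum homog_even_tens[OF e e] homog_even_tens[OF n homog_munit]) auto
qed

text \<open>Matrix units of the tensor square with row indices i, j and spectator column indices a,
  b. The factor absorbs the sign rule of the tensor product, so that left multiplication by S has
  the coefficients of \<open>D2\<close>, free of a and b.\<close>

definition e2 :: "int \<Rightarrow> int \<Rightarrow> int \<Rightarrow> int \<Rightarrow> (mat, mat) tensor" where
  "e2 a b i j = sgnp ((parity j + parity b) * parity a) \<cdot> (munit i a \<otimes> munit j b)"

lemma Rmat_e2:
  assumes "i \<in> idx N" "j \<in> idx N"
  shows "Rmat c x N * e2 a b i j = D2 c x (e2 a b) i j"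
proof -
  let ?I = "idx N" and ?s = "sgnp ((parity j + parity b) * parity a)"
  have nz: "i \<noteq> 0" "j \<noteq> 0"
    using assms by (auto dest: idx_nonzero)
  have m: "munit p r \<otimes> munit p' r' * munit i a \<otimes> munit j b =
      (if r = i \<and> r' = j then sgnp ((parity p' + parity r') * (parity i + parity a)) \<cdot> (munit p a \<otimes> munit p' b) else 0)"
    for p r p' r'
    using times_tens_homog[OF homog_munit homog_munit, where a = "munit p r" and b' = "munit j b"]
    by (auto simp: munit_mult)
  have 1: "(\<Sum>p\<in>?I. \<Sum>r\<in>?I. (c powi \<phi> p r) \<cdot> (munit p p \<otimes> munit r r)) * (munit i a \<otimes> munit j b)
      = R1 c i j \<cdot> (munit i a \<otimes> munit j b)"
  proof -
    have "(\<Sum>p\<in>?I. \<Sum>r\<in>?I. (c powi \<phi> p r) \<cdot> (munit p p \<otimes> munit r r)) * (munit i a \<otimes> munit j b)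
      = (\<Sum>p\<in>?I. \<Sum>r\<in>?I. if p = i then if r = j then R1 c i j \<cdot> (munit i a \<otimes> munit j b) else 0 else 0)"
      unfolding sum_distrib_right scl_mult_left m by (intro sum.cong refl) (auto simp: R1_def)
    also have "\<dots> = (\<Sum>p\<in>?I. if p = i then (\<Sum>r\<in>?I. if r = j then R1 c i j \<cdot> (munit i a \<otimes> munit j b) else 0) else 0)"
      by (simp add: sum_if_const)
    finally show ?thesis
      using assms by (simp add: sum.delta')
  qed
  \<comment> \<open>The summand \<open>munit r p\<close> meets \<open>munit i a\<close> only for p =
    i and r = j, the summand \<open>munit (- r) (- p)\<close> only for p = -i and r = j. The
    condition p < r becomes i < j and -i < j respectively.\<close>
  have 2: "(\<Sum>p\<in>?I. \<Sum>r\<in>{r\<in>?I. p < r}. sgnp (parity p) \<cdot> ((munit r p + munit (- r) (- p)) \<otimes> munit p r))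
        * (munit i a \<otimes> munit j b)
      = (if i < j then (sgnp (parity i) * sgnp ((parity i + parity j) * (parity i + parity a))) \<cdot> (munit j a \<otimes> munit i b) else 0)
      + (if - i < j then (sgnp (parity i + 1) * sgnp ((parity i + 1 + parity j) * (parity i + parity a))) \<cdot> (munit (- j) a \<otimes> munit (- i) b) else 0)"
    (is "?L = ?A + ?B")
  proof -
    have "?L = (\<Sum>p\<in>?I. \<Sum>r\<in>{r\<in>?I. p < r}. (if p = i then if r = j then ?A else 0 else 0)
        + (if p = - i then if r = j then ?B else 0 else 0))"
      unfolding sum_distrib_right scl_mult_left tens_lin distrib_right m
      by (intro sum.cong refl) (auto simp: parity_neg nz scl_add_right distrib_right distrib_left add_ac)
    also have "\<dots> = (\<Sum>p\<in>?I. if p = i then (\<Sum>r\<in>{r\<in>?I. p < r}. if r = j then ?A else 0) else 0)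
        + (\<Sum>p\<in>?I. if p = - i then (\<Sum>r\<in>{r\<in>?I. p < r}. if r = j then ?B else 0) else 0)"
      by (simp only: sum.distrib sum_if_const)
    finally show ?thesis
      using assms by (simp add: sum.delta')
  qed
  have s2: "?s * (x * (sgnp (parity i) * sgnp ((parity i + parity j) * (parity i + parity a))))
      = sgnp (parity i * parity j) * x * sgnp ((parity i + parity b) * parity a)"
    by (cases "parity i"; cases "parity j"; cases "parity a"; cases "parity b") simp_all
  have s3: "?s * (x * (sgnp (parity i + 1) * sgnp ((parity i + 1 + parity j) * (parity i + parity a))))
      = sgnp (parity i * parity j + parity i + 1) * x * sgnp ((parity i + 1 + parity b) * parity a)"
    by (cases "parity i"; cases "parity j"; cases "parity a"; cases "parity b") simp_all
  have "Rmat c x N * e2 a b i j = ?s \<cdot> (R1 c i j \<cdot> (munit i a \<otimes> munit j b) + x \<cdot> (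
      (if i < j then (sgnp (parity i) * sgnp ((parity i + parity j) * (parity i + parity a))) \<cdot> (munit j a \<otimes> munit i b) else 0)
      + (if - i < j then (sgnp (parity i + 1) * sgnp ((parity i + 1 + parity j) * (parity i + parity a))) \<cdot> (munit (- j) a \<otimes> munit (- i) b) else 0)))"
    unfolding e2_def Rmat_def scl_mult_right distrib_right scl_mult_left 1 2 ..
  also have "\<dots> = D2 c x (e2 a b) i j"
  proof -
    have t1: "?s \<cdot> R1 c i j \<cdot> (munit i a \<otimes> munit j b) = R1 c i j \<cdot> e2 a b i j"
      by (simp only: e2_def cqs.scale_scale mult.commute)
    have t2: "?s \<cdot> x \<cdot> (if i < j then (sgnp (parity i) * sgnp ((parity i + parity j) * (parity i + parity a))) \<cdot> (munit j a \<otimes> munit i b) else 0)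
        = R2 x i j \<cdot> e2 a b j i"
      by (cases "i < j") (simp_all only: R2_def e2_def if_True if_False cqs.scale_scale s2 mult_zero_left cqs.scale_zero_right cqs.scale_zero_left)
    have t3: "?s \<cdot> x \<cdot> (if - i < j then (sgnp (parity i + 1) * sgnp ((parity i + 1 + parity j) * (parity i + parity a))) \<cdot> (munit (- j) a \<otimes> munit (- i) b) else 0)
        = R3 x i j \<cdot> e2 a b (- j) (- i)"
      by (cases "- i < j")
         (simp_all only: R3_def e2_def if_True if_False cqs.scale_scale s3 mult_zero_left cqs.scale_zero_right cqs.scale_zero_left parity_neg[OF nz(1)])
    show ?thesis
      unfolding D2_def by (simp only: scl_add_right t1 t2 t3, simp only: add.assoc)
  qed
  finally show ?thesis .
qed

definition e3 :: "int \<Rightarrow> int \<Rightarrow> int \<Rightarrow> int \<Rightarrow> int \<Rightarrow> int \<Rightarrow> ((mat, mat) tensor, mat) tensor" where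
  "e3 a b e i j k = sgnp ((parity j + parity b) * parity a + (parity k + parity e) * (parity a + parity b))
     \<cdot> ((munit i a \<otimes> munit j b) \<otimes> munit k e)"

lemma e3_e2:
  "e3 a b e i j k = sgnp ((parity k + parity e) * (parity a + parity b)) \<cdot> (e2 a b i j \<otimes> munit k e)"
  "assocr (e3 a b e i j k) = sgnp (parity a * (parity j + parity b + parity k + parity e)) \<cdot> (munit i a \<otimes> e2 b e j k)"
  unfolding e3_def e2_def
  by (simp_all add: tens_lin sgnp_add mult.commute cqlinearD[OF cqlinear_assocr] assocr_tens distrib_left distrib_right mult_ac)

lemma Rmat12_e3:
  assumes "i \<in> idx N" "j \<in> idx N" "k \<in> idx N"
  shows "(Rmat c x N \<otimes> idm N) * e3 a b e i j k = D12 c x (e3 a b e) i j k"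
proof -
  have "(Rmat c x N \<otimes> idm N) * e3 a b e i j k
      = sgnp ((parity k + parity e) * (parity a + parity b)) \<cdot> (D2 c x (e2 a b) i j \<otimes> munit k e)"
    by (simp add: e3_e2 scl_mult_right times_tens_even homog_idm Rmat_e2 assms)
  also have "\<dots> = D12 c x (e3 a b e) i j k"
    by (simp add: D2_def D12_def e3_e2 tens_lin scl_add_right mult.commute)
  finally show ?thesis .
qed

text \<open>\<open>assocr\<close> is multiplicative and turns \<open>slot23 (idm N) X\<close> into
  \<open>idm N \<otimes> X\<close>, so the product takes place in a single tensor factor and
  \<open>Rmat_e2\<close> applies.\<close>

lemma Rmat23_e3:
  assumes "i \<in> idx N" "j \<in> idx N" "k \<in> idx N"
  shows "slot23 (idm N) (Rmat c x N) * e3 a b e i j k = D23 c x (e3 a b e) i j k"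
proof -
  have nz: "j \<noteq> 0" "k \<noteq> 0"
    using assms by (auto dest: idx_nonzero)
  have a: "assocr (slot23 (idm N) X) = idm N \<otimes> X" for X
    by (rule tensor_ext[where t = X])
      (simp_all add: cqlinear_compose[OF cqlinear_assocr cqlinear_slot23] cqlinear_tens slot23_tens assocr_tens)
  have p: "parity k + (parity b + (parity j + q)) = parity j + (parity b + (parity k + q))"
    "parity (- k) + (parity b + (parity (- j) + q)) = parity j + (parity b + (parity k + q))" for q
    by (simp_all add: parity_neg nz add_ac)
  have "assocr (slot23 (idm N) (Rmat c x N) * e3 a b e i j k)
      = sgnp (parity a * (parity j + parity b + parity k + parity e)) \<cdot> (munit i a \<otimes> D2 c x (e2 b e) j k)"
    using times_tens_homog[OF homog_Rmat homog_munit, where a = "idm N" and b' = "e2 b e j k"] assms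
    by (simp add: superalg_hom_mult[OF superalg_hom_assocr] a e3_e2(2) scl_mult_right Rmat_e2)
  also have "\<dots> = assocr (D23 c x (e3 a b e) i j k)"
    by (simp add: D_linear[OF cqlinear_assocr] e3_e2(2))
       (simp add: D2_def D23_def tens_lin scl_add_right mult.commute add.assoc p)
  finally show ?thesis
    by (metis assocl_assocr)
qed

lemma Rmat13_e3:
  assumes "i \<in> idx N" "j \<in> idx N" "k \<in> idx N"
  shows "slots13 N (Rmat c x N) * e3 a b e i j k = D13 c x (e3 a b e) i j k"
proof -
  have nz: "i \<noteq> 0" "k \<noteq> 0"
    using assms by (auto dest: idx_nonzero)
  \<comment> \<open>\<open>K\<close> inserts the spectator \<open>munit j b\<close> as middle
    factor, together with the sign for its exchange with the third factor; the projections
    \<open>hpart\<close> make this sign linear in that factor.\<close>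
  let ?B = "\<lambda>(y::mat) (z::mat). \<Sum>p\<in>{0, 1}. sgnp (p * (parity j + parity b)) \<cdot> ((y \<otimes> munit j b) \<otimes> hpart p z)"
  define K where "K = tlift ?B"
  have B: "bilin ?B"
    by (rule bilinI) (simp_all add: tens_lin hpart_add hpart_scl scl_add_right mult.commute add_ac)
  have K: "K (y \<otimes> z) = sgnp (p * (parity j + parity b)) \<cdot> ((y \<otimes> munit j b) \<otimes> z)"
    if "homog p z" for y z p
    unfolding K_def tlift_tens[OF B] using bit_exhaust[of p] by (auto simp: hpart_homog[OF that])
  have linK: "cqlinear K"
    using cqlinear_tlift[OF B] by (simp add: K_def)
  have *: "slots13 N X * ((munit i a \<otimes> munit j b) \<otimes> munit k e)
      = sgnp ((parity k + parity e) * (parity j + parity b)) \<cdot> K (X * (munit i a \<otimes> munit k e))" for X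
  proof (rule tensor_ext_homog[where t = X])
    show "cqlinear (\<lambda>X. slots13 N X * ((munit i a \<otimes> munit j b) \<otimes> munit k e))"
      by (rule cqlinear_compose[OF cqlinear_mult(2) cqlinear_slots13])
    show "cqlinear (\<lambda>X. sgnp ((parity k + parity e) * (parity j + parity b)) \<cdot> K (X * (munit i a \<otimes> munit k e)))"
      by (rule cqlinear_scl[OF cqlinear_compose[OF linK cqlinear_mult(2)]])
    fix u u' and m m' :: mat assume m: "homog u m" "homog u' m'"
    show "slots13 N (m \<otimes> m') * ((munit i a \<otimes> munit j b) \<otimes> munit k e)
      = sgnp ((parity k + parity e) * (parity j + parity b)) \<cdot> K (m \<otimes> m' * (munit i a \<otimes> munit k e))"
      using times_assoc3_homog[OF homog_idm m(2) homog_munit homog_munit, where a = m and c' = "munit k e"]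
      by (simp add: slots_tens times_tens_homog[OF m(2) homog_munit] cqlinearD[OF linK]
          K[OF homog_mult[OF m(2) homog_munit]] assms sgnp_mult_add mult_ac)
  qed
  have **: "sgnp (u * v) \<cdot> K (e2 a e i' k') = 
     sgnp (u * v + (parity k' + parity e) * parity a + (parity k' + parity e) * (parity j + parity b)) \<cdot> ((munit i' a \<otimes> munit j b) \<otimes> munit k' e)"
    for i' k' u v
    by (simp add: e2_def cqlinearD[OF linK] K[OF homog_munit] sgnp_add mult.assoc)
  \<comment> \<open>The accumulated exponent: the two terms in \<open>e3\<close>, the normalisation
    of \<open>e2 a e i k\<close>, and the insertion of the middle factor by
    \<open>K\<close>.\<close>
  define s where "s = (parity j + parity b) * parity a + (parity k + parity e) * (parity a + parity b)
    + (parity k + parity e) * parity a + (parity k + parity e) * (parity j + parity b)"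
  have "slots13 N (Rmat c x N) * e3 a b e i j k = sgnp (1 * s) \<cdot> K (Rmat c x N * e2 a e i k)"
    by (simp add: e3_def e2_def scl_mult_right * cqlinearD[OF linK] s_def sgnp_add mult_ac)
  also have "\<dots> = R1 c i k \<cdot> sgnp (1 * s) \<cdot> K (e2 a e i k) + R2 x i k \<cdot> sgnp (1 * s) \<cdot> K (e2 a e k i)
      + R3 x i k \<cdot> sgnp (1 * s) \<cdot> K (e2 a e (- k) (- i))"
    by (simp add: Rmat_e2 assms D2_linear[OF linK]) (simp add: D2_def scl_add_right mult.commute)
  also have "\<dots> = D13 c x (e3 a b e) i j k"
  proof -
    have 1: "1 * s + (parity k + parity e) * parity a + (parity k + parity e) * (parity j + parity b)
      = (parity j + parity b) * parity a + (parity k + parity e) * (parity a + parity b)"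
      unfolding s_def by (simp add: add_ac)
    have 2: "1 * s + (parity i + parity e) * parity a + (parity i + parity e) * (parity j + parity b)
      = (parity i + parity k) * parity j + ((parity j + parity b) * parity a + (parity i + parity e) * (parity a + parity b))"
      unfolding s_def
      by (cases "parity i"; cases "parity j"; cases "parity k"; cases "parity a"; cases "parity b"; cases "parity e") simp_all
    have 3: "1 * s + (parity (- i) + parity e) * parity a + (parity (- i) + parity e) * (parity j + parity b)
      = (parity i + parity k + 1) * parity j + ((parity j + parity b) * parity a + (parity (- i) + parity e) * (parity a + parity b))"
      unfolding s_def parity_neg[OF nz(1)]
      by (cases "parity i"; cases "parity j"; cases "parity k"; cases "parity a"; cases "parity b"; cases "parity e") simp_all
    show ?thesis
      unfolding ** 1 2 3 D13_def e3_def cqs.scale_scale by (simp only: sgnp_add mult.assoc)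
  qed
  finally show ?thesis .
qed

lemma D_cong:
  assumes "\<And>i j k. i \<in> idx N \<Longrightarrow> j \<in> idx N \<Longrightarrow> k \<in> idx N \<Longrightarrow> w i j k = w' i j k"
    and "i \<in> idx N" "j \<in> idx N" "k \<in> idx N"
  shows "D12 c x w i j k = D12 c x w' i j k" "D13 c x w i j k = D13 c x w' i j k"
    "D23 c x w i j k = D23 c x w' i j k"
  using assms by (simp_all add: D12_def D13_def D23_def)

lemma idm_Rmat:
  "(idm N \<otimes> idm N) * Rmat c x N = Rmat c x N" "Rmat c x N * (idm N \<otimes> idm N) = Rmat c x N"
  unfolding Rmat_def
  by (simp_all add: distrib_left distrib_right sum_distrib_left sum_distrib_right scl_mult_left scl_mult_right
      times_tens_even homog_idm)

text \<open>The diagonal terms add up to the identity, so an equation between left multiplications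
  need only be tested on the families \<open>e3 a b e\<close>.\<close>

lemma idm3_eq:
  "slot23 (idm N) (idm N \<otimes> idm N) = (\<Sum>a\<in>idx N. \<Sum>b\<in>idx N. \<Sum>e\<in>idx N. e3 a b e a b e)"
proof -
  have e: "e3 a b e a b e = (munit a a \<otimes> munit b b) \<otimes> munit e e" for a b e
    by (simp add: e3_def)
  show ?thesis
    unfolding e slot23_tens by (simp only: tens_sum[symmetric] idm_def[symmetric])
qed

text \<open>The operators \<open>D12\<close>, \<open>D13\<close>, \<open>D23\<close> form linear
  combinations and hence commute with left multiplication. A product of matrices applied to
  \<open>e3 a b e\<close> therefore becomes a composition of these operators in the opposite order,
  and \<open>yang_baxter\<close> compares the two compositions.\<close>

theorem Rmat_yang_baxter:
  assumes "c * d = 1" "x = c - d"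
  shows "(Rmat c x N \<otimes> idm N) * slots13 N (Rmat c x N) * slot23 (idm N) (Rmat c x N)
    = slot23 (idm N) (Rmat c x N) * slots13 N (Rmat c x N) * (Rmat c x N \<otimes> idm N)"
proof -
  let ?R = "Rmat c x N"
  let ?R12 = "?R \<otimes> idm N" and ?R13 = "slots13 N ?R" and ?R23 = "slot23 (idm N) ?R" and ?I = "slot23 (idm N) (idm N \<otimes> idm N)"
  note l = cqlinear_mult(1)
  have eq: "?R12 * ?R13 * ?R23 * e3 a b e a b e = ?R23 * ?R13 * ?R12 * e3 a b e a b e"
    if abe: "a \<in> idx N" "b \<in> idx N" "e \<in> idx N" for a b e
  proof -
    let ?w = "e3 a b e"
    have 1: "?R13 * D23 c x ?w a b e = D23 c x (D13 c x ?w) a b e"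
      unfolding D_linear[OF l] by (rule D_cong(3)[OF Rmat13_e3 abe])
    have one: "?R13 * D12 c x ?w a b e = D12 c x (D13 c x ?w) a b e"
      unfolding D_linear[OF l] by (rule D_cong(1)[OF Rmat13_e3 abe])
    have 2: "?R12 * D23 c x (D13 c x ?w) a b e = D23 c x (D13 c x (D12 c x ?w)) a b e"
      unfolding D_linear[OF l] by (rule D_cong(3)[OF D_cong(2)[OF Rmat12_e3] abe])
    have 3: "?R23 * D12 c x (D13 c x ?w) a b e = D12 c x (D13 c x (D23 c x ?w)) a b e"
      unfolding D_linear[OF l] by (rule D_cong(1)[OF D_cong(2)[OF Rmat23_e3] abe])
    have "?R12 * ?R13 * ?R23 * ?w a b e = D23 c x (D13 c x (D12 c x ?w)) a b e"
      by (simp only: mult.assoc Rmat23_e3 1 2 abe)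
    also have "\<dots> = D12 c x (D13 c x (D23 c x ?w)) a b e"
      by (rule yang_baxter[OF assms]) (use abe in \<open>auto dest: idx_nonzero\<close>)
    also have "\<dots> = ?R23 * ?R13 * ?R12 * ?w a b e"
      by (simp only: mult.assoc Rmat12_e3 one 3 abe)
    finally show ?thesis .
  qed
  have "?R12 * ?R13 * ?R23 * ?I = ?R23 * ?R13 * ?R12 * ?I"
    unfolding idm3_eq sum_distrib_left by (intro sum.cong refl eq)
  moreover have "?R23 * ?I = ?R23"
    by (simp add: slot23_mult homog_idm idm_Rmat)
  moreover have "?R12 * ?I = ?R12"
    by (simp add: slot23_tens times_tens_even homog_idm idm_Rmat)
  ultimately show ?thesis
    by (simp only: mult.assoc)
qed

corollary rll_Smat: "rll N (idm N) (Smat N)"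
  unfolding rll_def Smat_eq_Rmat
  by (rule Rmat_yang_baxter[of qq "inverse qq"]) (simp_all add: \<xi>_def)

lemma D2_cong:
  assumes "\<And>i j. i \<in> idx N \<Longrightarrow> j \<in> idx N \<Longrightarrow> w i j = w' i j" and "i \<in> idx N" "j \<in> idx N"
  shows "D2 c x w i j = D2 c x w' i j"
  using assms by (simp add: D2_def)

lemma Rmat_inverse:
  assumes "c * d = 1" "x = c - d"
  shows "Rmat c x N * Rmat d (- x) N = idm N \<otimes> idm N"
proof -
  have e: "Rmat c x N * (Rmat d (- x) N * e2 a b a b) = e2 a b a b" if ab: "a \<in> idx N" "b \<in> idx N" for a b
  proof -
    have "Rmat c x N * (Rmat d (- x) N * e2 a b a b) = D2 d (- x) (\<lambda>i j. Rmat c x N * e2 a b i j) a b"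
      unfolding Rmat_e2[OF ab] D2_linear[OF cqlinear_mult(1)] ..
    also have "\<dots> = D2 d (- x) (D2 c x (e2 a b)) a b"
      by (rule D2_cong[OF Rmat_e2 ab])
    also have "\<dots> = e2 a b a b"
      using D2_inverse[of d c "- x" a b "e2 a b"] assms ab by (simp add: idx_nonzero mult.commute)
    finally show ?thesis .
  qed
  have I: "idm N \<otimes> idm N = (\<Sum>a\<in>idx N. \<Sum>b\<in>idx N. e2 a b a b)"
    unfolding e2_def by (simp add: tens_sum[symmetric] idm_def[symmetric])
  have "Rmat c x N * (Rmat d (- x) N * (idm N \<otimes> idm N)) = idm N \<otimes> idm N"
    unfolding I sum_distrib_left by (intro sum.cong refl e)
  then show ?thesis
    by (simp add: idm_Rmat)
qed

section \<open>The coefficient matrices of S and the vector representation\<close>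

definition rcoef :: "cq \<Rightarrow> cq \<Rightarrow> nat \<Rightarrow> int \<Rightarrow> int \<Rightarrow> mat" where
  "rcoef c x N i j = (if i = j \<and> i \<in> idx N then \<Sum>k\<in>idx N. (c powi \<phi> k i) \<cdot> munit k k else 0)
     + (if i \<in> idx N \<and> j \<in> idx N \<and> i < j then (x * sgnp (parity i)) \<cdot> (munit j i + munit (- j) (- i)) else 0)"

lemma smat_rcoef: "smat N (rcoef c x N) = Rmat c x N"
proof -
  let ?I = "idx N"
  have "smat N (rcoef c x N) = (\<Sum>i\<in>?I. \<Sum>j\<in>?I. if i = j then (\<Sum>k\<in>?I. (c powi \<phi> k i) \<cdot> (munit k k \<otimes> munit i i)) else 0)
      + (\<Sum>i\<in>?I. \<Sum>j\<in>?I. if i < j then x \<cdot> sgnp (parity i) \<cdot> ((munit j i + munit (- j) (- i)) \<otimes> munit i j) else 0)"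
    unfolding smat_def rcoef_def sum.distrib[symmetric]
    by (intro sum.cong refl) (auto simp: tens_lin tens_sum)
  also have "(\<Sum>i\<in>?I. \<Sum>j\<in>?I. if i = j then (\<Sum>k\<in>?I. (c powi \<phi> k i) \<cdot> (munit k k \<otimes> munit i i)) else 0)
      = (\<Sum>k\<in>?I. \<Sum>i\<in>?I. (c powi \<phi> k i) \<cdot> (munit k k \<otimes> munit i i))"
    by (simp add: sum.delta) (rule sum.swap)
  also have "(\<Sum>i\<in>?I. \<Sum>j\<in>?I. if i < j then x \<cdot> sgnp (parity i) \<cdot> ((munit j i + munit (- j) (- i)) \<otimes> munit i j) else 0)
      = (\<Sum>i\<in>?I. \<Sum>j\<in>{j\<in>?I. i < j}. x \<cdot> sgnp (parity i) \<cdot> ((munit j i + munit (- j) (- i)) \<otimes> munit i j))"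
    by (simp only: sum.inter_filter[OF finite_idx])
  finally show ?thesis
    unfolding Rmat_def cqs.scale_sum_right .
qed

lemma graded_rcoef: "graded (rcoef c x N)"
  unfolding graded_def
proof (intro allI)
  fix i j
  have "homog (parity i + parity i) (\<Sum>k\<in>idx N. (c powi \<phi> k i) \<cdot> munit k k)"
    by (intro homog_sum homog_scl) (simp add: homog_munit_sum)
  moreover have "homog (parity i + parity j) (munit j i + munit (- j) (- i))" if "i \<in> idx N" "j \<in> idx N"
    using homog_add[OF homog_munit[of j i] homog_munit_neg[of j i]] that by (simp add: add.commute idx_nonzero)
  ultimately show "homog (parity i + parity j) (rcoef c x N i j)"
    unfolding rcoef_def by (intro homog_add) (auto simp: homog_zero intro: homog_scl)
qed

lemma idm_rcoef: "idm N * rcoef c x N i j = rcoef c x N i j" "rcoef c x N i j * idm N = rcoef c x N i j"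
  by (auto simp: rcoef_def sum_distrib_left sum_distrib_right scl_mult_left scl_mult_right distrib_left distrib_right)

text \<open>Negating i negates the exponent \<phi> k i, so the two diagonal matrices are inverse to
  each other.\<close>

lemma rcoef_diag:
  assumes "c \<noteq> 0" "i \<in> idx N"
  shows "rcoef c x N i i * rcoef c x N (- i) (- i) = idm N"
proof -
  have i: "i \<noteq> 0" using assms(2) by (rule idx_nonzero)
  have p: "\<phi> k (- i) = - \<phi> k i" for k
    using i by (auto simp: \<phi>_def parity_def)
  have "rcoef c x N i i * rcoef c x N (- i) (- i)
      = (\<Sum>k\<in>idx N. \<Sum>l\<in>idx N. if k = l then munit k k else 0)"
    unfolding rcoef_def using assms i
    by (simp add: sum_distrib_right sum_distrib_left[where A = "idx N"] p power_int_minus scl_mult_left scl_mult_right munit_mult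
        if_distrib[of "\<lambda>m. _ \<cdot> m"] cong: if_cong)
  also have "\<dots> = idm N"
    by (simp add: sum.delta idm_def)
  finally show ?thesis .
qed

lemma uq_family_rcoef: "uq_family N (idm N) (rcoef qq \<xi> N)"
proof -
  have "rcoef qq \<xi> N i j = 0" if "\<not> (i \<in> idx N \<and> j \<in> idx N \<and> i \<le> j)" for i j
    using that by (auto simp: rcoef_def)
  then show ?thesis
    using graded_rcoef[of qq \<xi> N]
    by (auto simp: uq_family_def unit_for_def idm_rcoef graded_def homog_idm rcoef_diag smat_rcoef rll_Smat
        simp flip: Smat_eq_Rmat)
qed

lemma ecoef_Smat:
  assumes "i \<in> idx N" "j \<in> idx N"
  shows "ecoef i j (Smat N) = rcoef qq \<xi> N i j"
  unfolding Smat_eq_Rmat smat_rcoef[symmetric] by (rule ecoef_smat[OF assms])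

lemma superalg_hom_vrep: "superalg_hom (vrep :: 'N::finite uq \<Rightarrow> mat)"
  and vrep_1: "vrep (1 :: 'N uq) = idm CARD('N)"
  and vrep_Lgen: "vrep (Lgen i j :: 'N uq) = rcoef qq \<xi> CARD('N) i j"
proof -
  note * = uq_universal_THE[OF uq_family_rcoef _ vrep_def]
  show "superalg_hom (vrep :: 'N uq \<Rightarrow> mat)"
    by (rule *(1); simp add: ecoef_Smat)
  show "vrep (1 :: 'N uq) = idm CARD('N)"
    by (rule *(2); simp add: ecoef_Smat)
  show "vrep (Lgen i j :: 'N uq) = rcoef qq \<xi> CARD('N) i j"
    by (rule *(3); simp add: ecoef_Smat)
qed

text \<open>The image of the matrix of \<open>Linv\<close> is a left inverse of S, and
  \<open>Rmat\<close> with inverted parameters is a right inverse; hence they agree, and entries can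
  be compared.\<close>

lemma vrep_Linv:
  assumes "i \<in> idx CARD('N)" "j \<in> idx CARD('N)"
  shows "vrep (Linv i j :: 'N::finite uq) = rcoef (inverse qq) (- \<xi>) CARD('N) i j"
proof -
  let ?N = "CARD('N)" and ?T = "tmap (vrep :: 'N uq \<Rightarrow> mat) id"
  let ?R = "Rmat (inverse qq) (- \<xi>) ?N" and ?X = "smat ?N (\<lambda>i j. vrep (Linv i j :: 'N uq))"
  note lin = superalg_hom_linear[OF superalg_hom_vrep]
  have T: "superalg_hom ?T"
    by (rule superalg_hom_tmap[OF superalg_hom_vrep superalg_hom_id(2)])
  have "?X * Smat ?N = ?T (smat ?N Linv * uqL)"
    by (simp add: superalg_hom_mult[OF T] tmap_smat lin vrep_Lgen smat_rcoef Smat_eq_Rmat)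
  also have "\<dots> = idm ?N \<otimes> idm ?N"
    unfolding Linv_uqL by (simp add: tmap_id_tens(2) lin vrep_1)
  finally have XS: "?X * Smat ?N = idm ?N \<otimes> idm ?N" .
  have SR: "Smat ?N * ?R = idm ?N \<otimes> idm ?N"
    unfolding Smat_eq_Rmat by (rule Rmat_inverse) (simp_all add: \<xi>_def)
  have u: "idm ?N * vrep u = vrep u" "vrep u * idm ?N = vrep u" for u :: "'N uq"
    by (simp_all flip: vrep_1 superalg_hom_mult[OF superalg_hom_vrep])
  have "?X = ?X * (Smat ?N * ?R)"
    unfolding SR by (rule unit_smat(2)[symmetric]) (simp_all add: u homog_idm)
  also have "\<dots> = ?R"
    by (simp only: mult.assoc[symmetric] XS idm_Rmat)
  finally show ?thesis
    unfolding smat_rcoef[symmetric] using assms by (rule smat_entry)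
qed

text \<open>\<open>rr c x p i q j\<close> is the coefficient of \<open>v\<^sub>p \<otimes> v\<^sub>i\<close> in the image of \<open>v\<^sub>q \<otimes> v\<^sub>j\<close>.\<close>

definition rr :: "cq \<Rightarrow> cq \<Rightarrow> int \<Rightarrow> int \<Rightarrow> int \<Rightarrow> int \<Rightarrow> cq" where
  "rr c x p i q j = R1 c q j * of_bool (p = q \<and> i = j) + R2 x q j * of_bool (p = j \<and> i = q)
     + R3 x q j * of_bool (p = - j \<and> i = - q)"

lemma entry_rcoef:
  assumes "i \<in> idx N" "j \<in> idx N" "p \<in> idx N" "q \<in> idx N"
  shows "entry (rcoef c x N i j) p q = sgnp ((parity i + parity j) * parity q) * rr c x p i q j"
proof -
  have nz: "i \<noteq> 0" "j \<noteq> 0" "p \<noteq> 0" "q \<noteq> 0"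
    using assms by (auto dest: idx_nonzero)
  note lin = cqlinearD[OF cqlinear_entry]
  have 1: "entry (if i = j \<and> i \<in> idx N then \<Sum>k\<in>idx N. (c powi \<phi> k i) \<cdot> munit k k else 0) p q
      = sgnp ((parity i + parity j) * parity q) * (R1 c q j * of_bool (p = q \<and> i = j))"
  proof (cases "i = j")
    case True
    have "entry (\<Sum>k\<in>idx N. (c powi \<phi> k i) \<cdot> munit k k) p q = (\<Sum>k\<in>idx N. if k = q then c powi \<phi> k i * of_bool (p = q) else 0)"
      unfolding lin scl_cq_def munit.rep_eq by (intro sum.cong) auto
    with True show ?thesis
      using assms by (simp add: R1_def sum.delta')
  qed (simp add: zero_mat.rep_eq)
  have 2: "entry (if i \<in> idx N \<and> j \<in> idx N \<and> i < j then (x * sgnp (parity i)) \<cdot> (munit j i + munit (- j) (- i)) else 0) p q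
     = sgnp ((parity i + parity j) * parity q) * (R2 x q j * of_bool (p = j \<and> i = q) + R3 x q j * of_bool (p = - j \<and> i = - q))"
  proof -
    \<comment> \<open>For q = i and for q = -i, the sign in the claim times the sign in
      \<open>R2\<close> respectively \<open>R3\<close> reduces to the sign of |i| in the definition
      of S.\<close>
    have A: "sgnp ((parity i + parity j) * parity i) * sgnp (parity i * parity j) = sgnp (parity i)"
      by (cases "parity i"; cases "parity j") simp_all
    have B: "sgnp ((parity i + parity j) * parity (- i)) * sgnp (parity (- i) * parity j + parity (- i) + 1) = sgnp (parity i)"
      unfolding parity_neg[OF nz(1)] by (cases "parity i"; cases "parity j") simp_all
    show ?thesis
    proof (cases "p = j \<and> i = q")
      case True
      then show ?thesis
        using assms nz A by (auto simp: lin scl_cq_def munit.rep_eq zero_mat.rep_eq R2_def mult_ac)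
    next
      case F: False
      show ?thesis
      proof (cases "p = - j \<and> q = - i")
        case True
        with F show ?thesis
          using assms nz B by (auto simp: lin scl_cq_def munit.rep_eq zero_mat.rep_eq R3_def mult_ac)
      next
        case False
        with F show ?thesis
          by (auto simp: lin scl_cq_def munit.rep_eq zero_mat.rep_eq)
      qed
    qed
  qed
  show ?thesis
    unfolding rcoef_def lin 1 2 rr_def by (simp add: algebra_simps)
qed

section \<open>Actions and equivariant maps\<close>

text \<open>The sign twist by s|x|, defined also for inhomogeneous x. With s = 1 it is the sign in
  \<open>\<Phi>\<close>; with s the parity of a crossed element it is the sign of the tensor product
  action.\<close>

definition tw :: "bit \<Rightarrow> 'a::superspace \<Rightarrow> 'a" where
  "tw s x = hpart 0 x + sgnp s \<cdot> hpart 1 x"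

lemma cqlinear_tw: "cqlinear (tw s)"
  unfolding tw_def by (intro cqlinear_add cqlinear_scl cqlinear_hpart)

lemma tw_homog: "homog p x \<Longrightarrow> tw s x = sgnp (s * p) \<cdot> x"
  using bit_exhaust[of p] by (auto simp: tw_def hpart_homog)

text \<open>An action of the whole of \<open>uq\<close> on a whole type, which avoids side
  conditions in the algebra. Subspaces and subalgebras are handled separately by
  \<open>stable\<close>.\<close>

definition is_act :: "('N::finite uq \<Rightarrow> 'm::superspace \<Rightarrow> 'm) \<Rightarrow> bool" where
  "is_act F \<longleftrightarrow> bilin F \<and> (\<forall>x. F 1 x = x) \<and> (\<forall>u v x. F (u * v) x = F u (F v x)) \<and>
     (\<forall>p p' u x. homog p u \<longrightarrow> homog p' x \<longrightarrow> homog (p + p') (F u x))"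

lemma is_actD:
  assumes "is_act F"
  shows "bilin F" "F 1 x = x" "F (u * v) x = F u (F v x)"
    "homog p u \<Longrightarrow> homog p' x \<Longrightarrow> homog (p + p') (F u x)"
  using assms by (auto simp: is_act_def)

lemma is_act_linear: "is_act F \<Longrightarrow> cqlinear (F u)" "is_act F \<Longrightarrow> cqlinear (\<lambda>u. F u x)"
  using is_actD(1)[of F] by (auto simp: bilin_iff)

text \<open>The action of the tensor square of \<open>uq\<close>, before the comultiplication is
  inserted. With a free tensor in place of a coproduct, identities can be checked on elementary
  tensors.\<close>

definition act2 :: "('N::finite uq \<Rightarrow> 'm::superspace \<Rightarrow> 'm) \<Rightarrow> ('N uq \<Rightarrow> 'k::superspace \<Rightarrow> 'k)
    \<Rightarrow> ('N uq, 'N uq) tensor \<Rightarrow> ('m, 'k) tensor \<Rightarrow> ('m, 'k) tensor" where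
  "act2 F G w z = tlift (\<lambda>u1 u2. tlift (\<lambda>x y. \<Sum>p\<in>{0, 1}. \<Sum>p'\<in>{0, 1}.
     sgnp (p * p') \<cdot> (F u1 (hpart p x) \<otimes> G (hpart p' u2) y)) z) w"

definition tact :: "('N::finite uq \<Rightarrow> 'm::superspace \<Rightarrow> 'm) \<Rightarrow> ('N uq \<Rightarrow> 'k::superspace \<Rightarrow> 'k)
    \<Rightarrow> 'N uq \<Rightarrow> ('m, 'k) tensor \<Rightarrow> ('m, 'k) tensor" where
  "tact F G u z = act2 F G (comult u) z"

lemma tensor_act_eq: "tensor_act = tact \<Phi> \<Phi>"
  by (intro ext) (simp add: tensor_act_def tact_def act2_def)

lemma act2:
  assumes F: "is_act F" and G: "is_act G"
  shows bilin_act2: "bilin (act2 F G)"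
    and act2_homog: "homog p x \<Longrightarrow> homog p' u2 \<Longrightarrow>
      act2 F G (u1 \<otimes> u2) (x \<otimes> y) = sgnp (p * p') \<cdot> (F u1 x \<otimes> G u2 y)"
proof -
  note f = bilinD[OF is_actD(1)[OF F]] and g = bilinD[OF is_actD(1)[OF G]]
  have z: "F u 0 = 0" "G 0 y = 0" for u y
    using cqlinearD(3)[OF is_act_linear(1)[OF F]] cqlinearD(3)[OF is_act_linear(2)[OF G]] by auto
  let ?B = "\<lambda>u1 u2 x y. \<Sum>p\<in>{0, 1}. \<Sum>p'\<in>{0, 1}. sgnp (p * p') \<cdot> (F u1 (hpart p x) \<otimes> G (hpart p' u2) y)"
  have l: "cqlinear (\<lambda>u1. ?B u1 u2 x y)" "cqlinear (\<lambda>u2. ?B u1 u2 x y)" "cqlinear (\<lambda>x. ?B u1 u2 x y)" "cqlinear (\<lambda>y. ?B u1 u2 x y)"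
    for u1 u2 x y
    by (rule cqlinearI;
        simp add: hpart_add hpart_scl f g tens_lin scl_add_right cqs.scale_right_diff_distrib add_ac)+
  have b: "bilin (?B u1 u2)" for u1 u2
    unfolding bilin_iff using l by blast
  have b': "bilin (\<lambda>u1 u2. tlift (?B u1 u2) z)" for z
    unfolding bilin_iff using cqlinear_tlift_fun[of "\<lambda>u1. ?B u1 _", OF l(1)] cqlinear_tlift_fun[of "?B _", OF l(2)] by blast
  show "bilin (act2 F G)"
    unfolding bilin_iff act2_def
    by (intro conjI allI cqlinear_tlift[OF b'] cqlinear_tlift_fun cqlinear_tlift[OF b])
  show "act2 F G (u1 \<otimes> u2) (x \<otimes> y) = sgnp (p * p') \<cdot> (F u1 x \<otimes> G u2 y)"
    if "homog p x" "homog p' u2"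
    unfolding act2_def unfolding tlift_tens[OF b'] unfolding tlift_tens[OF b]
    using bit_exhaust[of p] bit_exhaust[of p']
    by (auto simp: hpart_homog[OF that(1)] hpart_homog[OF that(2)] z)
qed

lemma act2_linear:
  assumes "is_act F" "is_act G"
  shows "cqlinear (act2 F G w)" "cqlinear (\<lambda>w. act2 F G w z)"
  using bilin_act2[OF assms] by (auto simp: bilin_iff)

lemma act2_mult:
  fixes F :: "'N::finite uq \<Rightarrow> 'm::superspace \<Rightarrow> 'm" and G :: "'N uq \<Rightarrow> 'k::superspace \<Rightarrow> 'k"
  assumes F: "is_act F" and G: "is_act G"
  shows "act2 F G (w * w') z = act2 F G w (act2 F G w' z)"
proof (rule tensor_ext_homog[where t = w])
  note l = act2_linear[OF F G]
  show "cqlinear (\<lambda>w. act2 F G (w * w') z)" "cqlinear (\<lambda>w. act2 F G w (act2 F G w' z))"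
    by (rule cqlinear_compose[OF l(2) cqlinear_mult(2)] l(2))+
  fix p1 p2 and u1 u2 :: "'N uq" assume u: "homog p1 u1" "homog p2 u2"
  show "act2 F G (u1 \<otimes> u2 * w') z = act2 F G (u1 \<otimes> u2) (act2 F G w' z)"
  proof (rule tensor_ext_homog[where t = w'])
    show "cqlinear (\<lambda>w'. act2 F G (u1 \<otimes> u2 * w') z)" "cqlinear (\<lambda>w'. act2 F G (u1 \<otimes> u2) (act2 F G w' z))"
      by (rule cqlinear_compose[OF l(2) cqlinear_mult(1)] cqlinear_compose[OF l(1) l(2)])+
    fix q1 q2 and v1 v2 :: "'N uq" assume v: "homog q1 v1" "homog q2 v2"
    show "act2 F G (u1 \<otimes> u2 * v1 \<otimes> v2) z = act2 F G (u1 \<otimes> u2) (act2 F G (v1 \<otimes> v2) z)"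
    proof (rule tensor_ext_homog[where t = z, OF l(1) cqlinear_compose[OF l(1) l(1)]])
      fix px py and x :: 'm and y :: 'k assume x: "homog px x"
      have "act2 F G ((u1 * v1) \<otimes> (u2 * v2)) (x \<otimes> y)
          = sgnp (px * (p2 + q2)) \<cdot> (F u1 (F v1 x) \<otimes> G u2 (G v2 y))"
        by (simp only: act2_homog[OF F G x homog_mult[OF u(2) v(2)]] is_actD(3)[OF F] is_actD(3)[OF G])
      moreover have "act2 F G (u1 \<otimes> u2) (F v1 x \<otimes> G v2 y)
          = sgnp ((q1 + px) * p2) \<cdot> (F u1 (F v1 x) \<otimes> G u2 (G v2 y))"
        by (rule act2_homog[OF F G is_actD(4)[OF F v(1) x] u(2)])
      ultimately show "act2 F G (u1 \<otimes> u2 * v1 \<otimes> v2) (x \<otimes> y) = act2 F G (u1 \<otimes> u2) (act2 F G (v1 \<otimes> v2) (x \<otimes> y))"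
        by (simp add: times_tens_homog[OF u(2) v(1)] act2_homog[OF F G x v(2)] cqlinearD[OF l(1)] cqlinearD[OF l(2)]
            sgnp_mult_add mult_ac)
    qed
  qed
qed

lemma is_act_tact:
  fixes F :: "'N::finite uq \<Rightarrow> 'm::superspace \<Rightarrow> 'm" and G :: "'N uq \<Rightarrow> 'k::superspace \<Rightarrow> 'k"
  assumes F: "is_act F" and G: "is_act G"
  shows "is_act (tact F G)"
  unfolding is_act_def
proof (intro conjI allI impI)
  note l = act2_linear[OF F G]
  show "bilin (tact F G)"
    unfolding bilin_iff tact_def
    using l(1) cqlinear_compose[OF l(2) superalg_hom_linear[OF superalg_hom_comult]] by blast
  show "tact F G 1 x = x" for x
    by (rule tensor_ext_homog[where t = x])
       (simp_all add: tact_def l(1) cqlinear_id one_tensor_def act2_homog[OF F G _ homog_one]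
         is_actD(2)[OF F] is_actD(2)[OF G])
  show "tact F G (u * v) x = tact F G u (tact F G v x)" for u v x
    by (simp add: tact_def superalg_hom_mult[OF superalg_hom_comult] act2_mult[OF F G])
  have h: "act2 F G (hpart p w) (hpart p' z) = hpart (p + p') (act2 F G (hpart p w) (hpart p' z))" for p p' w z
  proof (rule tensor_ext_homog[where t = w])
    show "cqlinear (\<lambda>w. act2 F G (hpart p w) (hpart p' z))"
      "cqlinear (\<lambda>w. hpart (p + p') (act2 F G (hpart p w) (hpart p' z)))"
      by (rule cqlinear_compose[OF l(2) cqlinear_hpart] cqlinear_compose[OF cqlinear_hpart cqlinear_compose[OF l(2) cqlinear_hpart]])+
    fix p1 p2 and u1 u2 :: "'N uq" assume u: "homog p1 u1" "homog p2 u2"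
    show "act2 F G (hpart p (u1 \<otimes> u2)) (hpart p' z) = hpart (p + p') (act2 F G (hpart p (u1 \<otimes> u2)) (hpart p' z))"
    proof (rule tensor_ext_homog[where t = z])
      show "cqlinear (\<lambda>z. act2 F G (hpart p (u1 \<otimes> u2)) (hpart p' z))"
        "cqlinear (\<lambda>z. hpart (p + p') (act2 F G (hpart p (u1 \<otimes> u2)) (hpart p' z)))"
        by (rule cqlinear_compose[OF l(1) cqlinear_hpart] cqlinear_compose[OF cqlinear_hpart cqlinear_compose[OF l(1) cqlinear_hpart]])+
      fix px py and x :: 'm and y :: 'k assume xy: "homog px x" "homog py y"
      have "homog (p1 + p2 + (px + py)) (act2 F G (u1 \<otimes> u2) (x \<otimes> y))"
        using homog_tens[OF is_actD(4)[OF F u(1) xy(1)] is_actD(4)[OF G u(2) xy(2)]]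
        by (simp add: act2_homog[OF F G xy(1) u(2)] homog_scl add_ac)
      then show "act2 F G (hpart p (u1 \<otimes> u2)) (hpart p' (x \<otimes> y))
          = hpart (p + p') (act2 F G (hpart p (u1 \<otimes> u2)) (hpart p' (x \<otimes> y)))"
        by (auto simp: hpart_tens_homog[OF u] hpart_tens_homog[OF xy] cqlinearD[OF l(1)] cqlinearD[OF l(2)] homog_def)
    qed
  qed
  fix p p' and u :: "'N uq" and x :: "('m, 'k) tensor" assume "homog p u" "homog p' x"
  then show "homog (p + p') (tact F G u x)"
    using h[of p "comult u" p' x] even_map_homog[OF superalg_hom_even[OF superalg_hom_comult]]
    unfolding tact_def homog_def by metis
qed

text \<open>Coassociativity: both sides are values of one linear map on the triple tensor product of
  \<open>uq\<close>, taken at the two iterated coproducts of u.\<close>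

lemma tact_assocr:
  fixes F :: "'N::finite uq \<Rightarrow> 'm::superspace \<Rightarrow> 'm" and G :: "'N uq \<Rightarrow> 'k::superspace \<Rightarrow> 'k"
    and H :: "'N uq \<Rightarrow> 'l::superspace \<Rightarrow> 'l"
  assumes F: "is_act F" and G: "is_act G" and H: "is_act H"
  shows "assocr (tact (tact F G) H u z) = tact F (tact G H) u (assocr z)"
proof (rule tensor_ext_homog[where t = z])
  note FG = is_act_tact[OF F G] and GH = is_act_tact[OF G H]
  note lA = is_act_linear(1)[OF is_act_tact[OF FG H]] and lB = is_act_linear(1)[OF is_act_tact[OF F GH]]
  note la = cqlinear_assocr
  show "cqlinear (\<lambda>z. assocr (tact (tact F G) H u z))" "cqlinear (\<lambda>z. tact F (tact G H) u (assocr z))"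
    by (rule cqlinear_compose[OF la lA] cqlinear_compose[OF lB la])+
  fix ps pt and s :: "('m, 'k) tensor" and t :: 'l assume t: "homog pt t"
  show "assocr (tact (tact F G) H u (s \<otimes> t)) = tact F (tact G H) u (assocr (s \<otimes> t))"
  proof (rule tensor_ext_homog[where t = s])
    show "cqlinear (\<lambda>s. assocr (tact (tact F G) H u (s \<otimes> t)))"
      by (rule cqlinear_compose[OF la cqlinear_compose[OF lA cqlinear_tens(2)]])
    show "cqlinear (\<lambda>s. tact F (tact G H) u (assocr (s \<otimes> t)))"
      by (rule cqlinear_compose[OF lB cqlinear_compose[OF la cqlinear_tens(2)]])
    fix px py and x :: 'm and y :: 'k assume x: "homog px x" and y: "homog py y"
    \<comment> \<open>\<open>T\<close> lets three elements of \<open>uq\<close> act on x, y, t. The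
      twists are the signs for the second acting element to pass x and for the third to pass x and
      y.\<close>
    define T where "T = tlift (\<lambda>a. tlift (\<lambda>b c. F a x \<otimes> (G (tw px b) y \<otimes> H (tw (px + py) c) t)))"
    have lF: "cqlinear (\<lambda>a. F a x \<otimes> r)" for r
      by (rule cqlinear_compose[OF cqlinear_tens(2) is_act_linear(2)[OF F]])
    have bGH: "bilin (\<lambda>b c. F a x \<otimes> (G (tw px b) y \<otimes> H (tw (px + py) c) t))" for a
      by (rule bilin_compose[OF bilin_tens cqlinear_compose[OF is_act_linear(2)[OF G] cqlinear_tw]
            cqlinear_compose[OF is_act_linear(2)[OF H] cqlinear_tw] cqlinear_tens(1)])
    have bT: "bilin (\<lambda>a. tlift (\<lambda>b c. F a x \<otimes> (G (tw px b) y \<otimes> H (tw (px + py) c) t)))"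
      unfolding bilin_iff by (intro conjI allI cqlinear_tlift[OF bGH] cqlinear_tlift_fun lF)
    have T: "T (a \<otimes> (b \<otimes> c)) = (sgnp (px * pb) * sgnp ((px + py) * pc)) \<cdot> (F a x \<otimes> (G b y \<otimes> H c t))"
      if "homog pb b" "homog pc c" for a b c pb pc
      by (simp add: T_def tlift_tens[OF bT] tlift_tens[OF bGH] tw_homog[OF that(1)] tw_homog[OF that(2)]
          cqlinearD[OF is_act_linear(2)[OF G]] cqlinearD[OF is_act_linear(2)[OF H]] tens_lin)
    have lT: "cqlinear T"
      unfolding T_def by (rule cqlinear_tlift[OF bT])
    have 1: "assocr (act2 (tact F G) H w ((x \<otimes> y) \<otimes> t)) = T (assocr (tmap comult id w))" for w
    proof (rule tensor_ext_homog[where t = w])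
      show "cqlinear (\<lambda>w. assocr (act2 (tact F G) H w ((x \<otimes> y) \<otimes> t)))"
        by (rule cqlinear_compose[OF la act2_linear(2)[OF FG H]])
      show "cqlinear (\<lambda>w. T (assocr (tmap comult id w)))"
        by (rule cqlinear_compose[OF lT cqlinear_compose[OF la cqlinear_tmap[OF superalg_hom_linear[OF superalg_hom_comult] cqlinear_id']]])
      fix p1 pc and u1 c :: "'N uq" assume c: "homog pc c"
      have "sgnp ((px + py) * pc) \<cdot> assocr (act2 F G v (x \<otimes> y) \<otimes> H c t) = T (assocr (v \<otimes> c))" for v
      proof (rule tensor_ext_homog[where t = v])
        show "cqlinear (\<lambda>v. sgnp ((px + py) * pc) \<cdot> assocr (act2 F G v (x \<otimes> y) \<otimes> H c t))"
          by (rule cqlinear_scl[OF cqlinear_compose[OF la cqlinear_compose[OF cqlinear_tens(2) act2_linear(2)[OF F G]]]])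
        show "cqlinear (\<lambda>v. T (assocr (v \<otimes> c)))"
          by (rule cqlinear_compose[OF lT cqlinear_compose[OF la cqlinear_tens(2)]])
        fix pa pb and a b :: "'N uq" assume b: "homog pb b"
        show "sgnp ((px + py) * pc) \<cdot> assocr (act2 F G (a \<otimes> b) (x \<otimes> y) \<otimes> H c t) = T (assocr ((a \<otimes> b) \<otimes> c))"
          by (simp add: act2_homog[OF F G x b] tens_lin cqlinearD[OF la] assocr_tens T[OF b c] mult.commute)
      qed
      then show "assocr (act2 (tact F G) H (u1 \<otimes> c) ((x \<otimes> y) \<otimes> t)) = T (assocr (tmap comult id (u1 \<otimes> c)))"
        unfolding act2_homog[OF FG H homog_tens[OF x y] c] tmap_id_tens(2)[OF superalg_hom_linear[OF superalg_hom_comult]]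
        by (simp add: tact_def cqlinearD[OF la])
    qed
    have 2: "act2 F (tact G H) w (x \<otimes> (y \<otimes> t)) = T (tmap id comult w)" for w
    proof (rule tensor_ext_homog[where t = w])
      show "cqlinear (\<lambda>w. act2 F (tact G H) w (x \<otimes> (y \<otimes> t)))"
        by (rule act2_linear(2)[OF F GH])
      show "cqlinear (\<lambda>w. T (tmap id comult w))"
        by (rule cqlinear_compose[OF lT cqlinear_tmap[OF cqlinear_id' superalg_hom_linear[OF superalg_hom_comult]]])
      fix p1 p2 and a u2 :: "'N uq" assume u2: "homog p2 u2"
      have "F a x \<otimes> act2 G H (tw px v) (y \<otimes> t) = T (a \<otimes> v)" for v
      proof (rule tensor_ext_homog[where t = v])
        show "cqlinear (\<lambda>v. F a x \<otimes> act2 G H (tw px v) (y \<otimes> t))"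
          by (rule cqlinear_compose[OF cqlinear_tens(1) cqlinear_compose[OF act2_linear(2)[OF G H] cqlinear_tw]])
        show "cqlinear (\<lambda>v. T (a \<otimes> v))"
          by (rule cqlinear_compose[OF lT cqlinear_tens(1)])
        fix pb pc and b c :: "'N uq" assume bc: "homog pb b" "homog pc c"
        show "F a x \<otimes> act2 G H (tw px (b \<otimes> c)) (y \<otimes> t) = T (a \<otimes> (b \<otimes> c))"
          by (simp add: tw_homog[OF homog_tens[OF bc]] cqlinearD[OF act2_linear(2)[OF G H]] act2_homog[OF G H y bc(2)]
              tens_lin T[OF bc] sgnp_mult_add mult_ac)
      qed
      from this[of "comult u2"]
      show "act2 F (tact G H) (a \<otimes> u2) (x \<otimes> (y \<otimes> t)) = T (tmap id comult (a \<otimes> u2))"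
        unfolding act2_homog[OF F GH x u2] tmap_id_tens(1)[OF superalg_hom_linear[OF superalg_hom_comult]]
        by (simp add: tact_def tw_homog[OF even_map_homog[OF superalg_hom_even[OF superalg_hom_comult] u2]]
            cqlinearD[OF act2_linear(2)[OF G H]] tens_lin)
    qed
    show "assocr (tact (tact F G) H u ((x \<otimes> y) \<otimes> t)) = tact F (tact G H) u (assocr ((x \<otimes> y) \<otimes> t))"
      unfolding tact_def[of "tact F G"] tact_def[of F "tact G H"] assocr_tens 1 2 coassoc ..
  qed
qed

lemma tact_assocl:
  assumes "is_act F" "is_act G" "is_act H"
  shows "assocl (tact F (tact G H) u z) = tact (tact F G) H u (assocl z)"
  by (metis tact_assocr[OF assms] assocl_assocr assocr_assocl)

subsection \<open>Stable subspaces\<close>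

definition hsub :: "'a::superspace set \<Rightarrow> bool" where
  "hsub X \<longleftrightarrow> cqsubspace X \<and> (\<forall>p. \<forall>x\<in>X. hpart p x \<in> X)"

definition stable :: "'N::finite uq set \<Rightarrow> ('N uq \<Rightarrow> 'm::superspace \<Rightarrow> 'm) \<Rightarrow> 'm set \<Rightarrow> bool" where
  "stable U F X \<longleftrightarrow> hsub X \<and> (\<forall>u\<in>U. \<forall>x\<in>X. F u x \<in> X)"

definition sub_coalg :: "'N::finite uq set \<Rightarrow> bool" where
  "sub_coalg U \<longleftrightarrow> hsub U \<and> (\<forall>u\<in>U. comult u \<in> tensor_sub U U)"

lemma hsubD:
  assumes "hsub X"
  shows "0 \<in> X" "x \<in> X \<Longrightarrow> y \<in> X \<Longrightarrow> x + y \<in> X" "x \<in> X \<Longrightarrow> c \<cdot> x \<in> X" "x \<in> X \<Longrightarrow> hpart p x \<in> X"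
  using assms cqs.subspace_0 cqs.subspace_add cqs.subspace_scale by (auto simp: hsub_def)

lemma hsub_sum: "hsub X \<Longrightarrow> (\<And>i. i \<in> I \<Longrightarrow> f i \<in> X) \<Longrightarrow> sum f I \<in> X"
  by (auto simp: hsub_def intro: cqs.subspace_sum)

lemma hsubI_span:
  assumes "\<And>g. g \<in> G \<Longrightarrow> \<exists>p. homog p g"
  shows "hsub (cqspan G)"
  unfolding hsub_def
proof (intro conjI allI ballI cqs.subspace_span)
  fix p x assume "x \<in> cqspan G"
  then show "hpart p x \<in> cqspan G"
  proof (induction rule: cqs.span_induct_alt)
    case (step c g y)
    obtain p' where "homog p' g" using assms[OF step(1)] by blast
    then have "hpart p g \<in> cqspan G"
      using step(1) by (simp add: hpart_homog cqs.span_base cqs.span_zero)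
    with step show ?case
      by (simp add: hpart_add hpart_scl cqs.span_add cqs.span_scale)
  qed (simp add: cqs.span_zero)
qed

lemma tensor_sub_tens: "x \<in> X \<Longrightarrow> y \<in> Y \<Longrightarrow> x \<otimes> y \<in> tensor_sub X Y"
  unfolding tensor_sub_def by (rule cqs.span_base) blast

lemma tensor_sub_closed:
  "z \<in> tensor_sub X Y \<Longrightarrow> z' \<in> tensor_sub X Y \<Longrightarrow> z + z' \<in> tensor_sub X Y"
  "z \<in> tensor_sub X Y \<Longrightarrow> c \<cdot> z \<in> tensor_sub X Y" "0 \<in> tensor_sub X Y"
  unfolding tensor_sub_def by (auto intro: cqs.span_add cqs.span_scale cqs.span_zero)

lemma tensor_sub_mono: "X \<subseteq> X' \<Longrightarrow> Y \<subseteq> Y' \<Longrightarrow> tensor_sub X Y \<subseteq> tensor_sub X' Y'"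
  unfolding tensor_sub_def by (rule cqs.span_mono) blast

lemma tensor_sub_induct [consumes 3, case_names tens add]:
  assumes "z \<in> tensor_sub X Y" and X: "hsub X" and Y: "hsub Y"
    and "\<And>p p' x y. x \<in> X \<Longrightarrow> y \<in> Y \<Longrightarrow> homog p x \<Longrightarrow> homog p' y \<Longrightarrow> P (x \<otimes> y)"
    and add: "\<And>z z'. z \<in> tensor_sub X Y \<Longrightarrow> z' \<in> tensor_sub X Y \<Longrightarrow> P z \<Longrightarrow> P z' \<Longrightarrow> P (z + z')"
  shows "P z"
proof -
  have t: "P (x \<otimes> y)" if "x \<in> X" "y \<in> Y" for x y
  proof -
    have e: "x \<otimes> y = (hpart 0 x \<otimes> hpart 0 y + hpart 0 x \<otimes> hpart 1 y) + (hpart 1 x \<otimes> hpart 0 y + hpart 1 x \<otimes> hpart 1 y)"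
      unfolding tens_lin(1,3)[symmetric] hpart_sum ..
    show ?thesis
      unfolding e
      by (intro add tensor_sub_closed tensor_sub_tens hsubD(4)[OF X] hsubD(4)[OF Y] that
          assms(4)[OF _ _ homog_hpart homog_hpart])
  qed
  from assms(1) have "z \<in> tensor_sub X Y \<and> P z"
    unfolding tensor_sub_def
  proof (induction rule: cqs.span_induct_alt)
    case base
    then show ?case
      using t[OF hsubD(1)[OF X] hsubD(1)[OF Y]] by (simp add: cqs.span_zero)
  next
    case (step c w z)
    then obtain x y where w: "w = x \<otimes> y" "x \<in> X" "y \<in> Y" by blast
    have "c \<cdot> w = (c \<cdot> x) \<otimes> y" by (simp add: w tens_lin)
    then have "P (c \<cdot> w)" "c \<cdot> w \<in> tensor_sub X Y"
      using t[OF hsubD(3)[OF X w(2)] w(3)] tensor_sub_tens[OF hsubD(3)[OF X w(2)] w(3)] by auto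
    with step add[of "c \<cdot> w" z] show ?case
      by (simp add: tensor_sub_def cqs.span_add)
  qed
  then show ?thesis by blast
qed

lemma hsub_tensor_sub:
  assumes "hsub X" "hsub Y"
  shows "hsub (tensor_sub X Y)"
  unfolding hsub_def
proof (intro conjI allI ballI)
  show "cqsubspace (tensor_sub X Y)"
    unfolding tensor_sub_def by (rule cqs.subspace_span)
  fix p z assume "z \<in> tensor_sub X Y"
  then show "hpart p z \<in> tensor_sub X Y"
    using assms
    by (induction rule: tensor_sub_induct)
       (auto simp: hpart_tens_homog hpart_add tensor_sub_tens tensor_sub_closed)
qed

lemma stable_tensor_sub:
  assumes U: "sub_coalg U" and F: "is_act F" "stable U F X" and G: "is_act G" "stable U G Y"
  shows "stable U (tact F G) (tensor_sub X Y)"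
proof -
  have X: "hsub X" "\<And>u x. u \<in> U \<Longrightarrow> x \<in> X \<Longrightarrow> F u x \<in> X" and Y: "hsub Y" "\<And>u y. u \<in> U \<Longrightarrow> y \<in> Y \<Longrightarrow> G u y \<in> Y"
    and hU: "hsub U"
    using F(2) G(2) U by (auto simp: stable_def sub_coalg_def)
  have "act2 F G w z \<in> tensor_sub X Y" if "w \<in> tensor_sub U U" "z \<in> tensor_sub X Y" for w z
    using that(1) hU hU
  proof (induction rule: tensor_sub_induct)
    case (tens p1 p2 u1 u2)
    from that(2) X(1) Y(1) show ?case
    proof (induction rule: tensor_sub_induct)
      case (tens px py x y)
      then show ?case
        using \<open>u1 \<in> U\<close> \<open>u2 \<in> U\<close>
        by (simp add: act2_homog[OF F(1) G(1) tens(3) \<open>homog p2 u2\<close>] X Y tensor_sub_tens tensor_sub_closed)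
    qed (simp add: cqlinearD[OF act2_linear(1)[OF F(1) G(1)]] tensor_sub_closed)
  qed (simp add: cqlinearD[OF act2_linear(2)[OF F(1) G(1)]] tensor_sub_closed)
  then show ?thesis
    using U by (auto simp: stable_def tact_def sub_coalg_def hsub_tensor_sub X(1) Y(1))
qed

text \<open>\<open>f\<close> is linear on the whole type, as \<Upsilon> is, while parity and
  equivariance are demanded only on \<open>X\<close>. The flexibility in \<open>X\<close> is what
  the spreading argument lives on.\<close>

definition mhom :: "'N::finite uq set \<Rightarrow> ('N uq \<Rightarrow> 'm::superspace \<Rightarrow> 'm) \<Rightarrow> ('N uq \<Rightarrow> 'k::superspace \<Rightarrow> 'k)
    \<Rightarrow> 'm set \<Rightarrow> ('m \<Rightarrow> 'k) \<Rightarrow> bool" where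
  "mhom U F G X f \<longleftrightarrow> cqlinear f \<and> (\<forall>p. \<forall>x\<in>X. f (hpart p x) = hpart p (f x)) \<and>
     (\<forall>u\<in>U. \<forall>x\<in>X. f (F u x) = G u (f x))"

lemma mhomD:
  assumes "mhom U F G X f"
  shows "cqlinear f" "x \<in> X \<Longrightarrow> f (hpart p x) = hpart p (f x)" "u \<in> U \<Longrightarrow> x \<in> X \<Longrightarrow> f (F u x) = G u (f x)"
    "x \<in> X \<Longrightarrow> homog p x \<Longrightarrow> homog p (f x)"
  using assms unfolding mhom_def homog_def by metis+

lemma mhom_mono: "mhom U F G X f \<Longrightarrow> Y \<subseteq> X \<Longrightarrow> mhom U F G Y f"
  by (auto simp: mhom_def)

lemma mhom_compose:
  assumes "mhom U F G X f" "mhom U G H Y g" "f ` X \<subseteq> Y"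
  shows "mhom U F H X (\<lambda>x. g (f x))"
  using assms cqlinear_compose[of g f] by (auto simp: mhom_def image_subset_iff)

lemma mhom_id: "mhom U F F X id"
  by (simp add: mhom_def cqlinear_id')

lemma tmap_tensor_sub:
  assumes "cqlinear f" "cqlinear g" "f ` X \<subseteq> X'" "g ` Y \<subseteq> Y'" "hsub X" "hsub Y"
  shows "tmap f g ` tensor_sub X Y \<subseteq> tensor_sub X' Y'"
proof
  fix w assume "w \<in> tmap f g ` tensor_sub X Y"
  then obtain z where z: "z \<in> tensor_sub X Y" "w = tmap f g z" by blast
  from z(1) assms(5,6) have "tmap f g z \<in> tensor_sub X' Y'"
    by (induction rule: tensor_sub_induct)
       (use assms in \<open>auto simp: tmap_tens cqlinearD[OF cqlinear_tmap] tensor_sub_tens tensor_sub_closed image_subset_iff\<close>)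
  then show "w \<in> tensor_sub X' Y'" by (simp add: z)
qed

lemma assocl_tensor_sub:
  assumes "hsub X" "hsub Y" "hsub Z"
  shows "assocl ` tensor_sub X (tensor_sub Y Z) \<subseteq> tensor_sub (tensor_sub X Y) Z"
proof
  fix w assume "w \<in> assocl ` tensor_sub X (tensor_sub Y Z)"
  then obtain z where z: "z \<in> tensor_sub X (tensor_sub Y Z)" "w = assocl z" by blast
  from z(1) assms(1) hsub_tensor_sub[OF assms(2,3)] have "assocl z \<in> tensor_sub (tensor_sub X Y) Z"
  proof (induction rule: tensor_sub_induct)
    case (tens p p' x t)
    from tens(2) assms(2,3) show ?case
      by (induction rule: tensor_sub_induct)
         (auto simp: tens_lin cqlinearD[OF cqlinear_assocl] assocl_tens tens(1) tensor_sub_tens tensor_sub_closed)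
  qed (simp add: cqlinearD[OF cqlinear_assocl] tensor_sub_closed)
  then show "w \<in> tensor_sub (tensor_sub X Y) Z" by (simp add: z)
qed

lemma assocr_tensor_sub:
  assumes "hsub X" "hsub Y" "hsub Z"
  shows "assocr ` tensor_sub (tensor_sub X Y) Z \<subseteq> tensor_sub X (tensor_sub Y Z)"
proof
  fix w assume "w \<in> assocr ` tensor_sub (tensor_sub X Y) Z"
  then obtain z where z: "z \<in> tensor_sub (tensor_sub X Y) Z" "w = assocr z" by blast
  from z(1) hsub_tensor_sub[OF assms(1,2)] assms(3) have "assocr z \<in> tensor_sub X (tensor_sub Y Z)"
  proof (induction rule: tensor_sub_induct)
    case (tens p p' t y)
    from tens(1) assms(1,2) show ?case
      by (induction rule: tensor_sub_induct)
         (auto simp: tens_lin cqlinearD[OF cqlinear_assocr] assocr_tens tens(2) tensor_sub_tens tensor_sub_closed)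
  qed (simp add: cqlinearD[OF cqlinear_assocr] tensor_sub_closed)
  then show "w \<in> tensor_sub X (tensor_sub Y Z)" by (simp add: z)
qed

lemma mhom_tmap:
  assumes U: "sub_coalg U" and acts: "is_act F" "is_act F'" "is_act G" "is_act G'"
    and X: "stable U F X" and Y: "stable U G Y"
    and f: "mhom U F F' X f" and g: "mhom U G G' Y g"
  shows "mhom U (tact F G) (tact F' G') (tensor_sub X Y) (tmap f g)"
proof -
  have hX: "hsub X" and hY: "hsub Y" and hU: "hsub U"
    using X Y U by (auto simp: stable_def sub_coalg_def)
  note lf = mhomD(1)[OF f] and lg = mhomD(1)[OF g]
  note l = cqlinear_tmap[OF lf lg] and l2 = act2_linear[OF acts(1,3)] and l2' = act2_linear[OF acts(2,4)]
  have "tmap f g (hpart p z) = hpart p (tmap f g z)" if "z \<in> tensor_sub X Y" for p z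
    using that hX hY
  proof (induction rule: tensor_sub_induct)
    case (tens px py x y)
    show ?case
      using hpart_tens_homog[OF tens(3,4)] hpart_tens_homog[OF mhomD(4)[OF f tens(1,3)] mhomD(4)[OF g tens(2,4)]]
      by (auto simp: tmap_tens[OF lf lg] cqlinearD[OF l])
  qed (simp add: hpart_add cqlinearD[OF l])
  moreover have "tmap f g (act2 F G w z) = act2 F' G' w (tmap f g z)"
    if "w \<in> tensor_sub U U" "z \<in> tensor_sub X Y" for w z
    using that(1) hU hU
  proof (induction rule: tensor_sub_induct)
    case (tens p1 p2 u1 u2)
    from that(2) hX hY show ?case
    proof (induction rule: tensor_sub_induct)
      case (tens px py x y)
      show ?case
        using \<open>u1 \<in> U\<close> \<open>u2 \<in> U\<close> tens(1,2)
        by (simp add: act2_homog[OF acts(1,3) tens(3) \<open>homog p2 u2\<close>] tmap_tens[OF lf lg] cqlinearD[OF l]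
            act2_homog[OF acts(2,4) mhomD(4)[OF f tens(1,3)] \<open>homog p2 u2\<close>] mhomD(3)[OF f] mhomD(3)[OF g])
    qed (simp add: cqlinearD[OF l2(1)] cqlinearD[OF l2'(1)] cqlinearD[OF l])
  qed (simp add: cqlinearD[OF l2(2)] cqlinearD[OF l2'(2)] cqlinearD[OF l])
  ultimately show ?thesis
    using U l by (auto simp: mhom_def tact_def sub_coalg_def)
qed

lemma mhom_assocl:
  assumes "is_act F" "is_act G" "is_act H"
  shows "mhom U (tact F (tact G H)) (tact (tact F G) H) X assocl"
  by (simp add: mhom_def cqlinear_assocl even_map_hpart[OF even_map_assocl] tact_assocl[OF assms])

lemma mhom_assocr:
  assumes "is_act F" "is_act G" "is_act H"
  shows "mhom U (tact (tact F G) H) (tact F (tact G H)) X assocr"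
  by (simp add: mhom_def cqlinear_assocr even_map_hpart[OF even_map_assocr] tact_assocr[OF assms])

text \<open>The descent step. With \<open>h\<close> a multiplication or the insertion of a unit, and
  \<open>R\<close> the composite that an axiom of \<Upsilon> equates with \<open>f\<close> after
  \<open>h\<close>, equivariance of \<open>h\<close> and \<open>R\<close> passes to \<open>f\<close>
  on the image. Stability of \<open>V\<close> is what allows the action to be moved through
  \<open>h\<close>.\<close>

lemma mhom_factor:
  assumes h: "mhom U F G V h" and R: "mhom U F H V R" and V: "stable U F V"
    and f: "cqlinear f" "\<And>v. v \<in> V \<Longrightarrow> f (h v) = R v" and Z: "Z \<subseteq> h ` V"
  shows "mhom U G H Z f"
proof -
  have "f (hpart p (h v)) = hpart p (f (h v))" if "v \<in> V" for p v
    using that V mhomD(2)[OF h that, symmetric] mhomD(2)[OF R that] f(2)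
    by (simp add: stable_def hsubD(4))
  moreover have "f (G u (h v)) = H u (f (h v))" if "u \<in> U" "v \<in> V" for u v
    using that V mhomD(3)[OF h that, symmetric] mhomD(3)[OF R that] f(2)
    by (simp add: stable_def)
  ultimately show ?thesis
    using f(1) Z by (auto simp: mhom_def image_iff subset_iff)
qed

lemma stable_image:
  assumes V: "stable U F V" and h: "mhom U F G V h"
  shows "stable U G (h ` V)"
proof -
  have "hpart p (h v) \<in> h ` V" if "v \<in> V" for p v
    using that V mhomD(2)[OF h that, of p, symmetric] by (simp add: stable_def hsubD(4))
  moreover have "G u (h v) \<in> h ` V" if "u \<in> U" "v \<in> V" for u v
    using that V mhomD(3)[OF h that, symmetric] by (simp add: stable_def)
  moreover have "cqsubspace (h ` V)"
  proof (rule cqs.subspaceI)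
    show "0 \<in> h ` V"
      using V cqlinearD(3)[OF mhomD(1)[OF h]] hsubD(1)[of V] by (force simp: stable_def)
    fix a b c assume "a \<in> h ` V"
    then obtain v where v: "v \<in> V" "a = h v" by blast
    then show "c \<cdot> a \<in> h ` V"
      using V hsubD(3)[of V v c] cqlinearD(2)[OF mhomD(1)[OF h], of c v] by (force simp: stable_def)
    assume "b \<in> h ` V"
    then obtain v' where v': "v' \<in> V" "b = h v'" by blast
    with v show "a + b \<in> h ` V"
      using V hsubD(2)[of V v v'] cqlinearD(1)[OF mhomD(1)[OF h], of v v'] by (force simp: stable_def)
  qed
  ultimately show ?thesis
    by (auto simp: stable_def hsub_def)
qed

lemma supermodule_on_stable:
  assumes "is_act F" "stable U F X"
  shows "supermodule_on U F X"
  using assms(2) bilinD[OF is_actD(1)[OF assms(1)]] is_actD(2-4)[OF assms(1)]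
  unfolding supermodule_on_def stable_def hsub_def by simp

section \<open>The dual superalgebra\<close>

lemma pair_simps [simp]:
  "pair 0 u = 0" "pair (f + g) u = pair f u + pair g u" "pair (c \<cdot> f) u = c * pair f u"
  by (simp_all add: zero_dual.rep_eq plus_dual.rep_eq scl_dual.rep_eq scl_cq_def)

lemma cqlinear_pair_left: "cqlinear (\<lambda>f. pair f u)"
  by (rule cqlinearI) (simp_all add: scl_cq_def)

lemmas pair_sum [simp] = cqlinearD(6)[OF cqlinear_pair_left]

lemma pair_Abs: "cqlinear f \<Longrightarrow> pair (Abs_dual f) u = f u"
  by (simp add: Abs_dual_inverse)

lemma dual_eqI_homog:
  fixes f g :: "'a::superspace dual"
  assumes "\<And>q u. homog q u \<Longrightarrow> pair f u = pair g u"
  shows "f = g"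
proof (rule dual_eqI)
  fix u show "pair f u = pair g u"
    by (induction u rule: homog_decomp) (simp_all add: assms cqlinearD(1)[OF cqlinear_pair])
qed

lemma homog_dualI:
  assumes "\<And>q u. homog q u \<Longrightarrow> q \<noteq> p \<Longrightarrow> pair f u = 0"
  shows "homog p f"
  unfolding homog_def
  by (rule dual_eqI_homog) (use assms in \<open>auto simp: hpart_dual.rep_eq hpart_homog cqlinearD(3)[OF cqlinear_pair]\<close>)

lemma homog_dualD:
  assumes "homog p f" "homog q u"
  shows "pair f u = 0 \<or> q = p"
proof -
  have "pair (hpart p f) u = pair f u"
    using assms(1) by (simp add: homog_def)
  then show ?thesis
    by (auto simp: hpart_dual.rep_eq hpart_homog[OF assms(2)] cqlinearD(3)[OF cqlinear_pair] split: if_splits)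
qed

text \<open>The pairing of two functionals with a tensor, before the comultiplication is inserted;
  the product of the dual is its transpose along \<open>comult\<close>.\<close>

definition mpair :: "'N::finite uq dual \<Rightarrow> 'N uq dual \<Rightarrow> ('N uq, 'N uq) tensor \<Rightarrow> cq" where
  "mpair f f' = tlift (\<lambda>u1 u2. \<Sum>p\<in>{0, 1}. \<Sum>p'\<in>{0, 1}.
     sgnp (p' * p) * pair f (hpart p u1) * pair (hpart p' f') u2)"

lemma mpair:
  shows cqlinear_mpair: "cqlinear (mpair f f')"
    and mpair_homog: "homog p1 u1 \<Longrightarrow> homog p2 u2 \<Longrightarrow> mpair f f' (u1 \<otimes> u2) = sgnp (p2 * p1) * pair f u1 * pair f' u2"
proof -
  let ?B = "\<lambda>u1 u2. \<Sum>p\<in>{0, 1}. \<Sum>p'\<in>{0, 1}. sgnp (p' * p) * pair f (hpart p u1) * pair (hpart p' f') u2"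
  note l = cqlinearD[OF cqlinear_pair]
  have B: "bilin ?B"
    by (rule bilinI) (simp_all add: l hpart_add hpart_scl scl_cq_def algebra_simps)
  show "cqlinear (mpair f f')"
    unfolding mpair_def by (rule cqlinear_tlift[OF B])
  show "mpair f f' (u1 \<otimes> u2) = sgnp (p2 * p1) * pair f u1 * pair f' u2" if "homog p1 u1" "homog p2 u2"
    unfolding mpair_def tlift_tens[OF B] using bit_exhaust[of p1] bit_exhaust[of p2]
    by (auto simp: hpart_homog[OF that(1)] hpart_homog[OF that(2)] hpart_dual.rep_eq l)
qed

lemma pair_dual_mult: "pair (dual_mult f f') u = mpair f f' (comult u)"
proof -
  have "cqlinear (\<lambda>u. mpair f f' (comult u))"
    by (rule cqlinear_compose[OF cqlinear_mpair superalg_hom_linear[OF superalg_hom_comult]])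
  then show ?thesis
    unfolding dual_mult_def mpair_def by (rule pair_Abs)
qed

lemma bilin_mpair: "bilin (\<lambda>f f'. mpair f f' z)"
proof -
  have 1: "mpair (f + g) f' z = mpair f f' z + mpair g f' z" "mpair f (f' + g) z = mpair f f' z + mpair f g z" for f g f'
    by (rule tensor_ext_homog[where t = z];
        simp add: cqlinear_mpair cqlinear_add mpair_homog algebra_simps)+
  have 2: "mpair (c \<cdot> f) f' z = c \<cdot> mpair f f' z" "mpair f (c \<cdot> f') z = c \<cdot> mpair f f' z" for c f f'
    by (rule tensor_ext_homog[where t = z, OF cqlinear_mpair cqlinear_scl[OF cqlinear_mpair]];
        simp add: mpair_homog scl_cq_def)+
  show ?thesis
    by (rule bilinI) (simp_all add: 1 2)
qed

lemma bilin_dual_mult: "bilin dual_mult"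
  by (rule bilinI; rule dual_eqI)
     (simp_all add: pair_dual_mult bilinD[OF bilin_mpair] scl_cq_def)

lemma homog_dual_mult:
  fixes f f' :: "'N::finite uq dual"
  assumes "homog p f" "homog p' f'"
  shows "homog (p + p') (dual_mult f f')"
proof (rule homog_dualI)
  fix q and u :: "'N uq" assume u: "homog q u" "q \<noteq> p + p'"
  have "mpair f f' (hpart q z) = 0" for z
  proof (rule tensor_ext_homog[where t = z and g = "\<lambda>_. 0"])
    show "cqlinear (\<lambda>z. mpair f f' (hpart q z))"
      by (rule cqlinear_compose[OF cqlinear_mpair cqlinear_hpart])
    show "cqlinear (\<lambda>_. 0 :: cq)"
      by (rule cqlinearI) simp_all
    fix p1 p2 and u1 u2 :: "'N uq" assume h: "homog p1 u1" "homog p2 u2"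
    show "mpair f f' (hpart q (u1 \<otimes> u2)) = 0"
      using homog_dualD[OF assms(1) h(1)] homog_dualD[OF assms(2) h(2)] u(2)
      by (auto simp: hpart_tens_homog[OF h] cqlinearD(3)[OF cqlinear_mpair] mpair_homog[OF h])
  qed
  from this[of "comult u"] show "pair (dual_mult f f') u = 0"
    using even_map_homog[OF superalg_hom_even[OF superalg_hom_comult] u(1)]
    by (simp add: pair_dual_mult homog_def)
qed

lemma pair_dual_one: "pair dual_one u = counit u"
  unfolding dual_one_def by (rule pair_Abs[OF superalg_hom_linear[OF superalg_hom_counit]])

lemma homog_dual_one: "homog 0 dual_one"
  by (rule homog_dualI) (use counit_homog in \<open>auto simp: pair_dual_one\<close>)

subsection \<open>The action\<close>

lemma pair_Phi: "pair (\<Phi> u f) u' = pair f (u' * tw 1 u)"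
proof -
  note l = cqlinearD[OF cqlinear_pair]
  have "cqlinear (\<lambda>u'. \<Sum>p\<in>{0, 1}. sgnp p * pair f (u' * hpart p u))"
    by (rule cqlinearI) (simp_all add: l distrib_right scl_mult_left scl_cq_def algebra_simps)
  from pair_Abs[OF this] show ?thesis
    by (simp add: \<Phi>_def tw_def distrib_left right_diff_distrib scl_mult_right l scl_cq_def)
qed

lemma tw_1: "tw s (1 :: 'a::superalgebra_1) = 1"
  by (simp add: tw_def)

lemma tw_mult: "tw s (u * v :: 'a::superalgebra) = tw s u * tw s v"
proof -
  have "tw s (u * v) = tw s u * tw s v" if u: "homog p u" for p u
  proof (induction v rule: homog_decomp)
    case (2 q v)
    then show ?case
      by (simp add: tw_homog[OF homog_mult[OF u 2]] tw_homog[OF u] tw_homog[OF 2] scl_mult_left scl_mult_right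
          sgnp_mult_add mult.commute)
  qed (simp add: distrib_left cqlinearD[OF cqlinear_tw])
  then show ?thesis
    by (induction u rule: homog_decomp) (simp_all add: distrib_right cqlinearD[OF cqlinear_tw])
qed

lemma even_map_tw: "even_map f \<Longrightarrow> f (tw s x) = tw s (f x)"
  by (simp add: tw_def cqlinearD[OF even_map_linear] even_map_hpart)

text \<open>Translation of the argument on the right gives a left action on functionals. The sign is
  harmless because the twist \<open>tw 1\<close> is multiplicative.\<close>

lemma is_act_Phi: "is_act (\<Phi> :: 'a::finite uq \<Rightarrow> _)"
  unfolding is_act_def
proof (intro conjI allI impI)
  show "bilin (\<Phi> :: 'a uq \<Rightarrow> _)"
    by (rule bilinI; rule dual_eqI)
       (simp_all add: pair_Phi cqlinearD[OF cqlinear_tw] distrib_left scl_mult_right cqlinearD[OF cqlinear_pair] scl_cq_def)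
  show "\<Phi> 1 x = x" for x :: "'a uq dual"
    by (rule dual_eqI) (simp add: pair_Phi tw_1)
  show "\<Phi> (u * v) x = \<Phi> u (\<Phi> v x)" for u v :: "'a uq" and x
    by (rule dual_eqI) (simp add: pair_Phi tw_mult mult.assoc)
  show "homog (p + p') (\<Phi> u x)" if "homog p u" "homog p' x" for p p' and u :: "'a uq" and x
  proof (rule homog_dualI)
    fix q and v :: "'a uq" assume v: "homog q v" "q \<noteq> p + p'"
    then show "pair (\<Phi> u x) v = 0"
      using homog_dualD[OF that(2) homog_mult[OF v(1) that(1)]]
      by (auto simp: pair_Phi tw_homog[OF that(1)] scl_mult_right cqlinearD[OF cqlinear_pair] scl_cq_def)
  qed
qed

lemma Phi_dual_one: "\<Phi> u dual_one = counit u \<cdot> dual_one"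
proof (rule dual_eqI)
  fix u'
  \<comment> \<open>The twist only alters the odd part, which the counit kills.\<close>
  have "counit (tw 1 u) = counit u"
    using counit_homog[OF homog_hpart, of 1 u] counit_lin(1)[of "hpart 0 u" "hpart 1 u"]
    by (simp add: tw_def counit_lin hpart_sum)
  then show "pair (\<Phi> u dual_one) u' = pair (counit u \<cdot> dual_one) u'"
    by (simp add: pair_Phi pair_dual_one superalg_hom_mult[OF superalg_hom_counit])
qed

lemmas Phi_linear = is_act_linear[OF is_act_Phi]

text \<open>On \<open>dual_one\<close> the action is through the counit, and the counit axiom
  contracts the coproduct.\<close>

lemma act_dual_one:
  fixes g :: "'a::finite uq dual"
  shows
  "tact \<Phi> \<Phi> u (g \<otimes> dual_one) = \<Phi> u g \<otimes> dual_one"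
  "tact \<Phi> \<Phi> u (dual_one \<otimes> g) = dual_one \<otimes> \<Phi> u g"
proof -
  note l = act2_linear[OF is_act_Phi is_act_Phi]
  have 1: "act2 \<Phi> \<Phi> w (g \<otimes> dual_one) = \<Phi> (tlift (\<lambda>x y. counit y \<cdot> x) w) g \<otimes> dual_one" if g: "homog p g" for g :: "'a uq dual" and w p
  proof (rule tensor_ext_homog[where t = w, OF l(2)])
    show "cqlinear (\<lambda>w. \<Phi> (tlift (\<lambda>x y. counit y \<cdot> x) w) g \<otimes> dual_one)"
      by (rule cqlinear_compose[OF cqlinear_tens(2) cqlinear_compose[OF Phi_linear(2) cqlinear_tlift[OF bilin_counit(2)]]])
    fix p1 p2 and u1 u2 :: "'a uq" assume "homog p2 u2"
    then show "act2 \<Phi> \<Phi> (u1 \<otimes> u2) (g \<otimes> dual_one) = \<Phi> (tlift (\<lambda>x y. counit y \<cdot> x) (u1 \<otimes> u2)) g \<otimes> dual_one"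
      using counit_homog[of p2 u2]
      by (auto simp: act2_homog[OF is_act_Phi is_act_Phi g] Phi_dual_one tlift_tens[OF bilin_counit(2)]
          cqlinearD[OF Phi_linear(2)] tens_lin)
  qed
  show "tact \<Phi> \<Phi> u (g \<otimes> dual_one) = \<Phi> u g \<otimes> dual_one"
    by (induction g rule: homog_decomp)
       (simp_all add: tens_lin cqlinearD[OF is_act_linear(1)[OF is_act_tact[OF is_act_Phi is_act_Phi]]]
         cqlinearD[OF Phi_linear(1)], simp add: tact_def 1 counit_right)
  have 2: "act2 \<Phi> \<Phi> w (dual_one \<otimes> g) = dual_one \<otimes> \<Phi> (tlift (\<lambda>x y. counit x \<cdot> y) w) g" for w
  proof (rule tensor_ext_homog[where t = w, OF l(2)])
    show "cqlinear (\<lambda>w. dual_one \<otimes> \<Phi> (tlift (\<lambda>x y. counit x \<cdot> y) w) g)"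
      by (rule cqlinear_compose[OF cqlinear_tens(1) cqlinear_compose[OF Phi_linear(2) cqlinear_tlift[OF bilin_counit(1)]]])
    fix p1 p2 and u1 u2 :: "'a uq" assume "homog p2 u2"
    then show "act2 \<Phi> \<Phi> (u1 \<otimes> u2) (dual_one \<otimes> g) = dual_one \<otimes> \<Phi> (tlift (\<lambda>x y. counit x \<cdot> y) (u1 \<otimes> u2)) g"
      by (simp add: act2_homog[OF is_act_Phi is_act_Phi homog_dual_one] Phi_dual_one tlift_tens[OF bilin_counit(1)]
          cqlinearD[OF Phi_linear(2)] tens_lin)
  qed
  show "tact \<Phi> \<Phi> u (dual_one \<otimes> g) = dual_one \<otimes> \<Phi> u g"
    by (simp add: tact_def 2 counit_left)
qed

lemma cqlinear_mul: "cqlinear mul" and mul_tens: "mul (f \<otimes> g) = dual_mult f g"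
  unfolding mul_def by (rule cqlinear_tlift[OF bilin_dual_mult] tlift_tens[OF bilin_dual_mult])+

lemma even_map_mul: "even_map mul"
  by (rule even_mapI_tensor[OF cqlinear_mul]) (simp add: mul_tens homog_dual_mult)

text \<open>The product of functionals is dual to the comultiplication, and the comultiplication is
  multiplicative; so translating the argument by u amounts to translating by the coproduct of
  u.\<close>

lemma mul_tact: "mul (tact \<Phi> \<Phi> u z) = \<Phi> u (mul (z :: ('N::finite uq dual, 'N uq dual) tensor))"
proof (rule tensor_ext_homog[where t = z])
  show "cqlinear (\<lambda>z. mul (tact \<Phi> \<Phi> u z))" "cqlinear (\<lambda>z. \<Phi> u (mul z))"
    by (rule cqlinear_compose[OF cqlinear_mul is_act_linear(1)[OF is_act_tact[OF is_act_Phi is_act_Phi]]]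
        cqlinear_compose[OF Phi_linear(1) cqlinear_mul])+
  fix pf pg and f g :: "'N uq dual" assume f: "homog pf f" and g: "homog pg g"
  define M where "M z = tlift (\<lambda>f g. mpair f g z)" for z :: "('N uq, 'N uq) tensor"
  have M: "cqlinear (M z)" "M z (f \<otimes> g) = mpair f g z" for z f g
    by (simp_all add: M_def cqlinear_tlift[OF bilin_mpair] tlift_tens[OF bilin_mpair])
  have M': "cqlinear (\<lambda>z. M z h)" for h
    unfolding M_def by (rule cqlinear_tlift_fun[OF cqlinear_mpair])
  have pm: "pair (mul h) u' = M (comult u') h" for h u'
    by (rule tensor_ext[where t = h])
       (simp_all add: M mul_tens pair_dual_mult cqlinear_compose[OF cqlinear_pair_left cqlinear_mul])
  \<comment> \<open>The same claim with arbitrary tensors \<open>z\<close> and \<open>w\<close> in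
    place of the coproducts of the argument and of u.\<close>
  have key: "mpair f g (z * tw 1 w) = M z (act2 \<Phi> \<Phi> w (f \<otimes> g))" for z w
  proof (rule tensor_ext_homog[where t = w])
    note l2 = act2_linear(2)[OF is_act_Phi is_act_Phi]
    show "cqlinear (\<lambda>w. mpair f g (z * tw 1 w))"
      by (rule cqlinear_compose[OF cqlinear_mpair cqlinear_compose[OF cqlinear_mult(1) cqlinear_tw]])
    show "cqlinear (\<lambda>w. M z (act2 \<Phi> \<Phi> w (f \<otimes> g)))"
      by (rule cqlinear_compose[OF M(1) l2])
    fix p1 p2 and u1 u2 :: "'N uq" assume u: "homog p1 u1" "homog p2 u2"
    show "mpair f g (z * tw 1 (u1 \<otimes> u2)) = M z (act2 \<Phi> \<Phi> (u1 \<otimes> u2) (f \<otimes> g))"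
    proof (rule tensor_ext_homog[where t = z])
      show "cqlinear (\<lambda>z. mpair f g (z * tw 1 (u1 \<otimes> u2)))"
        by (rule cqlinear_compose[OF cqlinear_mpair cqlinear_mult(2)])
      show "cqlinear (\<lambda>z. M z (act2 \<Phi> \<Phi> (u1 \<otimes> u2) (f \<otimes> g)))"
        by (rule M')
      fix pa pb and a b :: "'N uq" assume ab: "homog pa a" "homog pb b"
      note l = cqlinearD[OF cqlinear_pair] cqlinearD[OF cqlinear_mpair] cqlinearD[OF M(1)]
      have L: "mpair f g (a \<otimes> b * tw 1 (u1 \<otimes> u2)) = sgnp (p1 + p2) * sgnp (pb * p1) *
          (sgnp ((pb + p2) * (pa + p1)) * pair f (a * u1) * pair g (b * u2))"
        by (simp add: tw_homog[OF homog_tens[OF u]] scl_mult_right times_tens_homog[OF ab(2) u(1)] l scl_cq_def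
            mpair_homog[OF homog_mult[OF ab(1) u(1)] homog_mult[OF ab(2) u(2)]])
      have R: "M (a \<otimes> b) (act2 \<Phi> \<Phi> (u1 \<otimes> u2) (f \<otimes> g)) = sgnp (pf * p2) *
          (sgnp (pb * pa) * (sgnp p1 * pair f (a * u1)) * (sgnp p2 * pair g (b * u2)))"
        by (simp add: act2_homog[OF is_act_Phi is_act_Phi f u(2)] l M(2) scl_cq_def mpair_homog[OF ab] pair_Phi
            tw_homog[OF u(1)] tw_homog[OF u(2)] scl_mult_right)
      \<comment> \<open>Unless the pairing vanishes, the parity of f is determined by those of a and
        u1; the signs agree under this constraint.\<close>
      have "pair f (a * u1) = 0 \<or> pf = pa + p1"
        using homog_dualD[OF f homog_mult[OF ab(1) u(1)]] by auto
      then show "mpair f g (a \<otimes> b * tw 1 (u1 \<otimes> u2)) = M (a \<otimes> b) (act2 \<Phi> \<Phi> (u1 \<otimes> u2) (f \<otimes> g))"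
        unfolding L R
        by (cases pa; cases pb; cases p1; cases p2) auto
    qed
  qed
  show "mul (tact \<Phi> \<Phi> u (f \<otimes> g)) = \<Phi> u (mul (f \<otimes> g))"
  proof (rule dual_eqI)
    fix u'
    show "pair (mul (tact \<Phi> \<Phi> u (f \<otimes> g))) u' = pair (\<Phi> u (mul (f \<otimes> g))) u'"
      by (simp add: pm tact_def pair_Phi mul_tens pair_dual_mult superalg_hom_mult[OF superalg_hom_comult]
          even_map_tw[OF superalg_hom_even[OF superalg_hom_comult]] key)
  qed
qed

lemma mhom_mul: "mhom U (tact \<Phi> \<Phi>) \<Phi> X mul"
  by (simp add: mhom_def cqlinear_mul even_map_hpart[OF even_map_mul] mul_tact)

lemma hpart_tens_even:
  assumes "homog 0 a"
  shows "hpart p (x \<otimes> a) = hpart p x \<otimes> a" "hpart p (a \<otimes> x) = a \<otimes> hpart p x"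
  using bit_exhaust[of p] by (auto simp: hpart_tens hpart_homog[OF assms])

lemma mhom_tens_one: "mhom U \<Phi> (tact \<Phi> \<Phi>) X (\<lambda>g. g \<otimes> dual_one)"
  "mhom U \<Phi> (tact \<Phi> \<Phi>) X (\<lambda>g. dual_one \<otimes> g)"
  by (simp_all add: mhom_def cqlinear_tens act_dual_one hpart_tens_even[OF homog_dual_one])

subsection \<open>Generated subalgebras\<close>

lemma hsub_generated:
  fixes m :: "'a::superspace \<Rightarrow> 'a \<Rightarrow> 'a"
  assumes "bilin m" "\<And>p p' x y. homog p x \<Longrightarrow> homog p' y \<Longrightarrow> homog (p + p') (m x y)"
    and "homog 0 e" "\<And>g. g \<in> G \<Longrightarrow> \<exists>p. homog p g"
  shows "hsub (generated_subalg m e G)"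
proof -
  let ?A = "generated_subalg m e G"
  have zero: "0 \<in> ?A"
    using generated_subalg.scl[OF generated_subalg.one, where c = 0 and mult = m and one = e and G = G] by simp
  have "hpart p x \<in> ?A" if "x \<in> ?A" for p x
    using that
  proof (induction arbitrary: p)
    case one
    then show ?case using zero by (simp add: hpart_homog[OF assms(3)] generated_subalg.one)
  next
    case (gen x)
    then show ?case using zero assms(4)[OF gen] by (auto simp: hpart_homog generated_subalg.gen)
  next
    case (mult x y)
    have "m x y = m (hpart 0 x) (hpart 0 y) + m (hpart 0 x) (hpart 1 y) + (m (hpart 1 x) (hpart 0 y) + m (hpart 1 x) (hpart 1 y))"
      unfolding bilinD(1,3)[OF assms(1), symmetric] hpart_sum ..
    moreover have "hpart p (m (hpart q x) (hpart r y)) \<in> ?A" for q r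
      using mult.IH zero by (simp add: hpart_homog[OF assms(2)[OF homog_hpart homog_hpart]] generated_subalg.mult)
    ultimately show ?case
      by (simp add: hpart_add generated_subalg.add)
  qed (simp_all add: hpart_add hpart_scl generated_subalg.add generated_subalg.scl)
  then show ?thesis
    unfolding hsub_def using zero by (auto intro!: cqs.subspaceI generated_subalg.add generated_subalg.scl)
qed

lemma idx_mono: "n \<le> m \<Longrightarrow> idx n \<subseteq> idx m"
  by (auto simp: idx_def)

lemma idx_between: "i \<in> idx n \<Longrightarrow> j \<in> idx n \<Longrightarrow> i \<le> k \<Longrightarrow> k \<le> j \<Longrightarrow> k \<noteq> 0 \<Longrightarrow> k \<in> idx n"
  by (auto simp: idx_def)

lemma hsub_uq_sub: "hsub (uq_sub n :: 'N::finite uq set)"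
  unfolding uq_sub_def
  by (rule hsub_generated[OF bilin_mult homog_mult homog_one]) (auto intro: gradedD[OF graded_Lgen])

lemma Lgen_uq_sub: "i \<in> idx n \<Longrightarrow> j \<in> idx n \<Longrightarrow> (Lgen i j :: 'N::finite uq) \<in> uq_sub n"
  using hsubD(1)[OF hsub_uq_sub[of n], where 'N1 = 'N] fgen_outside[of i j, where 'N = 'N]
  unfolding uq_sub_def by (cases "i \<le> j") (auto intro: generated_subalg.gen)

text \<open>L is triangular, and a nonzero index between two indices of \<open>idx n\<close> lies in
  \<open>idx n\<close>. Hence the coproduct of a generator of size n involves only generators of
  size n.\<close>

lemma sub_coalg_uq_sub:
  assumes "n \<le> CARD('N)"
  shows "sub_coalg (uq_sub n :: 'N::finite uq set)"
proof -
  let ?U = "uq_sub n :: 'N uq set"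
  have m: "z * z' \<in> tensor_sub ?U ?U" if "z \<in> tensor_sub ?U ?U" "z' \<in> tensor_sub ?U ?U" for z z'
    using that(1) hsub_uq_sub hsub_uq_sub
  proof (induction rule: tensor_sub_induct)
    case (tens p p' x y)
    note 1 = tens
    from that(2) hsub_uq_sub hsub_uq_sub show ?case
    proof (induction rule: tensor_sub_induct)
      case (tens q q' x' y')
      show ?case
        using 1 tens
        by (simp add: times_tens_homog[OF 1(4) tens(3)] tensor_sub_closed tensor_sub_tens)
           (auto simp: uq_sub_def intro!: tensor_sub_closed tensor_sub_tens generated_subalg.mult)
    qed (simp add: distrib_left tensor_sub_closed)
  qed (simp add: distrib_right tensor_sub_closed)
  have "comult u \<in> tensor_sub ?U ?U" if "u \<in> ?U" for u
    using that unfolding uq_sub_def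
  proof (induction rule: generated_subalg.induct)
    case one
    show ?case
      unfolding comult_1 one_tensor_def by (intro tensor_sub_tens generated_subalg.one)
  next
    case (gen x)
    then obtain i j where ij: "x = Lgen i j" "i \<in> idx n" "j \<in> idx n" by blast
    have "csign i k j \<cdot> (Lgen i k \<otimes> Lgen k j) \<in> tensor_sub ?U ?U" if "k \<in> idx CARD('N)" for k
    proof (cases "i \<le> k \<and> k \<le> j")
      case True
      then have "k \<in> idx n"
        using idx_between[OF ij(2,3)] idx_nonzero[OF that] by blast
      then show ?thesis
        using ij by (intro tensor_sub_closed(2) tensor_sub_tens Lgen_uq_sub)
    next
      case False
      then have "(Lgen i k :: 'N uq) = 0 \<or> (Lgen k j :: 'N uq) = 0"
        using fgen_outside[of i k, where 'N = 'N] fgen_outside[of k j, where 'N = 'N] by blast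
      then show ?thesis
        by (auto simp: tensor_sub_closed)
    qed
    then have "comult x \<in> tensor_sub ?U ?U"
      unfolding ij(1) comult_Lgen
      by (intro hsub_sum hsub_tensor_sub hsub_uq_sub)
    then show ?case
      by (simp only: uq_sub_def)
  next
    case (mult x y)
    then show ?case
      using m[unfolded uq_sub_def] by (simp add: superalg_hom_mult[OF superalg_hom_comult])
  qed (simp_all add: comult_lin tensor_sub_closed)
  then show ?thesis
    by (simp add: sub_coalg_def hsub_uq_sub)
qed

lemma stable_uq_sub:
  assumes F: "is_act F" and X: "hsub X"
    and gen: "\<And>i j x. i \<in> idx n \<Longrightarrow> j \<in> idx n \<Longrightarrow> i \<le> j \<Longrightarrow> x \<in> X \<Longrightarrow> F (Lgen i j) x \<in> X"
  shows "stable (uq_sub n) F X"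
proof -
  have "F u x \<in> X" if "u \<in> uq_sub n" "x \<in> X" for u x
    using that unfolding uq_sub_def
    by (induction arbitrary: x rule: generated_subalg.induct)
       (auto simp: is_actD(2,3)[OF F] bilinD[OF is_actD(1)[OF F]] gen hsubD[OF X])
  with X show ?thesis by (simp add: stable_def)
qed

lemma mhom_uq_sub:
  assumes F: "is_act F" and G: "is_act G" and X: "stable (uq_sub n) F X"
    and f: "cqlinear f" "\<And>p x. x \<in> X \<Longrightarrow> f (hpart p x) = hpart p (f x)"
    and gen: "\<And>i j x. i \<in> idx n \<Longrightarrow> j \<in> idx n \<Longrightarrow> i \<le> j \<Longrightarrow> x \<in> X \<Longrightarrow> f (F (Lgen i j) x) = G (Lgen i j) (f x)"
  shows "mhom (uq_sub n) F G X f"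
proof -
  have "f (F u x) = G u (f x)" if "u \<in> uq_sub n" "x \<in> X" for u x
    using that unfolding uq_sub_def
  proof (induction arbitrary: x rule: generated_subalg.induct)
    \<comment> \<open>Stability returns \<open>F v x\<close> to \<open>X\<close>, where the
      induction hypothesis for u applies.\<close>
    case (mult u v)
    then have "F v x \<in> X"
      using X by (simp add: stable_def uq_sub_def)
    with mult show ?case
      by (simp add: is_actD(3)[OF F] is_actD(3)[OF G])
  qed (auto simp: is_actD(2)[OF F] is_actD(2)[OF G] bilinD[OF is_actD(1)[OF F]] bilinD[OF is_actD(1)[OF G]]
      cqlinearD[OF f(1)] gen)
  with f show ?thesis by (simp add: mhom_def)
qed

text \<open>An induction over elements would not do: equivariance of a map on \<open>X\<close> and \<open>Y\<close> descends to
  \<open>mul ` tensor_sub X Y\<close> only because \<open>X\<close> and \<open>Y\<close> are stable under the action.\<close>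

lemma generated_stable_induct:
  fixes G :: "'N::finite uq dual set"
  assumes U: "sub_coalg U" and G: "stable U \<Phi> (cqspan G)"
    and one: "E (cqspan {dual_one})" and gen: "E (cqspan G)"
    and add: "\<And>X Y. stable U \<Phi> X \<Longrightarrow> stable U \<Phi> Y \<Longrightarrow> X \<subseteq> generated_subalg dual_mult dual_one G \<Longrightarrow>
      Y \<subseteq> generated_subalg dual_mult dual_one G \<Longrightarrow> E X \<Longrightarrow> E Y \<Longrightarrow> E {x + y | x y. x \<in> X \<and> y \<in> Y}"
    and mult: "\<And>X Y. stable U \<Phi> X \<Longrightarrow> stable U \<Phi> Y \<Longrightarrow> X \<subseteq> generated_subalg dual_mult dual_one G \<Longrightarrow>
      Y \<subseteq> generated_subalg dual_mult dual_one G \<Longrightarrow> E X \<Longrightarrow> E Y \<Longrightarrow> E (mul ` tensor_sub X Y)"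
    and f: "f \<in> generated_subalg dual_mult dual_one G"
  shows "\<exists>X. stable U \<Phi> X \<and> X \<subseteq> generated_subalg dual_mult dual_one G \<and> E X \<and> f \<in> X"
proof -
  let ?A = "generated_subalg dual_mult dual_one G"
  have A0: "0 \<in> ?A"
    using generated_subalg.scl[OF generated_subalg.one, where c = 0 and mult = dual_mult and one = dual_one and G = G] by simp
  have span: "cqspan H \<subseteq> ?A" if "H \<subseteq> ?A" for H
  proof
    fix x assume "x \<in> cqspan H"
    then show "x \<in> ?A"
      by (induction rule: cqs.span_induct_alt) (use that A0 in \<open>auto intro: generated_subalg.add generated_subalg.scl\<close>)
  qed
  from f show ?thesis
  proof (induction rule: generated_subalg.induct)
    case one
    have "stable U \<Phi> (cqspan {dual_one})"
    proof -
      have "\<Phi> u x \<in> cqspan {dual_one}" if "x \<in> cqspan {dual_one}" for u :: "'N uq" and x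
        using that
      proof (induction rule: cqs.span_induct_alt)
        case (step c g y)
        have "(c * counit u) \<cdot> dual_one + \<Phi> u y \<in> cqspan {dual_one}"
          by (intro cqs.span_add cqs.span_scale cqs.span_base step.IH) simp
        with step(1) show ?case
          by (simp add: cqlinearD[OF Phi_linear(1)] Phi_dual_one)
      qed (simp add: cqlinearD[OF Phi_linear(1)] cqs.span_zero)
      moreover have "hsub (cqspan {dual_one :: 'N uq dual})"
        by (rule hsubI_span) (use homog_dual_one in auto)
      ultimately show ?thesis by (simp add: stable_def)
    qed
    then show ?case
      using assms(3) span[of "{dual_one}"] by (intro exI[of _ "cqspan {dual_one}"]) (auto intro: generated_subalg.one cqs.span_base)
  next
    case (gen x)
    then show ?case
      using assms(2,4) span[of G] by (intro exI[of _ "cqspan G"]) (auto intro: generated_subalg.gen cqs.span_base)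
  next
    case (add x y)
    obtain X where X: "stable U \<Phi> X" "X \<subseteq> ?A" "E X" "x \<in> X" using add.IH(1) by blast
    obtain Y where Y: "stable U \<Phi> Y" "Y \<subseteq> ?A" "E Y" "y \<in> Y" using add.IH(2) by blast
    let ?Z = "{x + y | x y. x \<in> X \<and> y \<in> Y}"
    have hX: "hsub X" and hY: "hsub Y" using X(1) Y(1) by (auto simp: stable_def)
    have "cqsubspace ?Z"
    proof (rule cqs.subspaceI)
      show "0 \<in> ?Z"
        using hsubD(1)[OF hX] hsubD(1)[OF hY] by (intro CollectI exI[of _ 0]) simp
      fix a b c assume "a \<in> ?Z"
      then obtain x1 y1 where a: "a = x1 + y1" "x1 \<in> X" "y1 \<in> Y" by blast
      from a(1) have "c \<cdot> a = c \<cdot> x1 + c \<cdot> y1" by (simp add: scl_add_right)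
      then show "c \<cdot> a \<in> ?Z"
        using hsubD(3)[OF hX a(2)] hsubD(3)[OF hY a(3)] by blast
      assume "b \<in> ?Z"
      then obtain x2 y2 where b: "b = x2 + y2" "x2 \<in> X" "y2 \<in> Y" by blast
      have "a + b = (x1 + x2) + (y1 + y2)" by (simp add: a b add_ac)
      then show "a + b \<in> ?Z"
        using hsubD(2)[OF hX a(2) b(2)] hsubD(2)[OF hY a(3) b(3)] by blast
    qed
    moreover have "hpart p z \<in> ?Z" if "z \<in> ?Z" for p z
    proof -
      from that obtain x1 y1 where z: "z = x1 + y1" "x1 \<in> X" "y1 \<in> Y" by blast
      have "hpart p z = hpart p x1 + hpart p y1" by (simp add: z hpart_add)
      then show ?thesis using hsubD(4)[OF hX z(2)] hsubD(4)[OF hY z(3)] by blast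
    qed
    moreover have "\<Phi> u z \<in> ?Z" if "u \<in> U" "z \<in> ?Z" for u z
    proof -
      from that obtain x1 y1 where z: "z = x1 + y1" "x1 \<in> X" "y1 \<in> Y" by blast
      have "\<Phi> u z = \<Phi> u x1 + \<Phi> u y1" by (simp add: z cqlinearD(1)[OF Phi_linear(1)])
      moreover have "\<Phi> u x1 \<in> X" "\<Phi> u y1 \<in> Y"
        using X(1) Y(1) z that(1) by (auto simp: stable_def)
      ultimately show ?thesis by blast
    qed
    ultimately have "stable U \<Phi> ?Z" by (simp add: stable_def hsub_def)
    moreover have "?Z \<subseteq> ?A" using X(2) Y(2) by (auto intro: generated_subalg.add)
    ultimately show ?case
      using assms(5)[OF X(1) Y(1) X(2) Y(2) X(3) Y(3)] X(4) Y(4) by blast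
  next
    case (scl x c)
    then show ?case by (meson hsubD(3) stable_def)
  next
    case (mult x y)
    obtain X where X: "stable U \<Phi> X" "X \<subseteq> ?A" "E X" "x \<in> X" using mult.IH(1) by blast
    obtain Y where Y: "stable U \<Phi> Y" "Y \<subseteq> ?A" "E Y" "y \<in> Y" using mult.IH(2) by blast
    have hX: "hsub X" and hY: "hsub Y" using X(1) Y(1) by (auto simp: stable_def)
    have "mul z \<in> ?A" if "z \<in> tensor_sub X Y" for z
      using that hX hY
      by (induction rule: tensor_sub_induct)
         (use X(2) Y(2) in \<open>auto simp: mul_tens cqlinearD[OF cqlinear_mul] intro: generated_subalg.mult generated_subalg.add\<close>)
    moreover have "stable U \<Phi> (mul ` tensor_sub X Y)"
      by (rule stable_image[OF stable_tensor_sub[OF U is_act_Phi X(1) is_act_Phi Y(1)] mhom_mul])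
    moreover have "dual_mult x y \<in> mul ` tensor_sub X Y"
      using X(4) Y(4) by (auto simp: tensor_sub_tens simp flip: mul_tens)
    ultimately show ?case
      using assms(6)[OF X(1) Y(1) X(2) Y(2) X(3) Y(3)] by (intro exI[of _ "mul ` tensor_sub X Y"]) auto
  qed
qed

text \<open>The stable induction with a property that always holds: every element lies in a stable
  subspace of the generated subalgebra.\<close>

lemma stable_generated:
  fixes G :: "'N::finite uq dual set"
  assumes U: "sub_coalg U" and G: "stable U \<Phi> (cqspan G)" "\<And>g. g \<in> G \<Longrightarrow> \<exists>p. homog p g"
  shows "stable U \<Phi> (generated_subalg dual_mult dual_one G)"
proof -
  have "\<Phi> u f \<in> generated_subalg dual_mult dual_one G" if "u \<in> U" "f \<in> generated_subalg dual_mult dual_one G" for u f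
    using generated_stable_induct[OF U G(1), of "\<lambda>_. True" f] that by (auto simp: stable_def)
  then show ?thesis
    by (simp add: stable_def hsub_generated[OF bilin_dual_mult homog_dual_mult homog_dual_one G(2)])
qed

section \<open>Matrix elements\<close>

lemma entry_idm: "entry (idm N) p q = (if p = q \<and> p \<in> idx N then 1 else 0)"
proof -
  have "entry (idm N) p q = (\<Sum>i\<in>idx N. if p = i \<and> q = i then 1 else 0)"
    unfolding idm_def by (simp only: cqlinearD(6)[OF cqlinear_entry] munit.rep_eq)
  also have "\<dots> = (\<Sum>i\<in>idx N. if p = i then of_bool (p = q) else 0)"
    by (rule sum.cong[OF refl]) auto
  also have "\<dots> = (if p = q \<and> p \<in> idx N then 1 else 0)"
    by (auto simp: sum.delta')
  finally show ?thesis .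
qed

lemma entry_idm_mult:
  assumes "idm N * m = m" "m * idm N = m" "entry m p q \<noteq> 0"
  shows "p \<in> idx N \<and> q \<in> idx N"
proof -
  obtain K where K: "finite K" "\<And>i j. entry m i j \<noteq> 0 \<Longrightarrow> i \<in> K \<and> j \<in> K"
    using mat_support[of m] by blast
  have p: "entry (idm N * m) p q = (\<Sum>k\<in>idx N. entry (idm N) p k * entry m k q)"
    by (rule entry_mult) (simp_all add: entry_idm split: if_splits)
  have q: "entry (m * idm N) p q = (\<Sum>k\<in>K. entry m p k * entry (idm N) k q)"
    by (rule entry_mult) (use K in simp_all)
  show ?thesis
  proof (intro conjI; rule ccontr)
    assume "p \<notin> idx N"
    then have "entry (idm N * m) p q = 0"
      unfolding p by (intro sum.neutral) (simp add: entry_idm)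
    with assms(1,3) show False by (simp only:)
  next
    assume "q \<notin> idx N"
    then have "entry (m * idm N) p q = 0"
      unfolding q by (intro sum.neutral ballI) (simp add: entry_idm, blast)
    with assms(2,3) show False by (simp only:)
  qed
qed

lemma vrep_mult: "vrep (u * v) = vrep u * vrep v"
  by (rule superalg_hom_mult[OF superalg_hom_vrep])

lemma vrep_support:
  assumes "entry (vrep (u :: 'N::finite uq)) p q \<noteq> 0"
  shows "p \<in> idx CARD('N)" "q \<in> idx CARD('N)"
  using entry_idm_mult[of "CARD('N)" "vrep u", OF _ _ assms]
  by (simp_all flip: vrep_1 vrep_mult)

lemma entry_vrep_mult:
  "entry (vrep (u * v :: 'N::finite uq)) p q = (\<Sum>k\<in>idx CARD('N). entry (vrep u) p k * entry (vrep v) k q)"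
  unfolding vrep_mult by (rule entry_mult) (auto dest: vrep_support)

lemma vrep_parity:
  assumes "homog r u" "entry (vrep u) p q \<noteq> 0"
  shows "r = parity p + parity q"
proof -
  have "entry (hpart r (vrep u)) p q = entry (vrep u) p q"
    using even_map_homog[OF superalg_hom_even[OF superalg_hom_vrep] assms(1)] by (simp add: homog_def)
  with assms(2) show ?thesis
    by (auto simp: hpart_mat.rep_eq split: if_splits)
qed

lemma cqlinear_entry_vrep: "cqlinear (\<lambda>u. entry (vrep u) i a)"
  by (rule cqlinear_compose[OF cqlinear_entry superalg_hom_linear[OF superalg_hom_vrep]])

lemma pair_tgen: "pair (tgen i a) u = entry (vrep u) i a"
  unfolding tgen_def by (rule pair_Abs[OF cqlinear_entry_vrep])

lemma homog_tgen: "homog (parity i + parity a) (tgen i a)"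
proof (rule homog_dualI)
  fix q and u :: "'a uq" assume "homog q u" "q \<noteq> parity i + parity a"
  then show "pair (tgen i a) u = 0"
    using vrep_parity[of q u i a] by (auto simp: pair_tgen)
qed

text \<open>The symmetry typical of the queer case: \<phi> k i does not change when k is negated,
  and \<open>munit j i + munit (- j) (- i)\<close> is invariant under negating both indices. It
  leads to \<open>tgen_neg\<close>, by which rows can be made positive.\<close>

lemma rcoef_neg: "entry (rcoef c x N i j) (- p) (- q) = entry (rcoef c x N i j) p q"
proof -
  have p: "\<phi> (- k) i = \<phi> k i" for k i
    by (auto simp: \<phi>_def)
  have 1: "entry (\<Sum>k\<in>idx N. (c powi \<phi> k i) \<cdot> munit k k) p q = (if p = q \<and> p \<in> idx N then c powi \<phi> p i else 0)" for p q
  proof -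
    have "entry (\<Sum>k\<in>idx N. (c powi \<phi> k i) \<cdot> munit k k) p q
        = (\<Sum>k\<in>idx N. if p = k then if q = p then c powi \<phi> p i else 0 else 0)"
      unfolding cqlinearD[OF cqlinear_entry] munit.rep_eq scl_cq_def by (intro sum.cong) auto
    then show ?thesis by (auto simp: sum.delta)
  qed
  have if_neg: "entry (if C then M else 0) (- p) (- q) = entry (if C then M else 0) p q"
    if "entry M (- p) (- q) = entry M p q" for C M
    using that by (simp add: zero_mat.rep_eq)
  have plus_neg: "entry (X + Y) (- p) (- q) = entry (X + Y) p q"
    if "entry X (- p) (- q) = entry X p q" "entry Y (- p) (- q) = entry Y p q" for X Y
    using that by (simp add: plus_mat.rep_eq)
  have "entry (\<Sum>k\<in>idx N. (c powi \<phi> k i) \<cdot> munit k k) (- p) (- q) = entry (\<Sum>k\<in>idx N. (c powi \<phi> k i) \<cdot> munit k k) p q"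
    by (simp only: 1 p neg_idx neg_equal_iff_equal)
  moreover have "entry ((x * sgnp (parity i)) \<cdot> (munit j i + munit (- j) (- i))) (- p) (- q)
      = entry ((x * sgnp (parity i)) \<cdot> (munit j i + munit (- j) (- i))) p q"
    by (auto simp: scl_mat.rep_eq plus_mat.rep_eq munit.rep_eq)
  ultimately show ?thesis
    unfolding rcoef_def by (intro plus_neg if_neg)
qed

lemma vrep_neg: "entry (vrep (u :: 'N::finite uq)) (- p) (- q) = entry (vrep u) p q"
proof (induction u arbitrary: p q rule: uq_induct)
  case one
  show ?case by (auto simp: vrep_1 entry_idm)
next
  case (gen i j u)
  have "entry (vrep (Lgen i j * u)) (- p) (- q)
      = (\<Sum>k\<in>idx CARD('N). entry (vrep (Lgen i j :: 'N uq)) (- p) k * entry (vrep u) k (- q))"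
    by (rule entry_vrep_mult)
  also have "\<dots> = (\<Sum>k\<in>idx CARD('N). entry (vrep (Lgen i j :: 'N uq)) (- p) (- k) * entry (vrep u) (- k) (- q))"
    by (rule sum.reindex_bij_witness[of _ uminus uminus]) auto
  also have "\<dots> = entry (vrep (Lgen i j * u)) p q"
    by (simp only: gen.IH vrep_Lgen rcoef_neg entry_vrep_mult)
  finally show ?case .
qed (simp_all add: cqlinearD[OF cqlinear_entry_vrep])

lemma tgen_neg: "tgen (- i) (- a) = tgen i a"
  by (rule dual_eqI) (simp add: pair_tgen vrep_neg)

section \<open>Structure constants of S and the action on matrix elements\<close>

abbreviation rq :: "int \<Rightarrow> int \<Rightarrow> int \<Rightarrow> int \<Rightarrow> cq" where "rq \<equiv> rr qq \<xi>"
abbreviation rq' :: "int \<Rightarrow> int \<Rightarrow> int \<Rightarrow> int \<Rightarrow> cq" where "rq' \<equiv> rr (inverse qq) (- \<xi>)"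

lemma rr_cases:
  assumes "rr c x p i q j \<noteq> 0"
  shows "(p = q \<and> i = j) \<or> (p = j \<and> i = q) \<or> (p = - j \<and> i = - q)"
proof (rule ccontr)
  assume *: "\<not> ?thesis"
  then have z: "of_bool (p = q \<and> i = j) = (0 :: cq)" "of_bool (p = j \<and> i = q) = (0 :: cq)"
    "of_bool (p = - j \<and> i = - q) = (0 :: cq)"
    by simp_all
  have "rr c x p i q j = 0"
    unfolding rr_def z by simp
  with assms show False by contradiction
qed

text \<open>Evenness of S, expressed through its nonzero coefficients. It provides the parity
  conditions under which the later sign identities are applied.\<close>

lemma rr_parity:
  assumes "rr c x p i q j \<noteq> 0" "q \<in> idx n" "j \<in> idx n"
  shows "parity p + parity i = parity q + parity j"
  using rr_cases[OF assms(1)]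
proof (elim disjE conjE)
  assume "p = - j" "i = - q"
  then show ?thesis
    using idx_nonzero[OF assms(2)] idx_nonzero[OF assms(3)] by (simp add: parity_neg add_ac)
qed (simp_all add: add.commute)

lemma rr_idx:
  assumes "q \<in> idx n" "j \<in> idx n" "p \<notin> idx n"
  shows "rr c x p i q j = 0"
proof (rule ccontr)
  assume "rr c x p i q j \<noteq> 0"
  from rr_cases[OF this] assms show False by auto
qed

text \<open>Translation on the right multiplies the matrix of u by that of the generator on the
  right, so only the column index moves, and the coefficients of S keep it inside
  \<open>idx n\<close>.\<close>

lemma Phi_tgen:
  assumes n: "n \<le> CARD('N)" and ij: "i \<in> idx n" "j \<in> idx n" "a \<in> idx n"
  shows "\<Phi> (Lgen i j) (tgen k a :: 'N::finite uq dual) = (\<Sum>y\<in>idx n.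
    (sgnp (parity i + parity j) * sgnp ((parity i + parity j) * parity a) * rq y i a j) \<cdot> tgen k y)"
proof (rule dual_eqI)
  fix u :: "'N uq"
  let ?I = "idx CARD('N)" and ?s = "sgnp (parity i + parity j)" and ?t = "sgnp ((parity i + parity j) * parity a)"
  have I: "i \<in> ?I" "j \<in> ?I" "a \<in> ?I"
    using ij idx_mono[OF n] by auto
  have "pair (\<Phi> (Lgen i j) (tgen k a)) u = ?s * entry (vrep (u * Lgen i j)) k a"
    by (simp add: pair_Phi tw_homog[OF gradedD[OF graded_Lgen]] scl_mult_right cqlinearD[OF cqlinear_pair] scl_cq_def pair_tgen)
  also have "\<dots> = (\<Sum>y\<in>?I. ?s * ?t * rq y i a j * entry (vrep u) k y)"
    unfolding entry_vrep_mult vrep_Lgen sum_distrib_left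
    by (intro sum.cong refl) (simp add: entry_rcoef I)
  also have "\<dots> = (\<Sum>y\<in>idx n. ?s * ?t * rq y i a j * entry (vrep u) k y)"
    by (rule sum.mono_neutral_right) (use idx_mono[OF n] rr_idx[OF ij(3,2)] in auto)
  finally show "pair (\<Phi> (Lgen i j) (tgen k a)) u = pair (\<Sum>y\<in>idx n. (?s * ?t * rq y i a j) \<cdot> tgen k y) u"
    by (simp add: pair_tgen)
qed

lemma pair_tbar: "pair (tbar \<alpha> b) (u :: 'N::finite uq) = sgnp (parity b * (parity \<alpha> + parity b)) * entry (vrep (anti u)) b \<alpha>"
proof -
  have "cqlinear (\<lambda>u :: 'N uq. sgnp (parity b * (parity \<alpha> + parity b)) * pair (tgen b \<alpha>) (antipode u))"
    unfolding antipode_eq_anti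
    using cqlinear_scl[OF cqlinear_compose[OF cqlinear_pair even_map_linear[OF even_map_anti]]]
    by (simp add: scl_cq_def)
  from pair_Abs[OF this] show ?thesis
    by (simp add: tbar_def pair_tgen antipode_eq_anti)
qed

lemma homog_tbar: "homog (parity \<alpha> + parity b) (tbar \<alpha> b)"
proof (rule homog_dualI)
  fix q and u :: "'a uq" assume "homog q u" "q \<noteq> parity \<alpha> + parity b"
  then show "pair (tbar \<alpha> b) u = 0"
    using vrep_parity[OF even_map_homog[OF even_map_anti], of q u b \<alpha>] by (auto simp: pair_tbar add.commute)
qed

text \<open>The hypotheses are the parity conditions valid where both a coefficient of S and a
  matrix entry are nonzero; eliminating b and q with them leaves a finite check.\<close>

lemma bit_sign_tbar:
  fixes b i u l q al :: bit
  assumes "b + i = u + l" "q = u + al"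
  shows "sgnp (i + l) * (sgnp (b * (al + b)) * (sgnp (q * (i + l)) * sgnp ((i + l) * u))) = sgnp (u * (al + u))"
proof -
  have b: "b = u + l + i"
    using arg_cong[OF assms(1), of "\<lambda>x. x + i"] by (simp add: add_ac)
  show ?thesis
    unfolding b assms(2) by (cases i; cases u; cases l; cases al) simp_all
qed

text \<open>The antipode reverses the product, so the generator now multiplies on the left and moves
  the index b; its matrix is that of \<open>Linv\<close>, which brings in the inverse of S.\<close>

lemma Phi_tbar:
  assumes n: "n \<le> CARD('N)" and ij: "i \<in> idx n" "l \<in> idx n" "b \<in> idx n"
  shows "\<Phi> (Lgen i l) (tbar \<alpha> b :: 'N::finite uq dual) = (\<Sum>u\<in>idx n. rq' b i u l \<cdot> tbar \<alpha> u)"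
proof (rule dual_eqI_homog)
  fix q and u' :: "'N uq" assume u': "homog q u'"
  let ?I = "idx CARD('N)" and ?s = "sgnp (parity i + parity l)" and ?b = "sgnp (parity b * (parity \<alpha> + parity b))"
  have I: "i \<in> ?I" "l \<in> ?I" "b \<in> ?I"
    using ij idx_mono[OF n] by auto
  have "pair (\<Phi> (Lgen i l) (tbar \<alpha> b)) u' = ?s * (?b * entry (vrep (anti (u' * Lgen i l))) b \<alpha>)"
    by (simp add: pair_Phi tw_homog[OF gradedD[OF graded_Lgen]] scl_mult_right cqlinearD[OF cqlinear_pair] scl_cq_def pair_tbar)
  also have "entry (vrep (anti (u' * Lgen i l))) b \<alpha>
      = sgnp (q * (parity i + parity l)) * (\<Sum>u\<in>?I. entry (rcoef (inverse qq) (- \<xi>) CARD('N) i l) b u * entry (vrep (anti u')) u \<alpha>)"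
    by (simp add: anti_mult[OF u' gradedD[OF graded_Lgen]] cqlinearD[OF cqlinear_entry_vrep] anti_Lgen entry_vrep_mult
        vrep_Linv I scl_cq_def)
  also have "?s * (?b * \<dots>) = (\<Sum>u\<in>?I. rq' b i u l * (sgnp (parity u * (parity \<alpha> + parity u)) * entry (vrep (anti u')) u \<alpha>))"
    unfolding sum_distrib_left
  proof (intro sum.cong refl)
    fix u assume u: "u \<in> ?I"
    show "?s * (?b * (sgnp (q * (parity i + parity l)) * (entry (rcoef (inverse qq) (- \<xi>) CARD('N) i l) b u * entry (vrep (anti u')) u \<alpha>)))
      = rq' b i u l * (sgnp (parity u * (parity \<alpha> + parity u)) * entry (vrep (anti u')) u \<alpha>)"
    proof (cases "rq' b i u l = 0 \<or> entry (vrep (anti u')) u \<alpha> = 0")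
      case True
      then show ?thesis by (auto simp: entry_rcoef I u)
    next
      case False
      then have "parity b + parity i = parity u + parity l" "q = parity u + parity \<alpha>"
        using rr_parity[of "inverse qq" "- \<xi>" b i u l, OF _ u I(2)] vrep_parity[OF even_map_homog[OF even_map_anti u']]
        by blast+
      from bit_sign_tbar[OF this, symmetric] show ?thesis
        by (simp add: entry_rcoef I u)
    qed
  qed
  also have "\<dots> = (\<Sum>u\<in>idx n. rq' b i u l * (sgnp (parity u * (parity \<alpha> + parity u)) * entry (vrep (anti u')) u \<alpha>))"
  proof (rule sum.mono_neutral_right)
    show "\<forall>u\<in>?I - idx n. rq' b i u l * (sgnp (parity u * (parity \<alpha> + parity u)) * entry (vrep (anti u')) u \<alpha>) = 0"
    proof
      fix u assume u: "u \<in> ?I - idx n"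
      have "rq' b i u l = 0"
      proof (rule ccontr)
        assume "rq' b i u l \<noteq> 0"
        then show False
          using rr_cases[of "inverse qq" "- \<xi>" b i u l] u ij by auto
      qed
      then show "rq' b i u l * (sgnp (parity u * (parity \<alpha> + parity u)) * entry (vrep (anti u')) u \<alpha>) = 0"
        by simp
    qed
  qed (use idx_mono[OF n] in auto)
  finally show "pair (\<Phi> (Lgen i l) (tbar \<alpha> b)) u' = pair (\<Sum>u\<in>idx n. rq' b i u l \<cdot> tbar \<alpha> u) u'"
    by (simp add: pair_tbar)
qed

section \<open>The braid relation in components\<close>

text \<open>In each operator one index is a spectator. For \<open>D13\<close> the sign of crossing
  the middle slot is absorbed into the family.\<close>

lemma D_eq_D2:
  "D12 c x w i j k = D2 c x (\<lambda>p q. w p q k) i j"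
  "D23 c x w i j k = D2 c x (\<lambda>p q. w i p q) j k"
  "i \<noteq> 0 \<Longrightarrow> D13 c x w i j k = D2 c x (\<lambda>p q. sgnp ((parity q + parity k) * parity j) \<cdot> w p j q) i k"
  by (simp_all add: D12_def D23_def D13_def D2_def parity_neg add_ac)

lemma D_inverse:
  fixes w :: "int \<Rightarrow> int \<Rightarrow> int \<Rightarrow> 'v::cqspace"
  assumes "c * d = 1" "x = c - d" "i \<in> idx N" "j \<in> idx N" "k \<in> idx N"
  shows "D12 c x (D12 d (- x) w) i j k = w i j k" "D13 c x (D13 d (- x) w) i j k = w i j k"
proof -
  have nz: "i \<noteq> 0" "j \<noteq> 0" "k \<noteq> 0"
    using assms by (auto dest: idx_nonzero)
  show "D12 c x (D12 d (- x) w) i j k = w i j k"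
    using D2_inverse[OF assms(1,2) nz(1,2), of "\<lambda>p q. w p q k"] by (simp add: D_eq_D2)
  have "D13 c x (D13 d (- x) w) i j k
      = D2 c x (\<lambda>p q. sgnp ((parity q + parity k) * parity j) \<cdot> D13 d (- x) w p j q) i k"
    by (rule D_eq_D2(3)[OF nz(1)])
  also have "\<dots> = D2 c x (D2 d (- x) (\<lambda>p q. sgnp ((parity q + parity k) * parity j) \<cdot> w p j q)) i k"
  proof (rule D2_cong[OF _ assms(3,5)])
    fix p q assume "p \<in> idx N" "q \<in> idx N"
    then have pq: "p \<noteq> 0" by (auto dest: idx_nonzero)
    have s: "sgnp ((parity q + parity k) * parity j) * sgnp ((q' + parity q) * parity j) = sgnp ((q' + parity k) * parity j)" for q'
      unfolding sgnp_add[symmetric] by (simp add: distrib_right[symmetric] add_ac)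
    show "sgnp ((parity q + parity k) * parity j) \<cdot> D13 d (- x) w p j q
        = D2 d (- x) (\<lambda>p q. sgnp ((parity q + parity k) * parity j) \<cdot> w p j q) p q"
      unfolding D_eq_D2(3)[OF pq] D2_linear[OF cqlinear_scl[OF cqlinear_id]] by (simp add: s)
  qed
  also have "\<dots> = w i j k"
    using D2_inverse[OF assms(1,2) nz(1,3), of "\<lambda>p q. sgnp ((parity q + parity k) * parity j) \<cdot> w p j q"] by simp
  finally show "D13 c x (D13 d (- x) w) i j k = w i j k" .
qed

text \<open>The Yang-Baxter equation with two of its three operators moved to the other side through
  their inverses.\<close>

lemma yang_baxter_mixed:
  fixes w :: "int \<Rightarrow> int \<Rightarrow> int \<Rightarrow> 'v::cqspace"
  assumes cd: "c * d = 1" "x = c - d" and ijk: "i \<in> idx N" "j \<in> idx N" "k \<in> idx N"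
  shows "D23 c x (D12 d (- x) (D13 d (- x) w)) i j k = D13 d (- x) (D12 d (- x) (D23 c x w)) i j k"
proof -
  have dc: "d * c = 1" "- x = d - c" "- (- x) = x"
    using cd by (simp_all add: mult.commute)
  \<comment> \<open>Chosen so that applying \<open>D12\<close> and then \<open>D13\<close> with
    parameters c, x gives back w; the Yang-Baxter equation for \<open>?v\<close> then expresses
    \<open>D23 c x w\<close>, and the outer operators are stripped one after the other.\<close>
  let ?v = "D12 d (- x) (D13 d (- x) w)"
  have 1: "D13 c x (D12 c x ?v) i j k = w i j k" if "i \<in> idx N" "j \<in> idx N" "k \<in> idx N" for i j k
    using D_cong(2)[of N "D12 c x ?v" "D13 d (- x) w" i j k c x, OF D_inverse(1)[OF cd] that] D_inverse(2)[OF cd that, of w]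
    by simp
  have 2: "D23 c x w i j k = D12 c x (D13 c x (D23 c x ?v)) i j k" if "i \<in> idx N" "j \<in> idx N" "k \<in> idx N" for i j k
    using D_cong(3)[of N "D13 c x (D12 c x ?v)" w, OF 1 that] yang_baxter[OF cd, of i j k ?v] that
    by (simp add: idx_nonzero)
  have 3: "D12 d (- x) (D23 c x w) i j k = D13 c x (D23 c x ?v) i j k" if "i \<in> idx N" "j \<in> idx N" "k \<in> idx N" for i j k
    using D_cong(1)[of N "D23 c x w" "D12 c x (D13 c x (D23 c x ?v))" i j k d "- x", OF 2 that]
      D_inverse(1)[OF dc(1,2) that, unfolded dc(3)] by simp
  show ?thesis
    using D_cong(2)[of N "D12 d (- x) (D23 c x w)" "D13 c x (D23 c x ?v)" i j k d "- x", OF 3 ijk]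
      D_inverse(2)[OF dc(1,2) ijk, unfolded dc(3), where w = "D23 c x ?v"] by simp
qed

lemma sum_delta_simp:
  assumes "finite A" "a \<in> A"
  shows "(\<Sum>k\<in>A. f k * of_bool (k = a)) = (f a :: cq)"
proof -
  have "(\<Sum>k\<in>A. f k * of_bool (k = a)) = (\<Sum>k\<in>A. if k = a then f k else 0)"
    by (intro sum.cong refl) simp
  then show ?thesis using assms by (simp add: sum.delta')
qed

lemma D2_sum:
  fixes w :: "int \<Rightarrow> int \<Rightarrow> cq"
  assumes "i \<in> idx n" "j \<in> idx n"
  shows "D2 c x w i j = (\<Sum>p\<in>idx n. \<Sum>q\<in>idx n. rr c x p q i j * w p q)"
proof -
  have s: "(\<Sum>p\<in>idx n. \<Sum>q\<in>idx n. r * of_bool (p = p' \<and> q = q') * w p q) = r * w p' q'"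
    if "p' \<in> idx n" "q' \<in> idx n" for r p' q'
  proof -
    have "(\<Sum>p\<in>idx n. \<Sum>q\<in>idx n. r * of_bool (p = p' \<and> q = q') * w p q)
        = (\<Sum>p\<in>idx n. (\<Sum>q\<in>idx n. (r * w p q) * of_bool (q = q')) * of_bool (p = p'))"
      unfolding sum_distrib_right by (intro sum.cong refl) auto
    then show ?thesis using that by (simp only: sum_delta_simp[OF finite_idx])
  qed
  show ?thesis
    unfolding rr_def distrib_right sum.distrib D2_def scl_cq_def
    using s[of i j] s[of j i] s[of "- j" "- i"] assms by simp
qed

text \<open>The relation \<open>S\<^sub>1\<^sub>3\<^sup>-\<^sup>1 S\<^sub>1\<^sub>2\<^sup>-\<^sup>1 S\<^sub>2\<^sub>3 = S\<^sub>2\<^sub>3 S\<^sub>1\<^sub>2\<^sup>-\<^sup>1 S\<^sub>1\<^sub>3\<^sup>-\<^sup>1\<close>.\<close>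

lemma braid_components:
  assumes I: "a \<in> idx n" "b \<in> idx n" "c \<in> idx n" "d \<in> idx n" "i \<in> idx n" "j \<in> idx n"
  shows "(\<Sum>l\<in>idx n. \<Sum>u\<in>idx n. \<Sum>y\<in>idx n.
      rq y l a j * rq' u c d y * rq' b i u l * sgnp ((parity i + parity l) * parity c))
    = (\<Sum>v\<in>idx n. \<Sum>s\<in>idx n. \<Sum>t\<in>idx n.
      rq' s t d j * rq' b v s a * rq c i v t * sgnp ((parity t + parity j) * parity a))"
proof -
  let ?I = "idx n"
  \<comment> \<open>The indicator of (b, c, i), evaluated in the end at (d, a, j): this extracts a
    single coefficient from an identity between operators.\<close>
  define w :: "int \<Rightarrow> int \<Rightarrow> int \<Rightarrow> cq" where "w p q r = of_bool (p = b) * of_bool (q = c) * of_bool (r = i)" for p q r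
  have D13: "D13 (inverse qq) (- \<xi>) w u v l = rq' b i u l * sgnp ((parity i + parity l) * parity c) * of_bool (v = c)"
    if "u \<in> ?I" "l \<in> ?I" for u v l
  proof -
    have "D13 (inverse qq) (- \<xi>) w u v l = (\<Sum>p\<in>?I. \<Sum>q\<in>?I. rq' p q u l * (sgnp ((parity q + parity l) * parity v) * w p v q))"
      using that by (simp add: D_eq_D2 idx_nonzero D2_sum scl_cq_def)
    also have "\<dots> = (\<Sum>p\<in>?I. (\<Sum>q\<in>?I. (rq' p q u l * sgnp ((parity q + parity l) * parity v) * of_bool (v = c)) * of_bool (q = i)) * of_bool (p = b))"
      unfolding w_def sum_distrib_right by (intro sum.cong refl) simp
    also have "\<dots> = rq' b i u l * sgnp ((parity i + parity l) * parity v) * of_bool (v = c)"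
      using I by (simp only: sum_delta_simp[OF finite_idx])
    finally show ?thesis by auto
  qed
  have D12: "D12 (inverse qq) (- \<xi>) (D13 (inverse qq) (- \<xi>) w) d y l
      = (\<Sum>u\<in>?I. rq' u c d y * rq' b i u l * sgnp ((parity i + parity l) * parity c))"
    if "y \<in> ?I" "l \<in> ?I" for y l
  proof -
    have "D12 (inverse qq) (- \<xi>) (D13 (inverse qq) (- \<xi>) w) d y l
      = (\<Sum>u\<in>?I. \<Sum>v\<in>?I. rq' u v d y * D13 (inverse qq) (- \<xi>) w u v l)"
      using that I by (simp add: D_eq_D2 D2_sum)
    also have "\<dots> = (\<Sum>u\<in>?I. \<Sum>v\<in>?I. (rq' u v d y * rq' b i u l * sgnp ((parity i + parity l) * parity c)) * of_bool (v = c))"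
      using that by (intro sum.cong refl) (simp add: D13 mult.assoc)
    finally show ?thesis
      using I by (simp only: sum_delta_simp[OF finite_idx])
  qed
  have L: "D23 qq \<xi> (D12 (inverse qq) (- \<xi>) (D13 (inverse qq) (- \<xi>) w)) d a j
      = (\<Sum>l\<in>?I. \<Sum>u\<in>?I. \<Sum>y\<in>?I. rq y l a j * rq' u c d y * rq' b i u l * sgnp ((parity i + parity l) * parity c))"
  proof -
    have "D23 qq \<xi> (D12 (inverse qq) (- \<xi>) (D13 (inverse qq) (- \<xi>) w)) d a j
      = (\<Sum>y\<in>?I. \<Sum>l\<in>?I. rq y l a j * (\<Sum>u\<in>?I. rq' u c d y * rq' b i u l * sgnp ((parity i + parity l) * parity c)))"
      using I by (simp add: D_eq_D2(2) D2_sum D12)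
    also have "\<dots> = (\<Sum>l\<in>?I. \<Sum>y\<in>?I. \<Sum>u\<in>?I. rq y l a j * rq' u c d y * rq' b i u l * sgnp ((parity i + parity l) * parity c))"
      unfolding sum_distrib_left mult.assoc by (rule sum.swap)
    also have "\<dots> = (\<Sum>l\<in>?I. \<Sum>u\<in>?I. \<Sum>y\<in>?I. rq y l a j * rq' u c d y * rq' b i u l * sgnp ((parity i + parity l) * parity c))"
      by (rule sum.cong[OF refl], rule sum.swap)
    finally show ?thesis .
  qed
  have D23: "D23 qq \<xi> w s v t = rq c i v t * of_bool (s = b)" if "v \<in> ?I" "t \<in> ?I" for s v t
  proof -
    have "D23 qq \<xi> w s v t = (\<Sum>p\<in>?I. \<Sum>q\<in>?I. rq p q v t * w s p q)"
      using that by (simp add: D_eq_D2(2) D2_sum)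
    also have "\<dots> = (\<Sum>p\<in>?I. (\<Sum>q\<in>?I. (rq p q v t * of_bool (s = b)) * of_bool (q = i)) * of_bool (p = c))"
      unfolding w_def sum_distrib_right by (intro sum.cong refl) simp
    finally show ?thesis
      using I by (simp only: sum_delta_simp[OF finite_idx])
  qed
  have D12': "D12 (inverse qq) (- \<xi>) (D23 qq \<xi> w) s a t = (\<Sum>v\<in>?I. rq' b v s a * rq c i v t)"
    if "s \<in> ?I" "t \<in> ?I" for s t
  proof -
    have "D12 (inverse qq) (- \<xi>) (D23 qq \<xi> w) s a t = (\<Sum>p\<in>?I. \<Sum>v\<in>?I. rq' p v s a * D23 qq \<xi> w p v t)"
      using that I by (simp add: D_eq_D2(1) D2_sum)
    also have "\<dots> = (\<Sum>p\<in>?I. (\<Sum>v\<in>?I. rq' p v s a * rq c i v t) * of_bool (p = b))"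
      unfolding sum_distrib_right using that by (intro sum.cong refl) (simp add: D23)
    finally show ?thesis
      using I by (simp only: sum_delta_simp[OF finite_idx])
  qed
  have R: "D13 (inverse qq) (- \<xi>) (D12 (inverse qq) (- \<xi>) (D23 qq \<xi> w)) d a j
      = (\<Sum>v\<in>?I. \<Sum>s\<in>?I. \<Sum>t\<in>?I. rq' s t d j * rq' b v s a * rq c i v t * sgnp ((parity t + parity j) * parity a))"
  proof -
    have "D13 (inverse qq) (- \<xi>) (D12 (inverse qq) (- \<xi>) (D23 qq \<xi> w)) d a j
      = (\<Sum>s\<in>?I. \<Sum>t\<in>?I. rq' s t d j * (sgnp ((parity t + parity j) * parity a) * (\<Sum>v\<in>?I. rq' b v s a * rq c i v t)))"
      using I by (simp add: D_eq_D2(3) idx_nonzero D2_sum scl_cq_def D12')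
    also have "\<dots> = (\<Sum>s\<in>?I. \<Sum>t\<in>?I. \<Sum>v\<in>?I. rq' s t d j * rq' b v s a * rq c i v t * sgnp ((parity t + parity j) * parity a))"
      unfolding sum_distrib_left by (intro sum.cong refl) (simp add: mult_ac)
    also have "\<dots> = (\<Sum>s\<in>?I. \<Sum>v\<in>?I. \<Sum>t\<in>?I. rq' s t d j * rq' b v s a * rq c i v t * sgnp ((parity t + parity j) * parity a))"
      by (rule sum.cong[OF refl], rule sum.swap)
    also have "\<dots> = (\<Sum>v\<in>?I. \<Sum>s\<in>?I. \<Sum>t\<in>?I. rq' s t d j * rq' b v s a * rq c i v t * sgnp ((parity t + parity j) * parity a))"
      by (rule sum.swap)
    finally show ?thesis .
  qed
  have "D23 qq \<xi> (D12 (inverse qq) (- \<xi>) (D13 (inverse qq) (- \<xi>) w)) d a j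
    = D13 (inverse qq) (- \<xi>) (D12 (inverse qq) (- \<xi>) (D23 qq \<xi> w)) d a j"
    by (rule yang_baxter_mixed[OF _ _ I(4,1,6)]) (simp_all add: \<xi>_def)
  then show ?thesis
    unfolding L R .
qed

section \<open>Equivariance of \<open>\<Upsilon>\<close> on the generators\<close>

lemma vsum_delta:
  assumes "finite A" "a \<in> A"
  shows "(\<Sum>k\<in>A. (f k * of_bool (k = a)) \<cdot> T k) = f a \<cdot> (T a :: 'v::cqspace)"
proof -
  have "(\<Sum>k\<in>A. (f k * of_bool (k = a)) \<cdot> T k) = (\<Sum>k\<in>A. if k = a then f k \<cdot> T k else 0)"
    by (intro sum.cong refl) simp
  then show ?thesis using assms by (simp add: sum.delta')
qed

text \<open>Recognises the prescribed formula as the matrix of the inverse of S: the parts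
  \<open>R1\<close>, \<open>R2\<close>, \<open>R3\<close> of a coefficient are the diagonal term,
  the sum with \<open>a = b\<close> and the sum with \<open>a = - b\<close>.\<close>

lemma Upsilon_generators:
  assumes \<Upsilon>: "is_Upsilon r s n \<Upsilon>" and I: "\<alpha> \<in> idx s" "u \<in> idx n" "k \<in> {1..int r}" "y \<in> idx n"
  shows "\<Upsilon> (tbar \<alpha> u \<otimes> tgen k y) = (\<Sum>c\<in>idx n. \<Sum>d\<in>idx n.
    (sgnp (parity y * (parity \<alpha> + parity d)) * rq' u c d y) \<cdot> (tgen k c \<otimes> tbar \<alpha> d))"
proof -
  let ?I = "idx n"
  define T where "T c d = (tgen k c :: 'a uq dual) \<otimes> (tbar \<alpha> d :: 'a uq dual)" for c d
  define e where "e d = sgnp (parity y * (parity \<alpha> + parity d))" for d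
  have 1: "(\<Sum>c\<in>?I. \<Sum>d\<in>?I. (e d * (R1 (inverse qq) d y * of_bool (u = d \<and> c = y))) \<cdot> T c d)
      = (e u * qq powi (- \<phi> u y)) \<cdot> T y u"
  proof -
    have "(\<Sum>c\<in>?I. \<Sum>d\<in>?I. (e d * (R1 (inverse qq) d y * of_bool (u = d \<and> c = y))) \<cdot> T c d)
      = (\<Sum>d\<in>?I. \<Sum>c\<in>?I. ((e d * R1 (inverse qq) d y * of_bool (d = u)) * of_bool (c = y)) \<cdot> T c d)"
      by (subst sum.swap, intro sum.cong refl) auto
    also have "\<dots> = (e u * R1 (inverse qq) u y) \<cdot> T y u"
      using I by (simp only: vsum_delta[OF finite_idx])
    finally show ?thesis
      by (simp add: R1_def power_int_minus power_int_inverse)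
  qed
  have 2: "(\<Sum>c\<in>?I. \<Sum>d\<in>?I. (e d * (R2 (- \<xi>) d y * of_bool (u = y \<and> c = d))) \<cdot> T c d)
      = (\<Sum>p\<in>{p\<in>?I. p < y}. (- (sgnp (parity y * parity \<alpha>) * \<xi>) * of_bool (y = u)) \<cdot> T p p)"
  proof -
    have "(\<Sum>c\<in>?I. \<Sum>d\<in>?I. (e d * (R2 (- \<xi>) d y * of_bool (u = y \<and> c = d))) \<cdot> T c d)
      = (\<Sum>c\<in>?I. \<Sum>d\<in>?I. ((e d * R2 (- \<xi>) d y * of_bool (y = u)) * of_bool (d = c)) \<cdot> T c d)"
      by (intro sum.cong refl) auto
    also have "\<dots> = (\<Sum>c\<in>?I. (e c * R2 (- \<xi>) c y * of_bool (y = u)) \<cdot> T c c)"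
      by (intro sum.cong refl) (simp only: vsum_delta[OF finite_idx])
    also have "\<dots> = (\<Sum>c\<in>?I. if c < y then (- (sgnp (parity y * parity \<alpha>) * \<xi>) * of_bool (y = u)) \<cdot> T c c else 0)"
    proof (intro sum.cong refl)
      fix c
      have "e c * (sgnp (parity c * parity y) * - \<xi>) = - (sgnp (parity y * parity \<alpha>) * \<xi>)"
        unfolding e_def by (cases "parity c"; cases "parity y"; cases "parity \<alpha>") simp_all
      then show "(e c * R2 (- \<xi>) c y * of_bool (y = u)) \<cdot> T c c
          = (if c < y then (- (sgnp (parity y * parity \<alpha>) * \<xi>) * of_bool (y = u)) \<cdot> T c c else 0)"
        by (simp only: R2_def) simp
    qed
    finally show ?thesis
      by (simp only: sum.inter_filter[OF finite_idx])
  qed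
  have 3: "(\<Sum>c\<in>?I. \<Sum>d\<in>?I. (e d * (R3 (- \<xi>) d y * of_bool (u = - y \<and> c = - d))) \<cdot> T c d)
      = (\<Sum>p\<in>{p\<in>?I. p < y}. (- (sgnp (parity y * parity \<alpha>) * \<xi>) * (sgnp (parity p) * of_bool (y = - u))) \<cdot> T p (- p))"
  proof -
    have "(\<Sum>c\<in>?I. \<Sum>d\<in>?I. (e d * (R3 (- \<xi>) d y * of_bool (u = - y \<and> c = - d))) \<cdot> T c d)
      = (\<Sum>c\<in>?I. \<Sum>d\<in>?I. ((e d * R3 (- \<xi>) d y * of_bool (y = - u)) * of_bool (d = - c)) \<cdot> T c d)"
      by (intro sum.cong refl) auto
    also have "\<dots> = (\<Sum>c\<in>?I. (e (- c) * R3 (- \<xi>) (- c) y * of_bool (y = - u)) \<cdot> T c (- c))"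
      by (intro sum.cong refl) (simp only: vsum_delta[OF finite_idx] neg_idx)
    also have "\<dots> = (\<Sum>c\<in>?I. if c < y then (- (sgnp (parity y * parity \<alpha>) * \<xi>) * (sgnp (parity c) * of_bool (y = - u))) \<cdot> T c (- c) else 0)"
    proof (intro sum.cong refl)
      fix c assume "c \<in> ?I"
      then have c: "c \<noteq> 0" by (rule idx_nonzero)
      have "e (- c) * (sgnp (parity (- c) * parity y + parity (- c) + 1) * - \<xi>) = - (sgnp (parity y * parity \<alpha>) * \<xi>) * sgnp (parity c)"
        unfolding e_def parity_neg[OF c] by (cases "parity c"; cases "parity y"; cases "parity \<alpha>") simp_all
      then show "(e (- c) * R3 (- \<xi>) (- c) y * of_bool (y = - u)) \<cdot> T c (- c)
          = (if c < y then (- (sgnp (parity y * parity \<alpha>) * \<xi>) * (sgnp (parity c) * of_bool (y = - u))) \<cdot> T c (- c) else 0)"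
        by (cases "c < y"; cases "y = - u") (simp_all only: R3_def of_bool_eq if_True if_False mult_1_right mult_zero_right cqs.scale_zero_left mult_zero_left neg_less_iff_less minus_minus simp_thms)
    qed
    finally show ?thesis
      by (simp only: sum.inter_filter[OF finite_idx])
  qed
  have "(\<Sum>c\<in>?I. \<Sum>d\<in>?I. (e d * rq' u c d y) \<cdot> T c d)
      = (e u * qq powi (- \<phi> u y)) \<cdot> T y u
        + ((\<Sum>p\<in>{p\<in>?I. p < y}. (- (sgnp (parity y * parity \<alpha>) * \<xi>) * of_bool (y = u)) \<cdot> T p p)
        + (\<Sum>p\<in>{p\<in>?I. p < y}. (- (sgnp (parity y * parity \<alpha>) * \<xi>) * (sgnp (parity p) * of_bool (y = - u))) \<cdot> T p (- p)))"
    unfolding rr_def distrib_left scl_add_left sum.distrib 1 2 3 by (simp only: add.assoc)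
  also have "\<dots> = \<Upsilon> (tbar \<alpha> u \<otimes> tgen k y)"
    using \<Upsilon> I
    by (simp add: is_Upsilon_def e_def T_def tens_lin cqs.scale_sum_right sum.distrib[symmetric] scl_add_right
        sum_negf[symmetric] flip: sum.distrib)
  finally show ?thesis
    by (simp add: e_def T_def)
qed

lemma tact_Lgen:
  assumes n: "n \<le> CARD('N)" and ij: "i \<in> idx n" "j \<in> idx n" and x: "homog p x"
  shows "tact \<Phi> \<Phi> (Lgen i j :: 'N::finite uq) (x \<otimes> y) = (\<Sum>l\<in>idx n.
    (csign i l j * sgnp (p * (parity l + parity j))) \<cdot> (\<Phi> (Lgen i l) x \<otimes> \<Phi> (Lgen l j) y))"
proof -
  have "tact \<Phi> \<Phi> (Lgen i j :: 'N uq) (x \<otimes> y) = (\<Sum>l\<in>idx CARD('N).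
    (csign i l j * sgnp (p * (parity l + parity j))) \<cdot> (\<Phi> (Lgen i l) x \<otimes> \<Phi> (Lgen l j) y))"
    unfolding tact_def comult_Lgen cqlinearD(2,6)[OF act2_linear(2)[OF is_act_Phi is_act_Phi]]
    by (intro sum.cong refl) (simp add: act2_homog[OF is_act_Phi is_act_Phi x gradedD[OF graded_Lgen]])
  also have "\<dots> = (\<Sum>l\<in>idx n.
    (csign i l j * sgnp (p * (parity l + parity j))) \<cdot> (\<Phi> (Lgen i l) x \<otimes> \<Phi> (Lgen l j) y))"
  proof (rule sum.mono_neutral_right)
    show "\<forall>l\<in>idx CARD('N) - idx n. (csign i l j * sgnp (p * (parity l + parity j))) \<cdot> (\<Phi> (Lgen i l) x \<otimes> \<Phi> (Lgen l j) y) = 0"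
    proof
      fix l assume l: "l \<in> idx CARD('N) - idx n"
      then have "\<not> (i \<le> l \<and> l \<le> j)"
        using idx_between[OF ij, of l] idx_nonzero[of l "CARD('N)"] by blast
      then have "(Lgen i l :: 'N uq) = 0 \<or> (Lgen l j :: 'N uq) = 0"
        using fgen_outside[of i l, where 'N = 'N] fgen_outside[of l j, where 'N = 'N] by blast
      then show "(csign i l j * sgnp (p * (parity l + parity j))) \<cdot> (\<Phi> (Lgen i l) x \<otimes> \<Phi> (Lgen l j) y) = 0"
        by (elim disjE) (simp_all only: cqlinearD(3)[OF Phi_linear(2)] tens_zero cqs.scale_zero_right)
    qed
  qed (use idx_mono[OF n] in auto)
  finally show ?thesis .
qed

lemma tens_double_sum:
  "(\<Sum>u\<in>A. f u \<cdot> x u) \<otimes> (\<Sum>y\<in>B. g y \<cdot> z y) = (\<Sum>u\<in>A. \<Sum>y\<in>B. (f u * g y) \<cdot> (x u \<otimes> z y))"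
  unfolding tens_sum(1) tens_lin(4) unfolding tens_sum(2) tens_lin(2) by (simp add: cqs.scale_sum_right)

lemma sum_rotate5:
  "(\<Sum>l\<in>A. \<Sum>u\<in>A. \<Sum>y\<in>A. \<Sum>c\<in>A. \<Sum>d\<in>A. f l u y c d)
    = (\<Sum>c\<in>A. \<Sum>d\<in>A. \<Sum>l\<in>A. \<Sum>u\<in>A. \<Sum>y\<in>A. f l u y c d)"
proof -
  have rot: "(\<Sum>l\<in>A. \<Sum>u\<in>A. \<Sum>y\<in>A. \<Sum>c\<in>A. g l u y c) = (\<Sum>c\<in>A. \<Sum>l\<in>A. \<Sum>u\<in>A. \<Sum>y\<in>A. g l u y c)" for g
  proof -
    have "(\<Sum>l\<in>A. \<Sum>u\<in>A. \<Sum>y\<in>A. \<Sum>c\<in>A. g l u y c) = (\<Sum>l\<in>A. \<Sum>u\<in>A. \<Sum>c\<in>A. \<Sum>y\<in>A. g l u y c)"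
      by (rule sum.cong[OF refl], rule sum.cong[OF refl], rule sum.swap)
    also have "\<dots> = (\<Sum>l\<in>A. \<Sum>c\<in>A. \<Sum>u\<in>A. \<Sum>y\<in>A. g l u y c)"
      by (rule sum.cong[OF refl], rule sum.swap)
    also have "\<dots> = (\<Sum>c\<in>A. \<Sum>l\<in>A. \<Sum>u\<in>A. \<Sum>y\<in>A. g l u y c)"
      by (rule sum.swap)
    finally show ?thesis .
  qed
  show ?thesis
    unfolding rot[of "\<lambda>l u y c. \<Sum>d\<in>A. f l u y c d"] by (rule sum.cong[OF refl], rule rot)
qed

text \<open>The first factor on the right-hand side involves only indices that stay fixed while l,
  u, y are summed, and it is the same factor as in \<open>bit_sign_right\<close>. What remains is
  the sign occurring in \<open>braid_components\<close>.\<close>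

lemma bit_sign_left:
  fixes a b c d i j l u y al :: bit
  assumes "y + l = a + j" "u + c = d + y" "b + i = u + l"
  shows "sgnp ((i + l) * (l + j)) * sgnp ((al + b) * (l + j)) * (sgnp (l + j) * sgnp ((l + j) * a)) * sgnp (y * (al + d))
    = sgnp (a * j + a * b + a * i + a * c + a + a * al + (i + j) * c) * sgnp ((i + l) * c)"
proof -
  have y: "y = a + j + l"
    using arg_cong[OF assms(1), of "\<lambda>x. x + l"] by (simp add: add_ac)
  have u: "u = b + i + l"
    using arg_cong[OF assms(3), of "\<lambda>x. x + l"] by (simp add: add_ac)
  have d: "d = b + i + l + c + (a + j + l)"
    using arg_cong[OF assms(2), of "\<lambda>x. x + y"] unfolding y u by (simp add: add_ac)
  show ?thesis
    unfolding d y by (cases a; cases b; cases c; cases i; cases j; cases l; cases al) simp_all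
qed

lemma bit_sign_right:
  fixes a b c d i j s t v al :: bit
  assumes "b + v = s + a" "c + i = v + t" "s + t = d + j"
  shows "sgnp ((i + t) * (t + j)) * sgnp (v * (t + j)) * sgnp (a * (al + s)) * (sgnp (i + t) * sgnp ((i + t) * v))
    = sgnp (a * j + a * b + a * i + a * c + a + a * al + (i + j) * c) * sgnp ((t + j) * a)"
proof -
  have v: "v = c + i + t"
    using arg_cong[OF assms(2), of "\<lambda>x. x + t"] by (simp add: add_ac)
  have s: "s = b + (c + i + t) + a"
    using arg_cong[OF assms(1), of "\<lambda>x. x + a"] unfolding v by (simp add: add_ac)
  show ?thesis
    unfolding s v by (cases a; cases b; cases c; cases i; cases j; cases t; cases al) simp_all
qed

text \<open>Both sides are expanded in the tensors \<open>T c d\<close>. No linear independence of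
  these is involved, since the coefficients themselves turn out to be equal.\<close>

lemma Upsilon_equivariant_generators:
  fixes \<Upsilon> :: "('N::finite uq dual, 'N uq dual) tensor \<Rightarrow> ('N uq dual, 'N uq dual) tensor"
  assumes n: "n \<le> CARD('N)" and \<Upsilon>: "is_Upsilon r s n \<Upsilon>"
    and I: "\<alpha> \<in> idx s" "b \<in> idx n" "k \<in> {1..int r}" "a \<in> idx n" "i \<in> idx n" "j \<in> idx n"
  shows "\<Upsilon> (tact \<Phi> \<Phi> (Lgen i j) (tbar \<alpha> b \<otimes> tgen k a)) = tact \<Phi> \<Phi> (Lgen i j) (\<Upsilon> (tbar \<alpha> b \<otimes> tgen k a))"
proof -
  let ?I = "idx n"
  have lin: "cqlinear \<Upsilon>"
    using \<Upsilon> by (simp add: is_Upsilon_def)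
  define T where "T c d = (tgen k c :: 'N uq dual) \<otimes> (tbar \<alpha> d :: 'N uq dual)" for c d
  \<comment> \<open>The sign common to all terms with a given c, taken from
    \<open>bit_sign_left\<close> and \<open>bit_sign_right\<close>.\<close>
  define E where "E c = sgnp (parity a * parity j + parity a * parity b + parity a * parity i + parity a * parity c
    + parity a + parity a * parity \<alpha> + (parity i + parity j) * parity c)" for c
  \<comment> \<open>\<open>A\<close> gives the coefficients of \<open>T c d\<close> when the action
    precedes \<Upsilon>, and \<open>B\<close> those when it follows \<Upsilon>. Where the
    coefficients of S are nonzero, \<open>rr_parity\<close> makes the sign identities
    available.\<close>
  define A where "A l u y c d = csign i l j * sgnp ((parity \<alpha> + parity b) * (parity l + parity j)) *
    (rq' b i u l * (sgnp (parity l + parity j) * sgnp ((parity l + parity j) * parity a) * rq y l a j)) *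
    (sgnp (parity y * (parity \<alpha> + parity d)) * rq' u c d y)" for l u y c d
  define B where "B v s t c d = (sgnp (parity a * (parity \<alpha> + parity s)) * rq' b v s a) *
    (csign i t j * sgnp (parity v * (parity t + parity j))) *
    ((sgnp (parity i + parity t) * sgnp ((parity i + parity t) * parity v) * rq c i v t) * rq' s t d j)" for v s t c d
  have A: "A l u y c d = E c * (rq y l a j * rq' u c d y * rq' b i u l * sgnp ((parity i + parity l) * parity c))"
    if "l \<in> ?I" "u \<in> ?I" "y \<in> ?I" "d \<in> ?I" for l u y c d
  proof (cases "rq y l a j = 0 \<or> rq' u c d y = 0 \<or> rq' b i u l = 0")
    case True
    then show ?thesis by (auto simp: A_def)
  next
    case False
    then have "parity y + parity l = parity a + parity j" "parity u + parity c = parity d + parity y"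
      "parity b + parity i = parity u + parity l"
      using rr_parity[OF _ I(4,6)] rr_parity[OF _ that(4,3)] rr_parity[OF _ that(2,1)] by blast+
    from bit_sign_left[OF this, of "parity \<alpha>"] show ?thesis
      unfolding A_def E_def csign_def by (simp add: mult_ac)
  qed
  have B: "B v s t c d = E c * (rq' s t d j * rq' b v s a * rq c i v t * sgnp ((parity t + parity j) * parity a))"
    if "v \<in> ?I" "s \<in> ?I" "t \<in> ?I" "d \<in> ?I" for v s t c d
  proof (cases "rq' s t d j = 0 \<or> rq' b v s a = 0 \<or> rq c i v t = 0")
    case True
    then show ?thesis by (auto simp: B_def)
  next
    case False
    then have "parity b + parity v = parity s + parity a" "parity c + parity i = parity v + parity t"
      "parity s + parity t = parity d + parity j"
      using rr_parity[OF _ that(4) I(6)] rr_parity[OF _ that(1,3)] rr_parity[OF _ that(2) I(4)] by blast+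
    from bit_sign_right[OF this, of "parity \<alpha>"] show ?thesis
      unfolding B_def E_def csign_def by (simp add: mult_ac)
  qed
  have AB: "(\<Sum>l\<in>?I. \<Sum>u\<in>?I. \<Sum>y\<in>?I. A l u y c d) = (\<Sum>v\<in>?I. \<Sum>s\<in>?I. \<Sum>t\<in>?I. B v s t c d)"
    if "c \<in> ?I" "d \<in> ?I" for c d
  proof -
    have "(\<Sum>l\<in>?I. \<Sum>u\<in>?I. \<Sum>y\<in>?I. A l u y c d)
      = E c * (\<Sum>l\<in>?I. \<Sum>u\<in>?I. \<Sum>y\<in>?I. rq y l a j * rq' u c d y * rq' b i u l * sgnp ((parity i + parity l) * parity c))"
      unfolding sum_distrib_left using that by (intro sum.cong refl A)
    also have "\<dots> = E c * (\<Sum>v\<in>?I. \<Sum>s\<in>?I. \<Sum>t\<in>?I. rq' s t d j * rq' b v s a * rq c i v t * sgnp ((parity t + parity j) * parity a))"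
      by (simp only: braid_components[OF I(4,2) that I(5,6)])
    also have "\<dots> = (\<Sum>v\<in>?I. \<Sum>s\<in>?I. \<Sum>t\<in>?I. B v s t c d)"
      unfolding sum_distrib_left using that by (intro sum.cong refl B[symmetric])
    finally show ?thesis .
  qed
  \<comment> \<open>The row index is positive, so the parity of \<open>tgen k v\<close> is that of
    its column v.\<close>
  have k: "parity k = 0"
    using I(3) by (simp add: parity_def)
  have U: "\<Upsilon> (tbar \<alpha> u \<otimes> tgen k y) = (\<Sum>c\<in>?I. \<Sum>d\<in>?I.
      (sgnp (parity y * (parity \<alpha> + parity d)) * rq' u c d y) \<cdot> T c d)" if "u \<in> ?I" "y \<in> ?I" for u y
    unfolding T_def by (rule Upsilon_generators[OF \<Upsilon> I(1) that(1) I(3) that(2)])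
  have "\<Upsilon> (tact \<Phi> \<Phi> (Lgen i j) (tbar \<alpha> b \<otimes> tgen k a))
      = (\<Sum>l\<in>?I. \<Sum>u\<in>?I. \<Sum>y\<in>?I. \<Sum>c\<in>?I. \<Sum>d\<in>?I. A l u y c d \<cdot> T c d)"
  proof -
    have "\<Upsilon> (tact \<Phi> \<Phi> (Lgen i j) (tbar \<alpha> b \<otimes> tgen k a))
      = (\<Sum>l\<in>?I. (csign i l j * sgnp ((parity \<alpha> + parity b) * (parity l + parity j))) \<cdot>
          (\<Sum>u\<in>?I. \<Sum>y\<in>?I. (rq' b i u l * (sgnp (parity l + parity j) * sgnp ((parity l + parity j) * parity a) * rq y l a j)) \<cdot>
            \<Upsilon> (tbar \<alpha> u \<otimes> tgen k y)))"
      unfolding tact_Lgen[OF n I(5,6) homog_tbar] cqlinearD(2,6)[OF lin]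
      by (rule sum.cong[OF refl])
         (simp only: Phi_tbar[OF n I(5) _ I(2)] Phi_tgen[OF n _ I(6,4)] tens_double_sum cqlinearD(2,6)[OF lin])
    also have "\<dots> = (\<Sum>l\<in>?I. \<Sum>u\<in>?I. \<Sum>y\<in>?I. \<Sum>c\<in>?I. \<Sum>d\<in>?I. A l u y c d \<cdot> T c d)"
      unfolding cqs.scale_sum_right A_def
      by (intro sum.cong refl) (simp add: U cqs.scale_sum_right mult.assoc)
    finally show ?thesis .
  qed
  also have "\<dots> = (\<Sum>c\<in>?I. \<Sum>d\<in>?I. (\<Sum>l\<in>?I. \<Sum>u\<in>?I. \<Sum>y\<in>?I. A l u y c d) \<cdot> T c d)"
    unfolding cqs.scale_sum_left by (rule sum_rotate5[where f = "\<lambda>l u y c d. A l u y c d \<cdot> T c d"])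
  also have "\<dots> = (\<Sum>c\<in>?I. \<Sum>d\<in>?I. (\<Sum>v\<in>?I. \<Sum>s\<in>?I. \<Sum>t\<in>?I. B v s t c d) \<cdot> T c d)"
    by (intro sum.cong refl) (simp only: AB)
  also have "\<dots> = (\<Sum>v\<in>?I. \<Sum>s\<in>?I. \<Sum>t\<in>?I. \<Sum>c\<in>?I. \<Sum>d\<in>?I. B v s t c d \<cdot> T c d)"
    unfolding cqs.scale_sum_left by (rule sum_rotate5[where f = "\<lambda>v s t c d. B v s t c d \<cdot> T c d", symmetric])
  also have "\<dots> = tact \<Phi> \<Phi> (Lgen i j) (\<Upsilon> (tbar \<alpha> b \<otimes> tgen k a))"
  proof -
    note ta = cqlinearD(2,6)[OF is_act_linear(1)[OF is_act_tact[OF is_act_Phi is_act_Phi]]]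
    have t: "tact \<Phi> \<Phi> (Lgen i j) (T v s) = (\<Sum>t\<in>?I. (csign i t j * sgnp (parity v * (parity t + parity j))) \<cdot>
      (\<Sum>c\<in>?I. \<Sum>d\<in>?I. ((sgnp (parity i + parity t) * sgnp ((parity i + parity t) * parity v) * rq c i v t) * rq' s t d j) \<cdot> T c d))"
      if "v \<in> ?I" "s \<in> ?I" for v s
    proof -
      have h: "homog (parity v) (tgen k v :: 'N uq dual)"
        using homog_tgen[of k v] by (simp add: k)
      show ?thesis
        unfolding T_def tact_Lgen[OF n I(5,6) h]
        by (rule sum.cong[OF refl])
           (simp only: Phi_tbar[OF n _ I(6) that(2)] Phi_tgen[OF n I(5) _ that(1)] tens_double_sum)
    qed
    have "tact \<Phi> \<Phi> (Lgen i j) (\<Upsilon> (tbar \<alpha> b \<otimes> tgen k a))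
      = (\<Sum>v\<in>?I. \<Sum>s\<in>?I. (sgnp (parity a * (parity \<alpha> + parity s)) * rq' b v s a) \<cdot> tact \<Phi> \<Phi> (Lgen i j) (T v s))"
      by (simp only: U[OF I(2,4)] ta)
    also have "\<dots> = (\<Sum>v\<in>?I. \<Sum>s\<in>?I. \<Sum>t\<in>?I. \<Sum>c\<in>?I. \<Sum>d\<in>?I. B v s t c d \<cdot> T c d)"
      unfolding B_def by (intro sum.cong refl) (simp add: t cqs.scale_sum_right mult.assoc)
    finally show ?thesis ..
  qed
  finally show ?thesis .
qed

section \<open>From the generators to the coordinate superalgebras\<close>

text \<open>Bundles an equivariant map with its two actions and with stable source and target, so
  that the long composites in the product steps are assembled by
  \<open>mmap_compose\<close>.\<close>

definition mmap :: "'N::finite uq set \<Rightarrow> ('N uq \<Rightarrow> 'm::superspace \<Rightarrow> 'm) \<Rightarrow> ('N uq \<Rightarrow> 'k::superspace \<Rightarrow> 'k)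
    \<Rightarrow> 'm set \<Rightarrow> 'k set \<Rightarrow> ('m \<Rightarrow> 'k) \<Rightarrow> bool" where
  "mmap U F G X Y f \<longleftrightarrow> is_act F \<and> is_act G \<and> stable U F X \<and> stable U G Y \<and> mhom U F G X f \<and> f ` X \<subseteq> Y"

lemma mmapI: "is_act F \<Longrightarrow> is_act G \<Longrightarrow> stable U F X \<Longrightarrow> stable U G Y \<Longrightarrow> mhom U F G X f \<Longrightarrow> f ` X \<subseteq> Y \<Longrightarrow>
    mmap U F G X Y f"
  by (simp add: mmap_def)

lemma mmapD:
  assumes "mmap U F G X Y f"
  shows "is_act F" "is_act G" "stable U F X" "stable U G Y" "mhom U F G X f" "f ` X \<subseteq> Y" "cqlinear f"
    "hsub X" "hsub Y"
  using assms mhomD(1) by (auto simp: mmap_def stable_def)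

lemma mmap_id: "is_act F \<Longrightarrow> stable U F X \<Longrightarrow> mmap U F F X X id"
  by (rule mmapI) (simp_all only: mhom_id image_id id_apply order_refl)

lemma mmap_compose:
  assumes f: "mmap U F G X Y f" and g: "mmap U G H Y Z g"
  shows "mmap U F H X Z (\<lambda>x. g (f x))"
proof (rule mmapI)
  show "mhom U F H X (\<lambda>x. g (f x))"
    by (rule mhom_compose[OF mmapD(5)[OF f] mmapD(5)[OF g] mmapD(6)[OF f]])
  show "(\<lambda>x. g (f x)) ` X \<subseteq> Z"
    using mmapD(6)[OF f] mmapD(6)[OF g] by blast
qed (use mmapD[OF f] mmapD[OF g] in blast)+

lemma mmap_tmap:
  assumes U: "sub_coalg U" and f: "mmap U F F' X X' f" and g: "mmap U G G' Y Y' g"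
  shows "mmap U (tact F G) (tact F' G') (tensor_sub X Y) (tensor_sub X' Y') (tmap f g)"
  by (rule mmapI[OF is_act_tact is_act_tact stable_tensor_sub[OF U] stable_tensor_sub[OF U]
        mhom_tmap[OF U] tmap_tensor_sub])
     (rule mmapD[OF f] mmapD[OF g])+

lemma mmap_assocl:
  assumes U: "sub_coalg U" and F: "is_act F" "stable U F X" and G: "is_act G" "stable U G Y"
    and H: "is_act H" "stable U H Z"
  shows "mmap U (tact F (tact G H)) (tact (tact F G) H) (tensor_sub X (tensor_sub Y Z))
    (tensor_sub (tensor_sub X Y) Z) assocl"
  using F(2) G(2) H(2)
  by (intro mmapI is_act_tact F G H stable_tensor_sub[OF U] mhom_assocl assocl_tensor_sub) (simp_all add: stable_def)

lemma mmap_assocr: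
  assumes U: "sub_coalg U" and F: "is_act F" "stable U F X" and G: "is_act G" "stable U G Y"
    and H: "is_act H" "stable U H Z"
  shows "mmap U (tact (tact F G) H) (tact F (tact G H)) (tensor_sub (tensor_sub X Y) Z)
    (tensor_sub X (tensor_sub Y Z)) assocr"
  using F(2) G(2) H(2)
  by (intro mmapI is_act_tact F G H stable_tensor_sub[OF U] mhom_assocr assocr_tensor_sub) (simp_all add: stable_def)

lemma mhom_factor_image:
  assumes h: "mhom U F G V h" and R: "mmap U F H V W R"
    and f: "cqlinear f" "\<And>v. v \<in> V \<Longrightarrow> f (h v) = R v" and Z: "Z \<subseteq> h ` V"
  shows "mhom U G H Z f \<and> f ` Z \<subseteq> W"
proof
  show "mhom U G H Z f"
    by (rule mhom_factor[OF h mmapD(5,3)[OF R] f Z])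
  show "f ` Z \<subseteq> W"
    using Z f(2) mmapD(6)[OF R] by (auto simp: image_subset_iff)
qed

lemma mhom_span:
  assumes F: "is_act F" and G: "is_act G" and f: "cqlinear f" and K: "\<And>x. x \<in> K \<Longrightarrow> mhom U F G {x} f"
  shows "mhom U F G (cqspan K) f"
proof -
  note lF = cqlinearD[OF is_act_linear(1)[OF F]] and lG = cqlinearD[OF is_act_linear(1)[OF G]]
  have "(\<forall>p. f (hpart p x) = hpart p (f x)) \<and> (\<forall>u\<in>U. f (F u x) = G u (f x))" if "x \<in> cqspan K" for x
    using that
  proof (induction rule: cqs.span_induct_alt)
    case base
    show ?case by (simp add: cqlinearD[OF f] lF lG)
  next
    case (step c g y)
    then show ?case
      using K[of g] by (simp add: mhom_def cqlinearD[OF f] lF lG hpart_add hpart_scl)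
  qed
  with f show ?thesis by (simp add: mhom_def)
qed

text \<open>Equivariance at a point is a linear condition on that point. Each elementary tensor may
  therefore bring its own subspace V, and these need not fit together.\<close>

lemma mhom_tensor_sub:
  assumes "is_act F" "is_act G" "cqlinear f" "\<And>x y. x \<in> X \<Longrightarrow> y \<in> Y \<Longrightarrow> \<exists>V. x \<otimes> y \<in> V \<and> mhom U F G V f"
  shows "mhom U F G (tensor_sub X Y) f"
  unfolding tensor_sub_def using assms by (intro mhom_span) (fastforce intro: mhom_mono)+

lemma mhom_plus:
  assumes F: "is_act F" and G: "is_act G" and "mhom U F G V f" "x \<in> V" "mhom U F G W f" "y \<in> W"
  shows "mhom U F G {x + y} f"
  using assms(3-6)
  by (simp add: mhom_def cqlinearD(1)[OF is_act_linear(1)[OF F]] cqlinearD(1)[OF is_act_linear(1)[OF G]]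
      hpart_add cqlinearD(1))

text \<open>Supplies the surjectivity hypothesis of \<open>mhom_factor\<close> when multiplication
  is applied in one tensor slot.\<close>

lemma tensor_sub_image:
  assumes "cqlinear f" "cqlinear g"
  shows "tensor_sub (f ` X) (g ` Y) \<subseteq> tmap f g ` tensor_sub X Y"
  unfolding tensor_sub_def[of "f ` X"]
proof (rule cqs.span_minimal)
  note l = cqlinearD[OF cqlinear_tmap[OF assms]]
  show "{a \<otimes> b |a b. a \<in> f ` X \<and> b \<in> g ` Y} \<subseteq> tmap f g ` tensor_sub X Y"
    using tensor_sub_tens[of _ X _ Y] by (force simp: tmap_tens[OF assms, symmetric])
  show "cqsubspace (tmap f g ` tensor_sub X Y)"
  proof (rule cqs.subspaceI)
    show "0 \<in> tmap f g ` tensor_sub X Y"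
      using tensor_sub_closed(3)[of X Y] l(3) by (metis image_eqI)
    fix a b c assume a: "a \<in> tmap f g ` tensor_sub X Y"
    then show "c \<cdot> a \<in> tmap f g ` tensor_sub X Y"
      using tensor_sub_closed(2)[of _ X Y c] by (auto simp: l(2)[symmetric])
    assume "b \<in> tmap f g ` tensor_sub X Y"
    with a show "a + b \<in> tmap f g ` tensor_sub X Y"
      using tensor_sub_closed(1)[of _ X Y] by (auto simp: l(1)[symmetric])
  qed
qed

lemma tensor_sub_single:
  assumes X: "hsub X"
  shows "tensor_sub (cqspan {e}) X \<subseteq> (\<lambda>x. e \<otimes> x) ` X" "tensor_sub X (cqspan {e}) \<subseteq> (\<lambda>x. x \<otimes> e) ` X"
proof -
  note X = hsubD[OF X]
  have e: "\<exists>c. a = c \<cdot> e" if "a \<in> cqspan {e}" for a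
    using that by (auto simp: cqs.span_singleton)
  have "cqsubspace ((\<lambda>x. e \<otimes> x) ` X)"
    by (rule cqs.subspaceI)
       (force intro: X simp: tens_lin(1,2)[symmetric] | (rule image_eqI[of _ _ 0], simp, rule X))+
  moreover have "cqsubspace ((\<lambda>x. x \<otimes> e) ` X)"
    by (rule cqs.subspaceI)
       (force intro: X simp: tens_lin(3,4)[symmetric] | (rule image_eqI[of _ _ 0], simp, rule X))+
  moreover have "a \<otimes> x \<in> (\<lambda>x. e \<otimes> x) ` X" "x \<otimes> a \<in> (\<lambda>x. x \<otimes> e) ` X" if a: "a \<in> cqspan {e}" "x \<in> X" for a x
  proof -
    obtain c where "a = c \<cdot> e" using e[OF a(1)] by blast
    then have "a \<otimes> x = e \<otimes> (c \<cdot> x)" "x \<otimes> a = (c \<cdot> x) \<otimes> e"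
      by (simp_all only: tens_lin)
    then show "a \<otimes> x \<in> (\<lambda>x. e \<otimes> x) ` X" "x \<otimes> a \<in> (\<lambda>x. x \<otimes> e) ` X"
      using imageI[OF X(3)[OF a(2), of c], of "\<lambda>x. e \<otimes> x"] imageI[OF X(3)[OF a(2), of c], of "\<lambda>x. x \<otimes> e"] by simp_all
  qed
  ultimately show "tensor_sub (cqspan {e}) X \<subseteq> (\<lambda>x. e \<otimes> x) ` X" and "tensor_sub X (cqspan {e}) \<subseteq> (\<lambda>x. x \<otimes> e) ` X"
    unfolding tensor_sub_def by - (rule cqs.span_minimal; blast)+
qed

lemma tensor_sub_span:
  "tensor_sub (cqspan G) (cqspan H) = cqspan {g \<otimes> h | g h. g \<in> G \<and> h \<in> H}" (is "_ = cqspan ?K")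
proof
  have 1: "g \<otimes> b \<in> cqspan ?K" if "g \<in> G" "b \<in> cqspan H" for g b
    using that(2)
  proof (induction rule: cqs.span_induct_alt)
    case (step c h y)
    then have "g \<otimes> h \<in> cqspan ?K" using that(1) by (blast intro: cqs.span_base)
    with step show ?case by (simp add: tens_lin cqs.span_add cqs.span_scale)
  qed (simp add: cqs.span_zero)
  have "a \<otimes> b \<in> cqspan ?K" if "a \<in> cqspan G" "b \<in> cqspan H" for a b
    using that(1)
  proof (induction rule: cqs.span_induct_alt)
    case (step c g y)
    then show ?case using 1[OF step(1) that(2)] by (simp add: tens_lin cqs.span_add cqs.span_scale)
  qed (simp add: cqs.span_zero)
  then show "tensor_sub (cqspan G) (cqspan H) \<subseteq> cqspan ?K"
    unfolding tensor_sub_def by (intro cqs.span_minimal) auto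
  show "cqspan ?K \<subseteq> tensor_sub (cqspan G) (cqspan H)"
    unfolding tensor_sub_def by (intro cqs.span_mono) (auto intro: cqs.span_base)
qed

lemma span_generated: "cqspan X \<subseteq> generated_subalg m e G" if "X \<subseteq> generated_subalg m e G"
proof
  have zero: "0 \<in> generated_subalg m e G"
    using generated_subalg.scl[OF generated_subalg.one, where c = 0 and mult = m and one = e and G = G] by simp
  fix x assume "x \<in> cqspan X"
  then show "x \<in> generated_subalg m e G"
    by (induction rule: cqs.span_induct_alt)
       (use that zero in \<open>auto intro: generated_subalg.add generated_subalg.scl\<close>)
qed

lemma mmap_mul:
  fixes G :: "'N::finite uq dual set"
  assumes U: "sub_coalg U" and A: "stable U \<Phi> (generated_subalg dual_mult dual_one G)" (is "stable _ _ ?A")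
  shows "mmap U (tact \<Phi> \<Phi>) \<Phi> (tensor_sub ?A ?A) ?A mul"
proof (rule mmapI)
  have hA: "hsub ?A"
    using A by (simp add: stable_def)
  show "mul ` tensor_sub ?A ?A \<subseteq> ?A"
  proof (rule image_subsetI)
    fix z assume "z \<in> tensor_sub ?A ?A"
    then show "mul z \<in> ?A"
      using hA hA
      by (induction rule: tensor_sub_induct)
         (simp_all add: mul_tens generated_subalg.mult cqlinearD[OF cqlinear_mul] generated_subalg.add)
  qed
qed (intro is_act_tact is_act_Phi stable_tensor_sub U A mhom_mul)+

lemma homog_Upsilon_generators:
  fixes \<Upsilon> :: "('N::finite uq dual, 'N uq dual) tensor \<Rightarrow> ('N uq dual, 'N uq dual) tensor"
  assumes "is_Upsilon r s n \<Upsilon>" "\<alpha> \<in> idx s" "b \<in> idx n" "k \<in> {1..int r}" "a \<in> idx n"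
  shows "homog (parity \<alpha> + parity b + (parity k + parity a)) (\<Upsilon> (tbar \<alpha> b \<otimes> tgen k a))"
  unfolding Upsilon_generators[OF assms]
proof (intro homog_sum)
  fix c d assume cd: "c \<in> idx n" "d \<in> idx n"
  show "homog (parity \<alpha> + parity b + (parity k + parity a))
    ((sgnp (parity a * (parity \<alpha> + parity d)) * rq' b c d a) \<cdot> ((tgen k c :: 'N uq dual) \<otimes> (tbar \<alpha> d :: 'N uq dual)))"
  proof (cases "rq' b c d a = 0")
    case False
    have b: "parity b = parity d + parity a + parity c"
      using arg_cong[OF rr_parity[OF False cd(2) assms(5)], of "\<lambda>x. x + parity c"] by (simp add: add_ac)
    have h: "homog (parity k + parity c + (parity \<alpha> + parity d)) ((tgen k c :: 'N uq dual) \<otimes> (tbar \<alpha> d :: 'N uq dual))"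
      by (intro homog_tens homog_tgen homog_tbar)
    have e: "parity k + parity c + (parity \<alpha> + parity d) = parity \<alpha> + parity b + (parity k + parity a)"
      unfolding b by (cases "parity a"; cases "parity c"; cases "parity d"; cases "parity k"; cases "parity \<alpha>") simp_all
    show ?thesis by (rule homog_scl[OF h[unfolded e]])
  qed (simp add: homog_zero)
qed

section \<open>The generators, their stable spans, and \<Upsilon> on them\<close>

definition genA :: "nat \<Rightarrow> nat \<Rightarrow> 'N::finite uq dual set" where
  "genA r n = {tgen i a | i a. i \<in> idx r \<and> a \<in> idx n}"

definition genB :: "nat \<Rightarrow> nat \<Rightarrow> 'N::finite uq dual set" where
  "genB s n = {tbar \<alpha> b | \<alpha> b. \<alpha> \<in> idx s \<and> b \<in> idx n}"

lemma coord_gen: "coordA r n = generated_subalg dual_mult dual_one (genA r n)"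
  "coordAbar s n = generated_subalg dual_mult dual_one (genB s n)"
  by (simp_all only: coordA_def coordAbar_def genA_def genB_def)

lemma gen_homog: "g \<in> genA r n \<Longrightarrow> \<exists>p. homog p g" "g \<in> genB s n \<Longrightarrow> \<exists>p. homog p g"
  unfolding genA_def genB_def by (blast intro: homog_tgen homog_tbar)+

text \<open>Negating both indices makes the row positive, and \<open>is_Upsilon\<close> prescribes
  values for positive rows.\<close>

lemma genA_pos:
  assumes "g \<in> genA r n"
  obtains i a where "i \<in> {1..int r}" "a \<in> idx n" "g = tgen i a"
proof -
  obtain i a where g: "i \<in> idx r" "a \<in> idx n" "g = tgen i a"
    using assms by (auto simp: genA_def)
  show thesis
  proof (cases "0 < i")
    case True
    with g show thesis by (intro that[of i a]) (auto simp: idx_def)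
  next
    case False
    with g show thesis
      by (intro that[of "- i" "- a"]) (auto simp: idx_def tgen_neg)
  qed
qed

lemma stable_gen:
  assumes n: "n \<le> CARD('N)"
  shows "stable (uq_sub n) \<Phi> (cqspan (genA r n :: 'N::finite uq dual set))"
    "stable (uq_sub n) \<Phi> (cqspan (genB s n :: 'N uq dual set))"
proof -
  have "\<Phi> (Lgen i j) x \<in> cqspan K" if K: "\<And>x. x \<in> K \<Longrightarrow> \<Phi> (Lgen i j) x \<in> cqspan K" and x: "x \<in> cqspan K"
    for i j x and K :: "'N uq dual set"
    using x by (induction rule: cqs.span_induct_alt)
       (simp_all add: cqlinearD[OF Phi_linear(1)] K cqs.span_zero cqs.span_add cqs.span_scale)
  note span = this
  have A: "\<Phi> (Lgen i j) x \<in> cqspan (genA r n)" if ij: "i \<in> idx n" "j \<in> idx n" and g: "x \<in> genA r n" for i j and x :: "'N uq dual"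
  proof -
    obtain k a where x: "k \<in> idx r" "a \<in> idx n" "x = tgen k a"
      using g by (auto simp: genA_def)
    show ?thesis
      unfolding x(3) Phi_tgen[OF n ij x(2)]
      using x(1) by (intro cqs.span_sum cqs.span_scale cqs.span_base) (auto simp: genA_def)
  qed
  have B: "\<Phi> (Lgen i j) x \<in> cqspan (genB s n)" if ij: "i \<in> idx n" "j \<in> idx n" and g: "x \<in> genB s n" for i j and x :: "'N uq dual"
  proof -
    obtain \<alpha> b where x: "\<alpha> \<in> idx s" "b \<in> idx n" "x = tbar \<alpha> b"
      using g by (auto simp: genB_def)
    show ?thesis
      unfolding x(3) Phi_tbar[OF n ij x(2)]
      using x(1) by (intro cqs.span_sum cqs.span_scale cqs.span_base) (auto simp: genB_def)
  qed
  show "stable (uq_sub n) \<Phi> (cqspan (genA r n :: 'N uq dual set))"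
  proof (rule stable_uq_sub[OF is_act_Phi])
    show "hsub (cqspan (genA r n :: 'N uq dual set))"
      by (rule hsubI_span) (rule gen_homog(1))
    show "\<Phi> (Lgen i j) x \<in> cqspan (genA r n)" if "i \<in> idx n" "j \<in> idx n" "x \<in> cqspan (genA r n)" for i j and x :: "'N uq dual"
      by (rule span[OF A[OF that(1,2)] that(3)])
  qed
  show "stable (uq_sub n) \<Phi> (cqspan (genB s n :: 'N uq dual set))"
  proof (rule stable_uq_sub[OF is_act_Phi])
    show "hsub (cqspan (genB s n :: 'N uq dual set))"
      by (rule hsubI_span) (rule gen_homog(2))
    show "\<Phi> (Lgen i j) x \<in> cqspan (genB s n)" if "i \<in> idx n" "j \<in> idx n" "x \<in> cqspan (genB s n)" for i j and x :: "'N uq dual"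
      by (rule span[OF B[OF that(1,2)] that(3)])
  qed
qed

text \<open>The second claim sharpens the target of \<Upsilon>: the formula keeps the row index k,
  so its first tensor factors stay in the span of the generators. \<open>mhom_Upsilon_left\<close>
  depends on this.\<close>

lemma mhom_Upsilon_gen:
  fixes \<Upsilon> :: "('N::finite uq dual, 'N uq dual) tensor \<Rightarrow> ('N uq dual, 'N uq dual) tensor"
  assumes n: "n \<le> CARD('N)" and pos: "0 < n" and \<Upsilon>: "is_Upsilon r s n \<Upsilon>"
  shows "mhom (uq_sub n) (tact \<Phi> \<Phi>) (tact \<Phi> \<Phi>) (tensor_sub (cqspan (genB s n)) (cqspan (genA r n))) \<Upsilon>"
    "\<Upsilon> ` tensor_sub (cqspan (genB s n)) (cqspan (genA r n)) \<subseteq> tensor_sub (cqspan (genA r n)) (coordAbar s n)"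
proof -
  let ?K = "{g \<otimes> h | g h. g \<in> (genB s n :: 'N uq dual set) \<and> h \<in> (genA r n :: 'N uq dual set)}"
  have lin: "cqlinear \<Upsilon>"
    using \<Upsilon> by (simp add: is_Upsilon_def)
  have K: "P z" if z: "z \<in> ?K" and
    P: "\<And>\<alpha> b k a. \<alpha> \<in> idx s \<Longrightarrow> b \<in> idx n \<Longrightarrow> k \<in> {1..int r} \<Longrightarrow> a \<in> idx n \<Longrightarrow> P (tbar \<alpha> b \<otimes> tgen k a)" for P z
  proof -
    obtain g h where gh: "z = g \<otimes> h" "g \<in> genB s n" "h \<in> genA r n"
      using z by blast
    obtain \<alpha> b where g: "\<alpha> \<in> idx s" "b \<in> idx n" "g = tbar \<alpha> b"
      using gh(2) by (auto simp: genB_def)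
    obtain k a where h: "k \<in> {1..int r}" "a \<in> idx n" "h = tgen k a"
      using gh(3) by (rule genA_pos)
    show ?thesis
      unfolding gh(1) g(3) h(3) by (rule P[OF g(1,2) h(1,2)])
  qed
  \<comment> \<open>\<open>mhom\<close> asks nothing of the acting set, so it can be the bare set of
    generators here; the passage to the subalgebra is made by \<open>mhom_uq_sub\<close>.\<close>
  have hK: "mhom {Lgen i j | i j. i \<in> idx n \<and> j \<in> idx n} (tact \<Phi> \<Phi>) (tact \<Phi> \<Phi>) (cqspan ?K) \<Upsilon>"
  proof (rule mhom_span[OF is_act_tact[OF is_act_Phi is_act_Phi] is_act_tact[OF is_act_Phi is_act_Phi] lin])
    fix z assume "z \<in> ?K"
    then show "mhom {Lgen i j | i j. i \<in> idx n \<and> j \<in> idx n} (tact \<Phi> \<Phi>) (tact \<Phi> \<Phi>) {z} \<Upsilon>"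
    proof (rule K)
      fix \<alpha> b k a assume I: "\<alpha> \<in> idx s" "b \<in> idx n" "k \<in> {1..int r}" "a \<in> idx n"
      let ?z = "(tbar \<alpha> b :: 'N uq dual) \<otimes> (tgen k a :: 'N uq dual)"
      have z: "homog (parity \<alpha> + parity b + (parity k + parity a)) ?z"
        by (intro homog_tens homog_tbar homog_tgen)
      have "\<Upsilon> (hpart p ?z) = hpart p (\<Upsilon> ?z)" for p
        unfolding hpart_homog[OF z] hpart_homog[OF homog_Upsilon_generators[OF \<Upsilon> I]]
        by (simp add: cqlinearD(3)[OF lin])
      then show "mhom {Lgen i j | i j. i \<in> idx n \<and> j \<in> idx n} (tact \<Phi> \<Phi>) (tact \<Phi> \<Phi>) {?z} \<Upsilon>"
        unfolding mhom_def using lin Upsilon_equivariant_generators[OF n \<Upsilon> I] by blast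
    qed
  qed
  have U: "sub_coalg (uq_sub n :: 'N uq set)"
    by (rule sub_coalg_uq_sub[OF n])
  obtain i where i: "i \<in> idx n"
    using pos by (auto simp: idx_def intro: that[of 1])
  show "mhom (uq_sub n) (tact \<Phi> \<Phi>) (tact \<Phi> \<Phi>) (tensor_sub (cqspan (genB s n)) (cqspan (genA r n))) \<Upsilon>"
  proof (rule mhom_uq_sub[OF is_act_tact[OF is_act_Phi is_act_Phi] is_act_tact[OF is_act_Phi is_act_Phi] _ lin])
    show "stable (uq_sub n) (tact \<Phi> \<Phi>) (tensor_sub (cqspan (genB s n :: 'N uq dual set)) (cqspan (genA r n :: 'N uq dual set)))"
      by (intro stable_tensor_sub U is_act_Phi stable_gen n)
  qed (use mhomD(2,3)[OF hK] in \<open>simp_all only: tensor_sub_span, blast+\<close>)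
  let ?W = "tensor_sub (cqspan (genA r n)) (coordAbar s n) :: ('N uq dual, 'N uq dual) tensor set"
  have "\<Upsilon> z \<in> ?W" if "z \<in> cqspan ?K" for z
    using that
  proof (induction rule: cqs.span_induct_alt)
    case base
    show ?case by (simp add: cqlinearD(3)[OF lin] tensor_sub_closed)
  next
    case (step c z y)
    from step(1) have "\<Upsilon> z \<in> ?W"
    proof (rule K)
      fix \<alpha> b k a assume I: "\<alpha> \<in> idx s" "b \<in> idx n" "k \<in> {1..int r}" "a \<in> idx n"
      have "tgen k c \<otimes> tbar \<alpha> d \<in> ?W" if "c \<in> idx n" "d \<in> idx n" for c d
      proof (rule tensor_sub_tens)
        show "tgen k c \<in> cqspan (genA r n)"
          using that I(3) by (intro cqs.span_base) (force simp: genA_def idx_def)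
        show "tbar \<alpha> d \<in> coordAbar s n"
          unfolding coord_gen using that I(1) by (intro generated_subalg.gen) (auto simp: genB_def)
      qed
      then show "\<Upsilon> (tbar \<alpha> b \<otimes> tgen k a) \<in> ?W"
        unfolding Upsilon_generators[OF \<Upsilon> I] tensor_sub_def
        by (intro cqs.span_sum cqs.span_scale) 
    qed
    with step(2) show ?case
      by (simp add: cqlinearD[OF lin] tensor_sub_closed)
  qed
  then show "\<Upsilon> ` tensor_sub (cqspan (genB s n)) (cqspan (genA r n)) \<subseteq> ?W"
    by (auto simp: tensor_sub_span)
qed

section \<open>Spreading equivariance of \<Upsilon> over products\<close>

lemma Upsilon_linear: "is_Upsilon r s n \<Upsilon> \<Longrightarrow> cqlinear \<Upsilon>"
  by (simp add: is_Upsilon_def)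

lemma Upsilon_image: "is_Upsilon r s n \<Upsilon> \<Longrightarrow>
    \<Upsilon> ` tensor_sub (coordAbar s n) (coordA r n) \<subseteq> tensor_sub (coordA r n) (coordAbar s n)"
  by (simp add: is_Upsilon_def)

lemma Upsilon_one:
  assumes "is_Upsilon r s n \<Upsilon>"
  shows "f \<in> coordA r n \<Longrightarrow> \<Upsilon> (dual_one \<otimes> f) = f \<otimes> dual_one"
    "g \<in> coordAbar s n \<Longrightarrow> \<Upsilon> (g \<otimes> dual_one) = dual_one \<otimes> g"
  using assms by (simp_all add: is_Upsilon_def)

lemma Upsilon_mult:
  assumes "is_Upsilon r s n \<Upsilon>"
  shows "g \<in> coordAbar s n \<Longrightarrow> f \<in> coordA r n \<Longrightarrow> f' \<in> coordA r n \<Longrightarrow>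
      \<Upsilon> (tmap id mul (g \<otimes> (f \<otimes> f'))) =
          tmap mul id (assocl (tmap id \<Upsilon> (assocr (tmap \<Upsilon> id (assocl (g \<otimes> (f \<otimes> f')))))))"
    "g \<in> coordAbar s n \<Longrightarrow> g' \<in> coordAbar s n \<Longrightarrow> f \<in> coordA r n \<Longrightarrow>
      \<Upsilon> (tmap mul id ((g \<otimes> g') \<otimes> f)) =
          tmap id mul (assocr (tmap \<Upsilon> id (assocl (tmap id \<Upsilon> (assocr ((g \<otimes> g') \<otimes> f))))))"
  using assms unfolding is_Upsilon_def by blast+

lemma stable_coord:
  assumes "n \<le> CARD('N)"
  shows "stable (uq_sub n) \<Phi> (coordA r n :: 'N::finite uq dual set)"
    "stable (uq_sub n) \<Phi> (coordAbar s n :: 'N uq dual set)"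
  unfolding coord_gen
  by (rule stable_generated[OF sub_coalg_uq_sub[OF assms]], rule stable_gen[OF assms], erule gen_homog)+

lemma mmap_mul_coord:
  assumes n: "n \<le> CARD('N)"
  shows "mmap (uq_sub n) (tact \<Phi> \<Phi>) \<Phi> (tensor_sub (coordA r n) (coordA r n)) (coordA r n :: 'N::finite uq dual set) mul"
    "mmap (uq_sub n) (tact \<Phi> \<Phi>) \<Phi> (tensor_sub (coordAbar s n) (coordAbar s n)) (coordAbar s n :: 'N uq dual set) mul"
  using mmap_mul[OF sub_coalg_uq_sub[OF n]] stable_coord[OF n] unfolding coord_gen by blast+

lemma one_in_coord: "dual_one \<in> coordA r n" "dual_one \<in> coordAbar s n"
  unfolding coord_gen by (rule generated_subalg.one)+

text \<open>The right factor is held at the span of the generators. Since \<Upsilon> returns that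
  span as first tensor factor, the hypothesis on X can be applied after the one on Y has been
  used.\<close>

lemma mhom_Upsilon_left:
  fixes \<Upsilon> :: "('N::finite uq dual, 'N uq dual) tensor \<Rightarrow> ('N uq dual, 'N uq dual) tensor"
  assumes n: "n \<le> CARD('N)" and pos: "0 < n" and \<Upsilon>: "is_Upsilon r s n \<Upsilon>" and g: "g \<in> coordAbar s n"
  shows "\<exists>Y. g \<in> Y \<and> mhom (uq_sub n) (tact \<Phi> \<Phi>) (tact \<Phi> \<Phi>) (tensor_sub Y (cqspan (genA r n))) \<Upsilon>"
proof -
  let ?U = "uq_sub n :: 'N uq set" and ?F = "cqspan (genA r n) :: 'N uq dual set"
  let ?A = "coordA r n :: 'N uq dual set" and ?B = "coordAbar s n :: 'N uq dual set"
  have U: "sub_coalg ?U"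
    by (rule sub_coalg_uq_sub[OF n])
  note lin = Upsilon_linear[OF \<Upsilon>]
  note \<Phi> = is_act_Phi and \<Phi>\<Phi> = is_act_tact[OF is_act_Phi is_act_Phi]
  have F: "stable ?U \<Phi> ?F" "hsub ?F"
    using stable_gen(1)[OF n] by (auto simp: stable_def)
  note A = stable_coord(1)[OF n, of r] and B = stable_coord(2)[OF n, of s]
  have FA: "?F \<subseteq> ?A"
    unfolding coord_gen by (intro span_generated subsetI generated_subalg.gen)
  \<comment> \<open>Equivariance alone would not be inductive: the product step also needs to know
    where \<Upsilon> sends \<open>tensor_sub Y ?F\<close>.\<close>
  define E where "E Y \<longleftrightarrow> mhom ?U (tact \<Phi> \<Phi>) (tact \<Phi> \<Phi>) (tensor_sub Y ?F) \<Upsilon> \<and> \<Upsilon> ` tensor_sub Y ?F \<subseteq> tensor_sub ?F ?B" for Y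
  have "\<exists>X. stable ?U \<Phi> X \<and> X \<subseteq> generated_subalg dual_mult dual_one (genB s n) \<and> E X \<and> g \<in> X"
  proof (rule generated_stable_induct[OF U stable_gen(2)[OF n] _ _ _ _ g[unfolded coord_gen]])
    show "E (cqspan {dual_one})"
      unfolding E_def
    proof (rule mhom_factor_image[OF mhom_tens_one(2) mmapI[OF \<Phi> \<Phi>\<Phi> F(1) stable_tensor_sub[OF U \<Phi> F(1) \<Phi> B] mhom_tens_one(1)] lin])
      show "(\<lambda>f. f \<otimes> dual_one) ` ?F \<subseteq> tensor_sub ?F ?B"
        using one_in_coord by (intro image_subsetI tensor_sub_tens)
      show "\<Upsilon> (dual_one \<otimes> f) = f \<otimes> dual_one" if "f \<in> ?F" for f
        using Upsilon_one(1)[OF \<Upsilon>] FA that by blast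
      show "tensor_sub (cqspan {dual_one}) ?F \<subseteq> (\<lambda>f. dual_one \<otimes> f) ` ?F"
        by (rule tensor_sub_single(1)[OF F(2)])
    qed
    show "E (cqspan (genB s n))"
      unfolding E_def using mhom_Upsilon_gen[OF n pos \<Upsilon>] by blast
  next
    fix X Y :: "'N uq dual set" assume E: "E X" "E Y"
    have xy: "mhom ?U (tact \<Phi> \<Phi>) (tact \<Phi> \<Phi>) {(x + y) \<otimes> f} \<Upsilon>" "\<Upsilon> ((x + y) \<otimes> f) \<in> tensor_sub ?F ?B"
      if "x \<in> X" "y \<in> Y" "f \<in> ?F" for x y f
    proof -
      have x: "x \<otimes> f \<in> tensor_sub X ?F" and y: "y \<otimes> f \<in> tensor_sub Y ?F"
        using that by (auto intro: tensor_sub_tens)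
      show "mhom ?U (tact \<Phi> \<Phi>) (tact \<Phi> \<Phi>) {(x + y) \<otimes> f} \<Upsilon>"
        unfolding tens_lin(3) using E by (intro mhom_plus[OF \<Phi>\<Phi> \<Phi>\<Phi> _ x _ y]) (simp_all add: E_def)
      show "\<Upsilon> ((x + y) \<otimes> f) \<in> tensor_sub ?F ?B"
        unfolding tens_lin(3) cqlinearD(1)[OF lin] using E x y
        by (intro tensor_sub_closed(1)) (auto simp: E_def)
    qed
    show "E {x + y |x y. x \<in> X \<and> y \<in> Y}"
      unfolding E_def
    proof
      show "mhom ?U (tact \<Phi> \<Phi>) (tact \<Phi> \<Phi>) (tensor_sub {x + y |x y. x \<in> X \<and> y \<in> Y} ?F) \<Upsilon>"
        using xy(1) by (intro mhom_tensor_sub[OF \<Phi>\<Phi> \<Phi>\<Phi> lin]) blast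
      show "\<Upsilon> ` tensor_sub {x + y |x y. x \<in> X \<and> y \<in> Y} ?F \<subseteq> tensor_sub ?F ?B"
      proof (rule image_subsetI)
        fix z assume "z \<in> tensor_sub {x + y |x y. x \<in> X \<and> y \<in> Y} ?F"
        then show "\<Upsilon> z \<in> tensor_sub ?F ?B"
          unfolding tensor_sub_def[of "{x + y |x y. x \<in> X \<and> y \<in> Y}"]
        proof (induction rule: cqs.span_induct_alt)
          case base
          show ?case by (simp add: cqlinearD(3)[OF lin] tensor_sub_closed)
        next
          case (step c z w)
          from step(1) xy(2) have "\<Upsilon> z \<in> tensor_sub ?F ?B" by blast
          with step(2) show ?case
            by (simp add: cqlinearD[OF lin] tensor_sub_closed)
        qed
      qed
    qed
  next
    fix X Y :: "'N uq dual set"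
    assume X: "stable ?U \<Phi> X" and Y: "stable ?U \<Phi> Y" and "X \<subseteq> generated_subalg dual_mult dual_one (genB s n)"
      and "Y \<subseteq> generated_subalg dual_mult dual_one (genB s n)" and E: "E X" "E Y"
    then have sub: "X \<subseteq> ?B" "Y \<subseteq> ?B" by (simp_all only: coord_gen)
    have h: "hsub X" "hsub Y" using X Y by (simp_all add: stable_def)
    have EX: "mmap ?U (tact \<Phi> \<Phi>) (tact \<Phi> \<Phi>) (tensor_sub X ?F) (tensor_sub ?F ?B) \<Upsilon>"
      using E(1) unfolding E_def by (intro mmapI \<Phi>\<Phi> stable_tensor_sub U \<Phi> X F B) blast+
    have EY: "mmap ?U (tact \<Phi> \<Phi>) (tact \<Phi> \<Phi>) (tensor_sub Y ?F) (tensor_sub ?F ?B) \<Upsilon>"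
      using E(2) unfolding E_def by (intro mmapI \<Phi>\<Phi> stable_tensor_sub U \<Phi> Y F B) blast+
    let ?V = "tensor_sub (tensor_sub X Y) ?F"
    \<comment> \<open>The right-hand side of the second product axiom. Up to regrouping the spaces
      are X, Y, F, then X, F, B, then F, B, B, and after multiplication F, B.\<close>
    note R = mmap_compose[OF mmap_compose[OF mmap_compose[OF mmap_compose[OF mmap_compose[OF
      mmap_assocr[OF U \<Phi> X \<Phi> Y \<Phi> F(1)]
      mmap_tmap[OF U mmap_id[OF \<Phi> X] EY]]
      mmap_assocl[OF U \<Phi> X \<Phi> F(1) \<Phi> B]]
      mmap_tmap[OF U EX mmap_id[OF \<Phi> B]]]
      mmap_assocr[OF U \<Phi> F(1) \<Phi> B \<Phi> B]]
      mmap_tmap[OF U mmap_id[OF \<Phi> F(1)] mmap_mul_coord(2)[OF n]]]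
    show "E (mul ` tensor_sub X Y)"
      unfolding E_def
    proof (rule mhom_factor_image[OF mhom_tmap[OF U \<Phi>\<Phi> \<Phi> \<Phi> \<Phi> stable_tensor_sub[OF U \<Phi> X \<Phi> Y] F(1) mhom_mul mhom_id] R lin])
      show "tensor_sub (mul ` tensor_sub X Y) ?F \<subseteq> tmap mul id ` ?V"
        using tensor_sub_image[OF cqlinear_mul cqlinear_id', of "tensor_sub X Y" ?F] by (simp only: image_id id_apply)
      fix v assume "v \<in> ?V"
      then show "\<Upsilon> (tmap mul id v) = tmap id mul (assocr (tmap \<Upsilon> id (assocl (tmap id \<Upsilon> (assocr v)))))"
        using hsub_tensor_sub[OF h] F(2)
      proof (induction rule: tensor_sub_induct)
        case (tens p p' t f)
        from tens(1) h show ?case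
        proof (induction rule: tensor_sub_induct)
          case (tens q q' x y)
          show ?case
            using sub FA tens(1,2) \<open>f \<in> ?F\<close> by (intro Upsilon_mult(2)[OF \<Upsilon>]) blast+
        next
          case (add z z')
          then show ?case
            by (simp only: tens_lin(3) cqlinearD(1)[OF mmapD(7)[OF R]] cqlinearD(1)[OF lin]
              cqlinearD(1)[OF cqlinear_tmap[OF cqlinear_mul cqlinear_id']])
        qed
      next
        case (add z z')
        then show ?case
          by (simp only: cqlinearD(1)[OF mmapD(7)[OF R]] cqlinearD(1)[OF lin]
            cqlinearD(1)[OF cqlinear_tmap[OF cqlinear_mul cqlinear_id']])
      qed
    qed
  qed
  then show ?thesis
    unfolding E_def by blast
qed

text \<open>Now the left factor is the whole \<open>coordAbar\<close>; the base case is assembled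
  from \<open>mhom_Upsilon_left\<close>, one element of the left factor at a time. The target needed
  in the product step is supplied by \<open>is_Upsilon\<close> itself, so equivariance alone can be
  carried along.\<close>

lemma mhom_Upsilon_right:
  fixes \<Upsilon> :: "('N::finite uq dual, 'N uq dual) tensor \<Rightarrow> ('N uq dual, 'N uq dual) tensor"
  assumes n: "n \<le> CARD('N)" and pos: "0 < n" and \<Upsilon>: "is_Upsilon r s n \<Upsilon>" and f: "f \<in> coordA r n"
  shows "\<exists>X. f \<in> X \<and> mhom (uq_sub n) (tact \<Phi> \<Phi>) (tact \<Phi> \<Phi>) (tensor_sub (coordAbar s n) X) \<Upsilon>"
proof -
  let ?U = "uq_sub n :: 'N uq set"
  let ?A = "coordA r n :: 'N uq dual set" and ?B = "coordAbar s n :: 'N uq dual set"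
  have U: "sub_coalg ?U"
    by (rule sub_coalg_uq_sub[OF n])
  note lin = Upsilon_linear[OF \<Upsilon>]
  note \<Phi> = is_act_Phi and \<Phi>\<Phi> = is_act_tact[OF is_act_Phi is_act_Phi]
  note A = stable_coord(1)[OF n, of r] and B = stable_coord(2)[OF n, of s]
  have hB: "hsub ?B"
    using B by (simp add: stable_def)
  define E where "E X \<longleftrightarrow> mhom ?U (tact \<Phi> \<Phi>) (tact \<Phi> \<Phi>) (tensor_sub ?B X) \<Upsilon>" for X
  have "\<exists>X. stable ?U \<Phi> X \<and> X \<subseteq> generated_subalg dual_mult dual_one (genA r n) \<and> E X \<and> f \<in> X"
  proof (rule generated_stable_induct[OF U stable_gen(1)[OF n] _ _ _ _ f[unfolded coord_gen]])
    show "E (cqspan {dual_one})"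
      unfolding E_def
    proof (rule mhom_factor[OF mhom_tens_one(1) mhom_tens_one(2) B lin])
      show "\<Upsilon> (g \<otimes> dual_one) = dual_one \<otimes> g" if "g \<in> ?B" for g
        by (rule Upsilon_one(2)[OF \<Upsilon> that])
      show "tensor_sub ?B (cqspan {dual_one}) \<subseteq> (\<lambda>g. g \<otimes> dual_one) ` ?B"
        by (rule tensor_sub_single(2)[OF hB])
    qed
    show "E (cqspan (genA r n))"
      unfolding E_def
    proof (rule mhom_tensor_sub[OF \<Phi>\<Phi> \<Phi>\<Phi> lin])
      fix g h :: "'N uq dual" assume "g \<in> ?B" and h: "h \<in> cqspan (genA r n)"
      then show "\<exists>V. g \<otimes> h \<in> V \<and> mhom ?U (tact \<Phi> \<Phi>) (tact \<Phi> \<Phi>) V \<Upsilon>"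
        using mhom_Upsilon_left[OF n pos \<Upsilon>, of g] tensor_sub_tens[OF _ h] by blast
    qed
  next
    fix X Y :: "'N uq dual set" assume E: "E X" "E Y"
    show "E {x + y |x y. x \<in> X \<and> y \<in> Y}"
      unfolding E_def
    proof (rule mhom_tensor_sub[OF \<Phi>\<Phi> \<Phi>\<Phi> lin])
      fix g h assume g: "g \<in> ?B" and "h \<in> {x + y |x y. x \<in> X \<and> y \<in> Y}"
      then obtain x y where h: "h = x + y" "x \<in> X" "y \<in> Y" by blast
      have "mhom ?U (tact \<Phi> \<Phi>) (tact \<Phi> \<Phi>) {g \<otimes> x + g \<otimes> y} \<Upsilon>"
        using E by (intro mhom_plus[OF \<Phi>\<Phi> \<Phi>\<Phi> _ tensor_sub_tens[OF g h(2)] _ tensor_sub_tens[OF g h(3)]])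
          (simp_all add: E_def)
      then show "\<exists>V. g \<otimes> h \<in> V \<and> mhom ?U (tact \<Phi> \<Phi>) (tact \<Phi> \<Phi>) V \<Upsilon>"
        unfolding h(1) tens_lin(1) by blast
    qed
  next
    fix X Y :: "'N uq dual set"
    assume X: "stable ?U \<Phi> X" and Y: "stable ?U \<Phi> Y" and "X \<subseteq> generated_subalg dual_mult dual_one (genA r n)"
      and "Y \<subseteq> generated_subalg dual_mult dual_one (genA r n)" and E: "E X" "E Y"
    then have sub: "X \<subseteq> ?A" "Y \<subseteq> ?A" by (simp_all only: coord_gen)
    have h: "hsub X" "hsub Y" using X Y by (simp_all add: stable_def)
    have EZ: "mmap ?U (tact \<Phi> \<Phi>) (tact \<Phi> \<Phi>) (tensor_sub ?B Z) (tensor_sub ?A ?B) \<Upsilon>"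
      if Z: "stable ?U \<Phi> Z" "Z \<subseteq> ?A" "E Z" for Z
    proof (rule mmapI)
      show "\<Upsilon> ` tensor_sub ?B Z \<subseteq> tensor_sub ?A ?B"
        using Upsilon_image[OF \<Upsilon>] tensor_sub_mono[OF order_refl Z(2), of ?B] by blast
    qed (use Z(3) in \<open>simp_all only: E_def \<Phi>\<Phi> stable_tensor_sub U \<Phi> Z(1) A B\<close>)
    note EX = EZ[OF X sub(1) E(1)] and EY = EZ[OF Y sub(2) E(2)]
    let ?V = "tensor_sub ?B (tensor_sub X Y)"
    \<comment> \<open>The right-hand side of the first product axiom. Up to regrouping the spaces
      are B, X, Y, then A, B, Y, then A, A, B, and after multiplication A, B.\<close>
    note R = mmap_compose[OF mmap_compose[OF mmap_compose[OF mmap_compose[OF mmap_compose[OF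
      mmap_assocl[OF U \<Phi> B \<Phi> X \<Phi> Y]
      mmap_tmap[OF U EX mmap_id[OF \<Phi> Y]]]
      mmap_assocr[OF U \<Phi> A \<Phi> B \<Phi> Y]]
      mmap_tmap[OF U mmap_id[OF \<Phi> A] EY]]
      mmap_assocl[OF U \<Phi> A \<Phi> A \<Phi> B]]
      mmap_tmap[OF U mmap_mul_coord(1)[OF n] mmap_id[OF \<Phi> B]]]
    show "E (mul ` tensor_sub X Y)"
      unfolding E_def
    proof (rule mhom_factor[OF mhom_tmap[OF U \<Phi> \<Phi> \<Phi>\<Phi> \<Phi> B stable_tensor_sub[OF U \<Phi> X \<Phi> Y] mhom_id mhom_mul] mmapD(5,3)[OF R] lin])
      show "tensor_sub ?B (mul ` tensor_sub X Y) \<subseteq> tmap id mul ` ?V"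
        using tensor_sub_image[OF cqlinear_id' cqlinear_mul, of ?B "tensor_sub X Y"] by (simp only: image_id id_apply)
      fix v assume "v \<in> ?V"
      then show "\<Upsilon> (tmap id mul v) = tmap mul id (assocl (tmap id \<Upsilon> (assocr (tmap \<Upsilon> id (assocl v)))))"
        using hB hsub_tensor_sub[OF h]
      proof (induction rule: tensor_sub_induct)
        case (tens p p' g t)
        from tens(2) h show ?case
        proof (induction rule: tensor_sub_induct)
          case (tens q q' x y)
          show ?case
            using sub tens(1,2) \<open>g \<in> ?B\<close> by (intro Upsilon_mult(1)[OF \<Upsilon>]) blast+
        next
          case (add z z')
          then show ?case
            by (simp only: tens_lin(1) cqlinearD(1)[OF mmapD(7)[OF R]] cqlinearD(1)[OF lin]
              cqlinearD(1)[OF cqlinear_tmap[OF cqlinear_id' cqlinear_mul]])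
        qed
      next
        case (add z z')
        then show ?case
          by (simp only: cqlinearD(1)[OF mmapD(7)[OF R]] cqlinearD(1)[OF lin]
            cqlinearD(1)[OF cqlinear_tmap[OF cqlinear_id' cqlinear_mul]])
      qed
    qed
  qed
  then show ?thesis
    unfolding E_def by blast
qed

theorem proposition3p4:
  fixes r s n :: nat
    and \<Upsilon> :: "('N::finite uq dual, 'N uq dual) tensor \<Rightarrow> ('N uq dual, 'N uq dual) tensor"
  assumes "r > 0" and "s > 0" and "n > 0"
    and "CARD('N) \<ge> max r (max s n)"
    and "is_Upsilon r s n \<Upsilon>"
  shows "supermodule_hom (uq_sub n)
           tensor_act (tensor_sub (coordAbar s n) (coordA r n))
           tensor_act (tensor_sub (coordA r n) (coordAbar s n))
           \<Upsilon>"
proof -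
  note \<Upsilon> = assms(5)
  have n: "n \<le> CARD('N)"
    using assms(4) by simp
  have U: "sub_coalg (uq_sub n :: 'N uq set)"
    by (rule sub_coalg_uq_sub[OF n])
  note \<Phi> = is_act_Phi and \<Phi>\<Phi> = is_act_tact[OF is_act_Phi is_act_Phi]
  note A = stable_coord(1)[OF n, of r] and B = stable_coord(2)[OF n, of s]
  have "mhom (uq_sub n) (tact \<Phi> \<Phi>) (tact \<Phi> \<Phi>) (tensor_sub (coordAbar s n) (coordA r n)) \<Upsilon>"
  proof (rule mhom_tensor_sub[OF \<Phi>\<Phi> \<Phi>\<Phi> Upsilon_linear[OF \<Upsilon>]])
    fix g f :: "'N uq dual" assume g: "g \<in> coordAbar s n" and "f \<in> coordA r n"
    then show "\<exists>V. g \<otimes> f \<in> V \<and> mhom (uq_sub n) (tact \<Phi> \<Phi>) (tact \<Phi> \<Phi>) V \<Upsilon>"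
      using mhom_Upsilon_right[OF n assms(3) \<Upsilon>, of f] tensor_sub_tens[OF g] by blast
  qed
  note h = mhomD(1-3)[OF this]
  show ?thesis
    unfolding supermodule_hom_def tensor_act_eq
    using supermodule_on_stable[OF \<Phi>\<Phi> stable_tensor_sub[OF U \<Phi> B \<Phi> A]]
      supermodule_on_stable[OF \<Phi>\<Phi> stable_tensor_sub[OF U \<Phi> A \<Phi> B]] Upsilon_image[OF \<Upsilon>] h(2,3)
    by (auto simp: cqlinearD[OF h(1)])
qed

end
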